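(* There exists an associative and commutative binary operation $\boxplus\boxplus:\mathcal{BID}\times\mathcal{BID}\to\mathcal{BID}$ such that for any $\nu_1,\nu_2\in\mathcal{BID}$, the relationship $$R_{\nu_1\boxplus\boxplus\nu_2}=R_{\nu_1}+R_{\nu_2}$$ holds in $(\mathbb{C}\setminus\mathbb{R})^2$.
   Context: For a Borel probability measure $\mu$ on $\mathbb{R}^2$, its marginals are $\mu^{(j)}=\mu\circ\pi_j^{-1}$, $j=1,2$, where $\pi_1(s,t)=s$, $\pi_2(s,t)=t$, and its Cauchy transform is $G_\mu(z,w)=\int_{\mathbb{R}^2}\frac{1}{(z-s)(w-t)}\,d\mu(s,t)$ for $z,w\in\mathbb{C}\setminus\mathbb{R}$. For a probability measure $m$ on $\mathbb{R}$, $G_m(z)=\int_{\mathbb{R}}\frac{1}{z-x}\,dm(x)$, $z\notin\mathbb{R}$. For $\alpha,\beta>0$ the Stolz angle is $\Delta=\Delta_{\alpha,\beta}=\{x+iy\in\mathbb{C}: y<0,\ |x|<-\alpha y,\ y>-\beta\}$, $\overline{\Delta}=\{\bar z:z\in\Delta\}$ is its reflection, and the associated product domain is $\Omega=(\Delta\cup\overline\Delta)\times(\Delta\cup\overline\Delta)$. The one-dimensional $R$-transform $R_m$ of a probability measure $m$ on $\mathbb{R}$ is the holomorphic function on $\Delta\cup\overline\Delta$ (for a sufficiently small Stolz angle $\Delta$) with $1/z+R_m(z)\notin\mathbb{R}$, $G_m(1/z+R_m(z))=z$, and $zR_m(z)\to0$ as $z\to0$ in $\Delta\cup\overline\Delta$.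 The bi-free partial $R$-transform of a probability measure $\mu$ on $\mathbb{R}^2$ is $$R_\mu(z,w)=zR_{\mu^{(1)}}(z)+wR_{\mu^{(2)}}(w)+\left[1-\frac{1}{h_\mu(z,w)}\right],\quad h_\mu(z,w)=\frac{G_\mu\left(1/z+R_{\mu^{(1)}}(z),\,1/w+R_{\mu^{(2)}}(w)\right)}{zw},$$ which is defined and holomorphic on a product domain $\Omega$ (with $\Delta$ small enough) on which $R_{\mu^{(1)}},R_{\mu^{(2)}}$ are defined and $h_\mu$ has no zeros. $\mathcal{BID}$ is the class of bi-freely infinitely divisible laws: probability measures $\nu$ on $\mathbb{R}^2$ such that for each integer $m\ge2$ there is a probability measure $\mu_m$ on $\mathbb{R}^2$ with $R_\nu=mR_{\mu_m}$ on the domain $\Omega$ of $R_\nu$. For $\nu\in\mathcal{BID}$, $R_\nu$ extends (uniquely) holomorphically from $\Omega$ to $(\mathbb{C}\setminus\mathbb{R})^2$, and the extension is still denoted $R_\nu$. *)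

theory Defs
  imports "HOL-Probability.Probability" "HOL-Complex_Analysis.Complex_Analysis"
begin

definition stolz_angle :: "real \<Rightarrow> real \<Rightarrow> complex set" where
  "stolz_angle \<alpha> \<beta> = {z. Im z < 0 \<and> \<bar>Re z\<bar> < - \<alpha> * Im z \<and> Im z > - \<beta>}"

definition stolz_pair :: "real \<Rightarrow> real \<Rightarrow> complex set" where
  "stolz_pair \<alpha> \<beta> = stolz_angle \<alpha> \<beta> \<union> cnj ` stolz_angle \<alpha> \<beta>"

definition stolz_product :: "real \<Rightarrow> real \<Rightarrow> (complex \<times> complex) set" where
  "stolz_product \<alpha> \<beta> = stolz_pair \<alpha> \<beta> \<times> stolz_pair \<alpha> \<beta>"

definition borel_prob :: "'a::topological_space measure \<Rightarrow> bool" where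
  "borel_prob \<mu> \<longleftrightarrow> prob_space \<mu> \<and> sets \<mu> = sets borel"

definition marginal1 :: "(real \<times> real) measure \<Rightarrow> real measure" where
  "marginal1 \<mu> = distr \<mu> borel fst"

definition marginal2 :: "(real \<times> real) measure \<Rightarrow> real measure" where
  "marginal2 \<mu> = distr \<mu> borel snd"

definition cauchy_transform :: "real measure \<Rightarrow> complex \<Rightarrow> complex" where
  "cauchy_transform m z = (\<integral>x. 1 / (z - complex_of_real x) \<partial>m)"

definition cauchy_transform2 ::
    "(real \<times> real) measure \<Rightarrow> complex \<Rightarrow> complex \<Rightarrow> complex" where
  "cauchy_transform2 \<mu> z w =
     (\<integral>p. 1 / ((z - complex_of_real (fst p)) * (w - complex_of_real (snd p))) \<partial>\<mu>)"

text \<open>The \<open>R\<close>-transform is only defined on sufficiently small Stolz angles, so it is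
  rendered relationally: \<open>R\<close> is the \<open>R\<close>-transform of \<open>m\<close> on the Stolz angle with parameters
  \<open>\<alpha>\<close>, \<open>\<beta>\<close> and its reflection.  Its values there are determined by \<open>m\<close>; the values of the
  total function \<open>R\<close> elsewhere are unconstrained.\<close>

definition has_R_transform ::
    "real measure \<Rightarrow> real \<Rightarrow> real \<Rightarrow> (complex \<Rightarrow> complex) \<Rightarrow> bool" where
  "has_R_transform m \<alpha> \<beta> R \<longleftrightarrow>
     R holomorphic_on stolz_pair \<alpha> \<beta> \<and>
     (\<forall>z \<in> stolz_pair \<alpha> \<beta>.
        1 / z + R z \<notin> \<real> \<and> cauchy_transform m (1 / z + R z) = z) \<and>
     ((\<lambda>z. z * R z) \<longlongrightarrow> 0) (at 0 within stolz_pair \<alpha> \<beta>)"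

text \<open>The function \<open>h\<^sub>\<mu>\<close>, with the \<open>R\<close>-transforms of the two marginals as parameters.\<close>

definition h_quotient ::
    "(real \<times> real) measure \<Rightarrow> (complex \<Rightarrow> complex) \<Rightarrow> (complex \<Rightarrow> complex) \<Rightarrow>
     complex \<Rightarrow> complex \<Rightarrow> complex" where
  "h_quotient \<mu> R1 R2 z w = cauchy_transform2 \<mu> (1 / z + R1 z) (1 / w + R2 w) / (z * w)"

definition has_bifree_R_transform ::
    "(real \<times> real) measure \<Rightarrow> real \<Rightarrow> real \<Rightarrow> (complex \<times> complex \<Rightarrow> complex) \<Rightarrow> bool" where
  "has_bifree_R_transform \<mu> \<alpha> \<beta> F \<longleftrightarrow>
     (\<exists>R1 R2. has_R_transform (marginal1 \<mu>) \<alpha> \<beta> R1 \<and>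
              has_R_transform (marginal2 \<mu>) \<alpha> \<beta> R2 \<and>
              (\<forall>(z, w) \<in> stolz_product \<alpha> \<beta>.
                 h_quotient \<mu> R1 R2 z w \<noteq> 0 \<and>
                 F (z, w) = z * R1 z + w * R2 w + (1 - 1 / h_quotient \<mu> R1 R2 z w)))"

text \<open>The domain of \<open>R\<^sub>\<nu>\<close> is some product domain on which it is defined; the
  \<open>R\<close>-transforms of all the roots \<open>\<mu>\<^sub>m\<close> are required to exist on that same domain.\<close>

definition BID :: "(real \<times> real) measure set" where
  "BID = {\<nu>. borel_prob \<nu> \<and>
     (\<exists>\<alpha>>0. \<exists>\<beta>>0. \<exists>F. has_bifree_R_transform \<nu> \<alpha> \<beta> F \<and>
        (\<forall>m::nat. m \<ge> 2 \<longrightarrow>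
           (\<exists>\<mu>\<^sub>m F\<^sub>m. borel_prob \<mu>\<^sub>m \<and> has_bifree_R_transform \<mu>\<^sub>m \<alpha> \<beta> F\<^sub>m \<and>
              (\<forall>p \<in> stolz_product \<alpha> \<beta>. F p = of_nat m * F\<^sub>m p))))}"

text \<open>Holomorphy in two complex variables: the Frechet derivative exists and is
  complex linear.  Only used on open sets.\<close>

definition holomorphic2_on ::
    "(complex \<times> complex \<Rightarrow> complex) \<Rightarrow> (complex \<times> complex) set \<Rightarrow> bool" where
  "holomorphic2_on F S \<longleftrightarrow>
     (\<forall>p \<in> S. \<exists>a b. (F has_derivative (\<lambda>(h, k). a * h + b * k)) (at p within S))"

definition nonreal2 :: "(complex \<times> complex) set" where
  "nonreal2 = (- \<real>) \<times> (- \<real>)"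

text \<open>For \<open>\<nu>\<close> in \<open>BID\<close>, the holomorphic extension of \<open>R\<^sub>\<nu>\<close> to \<open>nonreal2\<close>.  Every
  component of \<open>nonreal2\<close> meets the product domain in a nonempty open set, so the
  choice operator only leaves the values outside \<open>nonreal2\<close> undetermined.\<close>

definition bifree_R :: "(real \<times> real) measure \<Rightarrow> complex \<times> complex \<Rightarrow> complex" where
  "bifree_R \<nu> = (SOME F. holomorphic2_on F nonreal2 \<and>
                    (\<exists>\<alpha>>0. \<exists>\<beta>>0. has_bifree_R_transform \<nu> \<alpha> \<beta> F))"

end

theory Submission
  imports Defs
begin

text \<open>
  A law in \<open>BID\<close> has \<open>m\<close>-th roots \<open>\<mu>\<^sub>m\<close>, and as \<open>m\<close> grows the integrals
  \<open>m \<integral> u d\<mu>\<^sub>m\<close>, \<open>m \<integral> v d\<mu>\<^sub>m\<close>, \<open>m \<integral> u v d\<mu>\<^sub>m\<close> of the jump ratios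
  \<open>u = s / (1/z - s)\<close>, \<open>v = t / (1/w - t)\<close> converge to the three summands of
  its \<open>R\<close>-transform.  The same integrals against a finite measure with bounded jumps
  are the summands of the transform of a bi-free compound Poisson law, so a law with transform
  \<open>R\<^bsub>\<nu>\<^sub>1\<^esub> + R\<^bsub>\<nu>\<^sub>2\<^esub>\<close> is a limit of compound Poisson laws whose jump measures are sums
  of weighted truncated roots; dividing the weights by \<open>m\<close> gives its \<open>m\<close>-th roots.

  Compound Poisson laws are constructed without operators: the candidate Cauchy transform
  \<open>G\<close> is explicit in the inverses of two one-variable functions, and Stieltjes inversion reduces
  the existence of the law to \<open>Re (G(z, cnj w) - G(z, w)) \<ge> 0\<close>.  This
  positivity holds because a quadratic form with this as its key coefficient
  is reproduced by a contraction up to a square.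

  The extension of \<open>R\<^sub>\<nu>\<close> to \<open>nonreal2\<close> is a Vitali limit of
  \<open>m (G\<^bsub>\<mu>\<^sub>m\<^esub>(1/z, 1/w) / (z w) - 1)\<close> in each variable, and Osgood's lemma makes it
  jointly holomorphic.  The operation is obtained by choosing one law in \<open>BID\<close> for each sum of
  transforms, so that associativity and commutativity are inherited from addition.
\<close>

section \<open>Cauchy integrals on half planes\<close>

text \<open>For real jumps (s, t) put a = 1/z, b = 1/w, u = s/(a - s), v = t/(b - t), and let p be
  the integral of u v. The compound Poisson transform has 1 - 1/h = p, so its law must have Cauchy
  transform 1/(a b (1 - p)) at the point (K a, K b), where K a = 1/z + R(z). The construction is
  thus reduced to inverting K on half planes and to positivity of this expression.

  Positivity closes up because the jumps are real: |u|^2 is then linear in u and its conjugate, so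
  the quartic integrals that occur collapse to a few values of \<open>cross\<close>.

  Weak limits in the plane may lose mass at infinity, while a small Stolz angle only sees points
  near infinity. Both are handled by one asymptotic fact: in a cone, k k' G(k, k') tends to the
  total mass. It yields mass one, uniqueness of the R-transform and h -> 1 at the origin; sending
  only one variable to infinity yields the marginals.

  \<open>BID\<close> asks for all roots on one common domain. The domain of a sum is therefore fixed
  before the order k of the root; division by k only shrinks the quantities that have to be
  small.\<close>

lemma lborel_inverse_1_plus_square:
  "integrable lborel (\<lambda>x::real. inverse (1 + x\<^sup>2))"
  "(\<integral>x. inverse (1 + x\<^sup>2) \<partial>lborel) = pi"
proof -
  have "einterval (-\<infinity>) \<infinity> = UNIV" by (auto simp: einterval_def)
  then show "integrable lborel (\<lambda>x::real. inverse (1 + x\<^sup>2))"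
    "(\<integral>x. inverse (1 + x\<^sup>2) \<partial>lborel) = pi"
    using integrable_inverse_1_plus_square LBINT_inverse_1_plus_square
    by (simp_all add: interval_lebesgue_integral_def set_lebesgue_integral_def set_integrable_def)
qed

lemma integrable_decay_square:
  fixes q :: "real \<Rightarrow> complex"
  assumes cont: "continuous_on UNIV q" and R0: "R0 > 0"
    and bd: "\<And>x. \<bar>x\<bar> \<ge> R0 \<Longrightarrow> norm (q x) \<le> B / x\<^sup>2"
  shows "integrable lborel q"
proof -
  have "compact ((\<lambda>x. norm (q x) * (1 + x\<^sup>2)) ` {-R0..R0})"
    by (intro compact_continuous_image continuous_intros continuous_on_subset[OF cont]) auto
  then have "bdd_above ((\<lambda>x. norm (q x) * (1 + x\<^sup>2)) ` {-R0..R0})"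
    by (intro bounded_imp_bdd_above compact_imp_bounded)
  then obtain B1 where B1: "\<And>x. \<bar>x\<bar> \<le> R0 \<Longrightarrow> norm (q x) * (1 + x\<^sup>2) \<le> B1"
    unfolding bdd_above_def by (auto simp: abs_le_iff) (metis atLeastAtMost_iff minus_le_iff)
  define B2 where "B2 = max B1 (B * (1 + 1 / R0\<^sup>2))"
  have B0: "B \<ge> 0"
    using bd[of R0] R0 order.trans[OF norm_ge_zero bd[of R0]] by (auto simp: field_simps zero_le_mult_iff)
  have bound: "norm (q x) \<le> B2 * inverse (1 + x\<^sup>2)" for x
  proof (cases "\<bar>x\<bar> \<le> R0")
    case True
    then have "norm (q x) * (1 + x\<^sup>2) \<le> B2" using B1[of x] by (simp add: B2_def)
    then show ?thesis by (simp add: field_simps add_pos_nonneg)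
  next
    case False
    then have x: "\<bar>x\<bar> \<ge> R0" "x \<noteq> 0" "R0\<^sup>2 \<le> x\<^sup>2"
      using R0 power_mono[of R0 "\<bar>x\<bar>" 2] by auto
    have "norm (q x) * (1 + x\<^sup>2) \<le> B / x\<^sup>2 * (1 + x\<^sup>2)"
      using bd[OF x(1)] by (intro mult_right_mono) auto
    also have "\<dots> = B * (1 + 1 / x\<^sup>2)" using x(2) by (simp add: field_simps)
    also have "\<dots> \<le> B * (1 + 1 / R0\<^sup>2)"
      using B0 x(2,3) R0 by (intro mult_left_mono add_left_mono divide_left_mono) auto
    also have "\<dots> \<le> B2" by (simp add: B2_def)
    finally show ?thesis by (simp add: field_simps add_pos_nonneg)
  qed
  show ?thesis
  proof (rule Bochner_Integration.integrable_bound)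
    show "integrable lborel (\<lambda>x. B2 * inverse (1 + x\<^sup>2))"
      using lborel_inverse_1_plus_square by simp
    show "q \<in> borel_measurable lborel"
      using borel_measurable_continuous_onI[OF cont] by simp
    show "AE x in lborel. norm (q x) \<le> norm (B2 * inverse (1 + x\<^sup>2))"
      using bound by (auto intro: order_trans[OF _ abs_ge_self])
  qed
qed

lemma convex_Im_gt: "convex {z. Im z > c}"
  using convex_halfspace_Im_gt[of c] by simp

text \<open>Close the segment from -R to R by a half circle: the integrand is O(1/R^2) on an arc of
  length pi R, so the arc contributes O(1/R). Dominated convergence then passes from the segment to
  the line.\<close>

lemma half_plane_integral_0:
  assumes hol: "q holomorphic_on {z. Im z > -d}" and d: "d > 0" and R0: "R0 > 0"
    and bd: "\<And>w. Im w \<ge> 0 \<Longrightarrow> norm w \<ge> R0 \<Longrightarrow> norm (q w) \<le> B / (norm w)\<^sup>2"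
  shows "integrable lborel (\<lambda>x. q (of_real x))" "(\<integral>x. q (of_real x) \<partial>lborel) = 0"
proof -
  have contq: "continuous_on {z. Im z > -d} q" by (rule holomorphic_on_imp_continuous_on[OF hol])
  have cont: "continuous_on UNIV (\<lambda>x::real. q (of_real x))"
    by (intro continuous_on_compose2[OF contq] continuous_intros) (use d in auto)
  show int: "integrable lborel (\<lambda>x. q (of_real x))"
    by (rule integrable_decay_square[OF cont R0, of B]) (use bd[of "of_real _"] in auto)
  have B0: "B \<ge> 0"
    using bd[of "of_real R0"] R0 order.trans[OF norm_ge_zero bd[of "of_real R0"]]
    by (auto simp: zero_le_divide_iff)
  have est: "norm (\<integral>x. indicator {-R..R} x *\<^sub>R q (of_real x) \<partial>lborel) \<le> B * pi / R" if R: "R \<ge> R0" for R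
  proof -
    let ?L = "linepath (of_real (-R)) (of_real R) :: real \<Rightarrow> complex"
    let ?A = "part_circlepath 0 R 0 pi"
    have Rpos: "R > 0" using R R0 by simp
    have piL: "path_image ?L \<subseteq> {z. Im z > -d}"
      using d by (auto simp: closed_segment_def)
    have piA: "path_image ?A \<subseteq> {z. Im z \<ge> 0 \<and> norm z = R}"
    proof
      fix z assume "z \<in> path_image ?A"
      then obtain t where t: "0 \<le> t" "t \<le> pi" "z = of_real R * exp (\<i> * of_real t)"
        using Rpos by (auto simp: path_image_part_circlepath closed_segment_eq_real_ivl)
      then show "z \<in> {z. Im z \<ge> 0 \<and> norm z = R}"
        using Rpos sin_ge_zero[of t] by (auto simp: norm_mult Im_exp)
    qed
    have "((q has_contour_integral 0) (?L +++ ?A))"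
    proof (rule Cauchy_theorem_convex_simple[OF hol])
      show "convex {z. Im z > -d}" by (rule convex_Im_gt)
      show "path_image (?L +++ ?A) \<subseteq> {z. Im z > -d}"
        using piL piA d by (subst path_image_join) (auto simp: exp_pi_i')
    qed (auto simp: exp_pi_i' intro!: valid_path_join)
    moreover have iL: "q contour_integrable_on ?L"
      by (rule contour_integrable_continuous_linepath) (use continuous_on_subset[OF contq piL] in simp)
    moreover have iA: "q contour_integrable_on ?A"
      by (rule contour_integrable_continuous_part_circlepath, rule continuous_on_subset[OF contq])
        (use piA d in auto)
    ultimately have sum0: "contour_integral ?L q + contour_integral ?A q = 0"
      by (subst contour_integral_join[symmetric]) (auto simp: exp_pi_i' contour_integral_unique)
    have "norm (contour_integral ?A q) \<le> B / R\<^sup>2 * R * (pi - 0)"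
      by (rule has_contour_integral_bound_part_circlepath[OF has_contour_integral_integral[OF iA]])
        (use B0 Rpos R bd piA in auto)
    also have "\<dots> = B * pi / R" using Rpos by (simp add: power2_eq_square)
    finally have A: "norm (contour_integral ?A q) \<le> B * pi / R" .
    have "contour_integral ?L q = integral {-R..R} (\<lambda>x. q (of_real x))"
      by (subst contour_integral_linepath_Reals_eq) (use Rpos in auto)
    also have "\<dots> = (LINT x:{-R..R}|lborel. q (of_real x))"
      by (rule set_borel_integral_eq_integral(2)[symmetric])
        (use int in \<open>auto intro!: integrable_mult_indicator simp: set_integrable_def\<close>)
    finally show ?thesis
      using A sum0 by (simp add: set_lebesgue_integral_def add_eq_0_iff)
  qed
  have "((\<lambda>n. \<integral>x. indicator {- real n..real n} x *\<^sub>R q (of_real x) \<partial>lborel) \<longlonglongrightarrow> (\<integral>x. q (of_real x) \<partial>lborel))"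
  proof (rule integral_dominated_convergence[where w = "\<lambda>x. norm (q (of_real x))"])
    show "AE x in lborel. (\<lambda>n. indicator {- real n..real n} x *\<^sub>R q (of_real x)) \<longlonglongrightarrow> q (of_real x)"
    proof (intro AE_I2 tendsto_eventually)
      fix x :: real
      obtain N where N: "\<bar>x\<bar> \<le> real N" using real_arch_simple by blast
      show "\<forall>\<^sub>F n in sequentially. indicator {- real n..real n} x *\<^sub>R q (of_real x) = q (of_real x)"
        using eventually_ge_at_top[of N]
      proof eventually_elim
        case (elim n)
        then have "\<bar>x\<bar> \<le> real n" using N by linarith
        then show ?case by (simp add: abs_le_iff)
      qed
    qed
  qed (use int in \<open>auto simp: indicator_def\<close>)
  moreover have "(\<lambda>n. \<integral>x. indicator {- real n..real n} x *\<^sub>R q (of_real x) \<partial>lborel) \<longlonglongrightarrow> 0"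
  proof (rule Lim_null_comparison)
    show "\<forall>\<^sub>F n in sequentially. norm (\<integral>x. indicator {- real n..real n} x *\<^sub>R q (of_real x) \<partial>lborel) \<le> B * pi / real n"
      using eventually_ge_at_top[of "nat \<lceil>R0\<rceil>"] by eventually_elim (use est real_nat_ceiling_ge[of R0] in \<open>meson of_nat_mono order_trans\<close>)
    show "(\<lambda>n. B * pi / real n) \<longlonglongrightarrow> 0" by (rule lim_const_over_n)
  qed
  ultimately show "(\<integral>x. q (of_real x) \<partial>lborel) = 0" using LIMSEQ_unique by blast
qed


lemma lborel_poisson_kernel:
  fixes z :: complex
  assumes "Im z > 0"
  shows "integrable lborel (\<lambda>x. 1 / ((of_real x - z) * (of_real x - cnj z)))"
    "(\<integral>x. 1 / ((of_real x - z) * (of_real x - cnj z)) \<partial>lborel) = of_real (pi / Im z)"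
proof -
  let ?g = "\<lambda>x::real. inverse ((x - Re z)\<^sup>2 + (Im z)\<^sup>2)"
  have eq: "1 / ((of_real x - z) * (of_real x - cnj z)) = of_real (?g x)" for x
  proof -
    have "(of_real x - z) * (of_real x - cnj z) = of_real ((x - Re z)\<^sup>2 + (Im z)\<^sup>2)"
      by (simp add: complex_eq_iff power2_eq_square algebra_simps)
    then show ?thesis by (simp add: inverse_eq_divide)
  qed
  have g: "?g (Re z + Im z * x) = inverse ((Im z)\<^sup>2) * inverse (1 + x\<^sup>2)" for x
  proof -
    have "(Re z + Im z * x - Re z)\<^sup>2 + (Im z)\<^sup>2 = (Im z)\<^sup>2 * (1 + x\<^sup>2)"
      by (simp add: power2_eq_square algebra_simps)
    then show ?thesis by simp
  qed
  have ig: "integrable lborel ?g"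
    using lborel_integrable_real_affine_iff[of "Im z" ?g "Re z"] assms lborel_inverse_1_plus_square(1)
    unfolding g by simp
  then show "integrable lborel (\<lambda>x. 1 / ((of_real x - z) * (of_real x - cnj z)))"
    unfolding eq by (rule integrable_of_real)
  have "(\<integral>x. ?g x \<partial>lborel) = Im z * (\<integral>x. inverse ((Im z)\<^sup>2) * inverse (1 + x\<^sup>2) \<partial>lborel)"
    using lborel_integral_real_affine[of "Im z" ?g "Re z"] assms unfolding g by simp
  also have "\<dots> = Im z * (inverse ((Im z)\<^sup>2) * pi)"
    by (simp only: integral_mult_right_zero lborel_inverse_1_plus_square(2))
  also have "\<dots> = pi / Im z"
    using assms by (simp add: power2_eq_square field_simps)
  finally show "(\<integral>x. 1 / ((of_real x - z) * (of_real x - cnj z)) \<partial>lborel) = of_real (pi / Im z)"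
    unfolding eq by (simp only: integral_complex_of_real)
qed

lemma decay_divide:
  fixes w z c :: complex
  assumes "norm c \<le> B / norm w" "norm w \<ge> 2 * norm z" "norm w > 0"
  shows "norm (c / (w - z)) \<le> 2 * B / (norm w)\<^sup>2"
proof -
  have "norm w / 2 \<le> norm w - norm z" using assms by simp
  also have "\<dots> \<le> norm (w - z)" by (rule norm_triangle_ineq2)
  finally have "norm c / norm (w - z) \<le> (B / norm w) / (norm w / 2)"
    using assms by (intro frac_le) (auto intro: order_trans[OF norm_ge_zero])
  then show ?thesis by (simp add: norm_divide power2_eq_square field_simps)
qed

text \<open>The resolvent factor supplies the second power of decay needed to close the contour, so
  decay like 1/|w| is enough for f. For z below the axis the integrand is holomorphic above it; for
  z above, its pole is traded for a Poisson kernel.\<close>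

proposition half_plane_Cauchy_integral:
  assumes hol: "f holomorphic_on {z. Im z > -d}" and d: "d > 0" and R0: "R0 > 0"
    and bd: "\<And>w. Im w \<ge> 0 \<Longrightarrow> norm w \<ge> R0 \<Longrightarrow> norm (f w) \<le> B / norm w"
    and z: "Im z \<noteq> 0"
  shows "integrable lborel (\<lambda>x. f (of_real x) / (z - of_real x))"
    "(\<integral>x. f (of_real x) / (z - of_real x) \<partial>lborel) = (if Im z > 0 then -2 * pi * \<i> * f z else 0)"
proof -
  define R1 where "R1 = max R0 (2 * norm z)"
  have R1: "R1 > 0" "R1 \<ge> R0" "R1 \<ge> 2 * norm z" using R0 by (auto simp: R1_def)
  have flip: "f (of_real x) / (z - of_real x) = - (f (of_real x) / (of_real x - z))" for x
    by (metis minus_diff_eq minus_divide_right)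
  have "integrable lborel (\<lambda>x. f (of_real x) / (of_real x - z)) \<and>
    (\<integral>x. f (of_real x) / (of_real x - z) \<partial>lborel) = (if Im z > 0 then 2 * pi * \<i> * f z else 0)"
  proof (cases "Im z > 0")
    case False
    then have lt: "Im z < 0" using z by simp
    define q where "q w = f w / (w - z)" for w
    have "q holomorphic_on {w. Im w > - min d (- Im z)}"
      unfolding q_def using lt
      by (intro holomorphic_intros holomorphic_on_subset[OF hol]) auto
    moreover have "norm (q w) \<le> 2 * B / (norm w)\<^sup>2" if "Im w \<ge> 0" "norm w \<ge> R1" for w
      unfolding q_def using that R1 by (intro decay_divide bd) auto
    ultimately have "integrable lborel (\<lambda>x. q (of_real x)) \<and> (\<integral>x. q (of_real x) \<partial>lborel) = 0"
      using half_plane_integral_0[of q "min d (- Im z)" R1 "2 * B"] lt d R1 by auto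
    then show ?thesis using False by (simp add: q_def)
  next
    case True
    \<comment> \<open>\<open>c\<close> makes \<open>k\<close> vanish at z, so that
      \<open>k w / (w - z)\<close> has a removable singularity there, while the subtracted pole sits
      at \<open>cnj z\<close>, outside the upper half plane. Undoing the subtraction adds
      \<open>c\<close> times the Poisson kernel, whose integral is \<open>pi / Im z\<close>.\<close>
    define c where "c = f z * (z - cnj z)"
    define k where "k w = f w - c / (w - cnj z)" for w
    have ne: "z - cnj z \<noteq> 0" using True by (simp add: complex_eq_iff)
    have kz: "k z = 0" using ne by (simp add: k_def c_def)
    let ?d = "min d (Im z)"
    have holk: "k holomorphic_on {w. Im w > - ?d}"
      unfolding k_def using True
      by (intro holomorphic_intros holomorphic_on_subset[OF hol]) auto
    have op: "open {w. Im w > - ?d}" by (rule open_halfspace_Im_gt)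
    define q where "q w = (if w = z then deriv k z else (k w - k z) / (w - z))" for w
    have holq: "q holomorphic_on {w. Im w > - ?d}"
      unfolding q_def[abs_def] by (rule pole_lemma[OF holk]) (use op True d in \<open>simp add: interior_open\<close>)
    define B' where "B' = B + 2 * norm c"
    have "norm (q w) \<le> 2 * B' / (norm w)\<^sup>2" if w: "Im w \<ge> 0" "norm w \<ge> R1 + norm z" for w
    proof -
      have "w \<noteq> z" using w R1 by auto
      then have qw: "q w = k w / (w - z)" by (simp add: q_def kz)
      have nw: "norm w \<ge> R1" using w(2) norm_ge_zero[of z] by linarith
      have wp: "norm w > 0" using nw R1 by linarith
      have "norm w / 2 \<le> norm w - norm (cnj z)" using nw R1 by simp
      also have "\<dots> \<le> norm (w - cnj z)" by (rule norm_triangle_ineq2)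
      finally have "norm c / norm (w - cnj z) \<le> norm c / (norm w / 2)"
        using wp by (intro divide_left_mono mult_pos_pos) auto
      then have "norm (c / (w - cnj z)) \<le> 2 * norm c / norm w"
        by (simp add: norm_divide field_simps)
      moreover have "norm (f w) \<le> B / norm w" using w nw R1 by (intro bd) auto
      ultimately have "norm (k w) \<le> B' / norm w"
        unfolding k_def B'_def using norm_triangle_ineq4[of "f w" "c / (w - cnj z)"]
        by (simp add: add_divide_distrib)
      then show ?thesis unfolding qw using nw R1 wp by (intro decay_divide) auto
    qed
    then have q0: "integrable lborel (\<lambda>x. q (of_real x))" "(\<integral>x. q (of_real x) \<partial>lborel) = 0"
      using half_plane_integral_0[of q ?d "R1 + norm z" "2 * B'"] holq True d R1
      by (auto simp: add_pos_nonneg)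
    have nr: "of_real x \<noteq> z" "of_real x \<noteq> cnj z" for x using True by (auto simp: complex_eq_iff)
    have fq: "f (of_real x) / (of_real x - z) = q (of_real x) + c * (1 / ((of_real x - z) * (of_real x - cnj z)))" for x
      using nr[of x] ne by (simp add: q_def kz k_def diff_divide_distrib mult.commute)
        (simp add: c_def)
    have "of_real (pi / Im z) * (z - cnj z) = 2 * pi * \<i>"
      using True by (simp add: complex_eq_iff)
    then have "c * of_real (pi / Im z) = 2 * pi * \<i> * f z"
      by (simp add: c_def mult.commute mult.left_commute)
    moreover have "integrable lborel (\<lambda>x. c * (1 / ((of_real x - z) * (of_real x - cnj z))))"
      "(\<integral>x. c * (1 / ((of_real x - z) * (of_real x - cnj z))) \<partial>lborel) = c * of_real (pi / Im z)"
      using lborel_poisson_kernel[OF True]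
      by (simp_all only: integrable_mult_right integral_mult_right_zero)
    ultimately show ?thesis
      unfolding fq using q0 True
      by (simp only: Bochner_Integration.integrable_add Bochner_Integration.integral_add if_True) simp
  qed
  then show "integrable lborel (\<lambda>x. f (of_real x) / (z - of_real x))"
    "(\<integral>x. f (of_real x) / (z - of_real x) \<partial>lborel) = (if Im z > 0 then -2 * pi * \<i> * f z else 0)"
    unfolding flip by auto
qed

text \<open>The reflection w -> -w exchanges the half planes and changes the sign of the
  kernel.\<close>

corollary lower_half_plane_Cauchy_integral:
  assumes hol: "f holomorphic_on {z. Im z < d}" and d: "d > 0" and R0: "R0 > 0"
    and bd: "\<And>w. Im w \<le> 0 \<Longrightarrow> norm w \<ge> R0 \<Longrightarrow> norm (f w) \<le> B / norm w"
    and z: "Im z \<noteq> 0"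
  shows "integrable lborel (\<lambda>x. f (of_real x) / (z - of_real x))"
    "(\<integral>x. f (of_real x) / (z - of_real x) \<partial>lborel) = (if Im z < 0 then 2 * pi * \<i> * f z else 0)"
proof -
  have im: "uminus ` {z. Im z > - d} \<subseteq> {z. Im z < d}" by auto
  have hol': "(\<lambda>z. f (- z)) holomorphic_on {z. Im z > - d}"
    using holomorphic_on_compose_gen[OF holomorphic_on_minus[OF holomorphic_on_ident] hol im]
    by (simp add: comp_def)
  have bd': "norm (f (- w)) \<le> B / norm w" if "Im w \<ge> 0" "norm w \<ge> R0" for w
    using bd[of "- w"] that by simp
  have z': "Im (- z) \<noteq> 0" using z by simp
  note H = half_plane_Cauchy_integral[OF hol' d R0 bd' z']
  have eq: "f (of_real x) / (z - of_real x) = - (f (- of_real (- x)) / (- z - of_real (- x)))" for x :: real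
  proof -
    have "- z - of_real (- x) = - (z - of_real x)" by simp
    then show ?thesis by (simp only: of_real_minus minus_minus minus_divide_right[symmetric])
  qed
  show "integrable lborel (\<lambda>x. f (of_real x) / (z - of_real x))"
    unfolding eq using H(1) lborel_integrable_real_affine_iff[of "-1" "\<lambda>x. f (- of_real x) / (- z - of_real x)" 0]
    by simp
  show "(\<integral>x. f (of_real x) / (z - of_real x) \<partial>lborel) = (if Im z < 0 then 2 * pi * \<i> * f z else 0)"
    unfolding eq using H(2) lborel_integral_real_affine[of "-1" "\<lambda>x. f (- of_real x) / (- z - of_real x)" 0]
    by (auto split: if_splits)
qed

section \<open>Compactness of Cauchy transforms\<close>

text \<open>Schoenberg's space-filling curve has a measurable right inverse, which carries a law on the
  plane to a law on \<open>[0, 1]\<close>; the one-dimensional Helly theorem then suffices.\<close>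

definition schoenberg_bump :: "real \<Rightarrow> real" where
  "schoenberg_bump t = max 0 (min 1 (1/2 - cos (pi * t)))"

lemma schoenberg_bump_bounds: "0 \<le> schoenberg_bump t" "schoenberg_bump t \<le> 1"
  by (auto simp: schoenberg_bump_def)

lemma schoenberg_bump_periodic: "schoenberg_bump (2 * of_int k + x) = schoenberg_bump x"
proof -
  have "cos (pi * (2 * of_int k + x)) = cos (2 * pi * of_int k + pi * x)"
    by (simp add: algebra_simps)
  also have "\<dots> = cos (pi * x)"
    by (simp add: cos_add sin_int_2pin cos_int_2pin)
  finally show ?thesis by (simp add: schoenberg_bump_def)
qed

text \<open>1/2 - cos(pi t) is at most 0 on [0, 1/3] and at least 1 on [2/3, 1], so clipping it to
  [0, 1] produces two plateaus of length 1/3. They read off a ternary digit 0 or 2 regardless of the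
  digits that follow.\<close>

lemma schoenberg_bump_digit:
  assumes d: "d \<in> {0, 1::real}" and e: "0 \<le> e" "e \<le> 1/3"
  shows "schoenberg_bump (2 * d / 3 + e) = d"
proof (cases "d = 0")
  case True
  have "cos (pi / 3) \<le> cos (pi * e)"
    using e by (intro cos_monotone_0_pi_le) (auto simp: field_simps)
  then show ?thesis using True by (simp add: schoenberg_bump_def cos_60)
next
  case False
  then have d1: "d = 1" using d by auto
  have "cos (pi * (2/3 + e)) \<le> cos (2 / 3 * pi)"
    using e by (intro cos_monotone_0_pi_le) (auto simp: field_simps)
  then show ?thesis using d1 by (simp add: schoenberg_bump_def cos_120)
qed

text \<open>The index \<open>c\<close> selects the coordinate: on points of the Cantor set,
  \<open>c\<close> = 0 reads the ternary digits at even positions and \<open>c\<close> = 1 those at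
  odd positions, and the series reassembles them as binary digits.\<close>

definition schoenberg_curve :: "nat \<Rightarrow> real \<Rightarrow> real" where
  "schoenberg_curve c t = (\<Sum>n. (1/2)^Suc n * schoenberg_bump (3^(2*n+c) * t))"

lemma summable_half_Suc: "summable (\<lambda>n. (1/2::real)^Suc n)"
  by simp

lemma norm_schoenberg_term: "norm ((1/2)^Suc n * schoenberg_bump x) \<le> (1/2)^Suc n"
  using schoenberg_bump_bounds[of x] by (simp add: mult_left_le)

lemma schoenberg_curve_bounds: "0 \<le> schoenberg_curve c t" "schoenberg_curve c t \<le> 1"
proof -
  have s: "summable (\<lambda>n. (1/2)^Suc n * schoenberg_bump (3^(2*n+c) * t))"
    by (rule summable_comparison_test'[OF summable_half_Suc norm_schoenberg_term])
  show "0 \<le> schoenberg_curve c t"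
    unfolding schoenberg_curve_def using s by (intro suminf_nonneg) (auto simp: schoenberg_bump_bounds)
  have "schoenberg_curve c t \<le> (\<Sum>n. (1/2::real)^Suc n)"
    unfolding schoenberg_curve_def
    using s summable_half_Suc schoenberg_bump_bounds by (intro suminf_le) (auto simp: mult_left_le)
  also have "\<dots> = 1" using power_half_series by (simp add: sums_iff)
  finally show "schoenberg_curve c t \<le> 1" .
qed

lemma continuous_schoenberg_curve: "continuous_on UNIV (schoenberg_curve c)"
proof (rule uniform_limit_theorem)
  show "uniform_limit UNIV (\<lambda>N t. \<Sum>n<N. (1/2)^Suc n * schoenberg_bump (3^(2*n+c) * t))
      (schoenberg_curve c) sequentially"
    unfolding schoenberg_curve_def
    by (rule Weierstrass_m_test[OF norm_schoenberg_term summable_half_Suc])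
  show "\<forall>\<^sub>F N in sequentially. continuous_on UNIV
      (\<lambda>t. \<Sum>n<N. (1/2)^Suc n * schoenberg_bump (3^(2*n+c) * t))"
    unfolding schoenberg_bump_def by (intro always_eventually allI continuous_intros)
qed simp

definition binary_digit :: "real \<Rightarrow> nat \<Rightarrow> real" where
  "binary_digit x n = of_int (\<lfloor>2^Suc n * x\<rfloor> mod 2)"

lemma binary_digit_cases: "binary_digit x n \<in> {0, 1}"
  by (auto simp: binary_digit_def)

text \<open>The N-th partial sum is x rounded down to a multiple of 2^-N. The bounds on x make the
  integer part vanish at the start of the induction.\<close>

lemma binary_digit_sums:
  assumes x: "0 \<le> x" "x < 1"
  shows "(\<lambda>n. (1/2)^Suc n * binary_digit x n) sums x"
proof -
  have part: "(\<Sum>n<N. (1/2)^Suc n * binary_digit x n) = of_int \<lfloor>2^N * x\<rfloor> / 2^N" for N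
  proof (induction N)
    case 0
    have "\<lfloor>x\<rfloor> = 0" using x by linarith
    then show ?case by simp
  next
    case (Suc N)
    have "\<lfloor>2 * (2^N * x)\<rfloor> div 2 = \<lfloor>2^N * x\<rfloor>"
      using floor_divide_real_eq_div[of 2 "2 * (2^N * x)"] by simp
    then have "\<lfloor>2^Suc N * x\<rfloor> = 2 * \<lfloor>2^N * x\<rfloor> + \<lfloor>2^Suc N * x\<rfloor> mod 2"
      by (metis mult.assoc mult_div_mod_eq power_Suc)
    then have "real_of_int \<lfloor>2^Suc N * x\<rfloor> = 2 * of_int \<lfloor>2^N * x\<rfloor> + binary_digit x N"
      unfolding binary_digit_def by (metis of_int_add of_int_mult of_int_numeral)
    then show ?case using Suc by (simp add: field_simps power_one_over)
  qed
  have "(\<lambda>N. real_of_int \<lfloor>2^N * x\<rfloor> / 2^N) \<longlonglongrightarrow> x"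
  proof (rule real_tendsto_sandwich)
    have b: "x - (1/2)^N \<le> real_of_int \<lfloor>2^N * x\<rfloor> / 2^N \<and> real_of_int \<lfloor>2^N * x\<rfloor> / 2^N \<le> x" for N
    proof -
      have "2^N * x - 1 \<le> of_int \<lfloor>2^N * x\<rfloor>" "of_int \<lfloor>2^N * x\<rfloor> \<le> 2^N * x" by linarith+
      then have "(2^N * x - 1) / 2^N \<le> real_of_int \<lfloor>2^N * x\<rfloor> / 2^N"
        "real_of_int \<lfloor>2^N * x\<rfloor> / 2^N \<le> (2^N * x) / 2^N"
        by (intro divide_right_mono; simp)+
      then show ?thesis by (simp add: diff_divide_distrib power_one_over)
    qed
    show "\<forall>\<^sub>F N in sequentially. x - (1/2)^N \<le> real_of_int \<lfloor>2^N * x\<rfloor> / 2^N"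
      "\<forall>\<^sub>F N in sequentially. real_of_int \<lfloor>2^N * x\<rfloor> / 2^N \<le> x"
      using b by simp_all
    have "(\<lambda>N. x - (1/2::real)^N) \<longlonglongrightarrow> x - 0"
      by (intro tendsto_intros LIMSEQ_power_zero) simp
    then show "(\<lambda>N. x - (1/2::real)^N) \<longlonglongrightarrow> x" by simp
  qed simp
  then show ?thesis unfolding sums_def part .
qed

definition ternary_code :: "real \<Rightarrow> real \<Rightarrow> nat \<Rightarrow> real" where
  "ternary_code x y j = (if even j then binary_digit x (j div 2) else binary_digit y (j div 2))"

text \<open>A point of the Cantor set whose ternary digits, all 0 or 2, interleave the binary digits
  of x and y. It is only a measurable function of (x, y), which is what a push-forward
  requires.\<close>

definition schoenberg_inverse :: "real \<Rightarrow> real \<Rightarrow> real" where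
  "schoenberg_inverse x y = (\<Sum>j. 2 * ternary_code x y j / 3^Suc j)"

lemma ternary_code_cases: "ternary_code x y n \<in> {0, 1}"
  using binary_digit_cases by (auto simp: ternary_code_def)

lemma geometric_third: "summable (\<lambda>j. 2 / 3^Suc (j+k) :: real)" "(\<Sum>j. 2 / 3^Suc (j+k) :: real) = 1/3^k"
proof -
  have "(\<lambda>j. (2 / 3^Suc k) * (1/3)^j :: real) sums ((2 / 3^Suc k) * (1 / (1 - 1/3)))"
    by (intro sums_mult geometric_sums) simp
  also have "(\<lambda>j. (2 / 3^Suc k) * (1/3)^j :: real) = (\<lambda>j. 2 / 3^Suc (j+k))"
    by (auto simp: power_add power_one_over field_simps)
  finally show "summable (\<lambda>j. 2 / 3^Suc (j+k) :: real)" "(\<Sum>j. 2 / 3^Suc (j+k) :: real) = 1/3^k"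
    by (auto simp: sums_iff)
qed

lemma ternary_term_bounds:
  "0 \<le> 2 * ternary_code x y j / 3^Suc j" "2 * ternary_code x y j / 3^Suc j \<le> 2 / 3^Suc j"
  using ternary_code_cases[of x y j] by (auto simp: field_simps)

lemma summable_ternary: "summable (\<lambda>j. 2 * ternary_code x y (j+k) / 3^Suc (j+k))"
  by (rule summable_comparison_test'[OF geometric_third(1)[of k]])
    (simp only: real_norm_def abs_of_nonneg ternary_term_bounds)

lemma schoenberg_inverse_bounds: "0 \<le> schoenberg_inverse x y" "schoenberg_inverse x y \<le> 1"
proof -
  show "0 \<le> schoenberg_inverse x y"
    unfolding schoenberg_inverse_def
    using summable_ternary[of x y 0] ternary_term_bounds by (intro suminf_nonneg) auto
  have "schoenberg_inverse x y \<le> (\<Sum>j. 2 / 3^Suc j)"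
    unfolding schoenberg_inverse_def
    using summable_ternary[of x y 0] ternary_term_bounds geometric_third(1)[of 0]
    by (intro suminf_le) auto
  then show "schoenberg_inverse x y \<le> 1" using geometric_third(2)[of 0] by simp
qed

text \<open>Multiplication by 3^k turns the digits before position k into an even integer, which the
  period 2 absorbs, and leaves a tail in [0, 1/3], exactly the length of a plateau.\<close>

lemma schoenberg_bump_inverse:
  "schoenberg_bump (3^k * schoenberg_inverse x y) = ternary_code x y k"
proof -
  let ?d = "ternary_code x y"
  let ?f = "\<lambda>j. 2 * ?d j / 3^Suc j"
  have split: "schoenberg_inverse x y = (\<Sum>j. ?f (j + Suc k)) + (\<Sum>j<Suc k. ?f j)"
    unfolding schoenberg_inverse_def
    by (rule suminf_split_initial_segment) (use summable_ternary[of x y 0] in simp)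
  define e where "e = 3^k * (\<Sum>j. ?f (j + Suc k))"
  have "0 \<le> (\<Sum>j. ?f (j + Suc k))"
    by (intro suminf_nonneg summable_ternary ternary_term_bounds)
  moreover have "(\<Sum>j. ?f (j + Suc k)) \<le> (\<Sum>j. 2 / 3^Suc (j + Suc k))"
    by (intro suminf_le summable_ternary ternary_term_bounds geometric_third)
  ultimately have e: "0 \<le> e" "e \<le> 1/3"
    unfolding geometric_third(2) e_def by (auto simp: field_simps)
  have "\<exists>n::int. 3^k * (\<Sum>j<k. ?f j) = 2 * of_int n"
  proof -
    define n where "n = (\<Sum>j<k. (if ?d j = 0 then 0 else 3^(k - Suc j)) :: int)"
    have "3^k * ?f j = 2 * of_int (if ?d j = 0 then 0 else 3^(k - Suc j))" if "j < k" for j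
    proof -
      have "(3::real)^k = 3^(k - Suc j) * 3^Suc j"
        using that by (metis Suc_leI add.commute le_add_diff_inverse power_add)
      then show ?thesis using ternary_code_cases[of x y j] by auto
    qed
    then have "3^k * (\<Sum>j<k. ?f j) = 2 * of_int n"
      unfolding n_def sum_distrib_left of_int_sum by (intro sum.cong) auto
    then show ?thesis by blast
  qed
  then obtain n :: int where n: "3^k * (\<Sum>j<k. ?f j) = 2 * of_int n" by blast
  have "3^k * schoenberg_inverse x y = 2 * of_int n + (2 * ?d k / 3 + e)"
    unfolding split e_def using n by (simp add: distrib_left field_simps)
  then show ?thesis
    using schoenberg_bump_periodic schoenberg_bump_digit[OF ternary_code_cases e] by simp
qed

lemma schoenberg_curve_inverse:
  assumes "0 \<le> x" "x < 1" "0 \<le> y" "y < 1"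
  shows "schoenberg_curve 0 (schoenberg_inverse x y) = x"
    and "schoenberg_curve 1 (schoenberg_inverse x y) = y"
  using binary_digit_sums[of x] binary_digit_sums[of y] assms
  unfolding schoenberg_curve_def schoenberg_bump_inverse
  by (simp_all add: ternary_code_def sums_iff)

lemma schoenberg_inverse_measurable [measurable]:
  "(\<lambda>p. schoenberg_inverse (fst p) (snd p)) \<in> borel_measurable borel"
proof -
  have [measurable]: "(\<lambda>p::real \<times> real. ternary_code (fst p) (snd p) j) \<in> borel_measurable borel" for j
    unfolding ternary_code_def binary_digit_def
    by (cases "even j") (simp_all add: borel_prod[symmetric])
  show ?thesis unfolding schoenberg_inverse_def by measurable
qed

section \<open>Compactification of the line by the arctangent chart\<close>

definition line_chart :: "real \<Rightarrow> real" where "line_chart s = 1/2 + arctan s / pi"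
definition chart_line :: "real \<Rightarrow> real" where "chart_line x = tan (pi * (x - 1/2))"

lemma line_chart_bounds: "0 < line_chart s" "line_chart s < 1"
  using arctan_bounded[of s] by (auto simp: line_chart_def field_simps)

lemma chart_line_line_chart: "chart_line (line_chart s) = s"
  by (simp add: chart_line_def line_chart_def tan_arctan)

text \<open>The resolvent 1/(z - s) in the chart s = tan(pi (x - 1/2)), numerator and denominator
  multiplied by the cosine. In this form it is continuous on the whole line and vanishes at 0 and 1,
  the two points that stand for infinity.\<close>

definition chart_kernel :: "complex \<Rightarrow> real \<Rightarrow> complex" where
  "chart_kernel z x = of_real (cos (pi * (x - 1/2))) /
     (z * of_real (cos (pi * (x - 1/2))) - of_real (sin (pi * (x - 1/2))))"

lemma chart_kernel_denominator:
  fixes z :: complex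
  assumes "z \<notin> \<real>"
  shows "z * of_real (cos t) - of_real (sin t) \<noteq> 0"
proof
  assume eq: "z * of_real (cos t) - of_real (sin t) = 0"
  then have "Im z * cos t = 0" by (simp add: complex_eq_iff)
  then have "cos t = 0" using assms by (simp add: complex_is_Real_iff)
  then show False using eq sin_cos_squared_add[of t] by (simp add: complex_eq_iff)
qed

lemma chart_kernel_inside:
  assumes "0 < x" "x < 1"
  shows "chart_kernel z x = 1 / (z - of_real (chart_line x))"
proof -
  have c: "cos (pi * (x - 1/2)) > 0"
    using assms by (intro cos_gt_zero_pi) (auto simp: field_simps)
  have "of_real (cos (pi * (x - 1/2))) * (z - of_real (chart_line x)) =
     z * of_real (cos (pi * (x - 1/2))) - of_real (sin (pi * (x - 1/2)))"
    using c unfolding chart_line_def tan_def by (simp add: field_simps)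
  then show ?thesis
    using c unfolding chart_kernel_def by (metis div_by_1 mult_cancel_left mult_divide_mult_cancel_left
        nonzero_divide_mult_cancel_left of_real_eq_0_iff order_less_irrefl)
qed

lemma chart_kernel_boundary: "chart_kernel z 0 = 0" "chart_kernel z 1 = 0"
  by (simp_all add: chart_kernel_def)

lemma continuous_chart_kernel:
  "z \<notin> \<real> \<Longrightarrow> continuous_on UNIV (chart_kernel z)"
  unfolding chart_kernel_def
  by (intro continuous_intros) (use chart_kernel_denominator in blast)

lemma norm_chart_kernel:
  assumes "z \<notin> \<real>" "0 \<le> x" "x \<le> 1"
  shows "norm (chart_kernel z x) \<le> 1 / \<bar>Im z\<bar>"
proof (cases "x = 0 \<or> x = 1")
  case True
  then show ?thesis by (auto simp: chart_kernel_boundary)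
next
  case False
  then have x: "0 < x" "x < 1" using assms by auto
  have "\<bar>Im z\<bar> \<le> norm (z - of_real (chart_line x))"
    using abs_Im_le_cmod[of "z - of_real (chart_line x)"] by simp
  then show ?thesis using assms(1) unfolding chart_kernel_inside[OF x]
    by (simp add: norm_divide frac_le complex_is_Real_iff)
qed

text \<open>Every law on the plane is pulled back to a law on [0, 1], where Helly's theorem applies,
  and the Cauchy kernel becomes a bounded continuous function of the parameter. The limit on [0, 1]
  may charge parameters sent to the boundary of the square, that is, mass escaped to infinity. The
  kernel vanishes there, so restricting to \<open>E\<close> keeps the Cauchy transform; this is why
  \<open>N\<close> is only claimed to be finite.\<close>

proposition cauchy_transform2_compactness:
  fixes \<nu> :: "nat \<Rightarrow> (real \<times> real) measure"
  assumes \<nu>: "\<And>n. borel_prob (\<nu> n)"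
  obtains r N where "strict_mono r" "finite_measure N" "sets N = sets borel"
    "\<And>z w. z \<notin> \<real> \<Longrightarrow> w \<notin> \<real> \<Longrightarrow>
       (\<lambda>n. cauchy_transform2 (\<nu> (r n)) z w) \<longlonglongrightarrow> cauchy_transform2 N z w"
proof -
  have [measurable_cong]: "sets (\<nu> n) = sets (borel \<Otimes>\<^sub>M borel)" for n
    using \<nu> unfolding borel_prob_def borel_prod by blast
  define T where "T p = schoenberg_inverse (line_chart (fst p)) (line_chart (snd p))" for p
  have lc [measurable]: "line_chart \<in> borel_measurable borel"
    unfolding line_chart_def by measurable
  have T [measurable]: "T \<in> borel_measurable (borel \<Otimes>\<^sub>M borel)"
  proof -
    have "(\<lambda>p. (line_chart (fst p), line_chart (snd p))) \<in> borel \<Otimes>\<^sub>M borel \<rightarrow>\<^sub>M borel \<Otimes>\<^sub>M borel"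
      by measurable
    from measurable_compose[OF this, of "\<lambda>p. schoenberg_inverse (fst p) (snd p)" borel]
    show ?thesis using schoenberg_inverse_measurable by (simp add: T_def[abs_def] borel_prod)
  qed
  define P where "P n = distr (\<nu> n) borel T" for n
  have P: "real_distribution (P n)" for n
  proof -
    interpret prob_space "\<nu> n" using \<nu> by (simp add: borel_prob_def)
    show ?thesis unfolding P_def by (rule real_distribution_distr) measurable
  qed
  have T01: "0 \<le> T p" "T p \<le> 1" for p
    unfolding T_def by (rule schoenberg_inverse_bounds)+
  have "tight P"
    unfolding tight_def
  proof (intro conjI allI impI P)
    fix e :: real assume "e > 0"
    have "measure (P n) {-1<..2} = 1" for n
    proof -
      interpret prob_space "\<nu> n" using \<nu> by (simp add: borel_prob_def)
      have "measure (P n) {-1<..2} = measure (\<nu> n) (T -` {-1<..2} \<inter> space (\<nu> n))"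
        unfolding P_def by (subst measure_distr) auto
      also have "T -` {-1<..2} \<inter> space (\<nu> n) = space (\<nu> n)"
      proof -
        have "-1 < T p \<and> T p \<le> 2" for p using T01[of p] by linarith
        then show ?thesis by auto
      qed
      finally show ?thesis by (simp add: prob_space)
    qed
    then show "\<exists>a b. a < b \<and> (\<forall>n. 1 - e < measure (P n) {a<..b})"
      using \<open>e > 0\<close> by (intro exI[of _ "-1"] exI[of _ 2]) simp
  qed
  from tight_imp_convergent_subsubsequence[OF this strict_mono_id]
  obtain r Q where r: "strict_mono (r :: nat \<Rightarrow> nat)" and Q: "real_distribution Q"
    and wc: "weak_conv_m (P \<circ> id \<circ> r) Q" by blast
  interpret Q: real_distribution Q by fact
  let ?X = "schoenberg_curve 0" and ?Y = "schoenberg_curve 1"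
  have XY [measurable]: "schoenberg_curve c \<in> borel_measurable borel" for c
    by (rule borel_measurable_continuous_onI[OF continuous_schoenberg_curve])
  have cl [measurable]: "chart_line \<in> borel_measurable borel"
    unfolding chart_line_def tan_def by measurable
  define E where "E = {t. ?X t \<in> {0<..<1} \<and> ?Y t \<in> {0<..<1}}"
  have E [measurable]: "E \<in> sets borel"
    unfolding E_def by measurable
  define \<phi> where "\<phi> t = (chart_line (?X t), chart_line (?Y t))" for t
  have \<phi> [measurable]: "\<phi> \<in> borel \<rightarrow>\<^sub>M (borel \<Otimes>\<^sub>M borel)"
    unfolding \<phi>_def by measurable
  define N where "N = distr (restrict_space Q E) (borel \<Otimes>\<^sub>M borel) \<phi>"
  have \<phi>' [measurable]: "\<phi> \<in> restrict_space Q E \<rightarrow>\<^sub>M (borel \<Otimes>\<^sub>M borel)"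
    by (rule measurable_restrict_space1) measurable
  have fin: "finite_measure N"
    unfolding N_def by (intro finite_measure.finite_measure_distr finite_measure_restrict_space) (auto simp: Q.finite_measure_axioms)
  show ?thesis
  proof (rule that[OF r fin])
    show "sets N = sets borel" by (simp add: N_def borel_prod)
    fix z w :: complex assume zw: "z \<notin> \<real>" "w \<notin> \<real>"
    define h where "h t = chart_kernel z (?X t) * chart_kernel w (?Y t)" for t
    have [measurable]: "chart_kernel u \<in> borel_measurable borel" for u
      unfolding chart_kernel_def by measurable
    have [measurable]: "h \<in> borel_measurable borel" unfolding h_def by measurable
    have "(\<lambda>n. \<integral>t. h t \<partial>P (r n)) \<longlonglongrightarrow> (\<integral>t. h t \<partial>Q)"
    proof (rule weak_conv_imp_integral_bdd_continuous_conv)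
      show "weak_conv_m (\<lambda>n. P (r n)) Q" using wc by (simp add: comp_def)
      show "isCont h t" for t
      proof -
        have "continuous_on UNIV h" unfolding h_def
          by (intro continuous_on_mult continuous_on_compose2[OF continuous_chart_kernel[OF zw(1)]]
              continuous_on_compose2[OF continuous_chart_kernel[OF zw(2)]] continuous_schoenberg_curve) auto
        then show ?thesis by (simp add: continuous_on_eq_continuous_at)
      qed
      show "norm (h t) \<le> 1 / \<bar>Im z\<bar> * (1 / \<bar>Im w\<bar>)" for t
        unfolding h_def norm_mult
        by (intro mult_mono norm_chart_kernel zw schoenberg_curve_bounds) auto
    qed (use P Q in auto)
    moreover have "(\<integral>t. h t \<partial>P n) = cauchy_transform2 (\<nu> n) z w" for n
    proof -
      have "h (T p) = 1 / ((z - of_real (fst p)) * (w - of_real (snd p)))" for p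
      proof -
        have "?X (T p) = line_chart (fst p)" "?Y (T p) = line_chart (snd p)"
          unfolding T_def
          by (rule schoenberg_curve_inverse; simp add: less_imp_le line_chart_bounds)+
        then show ?thesis
          by (simp add: h_def chart_kernel_inside line_chart_bounds chart_line_line_chart)
      qed
      then show ?thesis
        unfolding P_def cauchy_transform2_def by (subst integral_distr) auto
    qed
    moreover have "(\<integral>t. h t \<partial>Q) = cauchy_transform2 N z w"
    proof -
      have "cauchy_transform2 N z w =
          (\<integral>t. 1 / ((z - of_real (fst (\<phi> t))) * (w - of_real (snd (\<phi> t)))) \<partial>restrict_space Q E)"
        unfolding N_def cauchy_transform2_def by (subst integral_distr) auto
      also have "\<dots> = (\<integral>t. indicator E t *\<^sub>R (1 / ((z - of_real (fst (\<phi> t))) * (w - of_real (snd (\<phi> t))))) \<partial>Q)"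
        by (rule integral_restrict_space) simp
      also have "\<dots> = (\<integral>t. h t \<partial>Q)"
      proof (rule Bochner_Integration.integral_cong[OF refl])
        fix t
        show "indicator E t *\<^sub>R (1 / ((z - of_real (fst (\<phi> t))) * (w - of_real (snd (\<phi> t))))) = h t"
        proof (cases "t \<in> E")
          case True
          then show ?thesis by (simp add: E_def \<phi>_def h_def chart_kernel_inside)
        next
          case False
          then have "?X t = 0 \<or> ?X t = 1 \<or> ?Y t = 0 \<or> ?Y t = 1"
            using schoenberg_curve_bounds[of 0 t] schoenberg_curve_bounds[of 1 t] by (auto simp: E_def)
          then have "h t = 0"
            by (elim disjE) (simp_all add: h_def chart_kernel_boundary)
          then show ?thesis using False by simp
        qed
      qed
      finally show ?thesis by simp
    qed
    ultimately show "(\<lambda>n. cauchy_transform2 (\<nu> (r n)) z w) \<longlonglongrightarrow> cauchy_transform2 N z w"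
      by simp
  qed
qed

section \<open>Compound Poisson transforms in one variable\<close>

lemma norm_diff_of_real_ge: "\<bar>Im a\<bar> \<le> norm (a - of_real x)"
  using abs_Im_le_cmod[of "a - of_real x"] by simp

lemma diff_of_real_neq_0: "Im a \<noteq> 0 \<Longrightarrow> a - of_real x \<noteq> 0"
  by (auto simp: complex_eq_iff)

lemma notin_Reals_iff_Im: "a \<notin> \<real> \<longleftrightarrow> Im a \<noteq> 0"
  by (simp add: complex_is_Real_iff)

lemma norm_integral_le:
  fixes h :: "'a \<Rightarrow> 'b::{banach, second_countable_topology}"
  assumes "integrable M h" "integrable M g" "\<And>x. norm (h x) \<le> g x"
  shows "norm (\<integral>x. h x \<partial>M) \<le> (\<integral>x. g x \<partial>M)"
  by (rule order_trans[OF integral_norm_bound integral_mono]) (use assms in auto)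

lemma norm_integral_mult_le:
  fixes h k :: "'a \<Rightarrow> complex"
  assumes "integrable M (\<lambda>x. h x * k x)"
    and "integrable M (\<lambda>x. (norm (h x))\<^sup>2)" "integrable M (\<lambda>x. (norm (k x))\<^sup>2)"
  shows "norm (\<integral>x. h x * k x \<partial>M) \<le> ((\<integral>x. (norm (h x))\<^sup>2 \<partial>M) + (\<integral>x. (norm (k x))\<^sup>2 \<partial>M)) / 2"
proof -
  have "norm (\<integral>x. h x * k x \<partial>M) \<le> (\<integral>x. ((norm (h x))\<^sup>2 + (norm (k x))\<^sup>2) / 2 \<partial>M)"
  proof (rule norm_integral_le[OF assms(1)])
    show "norm (h x * k x) \<le> ((norm (h x))\<^sup>2 + (norm (k x))\<^sup>2) / 2" for x
      using sum_squares_bound[of "norm (h x)" "norm (k x)"] by (simp add: norm_mult)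
  qed (use assms in simp)
  also have "\<dots> = ((\<integral>x. (norm (h x))\<^sup>2 \<partial>M) + (\<integral>x. (norm (k x))\<^sup>2 \<partial>M)) / 2"
    using assms by simp
  finally show ?thesis .
qed

text \<open>By the resolvent identity a difference quotient is minus the integral of a product of
  two resolvents. Near a these are uniformly bounded because |Im b| >= |Im a| / 2, so the error
  against the derivative is linear in |b - a|.\<close>

lemma (in finite_measure) holomorphic_integral_resolvent:
  fixes \<phi> :: "'a \<Rightarrow> complex" and f :: "'a \<Rightarrow> real"
  assumes [measurable]: "\<phi> \<in> borel_measurable M" "f \<in> borel_measurable M"
    and bd: "\<And>x. norm (\<phi> x) \<le> B"
  shows "(\<lambda>a. \<integral>x. \<phi> x / (a - of_real (f x)) \<partial>M) holomorphic_on (- \<real>)"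
proof -
  define H where "H a = (\<integral>x. \<phi> x / (a - of_real (f x)) \<partial>M)" for a
  have B0: "B \<ge> 0" using bd order_trans[OF norm_ge_zero] by blast
  have intg: "integrable M (\<lambda>x. \<phi> x / ((a - of_real (f x)) ^ m * (b - of_real (f x)) ^ n))"
    if "Im a \<noteq> 0" "Im b \<noteq> 0" for a b m n
  proof (rule integrable_const_bound[where B = "B / (\<bar>Im a\<bar> ^ m * \<bar>Im b\<bar> ^ n)"])
    show "AE x in M. norm (\<phi> x / ((a - of_real (f x)) ^ m * (b - of_real (f x)) ^ n)) \<le> B / (\<bar>Im a\<bar> ^ m * \<bar>Im b\<bar> ^ n)"
      using that bd B0 unfolding norm_divide norm_mult norm_power
      by (intro AE_I2 frac_le mult_mono power_mono norm_diff_of_real_ge) auto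
  qed measurable
  have "H field_differentiable at a" if a: "Im a \<noteq> 0" for a
  proof -
    \<comment> \<open>The exponents 2 and 0 put the square of a single resolvent into the two-point
      shape of \<open>intg\<close>.\<close>
    define D where "D = (\<integral>x. \<phi> x / ((a - of_real (f x)) ^ 2 * (a - of_real (f x)) ^ 0) \<partial>M)"
    define C where "C = B / (\<bar>Im a\<bar> ^ 2 * (\<bar>Im a\<bar> / 2)) * measure M (space M)"
    have "((\<lambda>b. (H b - H a) / (b - a)) \<longlongrightarrow> - D) (at a)"
    proof (rule Lim_transform_eventually)
      let ?Q = "\<lambda>b. - (\<integral>x. \<phi> x / ((a - of_real (f x)) ^ 1 * (b - of_real (f x)) ^ 1) \<partial>M)"
      have near: "\<forall>\<^sub>F b in at a. norm (b - a) < \<bar>Im a\<bar> / 2 \<and> b \<noteq> a"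
        using a by (auto simp: eventually_at dist_norm intro!: exI[of _ "\<bar>Im a\<bar> / 2"])
      have Imb: "\<bar>Im b\<bar> \<ge> \<bar>Im a\<bar> / 2" if "norm (b - a) < \<bar>Im a\<bar> / 2" for b
        using abs_Im_le_cmod[of "b - a"] that by simp
      show "\<forall>\<^sub>F b in at a. ?Q b = (H b - H a) / (b - a)"
        using near
      proof eventually_elim
        case (elim b)
        then have b: "Im b \<noteq> 0" using a Imb[of b] by auto
        have "H b - H a = (\<integral>x. \<phi> x / (b - of_real (f x)) - \<phi> x / (a - of_real (f x)) \<partial>M)"
          unfolding H_def using intg[OF b a, of 1 0] intg[OF a b, of 1 0]
          by (subst Bochner_Integration.integral_diff) simp_all
        also have "\<dots> = (\<integral>x. (a - b) * (\<phi> x / ((a - of_real (f x)) ^ 1 * (b - of_real (f x)) ^ 1)) \<partial>M)"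
        proof (intro Bochner_Integration.integral_cong refl)
          fix x
          show "\<phi> x / (b - of_real (f x)) - \<phi> x / (a - of_real (f x)) =
            (a - b) * (\<phi> x / ((a - of_real (f x)) ^ 1 * (b - of_real (f x)) ^ 1))"
            using diff_of_real_neq_0[OF a, of "f x"] diff_of_real_neq_0[OF b, of "f x"]
            by (simp add: divide_simps) (simp add: algebra_simps)
        qed
        also have "\<dots> = (b - a) * ?Q b"
          by (subst integral_mult_right_zero) (simp only: minus_mult_commute[symmetric] minus_diff_eq)
        finally show ?case using elim by simp
      qed
      show "(?Q \<longlongrightarrow> - D) (at a)"
      proof (rule LIM_zero_cancel, rule Lim_null_comparison)
        show "\<forall>\<^sub>F b in at a. norm (?Q b - (- D)) \<le> C * norm (b - a)"
          using near
        proof eventually_elim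
          case (elim b)
          then have b: "Im b \<noteq> 0" using a Imb[of b] by auto
          have "?Q b - (- D) = (\<integral>x. \<phi> x / ((a - of_real (f x)) ^ 2 * (a - of_real (f x)) ^ 0)
              - \<phi> x / ((a - of_real (f x)) ^ 1 * (b - of_real (f x)) ^ 1) \<partial>M)"
            unfolding D_def using intg[OF a b, of 1 1] intg[OF a a, of 2 0]
            by (subst Bochner_Integration.integral_diff) simp_all
          also have "\<dots> = (\<integral>x. (b - a) * (\<phi> x / ((a - of_real (f x)) ^ 2 * (b - of_real (f x)) ^ 1)) \<partial>M)"
          proof (intro Bochner_Integration.integral_cong refl)
            fix x
            show "\<phi> x / ((a - of_real (f x)) ^ 2 * (a - of_real (f x)) ^ 0)
              - \<phi> x / ((a - of_real (f x)) ^ 1 * (b - of_real (f x)) ^ 1)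
              = (b - a) * (\<phi> x / ((a - of_real (f x)) ^ 2 * (b - of_real (f x)) ^ 1))"
              using diff_of_real_neq_0[OF a, of "f x"] diff_of_real_neq_0[OF b, of "f x"]
              by (simp add: divide_simps power2_eq_square) (simp add: algebra_simps)
          qed
          also have "norm \<dots> \<le> (norm (b - a) * (B / (\<bar>Im a\<bar> ^ 2 * (\<bar>Im a\<bar> / 2)))) * measure M (space M)"
          proof -
            have "norm ((b - a) * (\<phi> x / ((a - of_real (f x)) ^ 2 * (b - of_real (f x)) ^ 1)))
              \<le> norm (b - a) * (B / (\<bar>Im a\<bar> ^ 2 * (\<bar>Im a\<bar> / 2)))" for x
              unfolding norm_mult norm_divide norm_power
              using a B0 bd order_trans[OF Imb norm_diff_of_real_ge] elim
              by (intro mult_left_mono frac_le mult_mono power_mono norm_diff_of_real_ge) auto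
            then have "norm (\<integral>x. (b - a) * (\<phi> x / ((a - of_real (f x)) ^ 2 * (b - of_real (f x)) ^ 1)) \<partial>M)
              \<le> (\<integral>x. norm (b - a) * (B / (\<bar>Im a\<bar> ^ 2 * (\<bar>Im a\<bar> / 2))) \<partial>M)"
              by (intro norm_integral_le integrable_mult_right intg a b) auto
            then show ?thesis
              by (simp only: lebesgue_integral_const real_scaleR_def mult.commute[of "measure M (space M)"])
          qed
          finally show ?case by (simp add: C_def mult_ac)
        qed
        show "((\<lambda>b. C * norm (b - a)) \<longlongrightarrow> 0) (at a)"
          by (intro tendsto_mult_right_zero tendsto_norm_zero) (simp add: LIM_zero_iff)
      qed
    qed
    then show ?thesis
      unfolding field_differentiable_def has_field_derivative_iff by blast
  qed
  then show ?thesis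
    unfolding H_def[symmetric] using open_Compl[OF closed_complex_Reals]
    by (auto simp: holomorphic_on_open field_differentiable_def[symmetric] notin_Reals_iff_Im)
qed

locale bounded_jumps = finite_measure M for M :: "'a measure" +
  fixes f :: "'a \<Rightarrow> real" and K :: real
  assumes f_measurable [measurable]: "f \<in> borel_measurable M"
    and f_bound: "\<And>x. \<bar>f x\<bar> \<le> K"
begin

text \<open>With a = 1/z and the jump s = f x this is z s / (1 - z s), so its integral is z R(z) for
  the compound Poisson R-transform.\<close>

definition jump_ratio :: "complex \<Rightarrow> 'a \<Rightarrow> complex" where
  "jump_ratio a x = of_real (f x) / (a - of_real (f x))"

text \<open>In terms of z = 1/a this is 1/z + R(z), where R(z) is the integral of s / (1 - z s): the
  map that the Cauchy transform of the law has to invert.\<close>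

definition K_transform :: "complex \<Rightarrow> complex" where
  "K_transform a = a + (\<integral>x. a * jump_ratio a x \<partial>M)"

definition ratio_energy :: "complex \<Rightarrow> real" where
  "ratio_energy a = (\<integral>x. (norm (jump_ratio a x))\<^sup>2 \<partial>M)"

lemma K_nonneg: "K \<ge> 0"
  using f_bound[of undefined] by linarith

lemma jump_ratio_measurable [measurable]: "jump_ratio a \<in> borel_measurable M"
  unfolding jump_ratio_def by measurable

lemma norm_jump_ratio: "Im a \<noteq> 0 \<Longrightarrow> norm (jump_ratio a x) \<le> K / \<bar>Im a\<bar>"
  unfolding jump_ratio_def norm_divide using f_bound[of x] K_nonneg norm_diff_of_real_ge
  by (intro frac_le) auto

lemma a_jump_ratio:
  "Im a \<noteq> 0 \<Longrightarrow> a * jump_ratio a x = of_real (f x) + of_real (f x) * jump_ratio a x"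
  using diff_of_real_neq_0[of a "f x"] by (simp add: jump_ratio_def field_simps)

lemma jump_ratio_cnj: "jump_ratio (cnj a) x = cnj (jump_ratio a x)"
  by (simp add: jump_ratio_def)

text \<open>Write u for the ratio and s for the real jump. Then a u = s (1 + u), and eliminating s
  between this and its conjugate makes |u|^2 linear in u and \<open>cnj u\<close>. All later
  reductions of quadratic integrals rest on this.\<close>

lemma norm_jump_ratio_sq:
  assumes "Im a \<noteq> 0"
  shows "of_real ((norm (jump_ratio a x))\<^sup>2) =
    (cnj a * cnj (jump_ratio a x) - a * jump_ratio a x) / (2 * \<i> * of_real (Im a))"
proof -
  define u where "u = jump_ratio a x"
  have eq: "a * u = of_real (f x) * (1 + u)"
    using a_jump_ratio[OF assms, of x] by (simp add: u_def algebra_simps)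
  have eq': "cnj a * cnj u = of_real (f x) * (1 + cnj u)"
    using arg_cong[OF eq, of cnj] by simp
  have "a * u * (1 + cnj u) = cnj a * cnj u * (1 + u)"
    unfolding eq eq' by simp
  then have "(a - cnj a) * (u * cnj u) = cnj a * cnj u - a * u"
    by (simp add: algebra_simps)
  moreover have "a - cnj a = 2 * \<i> * of_real (Im a)" by (simp add: complex_eq_iff)
  moreover have "u * cnj u = of_real ((norm u)\<^sup>2)" by (rule complex_norm_square[symmetric])
  ultimately have "(2 * \<i> * of_real (Im a)) * of_real ((norm u)\<^sup>2) = cnj a * cnj u - a * u" by simp
  then show ?thesis using assms by (simp add: u_def field_simps)
qed

lemma integrable_bounded_complex:
  fixes h :: "'a \<Rightarrow> complex"
  assumes "h \<in> borel_measurable M" "\<And>x. norm (h x) \<le> B"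
  shows "integrable M h"
  by (rule integrable_const_bound[where B = B]) (use assms in auto)

lemma integrable_jump_ratio: "Im a \<noteq> 0 \<Longrightarrow> integrable M (jump_ratio a)"
  by (rule integrable_bounded_complex[OF _ norm_jump_ratio]) auto

lemma integrable_norm_jump_ratio_sq:
  assumes "Im a \<noteq> 0"
  shows "integrable M (\<lambda>x. (norm (jump_ratio a x))\<^sup>2)"
proof (rule integrable_const_bound[where B = "(K / \<bar>Im a\<bar>)\<^sup>2"])
  show "AE x in M. norm ((norm (jump_ratio a x))\<^sup>2) \<le> (K / \<bar>Im a\<bar>)\<^sup>2"
    using norm_jump_ratio[OF assms] by (simp add: power_mono del: power_divide)
qed measurable

lemma ratio_energy_nonneg: "ratio_energy a \<ge> 0"
  unfolding ratio_energy_def by simp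

lemma ratio_energy_cnj: "ratio_energy (cnj a) = ratio_energy a"
  by (simp add: ratio_energy_def jump_ratio_cnj)

text \<open>Each jump removes the proportion |u|^2 of the imaginary part. Hence energy below 1 means
  that a and its image lie in the same half plane.\<close>

lemma Im_K_transform:
  assumes a: "Im a \<noteq> 0"
  shows "Im (K_transform a) = Im a * (1 - ratio_energy a)"
proof -
  have "Im (a * jump_ratio a x) = - Im a * (norm (jump_ratio a x))\<^sup>2" for x
  proof -
    have "cnj (a * jump_ratio a x) - a * jump_ratio a x =
        of_real ((norm (jump_ratio a x))\<^sup>2) * (2 * \<i> * of_real (Im a))"
      using norm_jump_ratio_sq[OF a, of x] a by (simp add: field_simps)
    moreover have "of_real r * (2 * \<i> * of_real s) = \<i> * of_real (r * (2 * s))" for r s :: real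
      by simp
    ultimately have "Im (cnj (a * jump_ratio a x) - a * jump_ratio a x) = (norm (jump_ratio a x))\<^sup>2 * (2 * Im a)"
      by (metis Im_i_times Re_complex_of_real)
    then show ?thesis by (simp add: algebra_simps)
  qed
  then have "(\<integral>x. Im (a * jump_ratio a x) \<partial>M) = - Im a * ratio_energy a"
    by (simp add: ratio_energy_def)
  moreover have "Im (\<integral>x. a * jump_ratio a x \<partial>M) = (\<integral>x. Im (a * jump_ratio a x) \<partial>M)"
    using integrable_mult_right[OF integrable_jump_ratio[OF a], of a] integral_Im by metis
  ultimately show ?thesis by (simp add: K_transform_def algebra_simps)
qed

lemma K_transform_cnj: "K_transform (cnj a) = cnj (K_transform a)"
  by (simp add: K_transform_def jump_ratio_cnj flip: integral_cnj)

lemma K_transform_near: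
  assumes "\<bar>Im a\<bar> \<ge> e" "e > 0"
  shows "norm (K_transform a - a) \<le> measure M (space M) * (K + K * K / e)"
proof -
  have a: "Im a \<noteq> 0" using assms by auto
  have "norm (a * jump_ratio a x) \<le> K + K * K / e" for x
  proof -
    have "norm (a * jump_ratio a x) \<le> \<bar>f x\<bar> + \<bar>f x\<bar> * norm (jump_ratio a x)"
      unfolding a_jump_ratio[OF a] by (rule order_trans[OF norm_triangle_ineq]) (simp add: norm_mult)
    also have "\<dots> \<le> K + K * (K / e)"
      using f_bound K_nonneg assms
      by (intro add_mono mult_mono order_trans[OF norm_jump_ratio[OF a]] divide_left_mono) auto
    finally show ?thesis by simp
  qed
  then have "norm (\<integral>x. a * jump_ratio a x \<partial>M) \<le> (\<integral>x. K + K * K / e \<partial>M)"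
    using integrable_jump_ratio[OF a] by (intro norm_integral_le) auto
  then show ?thesis by (simp add: K_transform_def mult.commute)
qed

section \<open>Inversion of \<open>K_transform\<close> on each half plane\<close>

lemma norm_integral_jump_ratio_mult:
  assumes "Im a \<noteq> 0" "Im b \<noteq> 0"
  shows "norm (\<integral>x. jump_ratio a x * jump_ratio b x \<partial>M) \<le> (ratio_energy a + ratio_energy b) / 2"
  unfolding ratio_energy_def
proof (intro norm_integral_mult_le integrable_norm_jump_ratio_sq assms)
  show "integrable M (\<lambda>x. jump_ratio a x * jump_ratio b x)"
    by (rule integrable_bounded_complex[where B = "K / \<bar>Im a\<bar> * (K / \<bar>Im b\<bar>)"])
      (auto simp: norm_mult simp del: times_divide_eq_right times_divide_eq_left
        intro!: mult_mono norm_jump_ratio assms divide_nonneg_nonneg K_nonneg)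
qed

text \<open>The second factor cannot vanish when both energies are below 1, since the integral is
  bounded by their mean. This gives injectivity where the half plane is preserved.\<close>

lemma K_transform_diff:
  assumes a: "Im a \<noteq> 0" and b: "Im b \<noteq> 0"
  shows "K_transform a - K_transform b = (a - b) * (1 - (\<integral>x. jump_ratio a x * jump_ratio b x \<partial>M))"
proof -
  have "(\<integral>x. a * jump_ratio a x \<partial>M) - (\<integral>x. b * jump_ratio b x \<partial>M)
      = (\<integral>x. a * jump_ratio a x - b * jump_ratio b x \<partial>M)"
    using integrable_jump_ratio a b by (simp add: Bochner_Integration.integral_diff)
  also have "\<dots> = (\<integral>x. - (a - b) * (jump_ratio a x * jump_ratio b x) \<partial>M)"
  proof (intro Bochner_Integration.integral_cong refl)
    fix x
    show "a * jump_ratio a x - b * jump_ratio b x = - (a - b) * (jump_ratio a x * jump_ratio b x)"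
      unfolding jump_ratio_def using diff_of_real_neq_0[OF a, of "f x"] diff_of_real_neq_0[OF b, of "f x"]
      by (simp add: divide_simps) (simp add: algebra_simps)
  qed
  also have "\<dots> = - (a - b) * (\<integral>x. jump_ratio a x * jump_ratio b x \<partial>M)"
    by (rule integral_mult_right_zero)
  finally show ?thesis by (simp add: K_transform_def algebra_simps)
qed

lemma K_transform_inj:
  assumes "Im a \<noteq> 0" "Im b \<noteq> 0" "ratio_energy a < 1" "ratio_energy b < 1"
    and eq: "K_transform a = K_transform b"
  shows "a = b"
proof (rule ccontr)
  assume "a \<noteq> b"
  then have "(\<integral>x. jump_ratio a x * jump_ratio b x \<partial>M) = 1"
    using K_transform_diff[OF assms(1,2)] eq by simp
  then show False using norm_integral_jump_ratio_mult[OF assms(1,2)] assms by simp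
qed

lemma K_transform_holomorphic: "K_transform holomorphic_on (- \<real>)"
proof -
  have "(\<lambda>a. a + a * (\<integral>x. of_real (f x) / (a - of_real (f x)) \<partial>M)) holomorphic_on (- \<real>)"
    by (intro holomorphic_intros holomorphic_integral_resolvent[where B = K]) (use f_bound in auto)
  then show ?thesis
    unfolding K_transform_def[abs_def] jump_ratio_def[abs_def] integral_mult_right_zero .
qed

lemma energy_lt_1_iff:
  assumes "Im a \<noteq> 0"
  shows "Im a * Im (K_transform a) > 0 \<longleftrightarrow> ratio_energy a < 1"
proof -
  have "Im a * Im (K_transform a) = (Im a)\<^sup>2 * (1 - ratio_energy a)"
    by (simp add: Im_K_transform[OF assms] power2_eq_square)
  then show ?thesis using assms by (simp add: zero_less_mult_iff)
qed

text \<open>A solution is a fixed point of \<Phi>. By \<open>Im_K_transform\<close> the values of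
  \<Phi> on the upper half plane have imaginary part at least that of \<zeta>, and at that height or
  above the displacement \<open>K_transform a - a\<close> is at most r. So \<Phi> maps a compact
  convex piece of a disc into itself and Brouwer's theorem applies.\<close>

lemma K_transform_surj_upper:
  assumes \<zeta>: "Im \<zeta> > 0"
  shows "\<exists>a. Im a > 0 \<and> K_transform a = \<zeta>"
proof -
  define r where "r = measure M (space M) * (K + K * K / Im \<zeta>)"
  define S where "S = {a. Im a \<ge> Im \<zeta>} \<inter> cball \<zeta> r"
  define \<Phi> where "\<Phi> a = \<zeta> - (K_transform a - a)" for a
  have r0: "r \<ge> 0" using \<zeta> K_nonneg by (simp add: r_def)
  have "continuous_on S \<Phi>"
    unfolding \<Phi>_def using \<zeta>
    by (intro continuous_intros continuous_on_subset[OF holomorphic_on_imp_continuous_on[OF K_transform_holomorphic]])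
      (auto simp: S_def complex_is_Real_iff)
  moreover have "\<Phi> \<in> S \<rightarrow> S"
  proof
    fix a assume "a \<in> S"
    then have a: "Im a \<ge> Im \<zeta>" "Im a > 0" using \<zeta> by (auto simp: S_def)
    have "Im (\<Phi> a) = Im \<zeta> + Im a * ratio_energy a"
      using a by (simp add: \<Phi>_def Im_K_transform algebra_simps)
    then have "Im (\<Phi> a) \<ge> Im \<zeta>" using a ratio_energy_nonneg by simp
    moreover have "norm (K_transform a - a) \<le> r"
      unfolding r_def by (rule K_transform_near) (use a \<zeta> in auto)
    ultimately show "\<Phi> a \<in> S" by (simp add: S_def \<Phi>_def dist_norm)
  qed
  moreover have "compact S" unfolding S_def
    by (intro closed_Int_compact closed_halfspace_Im_ge compact_cball)
  moreover have "convex S" unfolding S_def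
    by (intro convex_Int convex_halfspace_Im_ge convex_cball)
  moreover have "S \<noteq> {}" using r0 by (auto simp: S_def)
  ultimately obtain a where "a \<in> S" "\<Phi> a = a" using brouwer by metis
  then show ?thesis using \<zeta> by (auto simp: S_def \<Phi>_def intro!: exI[of _ a])
qed

lemma K_transform_surj:
  assumes \<zeta>: "Im \<zeta> \<noteq> 0"
  shows "\<exists>a. Im a * Im \<zeta> > 0 \<and> K_transform a = \<zeta>"
proof (cases "Im \<zeta> > 0")
  case True
  then show ?thesis using K_transform_surj_upper[OF True] by (auto intro: mult_pos_pos)
next
  case False
  then have "Im (cnj \<zeta>) > 0" using \<zeta> by simp
  from K_transform_surj_upper[OF this] obtain a where "Im a > 0" "K_transform a = cnj \<zeta>" by blast
  then show ?thesis using False \<zeta>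
    by (intro exI[of _ "cnj a"]) (auto simp: K_transform_cnj mult_pos_neg)
qed

text \<open>The reciprocal of \<open>F_transform\<close> is the Cauchy transform of the free compound Poisson law
  with jump measure \<open>distr M borel f\<close>.\<close>

definition F_transform :: "complex \<Rightarrow> complex" where
  "F_transform \<zeta> = (THE a. Im a * Im \<zeta> > 0 \<and> K_transform a = \<zeta>)"

lemma F_transform_unique:
  assumes "Im a * Im \<zeta> > 0" "K_transform a = \<zeta>"
  shows "F_transform \<zeta> = a"
  unfolding F_transform_def
proof (rule the_equality)
  show "Im a * Im \<zeta> > 0 \<and> K_transform a = \<zeta>" using assms by simp
  fix b assume b: "Im b * Im \<zeta> > 0 \<and> K_transform b = \<zeta>"
  have nz: "Im a \<noteq> 0" "Im b \<noteq> 0" using assms b by auto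
  have "ratio_energy a < 1" "ratio_energy b < 1"
    using energy_lt_1_iff[OF nz(1)] energy_lt_1_iff[OF nz(2)] assms b by auto
  then show "b = a" using K_transform_inj[OF nz] assms b by simp
qed

lemma F_transform:
  assumes "Im \<zeta> \<noteq> 0"
  shows "Im (F_transform \<zeta>) * Im \<zeta> > 0" "K_transform (F_transform \<zeta>) = \<zeta>"
    "Im (F_transform \<zeta>) \<noteq> 0" "ratio_energy (F_transform \<zeta>) < 1"
proof -
  obtain a where a: "Im a * Im \<zeta> > 0" "K_transform a = \<zeta>"
    using K_transform_surj[OF assms] by blast
  then show 1: "Im (F_transform \<zeta>) * Im \<zeta> > 0" "K_transform (F_transform \<zeta>) = \<zeta>"
    using F_transform_unique[OF a] by auto
  then show 2: "Im (F_transform \<zeta>) \<noteq> 0" by auto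
  show "ratio_energy (F_transform \<zeta>) < 1" using energy_lt_1_iff[OF 2] 1 by simp
qed

lemma F_transform_cnj:
  assumes "Im \<zeta> \<noteq> 0"
  shows "F_transform (cnj \<zeta>) = cnj (F_transform \<zeta>)"
  by (rule F_transform_unique) (use F_transform[OF assms] in \<open>auto simp: K_transform_cnj\<close>)

lemma F_transform_Im:
  assumes "Im \<zeta> \<noteq> 0"
  shows "Im \<zeta> = Im (F_transform \<zeta>) * (1 - ratio_energy (F_transform \<zeta>))"
    "\<bar>Im (F_transform \<zeta>)\<bar> \<ge> \<bar>Im \<zeta>\<bar>"
proof -
  show eq: "Im \<zeta> = Im (F_transform \<zeta>) * (1 - ratio_energy (F_transform \<zeta>))"
    using Im_K_transform[of "F_transform \<zeta>"] F_transform[OF assms] by simp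
  have "\<bar>Im \<zeta>\<bar> = \<bar>Im (F_transform \<zeta>)\<bar> * (1 - ratio_energy (F_transform \<zeta>))"
    by (subst eq) (use F_transform[OF assms] in \<open>simp add: abs_mult\<close>)
  also have "\<dots> \<le> \<bar>Im (F_transform \<zeta>)\<bar>"
    using ratio_energy_nonneg F_transform(4)[OF assms] by (intro mult_left_le) auto
  finally show "\<bar>Im (F_transform \<zeta>)\<bar> \<ge> \<bar>Im \<zeta>\<bar>" .
qed

lemma F_transform_near:
  assumes "\<bar>Im \<zeta>\<bar> \<ge> e" "e > 0"
  shows "norm (F_transform \<zeta> - \<zeta>) \<le> measure M (space M) * (K + K * K / e)"
proof -
  have \<zeta>: "Im \<zeta> \<noteq> 0" using assms by auto
  show ?thesis
    using K_transform_near[of e "F_transform \<zeta>"] F_transform_Im(2)[OF \<zeta>] F_transform(2)[OF \<zeta>] assms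
    by (simp add: norm_minus_commute)
qed

text \<open>\<open>D\<close> is the open set where the energy is below 1. There
  \<open>K_transform\<close> is injective, and the inverse of an injective holomorphic function is
  holomorphic.\<close>

lemma F_transform_holomorphic: "F_transform holomorphic_on (- \<real>)"
proof -
  define D where "D = (- \<real>) \<inter> {a. Im a * Im (K_transform a) > 0}"
  have cont: "continuous_on (- \<real>) K_transform"
    by (rule holomorphic_on_imp_continuous_on[OF K_transform_holomorphic])
  have "open D"
  proof -
    have "continuous_on (- \<real>) (\<lambda>a. Im a * Im (K_transform a))"
      by (intro continuous_intros cont)
    from continuous_open_preimage[OF this open_Compl[OF closed_complex_Reals] open_greaterThan[of 0]]
    show ?thesis by (simp add: D_def vimage_def Int_def)
  qed
  moreover have "K_transform holomorphic_on D"
    by (rule holomorphic_on_subset[OF K_transform_holomorphic]) (simp add: D_def)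
  moreover have "inj_on K_transform D"
  proof (rule inj_onI)
    fix a b assume "a \<in> D" "b \<in> D" "K_transform a = K_transform b"
    then show "a = b"
      using K_transform_inj[of a b] energy_lt_1_iff[of a] energy_lt_1_iff[of b]
      by (simp add: D_def notin_Reals_iff_Im)
  qed
  ultimately obtain g where g: "g holomorphic_on (K_transform ` D)" "\<And>a. a \<in> D \<Longrightarrow> g (K_transform a) = a"
    using holomorphic_has_inverse by metis
  have "F_transform \<zeta> \<in> D" "g \<zeta> = F_transform \<zeta>" if "\<zeta> \<notin> \<real>" for \<zeta>
  proof -
    have \<zeta>: "Im \<zeta> \<noteq> 0" using that by (simp add: notin_Reals_iff_Im)
    show D: "F_transform \<zeta> \<in> D" using F_transform[OF \<zeta>] by (simp add: D_def notin_Reals_iff_Im)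
    show "g \<zeta> = F_transform \<zeta>" using g(2)[OF D] F_transform(2)[OF \<zeta>] by simp
  qed
  then have "- \<real> \<subseteq> K_transform ` D" "\<And>\<zeta>. \<zeta> \<in> - \<real> \<Longrightarrow> g \<zeta> = F_transform \<zeta>"
    using F_transform(2) by (force simp: notin_Reals_iff_Im)+
  then show ?thesis using holomorphic_on_subset[OF g(1)] holomorphic_transform by blast
qed

end

section \<open>Positivity of the two-variable kernel\<close>

text \<open>These are the coefficient equations of the quadratic form in
  \<open>Re_green_nonneg\<close>: the first is that of x \<open>cnj y\<close>, the second that of
  |x|^2. With e = (1 + u) v, the abbreviations \<open>ve\<close>, \<open>ue\<close>,
  \<open>ee\<close> are the values that \<open>moments\<close> finds for the integrals of e
  \<open>cnj v\<close>, u \<open>cnj e\<close> and |e|^2.\<close>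

lemma cauchy_kernel_identities:
  fixes a b p q :: complex and V L :: real
  defines "G \<equiv> 1 / (a * b * (1 - p))" and "G' \<equiv> 1 / (a * cnj b * (1 - q))"
  defines "ve \<equiv> of_real V + (cnj b * q - b * p) / (b - cnj b)"
    and "ue \<equiv> cnj a * (cnj p - q) / (a - cnj a)"
    and "ee \<equiv> V + 2 * Re ((cnj b * q - b * p) / (b - cnj b))
      + Re ((cnj a * cnj b * cnj p - cnj a * b * cnj q - a * cnj b * q + a * b * p) / ((a - cnj a) * (b - cnj b)))"
  defines "m \<equiv> of_real L * cnj b * (G' - G) / (b - cnj b)"
  assumes a: "Im a \<noteq> 0" and b: "Im b \<noteq> 0" and p: "p \<noteq> 1" and q: "q \<noteq> 1" and L: "L * (1 - V) = 1"
  shows "m = G + m * q + of_real L * G * ve"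
    and "L * Re (G' - G) / (2 * Im a * Im b) = (norm G)\<^sup>2 + 2 * Re (m * cnj G * ue) + L * (norm G)\<^sup>2 * ee"
proof -
  have [simp]: "a \<noteq> 0" "b \<noteq> 0" using a b by auto
  define d e where "d = a - cnj a" and "e = b - cnj b"
  have d: "d = 2 * \<i> * of_real (Im a)" "d \<noteq> 0" and e: "e = 2 * \<i> * of_real (Im b)" "e \<noteq> 0"
    using a b by (auto simp: d_def e_def complex_eq_iff)
  have cd: "cnj d = - d" "cnj e = - e" by (simp_all add: d_def e_def)
  have cpq: "cnj p \<noteq> 1" "cnj q \<noteq> 1" using p q by (metis complex_cnj_cnj complex_cnj_one)+
  \<comment> \<open>The denominators are cleared from here on: after multiplication by a -
    \<open>cnj a\<close> and b - \<open>cnj b\<close>, both claims are polynomial consequences of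
    the equations that define G, G', their conjugates and L.\<close>
  have G: "G * (a * b * (1 - p)) = 1" using p by (simp add: G_def)
  have G': "G' * (a * cnj b * (1 - q)) = 1" using q by (simp add: G'_def)
  have cG: "cnj G * (cnj a * cnj b * (1 - cnj p)) = 1" using cpq by (simp add: G_def)
  have cG': "cnj G' * (cnj a * b * (1 - cnj q)) = 1" using cpq by (simp add: G'_def)
  have Lc: "of_real L * (1 - of_real V) = (1::complex)"
    using arg_cong[OF L, of complex_of_real] by simp
  have me: "m * e = of_real L * cnj b * (G' - G)" using e by (simp add: m_def e_def)
  have vee: "ve * e = of_real V * e + (cnj b * q - b * p)" unfolding ve_def e_def[symmetric] using e(2) by (simp add: distrib_right)
  have "e * (m - (G + m * q + of_real L * G * ve)) = 0"
    using me vee G G' Lc e_def by algebra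
  then show "m = G + m * q + of_real L * G * ve" using e by simp
  define ce where "ce = of_real V + (cnj b * q - b * p) / e - (b * cnj q - cnj b * cnj p) / e
     + (cnj a * cnj b * cnj p - cnj a * b * cnj q - a * cnj b * q + a * b * p) / (d * e)"
  have ce: "of_real ee = ce"
  proof -
    have *: "of_real (2 * Re z) = z + cnj z" for z by (simp add: complex_add_cnj)
    \<comment> \<open>This summand of \<open>ee\<close> is real, because conjugation changes the
      sign of both factors of its denominator and reproduces its numerator. Its real part can thus
      be replaced by the complex expression itself, which keeps the computation polynomial.\<close>
    define t where "t = (cnj a * cnj b * cnj p - cnj a * b * cnj q - a * cnj b * q + a * b * p) / (d * e)"
    have "cnj t = t"
      unfolding t_def complex_cnj_divide complex_cnj_mult cd by (simp add: algebra_simps)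
    then have t: "of_real (Re t) = t" by (metis Reals_cnj_iff of_real_Re)
    have "cnj ((cnj b * q - b * p) / e) = - (b * cnj q - cnj b * cnj p) / e"
      unfolding complex_cnj_divide cd by (simp add: minus_divide_left)
    then show ?thesis
      unfolding ee_def ce_def d_def[symmetric] e_def[symmetric] t_def[symmetric]
      unfolding of_real_add * t by (simp add: diff_divide_distrib)
  qed
  define X where "X = m * cnj G * ue"
  have X: "X * (d * e) = of_real L * cnj b * (G' - G) * cnj G * cnj a * (cnj p - q)"
    unfolding X_def m_def ue_def d_def[symmetric] e_def[symmetric] using d(2) e(2) by (simp add: field_simps)
  have cX: "cnj X * (d * e) = of_real L * b * (cnj G' - cnj G) * G * a * (p - cnj q)"
    using arg_cong[OF X, of cnj] by (simp add: cd)
  have R: "of_real ((norm G)\<^sup>2 + 2 * Re X + L * (norm G)\<^sup>2 * ee)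
      = G * cnj G + (X + cnj X) + of_real L * (G * cnj G) * ce"
  proof -
    have *: "of_real (2 * Re z) = z + cnj z" for z by (simp add: complex_add_cnj)
    show ?thesis unfolding of_real_add * unfolding of_real_mult complex_norm_square ce ..
  qed
  have rhs: "of_real ((norm G)\<^sup>2 + 2 * Re X + L * (norm G)\<^sup>2 * ee) * (d * e)
      = G * cnj G * (d * e) + of_real L * cnj b * (G' - G) * cnj G * cnj a * (cnj p - q)
        + of_real L * b * (cnj G' - cnj G) * G * a * (p - cnj q)
        + of_real L * (G * cnj G) * (ce * (d * e))" (is "?r * (d * e) = _")
    unfolding R distrib_right X cX by (simp add: mult.assoc)
  have ce': "ce * (d * e) = of_real V * (d * e) + d * (cnj b * q - b * p) - d * (b * cnj q - cnj b * cnj p)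
     + (cnj a * cnj b * cnj p - cnj a * b * cnj q - a * cnj b * q + a * b * p)"
    using d e by (simp add: ce_def field_simps)
  have "G * cnj G * (d * e) + of_real L * cnj b * (G' - G) * cnj G * cnj a * (cnj p - q)
        + of_real L * b * (cnj G' - cnj G) * G * a * (p - cnj q)
        + of_real L * (G * cnj G) * (ce * (d * e)) = - of_real L * (G' - G + cnj G' - cnj G)"
    using G G' cG cG' Lc ce' d_def e_def by algebra
  also have "G' - G + cnj G' - cnj G = of_real (2 * Re (G' - G))"
    using complex_add_cnj[of "G' - G"] by (simp add: algebra_simps)
  finally have fin: "?r * (d * e) = - of_real L * of_real (2 * Re (G' - G))" using rhs by simp
  have de: "d * e = of_real (- 4 * Im a * Im b)"
    unfolding d(1) e(1) by (simp add: algebra_simps)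
  have "((norm G)\<^sup>2 + 2 * Re X + L * (norm G)\<^sup>2 * ee) * (- 4 * Im a * Im b) = - L * (2 * Re (G' - G))"
    using fin unfolding de of_real_mult[symmetric] of_real_minus[symmetric] of_real_eq_iff .
  then have "L * Re (G' - G) / (2 * Im a * Im b) = (norm G)\<^sup>2 + 2 * Re X + L * (norm G)\<^sup>2 * ee"
    using a b by (simp add: field_simps)
  then show "L * Re (G' - G) / (2 * Im a * Im b) = (norm G)\<^sup>2 + 2 * Re (m * cnj G * ue) + L * (norm G)\<^sup>2 * ee"
    unfolding X_def .
qed

lemma (in bounded_jumps) norm_jump_ratio_sq':
  assumes "Im a \<noteq> 0"
  shows "of_real ((norm (jump_ratio a x))\<^sup>2) =
    (cnj a * cnj (jump_ratio a x) - a * jump_ratio a x) / (a - cnj a)"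
proof -
  have "a - cnj a = 2 * \<i> * of_real (Im a)" by (simp add: complex_eq_iff)
  then show ?thesis using norm_jump_ratio_sq[OF assms] by simp
qed

definition hermitian_form :: "real \<Rightarrow> complex \<Rightarrow> real \<Rightarrow> complex \<Rightarrow> complex \<Rightarrow> real" where
  "hermitian_form N m L x y = N * (norm x)\<^sup>2 + 2 * Re (m * x * cnj y) + L * (norm y)\<^sup>2"

lemma norm_add_square: "(norm (x + y :: complex))\<^sup>2 = (norm x)\<^sup>2 + 2 * Re (x * cnj y) + (norm y)\<^sup>2"
  unfolding cmod_power2 by (simp add: power2_eq_square algebra_simps)

lemma Re_of_real_mult: "Re (of_real r * z) = r * Re z"
  by simp

lemma hermitian_form_expand:
  "hermitian_form N m L (x * u) (x * (G * e) + y * v) =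
     (norm x)\<^sup>2 * (N * (norm u)\<^sup>2 + 2 * Re (m * cnj G * (u * cnj e)) + L * (norm G)\<^sup>2 * (norm e)\<^sup>2)
     + 2 * Re (x * cnj y * (m * (u * cnj v) + of_real L * G * (e * cnj v))) + (norm y)\<^sup>2 * (L * (norm v)\<^sup>2)"
proof -
  have "m * (x * u) * cnj (x * (G * e) + y * v) =
      of_real ((norm x)\<^sup>2) * (m * cnj G * (u * cnj e)) + x * cnj y * (m * (u * cnj v))"
    unfolding complex_norm_square by (simp add: algebra_simps)
  then have 1: "Re (m * (x * u) * cnj (x * (G * e) + y * v)) =
      (norm x)\<^sup>2 * Re (m * cnj G * (u * cnj e)) + Re (x * cnj y * (m * (u * cnj v)))"
    by (simp only: plus_complex.sel Re_of_real_mult)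
  have "L * (2 * Re (x * (G * e) * cnj (y * v))) = 2 * Re (x * cnj y * (of_real L * G * (e * cnj v)))"
  proof -
    have "of_real L * (x * (G * e) * cnj (y * v)) = x * cnj y * (of_real L * G * (e * cnj v))"
      by (simp add: mult_ac)
    then show ?thesis by (metis Re_of_real_mult mult.left_commute)
  qed
  then show ?thesis
    unfolding hermitian_form_def norm_add_square 1
    by (simp only: norm_mult power_mult_distrib distrib_left plus_complex.sel) (simp add: algebra_simps)
qed

lemma has_bochner_integral_le:
  fixes h k :: "'a \<Rightarrow> real"
  assumes "has_bochner_integral M h I" "has_bochner_integral M k J" "\<And>t. h t \<le> k t"
  shows "I \<le> J"
  using integral_mono[of M h k] assms by (auto simp: has_bochner_integral_iff)

locale two_jumps = f: bounded_jumps M f K + g: bounded_jumps M g K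
  for M :: "'a measure" and f g K
begin

definition cross :: "complex \<Rightarrow> complex \<Rightarrow> complex" where
  "cross a b = (\<integral>x. f.jump_ratio a x * g.jump_ratio b x \<partial>M)"

text \<open>With z = 1/a and w = 1/b the relation 1 - 1/h = \<open>cross a b\<close> gives h = 1/(1
  - \<open>cross a b\<close>), and this is z w h: the value prescribed for the Cauchy transform at
  the pair of points whose inverse images under the two \<open>K_transform\<close> maps are a and
  b.\<close>

definition green :: "complex \<Rightarrow> complex \<Rightarrow> complex" where
  "green a b = 1 / (a * b * (1 - cross a b))"

lemma integrable_cross:
  assumes "Im a \<noteq> 0" "Im b \<noteq> 0"
  shows "integrable M (\<lambda>x. f.jump_ratio a x * g.jump_ratio b x)"
  by (rule f.integrable_bounded_complex[where B = "K / \<bar>Im a\<bar> * (K / \<bar>Im b\<bar>)"])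
    (auto simp: norm_mult simp del: times_divide_eq_right times_divide_eq_left
      intro!: mult_mono f.norm_jump_ratio g.norm_jump_ratio assms divide_nonneg_nonneg f.K_nonneg)

lemma cross_cnj: "cross (cnj a) (cnj b) = cnj (cross a b)"
  unfolding cross_def f.jump_ratio_cnj g.jump_ratio_cnj complex_cnj_mult[symmetric] by (rule Bochner_Integration.integral_cnj)

lemma norm_cross:
  assumes "Im a \<noteq> 0" "Im b \<noteq> 0"
  shows "norm (cross a b) \<le> (f.ratio_energy a + g.ratio_energy b) / 2"
  unfolding cross_def f.ratio_energy_def g.ratio_energy_def
  by (intro norm_integral_mult_le integrable_cross f.integrable_norm_jump_ratio_sq
      g.integrable_norm_jump_ratio_sq assms)

text \<open>By \<open>norm_jump_ratio_sq'\<close> the factors |u|^2 and |v|^2 are linear in u, v and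
  their conjugates. Hence integrals of degree up to four collapse to U, V and the two values p, q of
  \<open>cross\<close> with their conjugates.\<close>

lemma moments:
  assumes a: "Im a \<noteq> 0" and b: "Im b \<noteq> 0"
  defines "u \<equiv> f.jump_ratio a" and "v \<equiv> g.jump_ratio b"
    and "p \<equiv> cross a b" and "q \<equiv> cross a (cnj b)"
    and "U \<equiv> f.ratio_energy a" and "V \<equiv> g.ratio_energy b"
  shows "has_bochner_integral M (\<lambda>x. (norm (u x))\<^sup>2) U"
    and "has_bochner_integral M (\<lambda>x. (norm (v x))\<^sup>2) V"
    and "has_bochner_integral M (\<lambda>x. u x * cnj (v x)) q"
    and "has_bochner_integral M (\<lambda>x. (1 + u x) * v x * cnj (v x))
      (of_real V + (cnj b * q - b * p) / (b - cnj b))"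
    and "has_bochner_integral M (\<lambda>x. u x * cnj ((1 + u x) * v x)) (cnj a * (cnj p - q) / (a - cnj a))"
    and "has_bochner_integral M (\<lambda>x. (norm ((1 + u x) * v x))\<^sup>2)
      (V + 2 * Re ((cnj b * q - b * p) / (b - cnj b))
      + Re ((cnj a * cnj b * cnj p - cnj a * b * cnj q - a * cnj b * q + a * b * p) / ((a - cnj a) * (b - cnj b))))"
proof -
  have d: "a - cnj a \<noteq> 0" "b - cnj b \<noteq> 0" using a b by (auto simp: complex_eq_iff)
  have b': "Im (cnj b) \<noteq> 0" using b by simp
  show iU: "has_bochner_integral M (\<lambda>x. (norm (u x))\<^sup>2) U"
    using f.integrable_norm_jump_ratio_sq[OF a] by (simp add: has_bochner_integral_iff u_def U_def f.ratio_energy_def)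
  show iV: "has_bochner_integral M (\<lambda>x. (norm (v x))\<^sup>2) V"
    using g.integrable_norm_jump_ratio_sq[OF b] by (simp add: has_bochner_integral_iff v_def V_def g.ratio_energy_def)
  have ip: "has_bochner_integral M (\<lambda>x. u x * v x) p"
    using integrable_cross[OF a b] by (simp add: has_bochner_integral_iff p_def cross_def u_def v_def)
  show iq: "has_bochner_integral M (\<lambda>x. u x * cnj (v x)) q"
    using integrable_cross[OF a b'] by (simp add: has_bochner_integral_iff q_def cross_def u_def v_def g.jump_ratio_cnj)
  have cn: "has_bochner_integral M (\<lambda>x. cnj (h x)) (cnj I)" if "has_bochner_integral M h I" for h I
    using has_bochner_integral_bounded_linear[OF bounded_linear_cnj that] .
  have ipc: "has_bochner_integral M (\<lambda>x. cnj (u x * v x)) (cnj p)" by (rule cn[OF ip])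
  have iqc: "has_bochner_integral M (\<lambda>x. cnj (u x * cnj (v x))) (cnj q)" by (rule cn[OF iq])
  note intros = has_bochner_integral_add has_bochner_integral_diff has_bochner_integral_mult_right
    has_bochner_integral_divide_zero
  have iV': "has_bochner_integral M (\<lambda>x. complex_of_real ((norm (v x))\<^sup>2)) (of_real V)"
    by (rule has_bochner_integral_of_real[OF iV])
  have iuvv: "has_bochner_integral M (\<lambda>x. (cnj b * (u x * cnj (v x)) - b * (u x * v x)) / (b - cnj b))
     ((cnj b * q - b * p) / (b - cnj b))"
    by (intro intros iq ip)
  have uvv: "(cnj b * (u x * cnj (v x)) - b * (u x * v x)) / (b - cnj b) = u x * of_real ((norm (v x))\<^sup>2)" for x
    unfolding v_def g.norm_jump_ratio_sq'[OF b] using d by (simp add: field_simps)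
  have iee: "has_bochner_integral M (\<lambda>x. (cnj a * cnj b * cnj (u x * v x) - cnj a * b * cnj (u x * cnj (v x))
      - a * cnj b * (u x * cnj (v x)) + a * b * (u x * v x)) / ((a - cnj a) * (b - cnj b)))
      ((cnj a * cnj b * cnj p - cnj a * b * cnj q - a * cnj b * q + a * b * p) / ((a - cnj a) * (b - cnj b)))"
    by (intro intros iq ip iqc ipc)
  have uuvv: "(cnj a * cnj b * cnj (u x * v x) - cnj a * b * cnj (u x * cnj (v x))
      - a * cnj b * (u x * cnj (v x)) + a * b * (u x * v x)) / ((a - cnj a) * (b - cnj b))
      = of_real ((norm (u x))\<^sup>2) * of_real ((norm (v x))\<^sup>2)" for x
    unfolding u_def v_def f.norm_jump_ratio_sq'[OF a] g.norm_jump_ratio_sq'[OF b] times_divide_times_eq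
    by (rule arg_cong2[where f = "(/)"]) (simp_all add: algebra_simps)
  show "has_bochner_integral M (\<lambda>x. (1 + u x) * v x * cnj (v x))
      (of_real V + (cnj b * q - b * p) / (b - cnj b))"
  proof -
    have "(1 + u x) * v x * cnj (v x) = of_real ((norm (v x))\<^sup>2) +
        (cnj b * (u x * cnj (v x)) - b * (u x * v x)) / (b - cnj b)" for x
      unfolding uvv complex_norm_square by (simp add: algebra_simps)
    then show ?thesis by (simp only:) (intro intros iV' iuvv)
  qed
  show "has_bochner_integral M (\<lambda>x. u x * cnj ((1 + u x) * v x)) (cnj a * (cnj p - q) / (a - cnj a))"
  proof -
    have "u x * cnj ((1 + u x) * v x) = u x * cnj (v x) + of_real ((norm (u x))\<^sup>2) * cnj (v x)" for x
      unfolding complex_norm_square by (simp add: algebra_simps)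
    also have "\<dots> x = (cnj a * cnj (u x * v x) - cnj a * (u x * cnj (v x))) / (a - cnj a)" for x
      unfolding u_def f.norm_jump_ratio_sq'[OF a] using d by (simp add: field_simps)
    finally have *: "u x * cnj ((1 + u x) * v x) = (cnj a * cnj (u x * v x) - cnj a * (u x * cnj (v x))) / (a - cnj a)" for x .
    show ?thesis unfolding * right_diff_distrib[of "cnj a"] by (intro intros ipc iq)
  qed
  show "has_bochner_integral M (\<lambda>x. (norm ((1 + u x) * v x))\<^sup>2)
      (V + 2 * Re ((cnj b * q - b * p) / (b - cnj b))
      + Re ((cnj a * cnj b * cnj p - cnj a * b * cnj q - a * cnj b * q + a * b * p) / ((a - cnj a) * (b - cnj b))))"
  proof -
    have *: "(norm ((1 + u x) * v x))\<^sup>2 = (norm (v x))\<^sup>2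
        + 2 * Re ((cnj b * (u x * cnj (v x)) - b * (u x * v x)) / (b - cnj b))
        + Re ((cnj a * cnj b * cnj (u x * v x) - cnj a * b * cnj (u x * cnj (v x))
      - a * cnj b * (u x * cnj (v x)) + a * b * (u x * v x)) / ((a - cnj a) * (b - cnj b)))" for x
      unfolding uvv uuvv of_real_mult[symmetric] Re_complex_of_real norm_mult power_mult_distrib norm_add_square[of 1]
      by (simp add: algebra_simps)
    show ?thesis unfolding *
      by (intro intros iV has_bochner_integral_bounded_linear[OF bounded_linear_Re] iuvv iee)
  qed
qed

text \<open>The quantity in question is a positive multiple of the coefficient \<open>N\<close> of a form \<open>Q\<close> that
  satisfies \<open>Q(x, y) = |x G + y|\<^sup>2 + \<integral> Q(x u, x G (1 + u) v + y v)\<close>.  The substitution under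
  the integral contracts, so iteration gives \<open>Q \<ge> 0\<close>.\<close>

lemma Re_green_nonneg:
  assumes a: "Im a \<noteq> 0" and b: "Im b \<noteq> 0"
    and U1: "f.ratio_energy a < 1" and V1: "g.ratio_energy b < 1"
  shows "Re (green a (cnj b) - green a b) * (Im a * Im b) \<ge> 0"
proof -
  define u v where "u = f.jump_ratio a" and "v = g.jump_ratio b"
  define U V where "U = f.ratio_energy a" and "V = g.ratio_energy b"
  define p q where "p = cross a b" and "q = cross a (cnj b)"
  define G G' where "G = 1 / (a * b * (1 - p))" and "G' = 1 / (a * cnj b * (1 - q))"
  \<comment> \<open>\<open>L\<close>, \<open>m\<close> and \<open>N\<close> solve the three
    coefficient equations of the fixed-point identity for \<open>Q\<close>. \<open>N\<close> carries
    the quantity whose sign is claimed, multiplied by a factor with the sign of Im a Im b.\<close>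
  define L where "L = 1 / (1 - V)"
  define N where "N = L * Re (G' - G) / (2 * Im a * Im b * (1 - U))"
  define m where "m = of_real L * cnj b * (G' - G) / (b - cnj b)"
  define e where "e x = (1 + u x) * v x" for x
  note mom = moments[OF a b, folded u_def v_def U_def V_def p_def q_def, folded e_def]
  define ve where "ve = of_real V + (cnj b * q - b * p) / (b - cnj b)"
  define ue where "ue = cnj a * (cnj p - q) / (a - cnj a)"
  define ee where "ee = V + 2 * Re ((cnj b * q - b * p) / (b - cnj b))
      + Re ((cnj a * cnj b * cnj p - cnj a * b * cnj q - a * cnj b * q + a * b * p) / ((a - cnj a) * (b - cnj b)))"
  note mom = mom[folded ve_def ue_def ee_def]
  have UV: "0 \<le> U" "U < 1" "0 \<le> V" "V < 1"
    using U1 V1 f.ratio_energy_nonneg g.ratio_energy_nonneg by (auto simp: U_def V_def)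
  have p1: "p \<noteq> 1"
    using norm_cross[OF a b] UV by (auto simp: p_def[symmetric] U_def[symmetric] V_def[symmetric])
  have q1: "q \<noteq> 1"
    using norm_cross[OF a, of "cnj b"] b UV
    by (auto simp: q_def[symmetric] U_def[symmetric] V_def[symmetric] g.ratio_energy_cnj)
  have LV: "L * (1 - V) = 1" using UV by (simp add: L_def)
  have L0: "L > 0" using UV by (simp add: L_def)
  note ids = cauchy_kernel_identities[OF a b p1 q1 LV, folded G_def G'_def, folded m_def ve_def ue_def ee_def]
  have Neq: "N = (norm G)\<^sup>2 + N * U + 2 * Re (m * cnj G * ue) + L * (norm G)\<^sup>2 * ee"
  proof -
    have "N * (1 - U) = L * Re (G' - G) / (2 * Im a * Im b)" using UV by (simp add: N_def)
    then show ?thesis unfolding ids(2) by (simp add: algebra_simps)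
  qed
  have Leq: "L = 1 + L * V" using LV by (simp add: algebra_simps)
  note intros = has_bochner_integral_add has_bochner_integral_diff has_bochner_integral_mult_right
    has_bochner_integral_bounded_linear[OF bounded_linear_Re]
  define Q where "Q = hermitian_form N m L"
  define \<phi> where "\<phi> x y t = x * (G * e t) + y * v t" for x y t
  have Qint: "has_bochner_integral M (\<lambda>t. Q (x * u t) (\<phi> x y t))
      ((norm x)\<^sup>2 * (N * U + 2 * Re (m * cnj G * ue) + L * (norm G)\<^sup>2 * ee)
     + 2 * Re (x * cnj y * (m * q + of_real L * G * ve)) + (norm y)\<^sup>2 * (L * V))" for x y
    unfolding Q_def \<phi>_def hermitian_form_expand by (intro intros mom)
  have Qfix: "has_bochner_integral M (\<lambda>t. Q (x * u t) (\<phi> x y t)) (Q x y - (norm (x * G + y))\<^sup>2)" for x y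
  proof -
    have "(norm (x * G + y))\<^sup>2 + ((norm x)\<^sup>2 * (N * U + 2 * Re (m * cnj G * ue) + L * (norm G)\<^sup>2 * ee)
     + 2 * Re (x * cnj y * (m * q + of_real L * G * ve)) + (norm y)\<^sup>2 * (L * V))
     = (norm x)\<^sup>2 * ((norm G)\<^sup>2 + N * U + 2 * Re (m * cnj G * ue) + L * (norm G)\<^sup>2 * ee)
     + 2 * Re (x * cnj y * (G + m * q + of_real L * G * ve)) + (norm y)\<^sup>2 * (1 + L * V)"
      unfolding norm_add_square norm_mult power_mult_distrib by (simp add: algebra_simps)
    also have "\<dots> = Q x y"
      unfolding Neq[symmetric] ids(1)[symmetric] Leq[symmetric] Q_def hermitian_form_def
      by (simp add: mult_ac)
    finally have eq: "((norm x)\<^sup>2 * (N * U + 2 * Re (m * cnj G * ue) + L * (norm G)\<^sup>2 * ee)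
     + 2 * Re (x * cnj y * (m * q + of_real L * G * ve)) + (norm y)\<^sup>2 * (L * V)) = Q x y - (norm (x * G + y))\<^sup>2"
      by linarith
    show ?thesis using Qint[of x y] unfolding eq .
  qed
  \<comment> \<open>\<open>P\<close> is a weighted norm in which the substitution contracts on
    average. The share \<delta> in Young's inequality keeps the rate of y at (1 + V)/2 < 1;
    \<open>C\<close> bounds what x leaks into the second slot; the weight \<Lambda> is so large that
    the gap (1 - U)/2 of the first slot absorbs this leak.\<close>
  define \<delta> where "\<delta> = (1 - V) / 2"
  define C where "C = (1 + 1 / \<delta>) * ((norm G)\<^sup>2 * ee)"
  define \<Lambda> where "\<Lambda> = 2 * C / (1 - U) + 1"
  define \<theta> where "\<theta> = max ((1 + U) / 2) ((1 + V) / 2)"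
  define P where "P x y = \<Lambda> * (norm x)\<^sup>2 + (norm y)\<^sup>2" for x y :: complex
  have \<theta>: "0 \<le> \<theta>" "\<theta> < 1" using UV by (auto simp: \<theta>_def le_max_iff_disj)
  have \<delta>: "\<delta> > 0" "(1 + \<delta>) * V \<le> (1 + V) / 2"
  proof -
    show "\<delta> > 0" using UV by (simp add: \<delta>_def)
    then have "\<delta> * V \<le> \<delta>" using UV by simp
    then show "(1 + \<delta>) * V \<le> (1 + V) / 2" by (simp add: \<delta>_def field_simps)
  qed
  have ee0: "ee \<ge> 0"
    using mom(6) by (auto simp: has_bochner_integral_iff)
  then have C0: "C \<ge> 0" using \<delta> by (simp add: C_def)
  have \<Lambda>: "\<Lambda> \<ge> 1" "\<Lambda> * U + C \<le> \<Lambda> * ((1 + U) / 2)"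
  proof -
    show "\<Lambda> \<ge> 1" using C0 UV by (simp add: \<Lambda>_def)
    have "\<Lambda> * ((1 - U) / 2) = C + (1 - U) / 2" using UV by (simp add: \<Lambda>_def field_simps)
    then show "\<Lambda> * U + C \<le> \<Lambda> * ((1 + U) / 2)" using UV by (simp add: field_simps)
  qed
  have P0: "P x y \<ge> 0" for x y using \<Lambda> by (simp add: P_def)
  define R where "R x y t = \<Lambda> * (norm x)\<^sup>2 * (norm (u t))\<^sup>2 + ((1 + 1 / \<delta>) * ((norm x)\<^sup>2 * (norm G)\<^sup>2) * (norm (e t))\<^sup>2
      + (1 + \<delta>) * (norm y)\<^sup>2 * (norm (v t))\<^sup>2)" for x y :: complex and t
  have Rint: "has_bochner_integral M (R x y) (\<Lambda> * (norm x)\<^sup>2 * U + ((1 + 1 / \<delta>) * ((norm x)\<^sup>2 * (norm G)\<^sup>2) * ee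
      + (1 + \<delta>) * (norm y)\<^sup>2 * V))" for x y
    unfolding R_def by (intro intros mom)
  have PR: "P (x * u t) (\<phi> x y t) \<le> R x y t" for x y t
  proof -
    have young: "(norm (z + w))\<^sup>2 \<le> (1 + 1 / \<delta>) * (norm z)\<^sup>2 + (1 + \<delta>) * (norm w)\<^sup>2" for z w :: complex
    proof -
      have "(norm (z + w))\<^sup>2 \<le> (norm z + norm w)\<^sup>2" by (intro power_mono norm_triangle_ineq) simp
      also have "\<dots> = (norm z)\<^sup>2 + 2 * norm z * norm w + (norm w)\<^sup>2" by (simp add: power2_sum)
      also have "2 * norm z * norm w \<le> (norm z)\<^sup>2 / \<delta> + \<delta> * (norm w)\<^sup>2"
      proof -
        have "0 \<le> (norm z - \<delta> * norm w)\<^sup>2 / \<delta>" using \<delta> by simp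
        also have "\<dots> = (norm z)\<^sup>2 / \<delta> + \<delta> * (norm w)\<^sup>2 - 2 * norm z * norm w"
          using \<delta> by (simp add: power2_eq_square field_simps)
        finally show ?thesis by simp
      qed
      finally show ?thesis by (simp add: algebra_simps)
    qed
    show ?thesis
      unfolding P_def R_def \<phi>_def
      using young[of "x * (G * e t)" "y * v t"] by (simp add: norm_mult power_mult_distrib mult_ac)
  qed
  have RP: "\<Lambda> * (norm x)\<^sup>2 * U + ((1 + 1 / \<delta>) * ((norm x)\<^sup>2 * (norm G)\<^sup>2) * ee
      + (1 + \<delta>) * (norm y)\<^sup>2 * V) \<le> \<theta> * P x y" for x y
  proof -
    have "\<Lambda> * (norm x)\<^sup>2 * U + (1 + 1 / \<delta>) * ((norm x)\<^sup>2 * (norm G)\<^sup>2) * ee = (norm x)\<^sup>2 * (\<Lambda> * U + C)"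
      by (simp add: C_def algebra_simps)
    also have "\<dots> \<le> (norm x)\<^sup>2 * (\<Lambda> * \<theta>)"
      using \<Lambda> by (intro mult_left_mono order_trans[OF \<Lambda>(2)]) (auto simp: \<theta>_def)
    finally have 1: "\<Lambda> * (norm x)\<^sup>2 * U + (1 + 1 / \<delta>) * ((norm x)\<^sup>2 * (norm G)\<^sup>2) * ee \<le> (norm x)\<^sup>2 * (\<Lambda> * \<theta>)" .
    have "(norm y)\<^sup>2 * ((1 + \<delta>) * V) \<le> (norm y)\<^sup>2 * \<theta>"
      by (intro mult_left_mono order_trans[OF \<delta>(2)]) (auto simp: \<theta>_def)
    with 1 show ?thesis by (simp add: P_def algebra_simps)
  qed
  define c where "c = \<bar>N\<bar> + norm m + \<bar>L\<bar>"
  have c0: "c \<ge> 0" by (simp add: c_def)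
  \<comment> \<open>The crude bound \<open>Q\<close> >= -c \<open>P\<close> starts the induction.
    Each passage through \<open>Qfix\<close> drops a square and gains the factor \<theta>, so in the
    limit \<open>Q\<close> is nonnegative; at (1, 0) its value is \<open>N\<close>.\<close>
  have lower: "Q x y \<ge> - c * \<theta> ^ n * P x y" for n x y
  proof (induction n arbitrary: x y)
    case 0
    have "\<bar>2 * Re (m * x * cnj y)\<bar> \<le> 2 * (norm m * norm x * norm y)"
      using abs_Re_le_cmod[of "m * x * cnj y"] by (simp add: norm_mult)
    also have "\<dots> = norm m * (2 * norm x * norm y)" by simp
    also have "\<dots> \<le> norm m * ((norm x)\<^sup>2 + (norm y)\<^sup>2)"
      by (intro mult_left_mono sum_squares_bound) auto
    finally have 1: "2 * Re (m * x * cnj y) \<ge> - (norm m * ((norm x)\<^sup>2 + (norm y)\<^sup>2))" by linarith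
    have 2: "N * (norm x)\<^sup>2 \<ge> - (\<bar>N\<bar> * (norm x)\<^sup>2)" "L * (norm y)\<^sup>2 \<ge> - (\<bar>L\<bar> * (norm y)\<^sup>2)"
      unfolding mult_minus_left[symmetric] by (intro mult_right_mono; simp)+
    have "\<bar>N\<bar> * (norm x)\<^sup>2 + norm m * ((norm x)\<^sup>2 + (norm y)\<^sup>2) + \<bar>L\<bar> * (norm y)\<^sup>2 \<le> c * ((norm x)\<^sup>2 + (norm y)\<^sup>2)"
      by (simp add: c_def algebra_simps)
    also have "\<dots> \<le> c * P x y"
      using \<Lambda> c0 by (intro mult_left_mono) (auto simp: P_def intro!: mult_right_mono[of 1 \<Lambda>, simplified])
    finally show ?case using 1 2 by (simp add: Q_def hermitian_form_def)
  next
    case (Suc n)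
    have "- c * \<theta> ^ n * (\<theta> * P x y) \<le> - c * \<theta> ^ n * (\<Lambda> * (norm x)\<^sup>2 * U + ((1 + 1 / \<delta>) * ((norm x)\<^sup>2 * (norm G)\<^sup>2) * ee
      + (1 + \<delta>) * (norm y)\<^sup>2 * V))"
      using c0 \<theta> by (intro mult_left_mono_neg RP) (simp add: mult_nonneg_nonneg)
    also have "\<dots> \<le> Q x y - (norm (x * G + y))\<^sup>2"
    proof (rule has_bochner_integral_le)
      show "has_bochner_integral M (\<lambda>t. Q (x * u t) (\<phi> x y t)) (Q x y - (norm (x * G + y))\<^sup>2)"
        by (rule Qfix)
      show "has_bochner_integral M (\<lambda>t. - c * \<theta> ^ n * R x y t) (- c * \<theta> ^ n * (\<Lambda> * (norm x)\<^sup>2 * U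
          + ((1 + 1 / \<delta>) * ((norm x)\<^sup>2 * (norm G)\<^sup>2) * ee + (1 + \<delta>) * (norm y)\<^sup>2 * V)))"
        by (intro intros Rint)
      fix t
      have "- c * \<theta> ^ n * R x y t \<le> - c * \<theta> ^ n * P (x * u t) (\<phi> x y t)"
        using c0 \<theta> by (intro mult_left_mono_neg PR) (simp add: mult_nonneg_nonneg)
      also have "\<dots> \<le> Q (x * u t) (\<phi> x y t)" by (rule Suc)
      finally show "- c * \<theta> ^ n * R x y t \<le> Q (x * u t) (\<phi> x y t)" .
    qed
    also have "\<dots> \<le> Q x y" by simp
    finally show ?case by (simp add: mult_ac)
  qed
  have "N \<ge> 0"
  proof -
    have "(\<lambda>n. - c * \<theta> ^ n * P 1 0) \<longlonglongrightarrow> - c * 0 * P 1 0"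
      by (intro tendsto_intros LIMSEQ_power_zero) (use \<theta> in auto)
    moreover have "\<And>n. - c * \<theta> ^ n * P 1 0 \<le> Q 1 0" by (rule lower)
    ultimately have "- c * 0 * P 1 0 \<le> Q 1 0" by (intro LIMSEQ_le_const2) auto
    then show ?thesis by (simp add: Q_def hermitian_form_def)
  qed
  moreover have "Re (G' - G) * (Im a * Im b) = N * (2 * (Im a * Im b)\<^sup>2 * (1 - U) * (1 - V))"
    using a b UV by (simp add: N_def L_def power2_eq_square)
  ultimately have "Re (G' - G) * (Im a * Im b) \<ge> 0" using UV by simp
  then show ?thesis by (simp add: green_def G_def G'_def p_def q_def)
qed

end

section \<open>Asymptotics and boundary smoothing\<close>

lemma norm_mult_resolvent_le:
  assumes "c > 0" "c * norm \<zeta> \<le> \<bar>Im \<zeta>\<bar>" "\<zeta> \<noteq> 0"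
  shows "norm (\<zeta> / (\<zeta> - of_real s)) \<le> 1 / c"
proof -
  have "c * norm \<zeta> \<le> norm (\<zeta> - of_real s)" using assms(2) norm_diff_of_real_ge order_trans by blast
  then show ?thesis using assms(1,3) unfolding norm_divide
    by (metis divide_left_mono frac_le less_eq_real_def mult_pos_pos norm_ge_zero nonzero_divide_mult_cancel_right zero_less_norm_iff norm_eq_zero)
qed

lemma tendsto_mult_resolvent:
  fixes \<zeta> :: "'a \<Rightarrow> complex"
  assumes "filterlim \<zeta> at_infinity F"
  shows "((\<lambda>n. \<zeta> n / (\<zeta> n - of_real s)) \<longlongrightarrow> 1) F"
proof -
  have nz: "\<forall>\<^sub>F n in F. \<zeta> n \<noteq> 0" by (rule filterlim_at_infinity_imp_eventually_ne[OF assms])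
  have "((\<lambda>n. 1 / (1 - of_real s / \<zeta> n)) \<longlongrightarrow> 1 / (1 - 0)) F"
    by (intro tendsto_intros tendsto_divide_0[OF tendsto_const assms]) auto
  then have "((\<lambda>n. 1 / (1 - of_real s / \<zeta> n)) \<longlongrightarrow> 1) F" by simp
  moreover have "\<forall>\<^sub>F n in F. 1 / (1 - of_real s / \<zeta> n) = \<zeta> n / (\<zeta> n - of_real s)"
    using nz by eventually_elim (simp add: field_simps)
  ultimately show ?thesis by (rule Lim_transform_eventually)
qed

text \<open>In a cone the factor \<zeta> / (\<zeta> - s) is bounded by 1/c and tends to 1, so
  dominated convergence applies. This is how the mass of a limit measure is recovered and loss of
  mass excluded.\<close>

lemma cauchy_transform2_mass:
  assumes N: "finite_measure N" "sets N = sets borel" and c: "c > 0"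
    and \<zeta>: "\<And>n. c * norm (\<zeta> n) \<le> \<bar>Im (\<zeta> n)\<bar>" "\<And>n. \<zeta> n \<noteq> 0" "filterlim \<zeta> at_infinity sequentially"
    and \<omega>: "\<And>n. c * norm (\<omega> n) \<le> \<bar>Im (\<omega> n)\<bar>" "\<And>n. \<omega> n \<noteq> 0" "filterlim \<omega> at_infinity sequentially"
  shows "(\<lambda>n. \<zeta> n * \<omega> n * cauchy_transform2 N (\<zeta> n) (\<omega> n)) \<longlonglongrightarrow> of_real (measure N (space N))"
proof -
  interpret finite_measure N by fact
  have [measurable_cong]: "sets N = sets (borel \<Otimes>\<^sub>M borel)" by (simp only: N(2) borel_prod)
  define h where "h n p = \<zeta> n / (\<zeta> n - of_real (fst p)) * (\<omega> n / (\<omega> n - of_real (snd p)))" for n and p :: "real \<times> real"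
  have "(\<lambda>n. \<integral>p. h n p \<partial>N) \<longlonglongrightarrow> (\<integral>p. 1 \<partial>N)"
  proof (rule integral_dominated_convergence[where w = "\<lambda>_. 1 / c * (1 / c)"])
    show "AE p in N. (\<lambda>n. h n p) \<longlonglongrightarrow> 1"
      using tendsto_mult[OF tendsto_mult_resolvent[OF \<zeta>(3)] tendsto_mult_resolvent[OF \<omega>(3)]]
      by (simp add: h_def)
    show "AE p in N. norm (h n p) \<le> 1 / c * (1 / c)" for n
      unfolding h_def norm_mult using c
      by (intro AE_I2 mult_mono norm_mult_resolvent_le \<zeta> \<omega>) auto
  qed (auto simp: h_def)
  moreover have "(\<integral>p. h n p \<partial>N) = \<zeta> n * \<omega> n * cauchy_transform2 N (\<zeta> n) (\<omega> n)" for n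
    unfolding cauchy_transform2_def integral_mult_right_zero[symmetric] by (simp add: h_def)
  ultimately show ?thesis by (simp add: scaleR_conv_of_real)
qed

lemma signed_half_plane_Cauchy_integral:
  assumes \<sigma>: "\<sigma> \<in> {1, -1::real}"
    and hol: "f holomorphic_on {z. \<sigma> * Im z > -d}" and d: "d > 0" and R0: "R0 > 0"
    and bd: "\<And>w. \<sigma> * Im w \<ge> 0 \<Longrightarrow> norm w \<ge> R0 \<Longrightarrow> norm (f w) \<le> B / norm w"
    and z: "Im z \<noteq> 0"
  shows "integrable lborel (\<lambda>x. f (of_real x) / (z - of_real x))"
    "(\<integral>x. f (of_real x) / (z - of_real x) \<partial>lborel)
       = (if \<sigma> * Im z > 0 then -2 * pi * \<i> * of_real \<sigma> * f z else 0)"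
  using half_plane_Cauchy_integral[of f d R0 B z] lower_half_plane_Cauchy_integral[of f d R0 B z] assms
  by auto

text \<open>The one-variable majorant for the Fubini argument in
  \<open>G_transform_double_integral\<close>.\<close>

lemma integrable_resolvent_decay:
  assumes "Im z \<noteq> 0"
  shows "integrable lborel (\<lambda>s. norm (1 / (complex_of_real (1 + \<bar>s\<bar>) * (z - of_real s))))"
proof (rule integrable_norm, rule integrable_decay_square[where ?R0.0 = "2 * norm z" and B = 2])
  have "complex_of_real (1 + \<bar>s\<bar>) \<noteq> 0" for s by (simp add: of_real_eq_0_iff[of "1 + \<bar>s\<bar>", unfolded of_real_add of_real_1])
  then show "continuous_on UNIV (\<lambda>s. 1 / (complex_of_real (1 + \<bar>s\<bar>) * (z - of_real s)))"
    using diff_of_real_neq_0[OF assms] by (intro continuous_intros) auto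
  show "2 * norm z > 0" using assms by auto
  fix s :: real assume s: "2 * norm z \<le> \<bar>s\<bar>"
  have "\<bar>s\<bar> > 0" using s assms by (metis abs_ge_zero mult_2 norm_le_zero_iff zero_complex.sel(2) add_le_same_cancel1 dual_order.trans less_eq_real_def norm_ge_zero order_le_imp_less_or_eq)
  have "\<bar>s\<bar> / 2 \<le> norm (z - of_real s)"
    using norm_triangle_ineq2[of "of_real s" z] s by (simp add: norm_minus_commute)
  then have "1 / ((1 + \<bar>s\<bar>) * norm (z - of_real s)) \<le> 1 / (\<bar>s\<bar> * (\<bar>s\<bar> / 2))"
    using \<open>\<bar>s\<bar> > 0\<close> by (intro divide_left_mono mult_mono mult_pos_pos) auto
  also have "\<dots> = 2 / s\<^sup>2" by (simp add: power2_eq_square)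
  finally show "norm (1 / (complex_of_real (1 + \<bar>s\<bar>) * (z - of_real s))) \<le> 2 / s\<^sup>2"
    by (simp add: norm_divide norm_mult del: of_real_add)
qed

section \<open>The candidate Cauchy transform: holomorphy, decay and boundary integrals\<close>

context two_jumps
begin

definition G_transform :: "complex \<Rightarrow> complex \<Rightarrow> complex" where
  "G_transform \<zeta> \<omega> = green (f.F_transform \<zeta>) (g.F_transform \<omega>)"

lemma cross_neq_1:
  assumes "Im a \<noteq> 0" "Im b \<noteq> 0" "f.ratio_energy a < 1" "g.ratio_energy b < 1"
  shows "1 - cross a b \<noteq> 0"
  using norm_cross[OF assms(1,2)] assms(3,4) by (auto simp: right_minus_eq)

lemma G_transform_cnj:
  "Im \<zeta> \<noteq> 0 \<Longrightarrow> Im \<omega> \<noteq> 0 \<Longrightarrow> G_transform (cnj \<zeta>) (cnj \<omega>) = cnj (G_transform \<zeta> \<omega>)"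
  by (simp add: G_transform_def green_def f.F_transform_cnj g.F_transform_cnj cross_cnj)

lemma G_transform_pos:
  assumes "Im \<zeta> > 0" "Im \<omega> > 0"
  shows "Re (G_transform \<zeta> (cnj \<omega>) - G_transform \<zeta> \<omega>) \<ge> 0"
proof -
  have nz: "Im \<zeta> \<noteq> 0" "Im \<omega> \<noteq> 0" using assms by auto
  have "0 < Im (f.F_transform \<zeta>)" "0 < Im (g.F_transform \<omega>)"
    using f.F_transform(1)[OF nz(1)] g.F_transform(1)[OF nz(2)] assms by (auto simp: zero_less_mult_iff)
  then have "0 < Im (f.F_transform \<zeta>) * Im (g.F_transform \<omega>)" by simp
  then show ?thesis
    using Re_green_nonneg[OF f.F_transform(3)[OF nz(1)] g.F_transform(3)[OF nz(2)]
        f.F_transform(4)[OF nz(1)] g.F_transform(4)[OF nz(2)]]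
    by (auto simp: G_transform_def g.F_transform_cnj[OF nz(2)] zero_le_mult_iff)
qed

lemma G_transform_holomorphic1:
  assumes \<omega>: "Im \<omega> \<noteq> 0"
  shows "(\<lambda>\<zeta>. G_transform \<zeta> \<omega>) holomorphic_on (- \<real>)"
proof -
  let ?b = "g.F_transform \<omega>"
  have b: "Im ?b \<noteq> 0" using g.F_transform(3)[OF \<omega>] .
  have "(\<lambda>a. \<integral>x. (of_real (f x) * g.jump_ratio ?b x) / (a - of_real (f x)) \<partial>M) holomorphic_on (- \<real>)"
    by (rule f.holomorphic_integral_resolvent[where B = "K * (K / \<bar>Im ?b\<bar>)"])
      (auto simp: norm_mult simp del: times_divide_eq_right intro!: mult_mono f.f_bound g.norm_jump_ratio b f.K_nonneg)
  moreover have "(\<integral>x. (of_real (f x) * g.jump_ratio ?b x) / (a - of_real (f x)) \<partial>M) = cross a ?b" for a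
    by (simp add: cross_def f.jump_ratio_def)
  ultimately have c: "(\<lambda>a. cross a ?b) holomorphic_on (- \<real>)" by simp
  have im: "f.F_transform ` (- \<real>) \<subseteq> - \<real>" using f.F_transform(3) by (auto simp: notin_Reals_iff_Im simp del: Compl_iff simp: Compl_iff complex_is_Real_iff)
  have "(\<lambda>\<zeta>. cross (f.F_transform \<zeta>) ?b) holomorphic_on (- \<real>)"
    using holomorphic_on_compose_gen[OF f.F_transform_holomorphic c im] by (simp add: comp_def)
  moreover have "f.F_transform \<zeta> * ?b * (1 - cross (f.F_transform \<zeta>) ?b) \<noteq> 0" if "\<zeta> \<in> - \<real>" for \<zeta>
  proof -
    have \<zeta>: "Im \<zeta> \<noteq> 0" using that by (simp add: complex_is_Real_iff)
    show ?thesis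
      using cross_neq_1[OF f.F_transform(3)[OF \<zeta>] b f.F_transform(4)[OF \<zeta>] g.F_transform(4)[OF \<omega>]]
        f.F_transform(3)[OF \<zeta>] b by auto
  qed
  ultimately show ?thesis unfolding G_transform_def green_def
    by (intro holomorphic_intros f.F_transform_holomorphic) auto
qed

end

lemma (in two_jumps) swap: "two_jumps M g f K"
  by (simp add: two_jumps_def f.bounded_jumps_axioms g.bounded_jumps_axioms)

context two_jumps
begin

text \<open>Exchanging the coordinates carries holomorphy in the first variable over to the
  second.\<close>

lemma G_transform_swap: "two_jumps.G_transform M g f \<omega> \<zeta> = G_transform \<zeta> \<omega>"
proof -
  interpret s: two_jumps M g f K by (rule swap)
  show ?thesis
    by (simp add: G_transform_def s.G_transform_def green_def s.green_def cross_def s.cross_def mult_ac)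
qed

lemma G_transform_holomorphic2:
  assumes "Im \<zeta> \<noteq> 0"
  shows "(\<lambda>\<omega>. G_transform \<zeta> \<omega>) holomorphic_on (- \<real>)"
  using two_jumps.G_transform_holomorphic1[OF swap assms] by (simp add: G_transform_swap)

end

text \<open>On |Im \<zeta>| >= e the inverse moves points by at most D. Since 1 minus the energy
  equals |Im \<zeta>| divided by the absolute imaginary part of \<open>F_transform\<close> \<zeta>,
  it stays away from 0, and \<open>F_transform\<close> \<zeta> grows at least like \<zeta>.\<close>

lemma (in bounded_jumps) F_transform_bounds:
  assumes e: "e > 0" and D: "D = measure M (space M) * (K + K * K / e)" and \<zeta>: "\<bar>Im \<zeta>\<bar> \<ge> e"
  shows "1 - ratio_energy (F_transform \<zeta>) \<ge> e / (e + D)"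
    and "1 + norm \<zeta> \<le> (1 + (1 + D) / e) * norm (F_transform \<zeta>)"
proof -
  let ?a = "F_transform \<zeta>"
  have nz: "Im \<zeta> \<noteq> 0" using \<zeta> e by auto
  have D0: "D \<ge> 0" using e K_nonneg unfolding D by simp
  have near: "norm (?a - \<zeta>) \<le> D" unfolding D by (rule F_transform_near[OF \<zeta> e])
  have Im_le: "\<bar>Im ?a\<bar> \<le> \<bar>Im \<zeta>\<bar> + D"
    using near abs_Im_le_cmod[of "?a - \<zeta>"] by simp
  have "\<bar>Im \<zeta>\<bar> = \<bar>Im ?a\<bar> * (1 - ratio_energy ?a)"
    by (subst F_transform_Im(1)[OF nz]) (use F_transform[OF nz] in \<open>simp add: abs_mult\<close>)
  then have "1 - ratio_energy ?a = \<bar>Im \<zeta>\<bar> / \<bar>Im ?a\<bar>"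
    using F_transform(3)[OF nz] by (simp add: field_simps)
  also have "\<dots> \<ge> \<bar>Im \<zeta>\<bar> / (\<bar>Im \<zeta>\<bar> + D)"
    using Im_le F_transform(3)[OF nz] nz D0 by (intro divide_left_mono mult_pos_pos add_pos_nonneg) auto
  also have "\<bar>Im \<zeta>\<bar> / (\<bar>Im \<zeta>\<bar> + D) \<ge> e / (e + D)"
    using \<zeta> e D0 by (simp add: divide_simps add_pos_nonneg) (simp add: algebra_simps mult_left_mono)
  finally show "1 - ratio_energy ?a \<ge> e / (e + D)" .
  have "e \<le> norm ?a" using \<zeta> F_transform_Im(2)[OF nz] abs_Im_le_cmod[of ?a] by linarith
  then have "(1 + D) * e \<le> (1 + D) * norm ?a" using D0 by (intro mult_left_mono) auto
  then have 1: "1 + D \<le> (1 + D) / e * norm ?a" using e by (simp add: pos_le_divide_eq)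
  have "norm \<zeta> \<le> norm ?a + D" using near norm_triangle_ineq2[of \<zeta> ?a] by (simp add: norm_minus_commute)
  with 1 show "1 + norm \<zeta> \<le> (1 + (1 + D) / e) * norm ?a" by (simp add: distrib_right)
qed

text \<open>|\<open>cross\<close>| is at most the mean of the two energies, so the uniform energy
  gap \<kappa> keeps 1 - \<open>cross\<close> away from 0. The growth of both
  \<open>F_transform\<close> factors then gives decay in each variable separately.\<close>

lemma (in two_jumps) G_transform_bound:
  assumes e: "e > 0"
  shows "\<exists>B>0. \<forall>\<zeta> \<omega>. \<bar>Im \<zeta>\<bar> \<ge> e \<longrightarrow> \<bar>Im \<omega>\<bar> \<ge> e \<longrightarrow>
    norm (G_transform \<zeta> \<omega>) \<le> B / ((1 + norm \<zeta>) * (1 + norm \<omega>))"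
proof -
  define D where "D = measure M (space M) * (K + K * K / e)"
  define \<kappa> where "\<kappa> = e / (e + D)"
  define C where "C = 1 + (1 + D) / e"
  have D0: "D \<ge> 0" using e f.K_nonneg unfolding D_def by simp
  have \<kappa>: "\<kappa> > 0" and C: "C > 0" using e D0 by (auto simp: \<kappa>_def C_def add_pos_nonneg)
  show ?thesis
  proof (intro exI[of _ "C * C / \<kappa>"] conjI allI impI)
    show "C * C / \<kappa> > 0" using \<kappa> C by simp
    fix \<zeta> \<omega> :: complex assume z: "\<bar>Im \<zeta>\<bar> \<ge> e" and w: "\<bar>Im \<omega>\<bar> \<ge> e"
    let ?a = "f.F_transform \<zeta>" and ?b = "g.F_transform \<omega>"
    note fb = f.F_transform_bounds[OF e D_def z, folded \<kappa>_def C_def]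
    note gb = g.F_transform_bounds[OF e D_def w, folded \<kappa>_def C_def]
    have nz: "Im \<zeta> \<noteq> 0" "Im \<omega> \<noteq> 0" using z w e by auto
    have "\<kappa> \<le> 1 - norm (cross ?a ?b)"
    proof -
      have "2 * norm (cross ?a ?b) \<le> f.ratio_energy ?a + g.ratio_energy ?b"
        using norm_cross[OF f.F_transform(3)[OF nz(1)] g.F_transform(3)[OF nz(2)]] by simp
      with fb(1) gb(1) show ?thesis by linarith
    qed
    also have "\<dots> \<le> norm (1 - cross ?a ?b)"
      using norm_triangle_ineq2[of 1 "cross ?a ?b"] by simp
    finally have c: "\<kappa> \<le> norm (1 - cross ?a ?b)" .
    have p: "1 + norm \<zeta> > 0" "1 + norm \<omega> > 0" by (auto simp: add_pos_nonneg)
    have "(1 + norm \<zeta>) * (1 + norm \<omega>) * \<kappa> \<le> (C * norm ?a) * (C * norm ?b) * norm (1 - cross ?a ?b)"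
      using fb(2) gb(2) c \<kappa> C p by (intro mult_mono) auto
    then have "(1 + norm \<zeta>) * (1 + norm \<omega>) * \<kappa> \<le> C * C * (norm ?a * norm ?b * norm (1 - cross ?a ?b))"
      by (simp only: mult_ac)
    moreover have "norm ?a * norm ?b * norm (1 - cross ?a ?b) > 0"
      using c \<kappa> f.F_transform(3)[OF nz(1)] g.F_transform(3)[OF nz(2)]
      by (intro mult_pos_pos) (auto intro: order.strict_trans2)
    ultimately have "1 / (norm ?a * norm ?b * norm (1 - cross ?a ?b)) * ((1 + norm \<zeta>) * (1 + norm \<omega>) * \<kappa>) \<le> C * C"
      by (simp add: pos_divide_le_eq)
    then show "norm (G_transform \<zeta> \<omega>) \<le> C * C / \<kappa> / ((1 + norm \<zeta>) * (1 + norm \<omega>))"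
      unfolding G_transform_def green_def norm_divide norm_mult norm_one using p \<kappa>
      by (simp add: pos_le_divide_eq mult_ac)
  qed
qed

context two_jumps
begin

lemma G_transform_measurable:
  assumes c: "Im c \<noteq> 0" and c': "Im c' \<noteq> 0"
  shows "(\<lambda>p. G_transform (of_real (fst p) + c) (of_real (snd p) + c'))
    \<in> borel_measurable (borel \<Otimes>\<^sub>M borel)"
proof -
  define \<alpha> \<beta> where "\<alpha> s = f.F_transform (of_real s + c)" and "\<beta> t = g.F_transform (of_real t + c')" for s t :: real
  have [measurable]: "\<alpha> \<in> borel_measurable borel" "\<beta> \<in> borel_measurable borel"
    unfolding \<alpha>_def \<beta>_def using c c'
    by (intro borel_measurable_continuous_onI
        continuous_on_compose2[OF holomorphic_on_imp_continuous_on[OF f.F_transform_holomorphic]]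
        continuous_on_compose2[OF holomorphic_on_imp_continuous_on[OF g.F_transform_holomorphic]]
        continuous_intros; auto simp: complex_is_Real_iff)+
  have [measurable]: "(\<lambda>p. cross (\<alpha> (fst p)) (\<beta> (snd p))) \<in> borel_measurable (borel \<Otimes>\<^sub>M borel)"
    unfolding cross_def f.jump_ratio_def g.jump_ratio_def by measurable
  show ?thesis
    unfolding G_transform_def green_def \<alpha>_def[symmetric] \<beta>_def[symmetric] by measurable
qed

text \<open>Two successive half-plane Cauchy integrals, each contributing -2 pi i times the sign of
  its half plane. The shift by e keeps both lines of integration off the real axis, and
  \<open>G_transform_bound\<close> provides the majorant for Fubini.\<close>

lemma G_transform_double_integral:
  assumes e: "e > 0" and \<sigma>: "\<sigma> \<in> {1, -1::real}" and \<tau>: "\<tau> \<in> {1, -1::real}"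
    and z: "Im z \<noteq> 0" and w: "Im w \<noteq> 0"
  defines "c \<equiv> \<i> * of_real (\<sigma> * e)" and "c' \<equiv> \<i> * of_real (\<tau> * e)"
  shows "has_bochner_integral (lborel \<Otimes>\<^sub>M lborel)
    (\<lambda>p. G_transform (of_real (fst p) + c) (of_real (snd p) + c') / ((z - of_real (fst p)) * (w - of_real (snd p))))
    (if \<sigma> * Im z > 0 \<and> \<tau> * Im w > 0 then - 4 * complex_of_real pi ^ 2 * complex_of_real (\<sigma> * \<tau>) * G_transform (z + c) (w + c') else 0)"
proof -
  define h where "h p = G_transform (of_real (fst p) + c) (of_real (snd p) + c') / ((z - of_real (fst p)) * (w - of_real (snd p)))"
    for p :: "real \<times> real"
  obtain B where B: "B > 0" "\<And>\<zeta> \<omega>. \<bar>Im \<zeta>\<bar> \<ge> e \<Longrightarrow> \<bar>Im \<omega>\<bar> \<ge> e \<Longrightarrow>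
      norm (G_transform \<zeta> \<omega>) \<le> B / ((1 + norm \<zeta>) * (1 + norm \<omega>))"
    using G_transform_bound[OF e] by blast
  have nzc: "Im c \<noteq> 0" "Im c' \<noteq> 0" using e \<sigma> \<tau> by (auto simp: c_def c'_def)
  have [measurable]: "h \<in> borel_measurable (borel \<Otimes>\<^sub>M borel)"
    unfolding h_def using G_transform_measurable[OF nzc] by measurable
  define k where "k z s = norm (1 / (complex_of_real (1 + \<bar>s\<bar>) * (z - of_real s)))" for z s
  have hk: "norm (h (s, t)) \<le> B * k z s * k w t" for s t
  proof -
    have "\<bar>s\<bar> \<le> norm (of_real s + c)" "\<bar>t\<bar> \<le> norm (of_real t + c')"
      using abs_Re_le_cmod[of "of_real s + c"] abs_Re_le_cmod[of "of_real t + c'"] by (simp_all add: c_def c'_def)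
    then have "B / ((1 + norm (of_real s + c)) * (1 + norm (of_real t + c'))) \<le> B / ((1 + \<bar>s\<bar>) * (1 + \<bar>t\<bar>))"
      using B(1) by (intro divide_left_mono mult_mono mult_pos_pos) (auto simp: add_pos_nonneg)
    moreover have "norm (G_transform (of_real s + c) (of_real t + c')) \<le> B / ((1 + norm (of_real s + c)) * (1 + norm (of_real t + c')))"
      using \<sigma> \<tau> e by (intro B(2)) (auto simp: c_def c'_def)
    ultimately have "norm (G_transform (of_real s + c) (of_real t + c')) \<le> B / ((1 + \<bar>s\<bar>) * (1 + \<bar>t\<bar>))" by linarith
    then have "norm (h (s, t)) \<le> B / ((1 + \<bar>s\<bar>) * (1 + \<bar>t\<bar>)) / (norm (z - of_real s) * norm (w - of_real t))"
      unfolding h_def norm_divide norm_mult fst_conv snd_conv by (intro divide_right_mono) auto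
    also have "\<dots> = B * k z s * k w t"
      by (simp add: k_def norm_divide norm_mult mult_ac del: of_real_add)
    finally show ?thesis .
  qed
  have ki: "integrable lborel (k z)" "integrable lborel (k w)"
    unfolding k_def[abs_def] by (intro integrable_resolvent_decay z w)+
  have k0: "k z s \<ge> 0" for z s by (simp add: k_def)
  have inth: "integrable (lborel \<Otimes>\<^sub>M lborel) h"
  proof (rule Bochner_Integration.integrable_bound)
    show "integrable (lborel \<Otimes>\<^sub>M lborel) (\<lambda>p. (B * k z (fst p)) * k w (snd p))"
    proof (rule lborel_pair.Fubini_integrable)
      have [measurable]: "k z \<in> borel_measurable borel" for z
        unfolding k_def[abs_def] by measurable
      show "(\<lambda>p. (B * k z (fst p)) * k w (snd p)) \<in> borel_measurable (lborel \<Otimes>\<^sub>M lborel)" by measurable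
      show "integrable lborel (\<lambda>x. \<integral>y. norm ((B * k z (fst (x, y))) * k w (snd (x, y))) \<partial>lborel)"
        using ki k0 B(1) by (simp add: abs_mult)
      show "AE x in lborel. integrable lborel (\<lambda>y. (B * k z (fst (x, y))) * k w (snd (x, y)))"
        using ki by simp
    qed
    show "AE p in lborel \<Otimes>\<^sub>M lborel. norm (h p) \<le> norm (B * k z (fst p) * k w (snd p))"
      using hk k0 B(1) by (auto simp: abs_mult split: prod.splits)
  qed simp
  have inner: "(\<integral>t. h (s, t) \<partial>lborel) =
      (if \<tau> * Im w > 0 then -2 * pi * \<i> * of_real \<tau> * G_transform (of_real s + c) (w + c') else 0) / (z - of_real s)" for s
  proof -
    have im: "(\<lambda>w. w + c') ` {w. \<tau> * Im w > - e} \<subseteq> - \<real>" using \<tau> e by (auto simp: c'_def complex_is_Real_iff)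
    have s: "Im (of_real s + c) \<noteq> 0" using nzc by simp
    have "(\<lambda>w. G_transform (of_real s + c) (w + c')) holomorphic_on {w. \<tau> * Im w > - e}"
      using holomorphic_on_compose_gen[OF _ G_transform_holomorphic2[OF s] im]
      by (simp add: comp_def holomorphic_on_add)
    moreover have "norm (G_transform (of_real s + c) (u + c')) \<le> (B * 2) / norm u"
      if u: "\<tau> * Im u \<ge> 0" "norm u \<ge> 2 * e" for u
    proof -
      have "\<bar>Im (u + c')\<bar> \<ge> e" using \<tau> u e by (auto simp: c'_def)
      then have "norm (G_transform (of_real s + c) (u + c')) \<le> B / ((1 + norm (of_real s + c)) * (1 + norm (u + c')))"
        using \<sigma> e by (intro B(2)) (auto simp: c_def)
      also have "\<dots> \<le> B / (1 * (norm u / 2))"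
      proof (intro divide_left_mono mult_mono)
        have "norm c' = e" using \<tau> e by (auto simp: c'_def norm_mult)
        then show "norm u / 2 \<le> 1 + norm (u + c')"
          using norm_triangle_ineq2[of u "- c'"] u(2) by simp
      qed (use B u e in \<open>auto simp: add_pos_nonneg intro!: mult_pos_pos\<close>)
      finally show ?thesis by simp
    qed
    ultimately have "(\<integral>t. G_transform (of_real s + c) (of_real t + c') / (w - of_real t) \<partial>lborel) =
      (if \<tau> * Im w > 0 then -2 * pi * \<i> * of_real \<tau> * G_transform (of_real s + c) (w + c') else 0)"
      using signed_half_plane_Cauchy_integral(2)[OF \<tau>, of "\<lambda>w. G_transform (of_real s + c) (w + c')" e "2 * e" "B * 2" w] e w
      by simp
    moreover have "h (s, t) = G_transform (of_real s + c) (of_real t + c') / (w - of_real t) / (z - of_real s)" for t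
      by (simp add: h_def mult.commute)
    ultimately show ?thesis by (simp only: integral_divide_zero)
  qed
  have outer: "(\<integral>s. G_transform (of_real s + c) (w + c') / (z - of_real s) \<partial>lborel)
      = (if \<sigma> * Im z > 0 then -2 * pi * \<i> * of_real \<sigma> * G_transform (z + c) (w + c') else 0)"
    if w': "\<tau> * Im w > 0"
  proof -
    have im: "(\<lambda>w. w + c) ` {w. \<sigma> * Im w > - e} \<subseteq> - \<real>" using \<sigma> e by (auto simp: c_def complex_is_Real_iff)
    have Imw: "\<bar>Im (w + c')\<bar> \<ge> e" "Im (w + c') \<noteq> 0" using \<tau> w' e by (auto simp: c'_def)
    have "(\<lambda>\<zeta>. G_transform (\<zeta> + c) (w + c')) holomorphic_on {w. \<sigma> * Im w > - e}"
      using holomorphic_on_compose_gen[OF _ G_transform_holomorphic1[OF Imw(2)] im]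
      by (simp add: comp_def holomorphic_on_add)
    moreover have "norm (G_transform (u + c) (w + c')) \<le> (B * 2) / norm u"
      if u: "\<sigma> * Im u \<ge> 0" "norm u \<ge> 2 * e" for u
    proof -
      have "\<bar>Im (u + c)\<bar> \<ge> e" using \<sigma> u e by (auto simp: c_def)
      then have "norm (G_transform (u + c) (w + c')) \<le> B / ((1 + norm (u + c)) * (1 + norm (w + c')))"
        using Imw by (intro B(2)) auto
      also have "\<dots> \<le> B / ((norm u / 2) * 1)"
      proof (intro divide_left_mono mult_mono)
        have "norm c = e" using \<sigma> e by (auto simp: c_def norm_mult)
        then show "norm u / 2 \<le> 1 + norm (u + c)"
          using norm_triangle_ineq2[of u "- c"] u(2) by simp
      qed (use B u e in \<open>auto simp: add_pos_nonneg intro!: mult_pos_pos\<close>)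
      finally show ?thesis by simp
    qed
    ultimately show ?thesis
      using signed_half_plane_Cauchy_integral(2)[OF \<sigma>, of "\<lambda>\<zeta>. G_transform (\<zeta> + c) (w + c')" e "2 * e" "B * 2" z] e z
      by simp
  qed
  have "integral\<^sup>L (lborel \<Otimes>\<^sub>M lborel) h = (\<integral>s. (\<integral>t. h (s, t) \<partial>lborel) \<partial>lborel)"
    by (rule lborel_pair.integral_fst'[OF inth, symmetric])
  also have "\<dots> = (if \<sigma> * Im z > 0 \<and> \<tau> * Im w > 0 then - 4 * complex_of_real pi ^ 2 * complex_of_real (\<sigma> * \<tau>) * G_transform (z + c) (w + c') else 0)"
  proof (cases "\<tau> * Im w > 0")
    case False
    then show ?thesis by (simp add: inner)
  next
    case True
    have "(\<integral>s. (\<integral>t. h (s, t) \<partial>lborel) \<partial>lborel) = (\<integral>s. (-2 * pi * \<i> * of_real \<tau>) *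
        (G_transform (of_real s + c) (w + c') / (z - of_real s)) \<partial>lborel)"
      using True by (simp add: inner)
    also have "\<dots> = (-2 * pi * \<i> * of_real \<tau>) * (\<integral>s. G_transform (of_real s + c) (w + c') / (z - of_real s) \<partial>lborel)"
      by (rule integral_mult_right_zero)
    also have "\<dots> = (if \<sigma> * Im z > 0 then - 4 * complex_of_real pi ^ 2 * complex_of_real (\<sigma> * \<tau>) * G_transform (z + c) (w + c') else 0)"
    proof -
      have "(- 2 * p * \<i> * t) * (- 2 * p * \<i> * r * G) = - 4 * p ^ 2 * (r * t) * G" for p t r G :: complex
        using i_squared by algebra
      from this[of "of_real pi" "of_real \<tau>" "of_real \<sigma>" "G_transform (z + c) (w + c')"]
      show ?thesis unfolding outer[OF True] by (simp only: if_distrib[of "(*) _"] of_real_mult of_real_power mult_zero_right of_real_minus of_real_numeral)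
    qed
    finally show ?thesis using True by simp
  qed
  finally show ?thesis
    using inth unfolding has_bochner_integral_iff h_def[symmetric] by simp
qed

end

section \<open>Behaviour on the imaginary axis and the smoothed laws\<close>

lemma (in bounded_jumps) ratio_energy_le:
  assumes "Im a \<noteq> 0"
  shows "ratio_energy a \<le> measure M (space M) * (K / \<bar>Im a\<bar>)\<^sup>2"
proof -
  have "(norm (jump_ratio a x))\<^sup>2 \<le> (K / \<bar>Im a\<bar>)\<^sup>2" for x
    by (intro power_mono norm_jump_ratio assms) auto
  then have "ratio_energy a \<le> (\<integral>x. (K / \<bar>Im a\<bar>)\<^sup>2 \<partial>M)"
    unfolding ratio_energy_def using integrable_norm_jump_ratio_sq[OF assms] by (intro integral_mono) auto
  then show ?thesis by simp
qed

text \<open>The displacement is bounded by \<open>F_transform_near\<close> while the point grows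
  like n; the imaginary part grows at least like n, so the energy is O(1/n^2).\<close>

lemma (in bounded_jumps) F_transform_imaginary_axis:
  assumes e: "e > 0" and \<sigma>: "\<sigma> \<in> {1, -1::real}"
  defines "a \<equiv> \<lambda>n::nat. F_transform (\<i> * of_real (\<sigma> * (real n + e)))"
  shows "(\<lambda>n. a n / of_nat n) \<longlonglongrightarrow> \<i> * of_real \<sigma>"
    and "(\<lambda>n. ratio_energy (a n)) \<longlonglongrightarrow> 0"
proof -
  define D where "D = measure M (space M) * (K + K * K / e)"
  have Im: "\<bar>Im (\<i> * of_real (\<sigma> * (real n + e)))\<bar> = real n + e" for n
    using \<sigma> e by auto
  have nz: "Im (\<i> * of_real (\<sigma> * (real n + e))) \<noteq> 0" for n
    using Im[of n] e by auto
  show "(\<lambda>n. a n / of_nat n) \<longlonglongrightarrow> \<i> * of_real \<sigma>"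
  proof (rule LIM_zero_cancel, rule Lim_null_comparison)
    show "\<forall>\<^sub>F n in sequentially. norm (a n / of_nat n - \<i> * of_real \<sigma>) \<le> (D + e) / real n"
      using eventually_gt_at_top[of 0]
    proof eventually_elim
      case (elim n)
      define X Y where "X = a n - \<i> * of_real (\<sigma> * (real n + e))" and "Y = \<i> * complex_of_real (\<sigma> * e)"
      have "norm X \<le> D"
        unfolding X_def a_def D_def by (rule F_transform_near[OF _ e]) (use Im in simp)
      moreover have "norm Y = e" using \<sigma> e by (auto simp: Y_def norm_mult)
      ultimately have "norm (X + Y) \<le> D + e" using norm_triangle_ineq[of X Y] by linarith
      then have "norm (X + Y) / real n \<le> (D + e) / real n"
        by (intro divide_right_mono) auto
      moreover have "a n / of_nat n - \<i> * of_real \<sigma> = (X + Y) / of_nat n"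
      proof -
        have "X + Y = a n - \<i> * of_real \<sigma> * of_nat n" by (simp add: X_def Y_def distrib_left)
        then show ?thesis using elim by (simp add: diff_divide_distrib)
      qed
      ultimately show ?case by (simp add: norm_divide)
    qed
    show "(\<lambda>n. (D + e) / real n) \<longlonglongrightarrow> 0" by (rule lim_const_over_n)
  qed
  show "(\<lambda>n. ratio_energy (a n)) \<longlonglongrightarrow> 0"
  proof (rule Lim_null_comparison)
    show "\<forall>\<^sub>F n in sequentially. norm (ratio_energy (a n)) \<le> measure M (space M) * (K / real n)\<^sup>2"
      using eventually_gt_at_top[of 0]
    proof eventually_elim
      case (elim n)
      have Ima: "\<bar>Im (a n)\<bar> \<ge> real n" "Im (a n) \<noteq> 0"
        using F_transform_Im(2)[OF nz, of n] F_transform(3)[OF nz, of n] e Im[of n]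
        unfolding a_def by linarith+
      have "ratio_energy (a n) \<le> measure M (space M) * (K / \<bar>Im (a n)\<bar>)\<^sup>2"
        by (rule ratio_energy_le[OF Ima(2)])
      also have "\<dots> \<le> measure M (space M) * (K / real n)\<^sup>2"
        using Ima elim K_nonneg by (intro mult_left_mono power_mono divide_left_mono) auto
      finally show ?case using ratio_energy_nonneg by simp
    qed
    have "(\<lambda>n. measure M (space M) * (K / real n)\<^sup>2) \<longlonglongrightarrow> measure M (space M) * 0\<^sup>2"
      by (intro tendsto_intros lim_const_over_n)
    then show "(\<lambda>n. measure M (space M) * (K / real n)\<^sup>2) \<longlonglongrightarrow> 0" by simp
  qed
qed

context two_jumps
begin

lemma G_transform_imaginary_axis:
  assumes e: "e > 0" and \<sigma>: "\<sigma> \<in> {1, -1::real}" and \<tau>: "\<tau> \<in> {1, -1::real}"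
  shows "(\<lambda>n. of_nat n ^ 2 * G_transform (\<i> * of_real (\<sigma> * (real n + e))) (\<i> * of_real (\<tau> * (real n + e))))
    \<longlonglongrightarrow> - of_real (\<sigma> * \<tau>)"
proof -
  define a where "a n = f.F_transform (\<i> * of_real (\<sigma> * (real n + e)))" for n
  define b where "b n = g.F_transform (\<i> * of_real (\<tau> * (real n + e)))" for n
  note fa = f.F_transform_imaginary_axis[OF e \<sigma>, folded a_def]
  note gb = g.F_transform_imaginary_axis[OF e \<tau>, folded b_def]
  have nz: "Im (a n) \<noteq> 0" "Im (b n) \<noteq> 0" for n
    unfolding a_def b_def by (rule f.F_transform(3) g.F_transform(3); use \<sigma> \<tau> e in auto)+
  have "(\<lambda>n. cross (a n) (b n)) \<longlonglongrightarrow> 0"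
  proof (rule Lim_null_comparison)
    show "\<forall>\<^sub>F n in sequentially. norm (cross (a n) (b n)) \<le> (f.ratio_energy (a n) + g.ratio_energy (b n)) / 2"
      by (intro always_eventually allI norm_cross nz)
    have "(\<lambda>n. (f.ratio_energy (a n) + g.ratio_energy (b n)) / 2) \<longlonglongrightarrow> (0 + 0) / 2"
      by (intro tendsto_intros fa gb) simp
    then show "(\<lambda>n. (f.ratio_energy (a n) + g.ratio_energy (b n)) / 2) \<longlonglongrightarrow> 0" by simp
  qed
  then have "(\<lambda>n. 1 / ((a n / of_nat n) * (b n / of_nat n) * (1 - cross (a n) (b n))))
     \<longlonglongrightarrow> 1 / ((\<i> * of_real \<sigma>) * (\<i> * of_real \<tau>) * (1 - 0))"
    using \<sigma> \<tau> by (intro tendsto_intros fa gb) auto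
  also have "1 / ((\<i> * of_real \<sigma>) * (\<i> * of_real \<tau>) * (1 - 0)) = - complex_of_real (\<sigma> * \<tau>)"
    using \<sigma> \<tau> by auto
  also have "(\<lambda>n. 1 / ((a n / of_nat n) * (b n / of_nat n) * (1 - cross (a n) (b n)))) =
     (\<lambda>n. of_nat n ^ 2 * G_transform (\<i> * of_real (\<sigma> * (real n + e))) (\<i> * of_real (\<tau> * (real n + e))))"
    by (simp only: G_transform_def green_def a_def b_def) (simp add: power2_eq_square)
  finally show ?thesis .
qed

text \<open>Stieltjes inversion at height e: the boundary values of \<open>G_transform\<close> on
  the four shifted planes combine with alternating signs into a density, nonnegative by
  \<open>G_transform_pos\<close>. The outcome is what the wanted law becomes after convolution with
  a product of two Cauchy laws of scale e.\<close>

lemma smoothed_law: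
  assumes e: "e > 0"
  shows "\<exists>\<nu>. borel_prob \<nu> \<and> (\<forall>z w. Im z \<noteq> 0 \<longrightarrow> Im w \<noteq> 0 \<longrightarrow>
    cauchy_transform2 \<nu> z w = G_transform (z + \<i> * of_real (sgn (Im z) * e)) (w + \<i> * of_real (sgn (Im w) * e)))"
proof -
  define c where "c \<sigma> = \<i> * of_real (\<sigma> * e)" for \<sigma> :: real
  define q where "q \<sigma> \<tau> p = G_transform (of_real (fst p) + c \<sigma>) (of_real (snd p) + c \<tau>)" for \<sigma> \<tau> and p :: "real \<times> real"
  define d where "d p = Re (q 1 (-1) p - q 1 1 p) / (2 * pi\<^sup>2)" for p
  have Imc: "Im (c 1) \<noteq> 0" "Im (c (-1)) \<noteq> 0" using e by (auto simp: c_def)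
  have [measurable]: "q 1 1 \<in> borel_measurable (borel \<Otimes>\<^sub>M borel)" "q 1 (-1) \<in> borel_measurable (borel \<Otimes>\<^sub>M borel)"
    unfolding q_def[abs_def] by (intro G_transform_measurable Imc)+
  have [measurable]: "d \<in> borel_measurable (borel \<Otimes>\<^sub>M borel)" unfolding d_def[abs_def] by measurable
  have d0: "d p \<ge> 0" for p
    using G_transform_pos[of "of_real (fst p) + c 1" "of_real (snd p) + c 1"] e
    by (simp add: d_def q_def c_def)
  have qc: "q (-1) 1 p = cnj (q 1 (-1) p)" "q (-1) (-1) p = cnj (q 1 1 p)" for p
    using G_transform_cnj[of "of_real (fst p) + c 1" "of_real (snd p) + c (-1)"]
      G_transform_cnj[of "of_real (fst p) + c 1" "of_real (snd p) + c 1"] e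
    by (simp_all add: q_def c_def)
  have dq: "complex_of_real (d p) = (q 1 (-1) p + q (-1) 1 p - q 1 1 p - q (-1) (-1) p) / (4 * pi\<^sup>2)" for p
  proof -
    have "q 1 (-1) p + q (-1) 1 p - q 1 1 p - q (-1) (-1) p = of_real (2 * Re (q 1 (-1) p - q 1 1 p))"
      unfolding qc using complex_add_cnj[of "q 1 (-1) p - q 1 1 p"] by (simp add: algebra_simps)
    moreover have "d p = (2 * Re (q 1 (-1) p - q 1 1 p)) / (4 * pi\<^sup>2)"
      using pi_gt_zero by (simp add: d_def field_simps)
    ultimately show ?thesis by (simp only: of_real_divide)
  qed
  define H where "H z w = G_transform (z + c (sgn (Im z))) (w + c (sgn (Im w)))" for z w
  have main: "has_bochner_integral (lborel \<Otimes>\<^sub>M lborel)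
      (\<lambda>p. of_real (d p) / ((z - of_real (fst p)) * (w - of_real (snd p)))) (H z w)"
    if z: "Im z \<noteq> 0" and w: "Im w \<noteq> 0" for z w
  proof -
    define J where "J \<sigma> \<tau> = (if \<sigma> * Im z > 0 \<and> \<tau> * Im w > 0 then - 4 * complex_of_real pi ^ 2 * complex_of_real (\<sigma> * \<tau>) * G_transform (z + c \<sigma>) (w + c \<tau>) else 0)" for \<sigma> \<tau>
    define k where "k p = (z - of_real (fst p)) * (w - of_real (snd p))" for p
    have I: "has_bochner_integral (lborel \<Otimes>\<^sub>M lborel) (\<lambda>p. q \<sigma> \<tau> p / k p) (J \<sigma> \<tau>)"
      if "\<sigma> \<in> {1, -1}" "\<tau> \<in> {1, -1}" for \<sigma> \<tau>
      using G_transform_double_integral[OF e that z w] unfolding q_def k_def J_def c_def .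
    \<comment> \<open>Only the term whose signs match the quadrant of (z, w) survives. The sign
      \<sigma> \<tau> and the factor -4 pi^2 in it are cancelled by the sign in front of that term
      and by the denominator.\<close>
    have Jsum: "(J 1 (-1) + J (-1) 1 - J 1 1 - J (-1) (-1)) / (4 * pi\<^sup>2) = H z w"
    proof -
      have pi: "4 * (complex_of_real pi)\<^sup>2 \<noteq> 0" by simp
      consider "Im z > 0" "Im w > 0" | "Im z > 0" "Im w < 0" | "Im z < 0" "Im w > 0" | "Im z < 0" "Im w < 0"
        using z w by linarith
      then show ?thesis
        by cases (simp_all add: J_def H_def pi)
    qed
    have qsum: "(q 1 (-1) p / k p + q (-1) 1 p / k p - q 1 1 p / k p - q (-1) (-1) p / k p) / (4 * pi\<^sup>2) = of_real (d p) / k p" for p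
      unfolding dq add_divide_distrib[symmetric] diff_divide_distrib[symmetric]
      by (simp only: divide_divide_eq_left mult.commute)
    have "has_bochner_integral (lborel \<Otimes>\<^sub>M lborel)
      (\<lambda>p. (q 1 (-1) p / k p + q (-1) 1 p / k p - q 1 1 p / k p - q (-1) (-1) p / k p) / (4 * pi\<^sup>2))
      ((J 1 (-1) + J (-1) 1 - J 1 1 - J (-1) (-1)) / (4 * pi\<^sup>2))"
      by (intro has_bochner_integral_divide_zero has_bochner_integral_add has_bochner_integral_diff I) auto
    then show ?thesis unfolding qsum Jsum unfolding k_def .
  qed
  have "has_bochner_integral (lborel \<Otimes>\<^sub>M lborel) d 1"
  proof -
    \<comment> \<open>\<open>P n\<close> increases to 1 with n, and it is a combination of the
      resolvents at i n and -i n. The integral of d against two such factors is therefore an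
      explicit combination \<open>m n\<close> of values of \<open>H\<close>, and its limit is the
      mass of d.\<close>
    define P where "P n s = (real n)\<^sup>2 / ((real n)\<^sup>2 + s\<^sup>2)" for n s
    define m where "m n = - (of_nat n ^ 2 / 4) * (H (\<i> * of_nat n) (\<i> * of_nat n) - H (- (\<i> * of_nat n)) (\<i> * of_nat n)
        - H (\<i> * of_nat n) (- (\<i> * of_nat n)) + H (- (\<i> * of_nat n)) (- (\<i> * of_nat n)))" for n :: nat
    have PP: "has_bochner_integral (lborel \<Otimes>\<^sub>M lborel) (\<lambda>p. d p * (P n (fst p) * P n (snd p))) (Re (m n))"
      if n: "n > 0" for n
    proof -
      let ?z = "\<i> * of_nat n :: complex"
      let ?k = "\<lambda>z w p. of_real (d p) / ((z - of_real (fst p)) * (w - of_real (snd p))) :: complex"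
      have "has_bochner_integral (lborel \<Otimes>\<^sub>M lborel)
        (\<lambda>p. - (of_nat n ^ 2 / 4) * (?k ?z ?z p - ?k (- ?z) ?z p - ?k ?z (- ?z) p + ?k (- ?z) (- ?z) p)) (m n)"
        unfolding m_def using n
        by (intro has_bochner_integral_mult_right has_bochner_integral_add has_bochner_integral_diff main) auto
      moreover have "- (of_nat n ^ 2 / 4) * (?k ?z ?z p - ?k (- ?z) ?z p - ?k ?z (- ?z) p + ?k (- ?z) (- ?z) p)
          = of_real (d p * (P n (fst p) * P n (snd p)))" for p
      proof -
        have P: "complex_of_real (P n s) = \<i> * (of_nat n / 2 * (1 / (?z - of_real s) - 1 / (- ?z - of_real s)))" for s
        proof -
          have ne: "?z - of_real s \<noteq> 0" "- ?z - of_real s \<noteq> 0" using n by (auto simp: complex_eq_iff)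
          have eq: "(?z - of_real s) * (- ?z - of_real s) = of_real ((real n)\<^sup>2 + s\<^sup>2)"
            by (simp add: power2_eq_square algebra_simps)
          have "1 / (?z - of_real s) - 1 / (- ?z - of_real s) = - 2 * ?z / ((?z - of_real s) * (- ?z - of_real s))"
            unfolding diff_frac_eq[OF ne] by simp
          then have "\<i> * (of_nat n / 2 * (1 / (?z - of_real s) - 1 / (- ?z - of_real s))) =
              (- ?z * ?z) / of_real ((real n)\<^sup>2 + s\<^sup>2)"
            unfolding eq by simp
          also have "- ?z * ?z = of_real ((real n)\<^sup>2)" by (simp add: power2_eq_square complex_eq_iff)
          finally show ?thesis unfolding P_def of_real_divide by (rule sym)
        qed
        define A B C D where "A = 1 / (?z - of_real (fst p))" "B = 1 / (- ?z - of_real (fst p))"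
          "C = 1 / (?z - of_real (snd p))" "D = 1 / (- ?z - of_real (snd p))"
        have k: "?k ?z ?z p = of_real (d p) * (A * C)" "?k (- ?z) ?z p = of_real (d p) * (B * C)"
          "?k ?z (- ?z) p = of_real (d p) * (A * D)" "?k (- ?z) (- ?z) p = of_real (d p) * (B * D)"
          by (simp_all add: A_B_C_D_def)
        have "of_real (d p * (P n (fst p) * P n (snd p))) =
            of_real (d p) * ((\<i> * (of_nat n / 2 * (A - B))) * (\<i> * (of_nat n / 2 * (C - D))))"
          unfolding of_real_mult P A_B_C_D_def ..
        also have "\<dots> = (\<i> * \<i>) * (of_real (d p) * ((of_nat n / 2 * (A - B)) * (of_nat n / 2 * (C - D))))"
          by (simp only: mult_ac)
        also have "(of_nat n / 2 * (A - B)) * (of_nat n / 2 * (C - D)) = of_nat n ^ 2 / 4 * ((A - B) * (C - D))"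
          by (simp add: power2_eq_square)
        also have "of_real (d p) * (of_nat n ^ 2 / 4 * ((A - B) * (C - D))) = of_nat n ^ 2 / 4 * (of_real (d p) * ((A - B) * (C - D)))"
          by (rule mult.left_commute)
        also have "of_real (d p) * ((A - B) * (C - D)) = of_real (d p) * (A * C) - of_real (d p) * (B * C)
            - of_real (d p) * (A * D) + of_real (d p) * (B * D)"
          by (simp add: algebra_simps)
        finally show ?thesis unfolding k by simp
      qed
      ultimately have "has_bochner_integral (lborel \<Otimes>\<^sub>M lborel) (\<lambda>p. complex_of_real (d p * (P n (fst p) * P n (snd p)))) (m n)"
        by simp
      from has_bochner_integral_bounded_linear[OF bounded_linear_Re this] show ?thesis by simp
    qed
    have lim: "m \<longlonglongrightarrow> 1"
    proof -
      define T where "T \<sigma> \<tau> n = of_nat n ^ 2 * G_transform (\<i> * of_real (\<sigma> * (real n + e))) (\<i> * of_real (\<tau> * (real n + e)))"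
        for \<sigma> \<tau> :: real and n :: nat
      have T: "T \<sigma> \<tau> \<longlonglongrightarrow> - of_real (\<sigma> * \<tau>)" if "\<sigma> \<in> {1, -1}" "\<tau> \<in> {1, -1}" for \<sigma> \<tau>
        using G_transform_imaginary_axis[OF e that] unfolding T_def .
      have "(\<lambda>n. - (1 / 4) * (T 1 1 n - T (-1) 1 n - T 1 (-1) n + T (-1) (-1) n))
         \<longlonglongrightarrow> - (1 / 4) * (- of_real (1 * 1) - (- of_real (-1 * 1)) - (- of_real (1 * -1)) + (- of_real (-1 * -1)))"
        by (intro tendsto_intros T) auto
      then have "(\<lambda>n. - (1 / 4) * (T 1 1 n - T (-1) 1 n - T 1 (-1) n + T (-1) (-1) n)) \<longlonglongrightarrow> 1" by simp
      moreover have "\<forall>\<^sub>F n in sequentially. - (1 / 4) * (T 1 1 n - T (-1) 1 n - T 1 (-1) n + T (-1) (-1) n) = m n"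
        using eventually_gt_at_top[of 0]
      proof eventually_elim
        case (elim n)
        have "\<i> * of_nat n + c 1 = \<i> * of_real (1 * (real n + e))"
          "- (\<i> * of_nat n) + c (-1) = \<i> * of_real (-1 * (real n + e))"
          by (simp_all add: c_def algebra_simps)
        note * = this
        have HG: "H (\<i> * of_nat n) (\<i> * of_nat n) = G_transform (\<i> * of_real (1 * (real n + e))) (\<i> * of_real (1 * (real n + e)))"
          "H (- (\<i> * of_nat n)) (\<i> * of_nat n) = G_transform (\<i> * of_real (-1 * (real n + e))) (\<i> * of_real (1 * (real n + e)))"
          "H (\<i> * of_nat n) (- (\<i> * of_nat n)) = G_transform (\<i> * of_real (1 * (real n + e))) (\<i> * of_real (-1 * (real n + e)))"
          "H (- (\<i> * of_nat n)) (- (\<i> * of_nat n)) = G_transform (\<i> * of_real (-1 * (real n + e))) (\<i> * of_real (-1 * (real n + e)))"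
          unfolding *[symmetric] using elim by (simp_all add: H_def)
        have "- (1 / 4) * (N * a - N * b - N * x + N * y) = - (N / 4) * (a - b - x + y)" for N a b x y :: complex
          by (simp add: algebra_simps)
        then show ?case unfolding T_def m_def HG .
      qed
      ultimately show ?thesis by (rule Lim_transform_eventually)
    qed
    \<comment> \<open>The index starts at 1: for n = 0 the points i n and -i n would be
      real.\<close>
    define F where "F i p = d p * (P (Suc i) (fst p) * P (Suc i) (snd p))" for i and p :: "real \<times> real"
    have P01: "0 \<le> P n s" "P n s \<le> 1" for n s
      unfolding P_def by (auto simp: divide_le_eq_1 add_nonneg_eq_0_iff intro: order.not_eq_order_implies_strict)
    have Pmono: "P (Suc i) s \<le> P (Suc j) s" if "i \<le> j" for i j s
    proof -
      have "(real (Suc i))\<^sup>2 * s\<^sup>2 \<le> (real (Suc j))\<^sup>2 * s\<^sup>2"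
        using that by (intro mult_right_mono power_mono) auto
      moreover have "0 < (real (Suc i))\<^sup>2 + s\<^sup>2" "0 < (real (Suc j))\<^sup>2 + s\<^sup>2" by (auto intro!: add_pos_nonneg)
      moreover have "x / (x + t) \<le> y / (y + t)" if "x * t \<le> y * t" "0 < x + t" "0 < y + t" for x y t :: real
      proof -
        have "x \<le> y * (x + t) / (y + t)"
          using that by (subst pos_le_divide_eq) (auto simp: distrib_left mult.commute)
        then show ?thesis using that by (subst pos_divide_le_eq) auto
      qed
      ultimately show ?thesis unfolding P_def by blast
    qed
    have Plim: "(\<lambda>i. P (Suc i) s) \<longlonglongrightarrow> 1" for s
    proof -
      have "(\<lambda>i. 1 / (1 + s\<^sup>2 * (inverse (real (Suc i)))\<^sup>2)) \<longlonglongrightarrow> 1 / (1 + s\<^sup>2 * 0\<^sup>2)"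
        by (intro tendsto_intros LIMSEQ_inverse_real_of_nat) auto
      moreover have "1 / (1 + s\<^sup>2 * (inverse (real (Suc i)))\<^sup>2) = P (Suc i) s" for i
      proof -
        define N where "N = real (Suc i)"
        have "N > 0" by (simp add: N_def)
        then have "N\<^sup>2 * (1 + s\<^sup>2 * (inverse N)\<^sup>2) = N\<^sup>2 + s\<^sup>2"
          by (simp add: field_simps)
        moreover have "1 + s\<^sup>2 * (inverse N)\<^sup>2 > 0" by (simp add: add_pos_nonneg)
        ultimately show ?thesis
          using \<open>N > 0\<close> unfolding P_def N_def[symmetric]
          by (metis less_irrefl mult_divide_mult_cancel_left mult.right_neutral zero_eq_power2)
      qed
      ultimately show ?thesis by simp
    qed
    have Fi: "integrable (lborel \<Otimes>\<^sub>M lborel) (F i)" "integral\<^sup>L (lborel \<Otimes>\<^sub>M lborel) (F i) = Re (m (Suc i))" for i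
      using PP[of "Suc i", folded F_def[of i]] by (simp_all only: has_bochner_integral_iff zero_less_Suc simp_thms)
    show ?thesis
    proof (rule has_bochner_integral_monotone_convergence[where f = F])
      show "AE p in lborel \<Otimes>\<^sub>M lborel. mono (\<lambda>i. F i p)"
        unfolding F_def mono_def
        by (rule AE_I2, intro allI impI, rule mult_left_mono[OF mult_mono d0]) (simp_all only: Pmono P01)
      show "AE p in lborel \<Otimes>\<^sub>M lborel. (\<lambda>i. F i p) \<longlonglongrightarrow> d p"
      proof (rule AE_I2)
        fix p
        have "(\<lambda>i. F i p) \<longlonglongrightarrow> d p * (1 * 1)"
          unfolding F_def by (intro tendsto_intros Plim)
        then show "(\<lambda>i. F i p) \<longlonglongrightarrow> d p" by simp
      qed
      have "(\<lambda>i. Re (m (Suc i))) \<longlonglongrightarrow> Re 1"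
        by (intro tendsto_intros LIMSEQ_Suc lim)
      then show "(\<lambda>i. integral\<^sup>L (lborel \<Otimes>\<^sub>M lborel) (F i)) \<longlonglongrightarrow> 1"
        by (simp add: Fi)
    qed (use Fi in auto)
  qed
  then have d1: "integrable (lborel \<Otimes>\<^sub>M lborel) d" "integral\<^sup>L (lborel \<Otimes>\<^sub>M lborel) d = 1"
    by (auto simp: has_bochner_integral_iff)
  define \<nu> where "\<nu> = density (lborel \<Otimes>\<^sub>M lborel) (\<lambda>p. ennreal (d p))"
  have "emeasure \<nu> (space \<nu>) = (\<integral>\<^sup>+p. ennreal (d p) \<partial>(lborel \<Otimes>\<^sub>M lborel))"
    unfolding \<nu>_def space_density
    by (subst emeasure_density; measurable)
  also have "\<dots> = 1"
    by (subst nn_integral_eq_integral[OF d1(1)]) (auto simp: d0 d1(2))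
  finally have "prob_space \<nu>" by (rule prob_spaceI)
  moreover have "sets \<nu> = sets borel"
    by (simp add: \<nu>_def lborel_prod)
  moreover have "cauchy_transform2 \<nu> z w = H z w" if "Im z \<noteq> 0" "Im w \<noteq> 0" for z w
  proof -
    have "cauchy_transform2 \<nu> z w = (\<integral>p. d p *\<^sub>R (1 / ((z - of_real (fst p)) * (w - of_real (snd p)))) \<partial>(lborel \<Otimes>\<^sub>M lborel))"
      unfolding cauchy_transform2_def \<nu>_def
      by (rule integral_density) (measurable, simp add: d0)
    also have "\<dots> = H z w"
      using main[OF that] by (simp add: has_bochner_integral_iff scaleR_conv_of_real)
    finally show ?thesis .
  qed
  ultimately show ?thesis
    unfolding borel_prob_def H_def c_def by (intro exI[of _ \<nu>] conjI allI impI)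
qed

end

section \<open>Bi-free compound Poisson laws\<close>

context two_jumps
begin

lemma cross_tendsto:
  assumes a: "a \<longlonglongrightarrow> a0" and b: "b \<longlonglongrightarrow> b0" and e: "e > 0"
    and Im: "\<And>n. \<bar>Im (a n)\<bar> \<ge> e" "\<And>n. \<bar>Im (b n)\<bar> \<ge> e" and nz: "Im a0 \<noteq> 0" "Im b0 \<noteq> 0"
  shows "(\<lambda>n. cross (a n) (b n)) \<longlonglongrightarrow> cross a0 b0"
  unfolding cross_def
proof (rule integral_dominated_convergence[where w = "\<lambda>_. K / e * (K / e)"])
  show "AE x in M. (\<lambda>n. f.jump_ratio (a n) x * g.jump_ratio (b n) x) \<longlonglongrightarrow> f.jump_ratio a0 x * g.jump_ratio b0 x"
    unfolding f.jump_ratio_def g.jump_ratio_def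
    using diff_of_real_neq_0[OF nz(1)] diff_of_real_neq_0[OF nz(2)] by (intro AE_I2 tendsto_intros a b) auto
  have "norm (f.jump_ratio (a n) x) \<le> K / e" "norm (g.jump_ratio (b n) x) \<le> K / e" for n x
  proof -
    have "Im (a n) \<noteq> 0" "Im (b n) \<noteq> 0" using Im[of n] e by auto
    then have "norm (f.jump_ratio (a n) x) \<le> K / \<bar>Im (a n)\<bar>" "norm (g.jump_ratio (b n) x) \<le> K / \<bar>Im (b n)\<bar>"
      by (intro f.norm_jump_ratio g.norm_jump_ratio; simp)+
    moreover have "K / \<bar>Im (a n)\<bar> \<le> K / e" "K / \<bar>Im (b n)\<bar> \<le> K / e"
      using Im[of n] e f.K_nonneg by (intro divide_left_mono mult_pos_pos; linarith)+
    ultimately show "norm (f.jump_ratio (a n) x) \<le> K / e" "norm (g.jump_ratio (b n) x) \<le> K / e"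
      by linarith+
  qed
  then show "AE x in M. norm (f.jump_ratio (a n) x * g.jump_ratio (b n) x) \<le> K / e * (K / e)" for n
    unfolding norm_mult by (intro AE_I2 mult_mono) (auto intro: divide_nonneg_pos f.K_nonneg e)
qed auto

lemma G_transform_tendsto:
  assumes \<zeta>: "\<zeta> \<longlonglongrightarrow> \<zeta>0" and \<omega>: "\<omega> \<longlonglongrightarrow> \<omega>0" and e: "e > 0"
    and Im: "\<And>n. \<bar>Im (\<zeta> n)\<bar> \<ge> e" "\<And>n. \<bar>Im (\<omega> n)\<bar> \<ge> e" and nz: "Im \<zeta>0 \<noteq> 0" "Im \<omega>0 \<noteq> 0"
  shows "(\<lambda>n. G_transform (\<zeta> n) (\<omega> n)) \<longlonglongrightarrow> G_transform \<zeta>0 \<omega>0"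
proof -
  have Imn: "Im (\<zeta> n) \<noteq> 0" "Im (\<omega> n) \<noteq> 0" for n using Im[of n] e by auto
  have op: "open (- \<real> :: complex set)" by (rule open_Compl[OF closed_complex_Reals])
  have "isCont f.F_transform \<zeta>0" "isCont g.F_transform \<omega>0"
    using holomorphic_on_imp_continuous_on[OF f.F_transform_holomorphic]
      holomorphic_on_imp_continuous_on[OF g.F_transform_holomorphic] nz
    by (auto simp: continuous_on_eq_continuous_at[OF op] complex_is_Real_iff)
  then have F: "(\<lambda>n. f.F_transform (\<zeta> n)) \<longlonglongrightarrow> f.F_transform \<zeta>0" "(\<lambda>n. g.F_transform (\<omega> n)) \<longlonglongrightarrow> g.F_transform \<omega>0"
    using \<zeta> \<omega> by (auto intro: isCont_tendsto_compose)
  have "(\<lambda>n. cross (f.F_transform (\<zeta> n)) (g.F_transform (\<omega> n))) \<longlonglongrightarrow> cross (f.F_transform \<zeta>0) (g.F_transform \<omega>0)"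
    using order_trans[OF Im(1) f.F_transform_Im(2)[OF Imn(1)]] order_trans[OF Im(2) g.F_transform_Im(2)[OF Imn(2)]]
    by (intro cross_tendsto[where e = e] F e f.F_transform(3) g.F_transform(3) nz) auto
  then show ?thesis
    unfolding G_transform_def green_def
    using f.F_transform(3)[OF nz(1)] g.F_transform(3)[OF nz(2)]
      cross_neq_1[OF f.F_transform(3)[OF nz(1)] g.F_transform(3)[OF nz(2)] f.F_transform(4)[OF nz(1)] g.F_transform(4)[OF nz(2)]]
    by (intro tendsto_intros F) auto
qed

text \<open>Let the smoothing height tend to 0. Compactness provides a limit measure, continuity of
  \<open>G_transform\<close> identifies its Cauchy transform, and the asymptotics on the imaginary
  axis show that no mass is lost.\<close>

theorem law_exists:
  obtains \<nu> where "borel_prob \<nu>"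
    "\<And>\<zeta> \<omega>. Im \<zeta> \<noteq> 0 \<Longrightarrow> Im \<omega> \<noteq> 0 \<Longrightarrow> cauchy_transform2 \<nu> \<zeta> \<omega> = G_transform \<zeta> \<omega>"
proof -
  define e where "e n = inverse (real (Suc n))" for n
  have e0: "e n > 0" for n by (simp add: e_def)
  define sh where "sh n z = z + \<i> * of_real (sgn (Im z) * e n)" for n z
  have "\<exists>\<nu>. borel_prob \<nu> \<and> (\<forall>z w. Im z \<noteq> 0 \<longrightarrow> Im w \<noteq> 0 \<longrightarrow>
    cauchy_transform2 \<nu> z w = G_transform (sh n z) (sh n w))" for n
    using smoothed_law[OF e0] unfolding sh_def .
  then have "\<exists>\<nu>. \<forall>n. borel_prob (\<nu> n) \<and> (\<forall>z w. Im z \<noteq> 0 \<longrightarrow> Im w \<noteq> 0 \<longrightarrow>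
    cauchy_transform2 (\<nu> n) z w = G_transform (sh n z) (sh n w))"
    by (intro choice allI)
  then obtain \<nu> where \<nu>: "\<And>n. borel_prob (\<nu> n)"
    "\<And>n z w. Im z \<noteq> 0 \<Longrightarrow> Im w \<noteq> 0 \<Longrightarrow> cauchy_transform2 (\<nu> n) z w = G_transform (sh n z) (sh n w)"
    by blast
  obtain r N where r: "strict_mono r"
    and N: "finite_measure N" "sets N = sets borel"
    and lim: "\<And>z w. z \<notin> \<real> \<Longrightarrow> w \<notin> \<real> \<Longrightarrow>
       (\<lambda>n. cauchy_transform2 (\<nu> (r n)) z w) \<longlonglongrightarrow> cauchy_transform2 N z w"
    using cauchy_transform2_compactness[of \<nu>, OF \<nu>(1)] by blast
  have er: "(\<lambda>n. e (r n)) \<longlonglongrightarrow> 0"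
    using LIMSEQ_subseq_LIMSEQ[OF LIMSEQ_inverse_real_of_nat r] by (simp add: comp_def e_def)
  have sh: "(\<lambda>n. sh (r n) z) \<longlonglongrightarrow> z" for z
  proof -
    have "(\<lambda>n. sh (r n) z) \<longlonglongrightarrow> z + \<i> * of_real (sgn (Im z) * 0)"
      unfolding sh_def by (intro tendsto_intros er)
    then show ?thesis by simp
  qed
  have Imsh: "\<bar>Im (sh n z)\<bar> \<ge> \<bar>Im z\<bar>" for n z
    using e0[of n] by (auto simp: sh_def sgn_real_def)
  have eq: "cauchy_transform2 N z w = G_transform z w" if z: "Im z \<noteq> 0" and w: "Im w \<noteq> 0" for z w
  proof (rule LIMSEQ_unique)
    show "(\<lambda>n. cauchy_transform2 (\<nu> (r n)) z w) \<longlonglongrightarrow> cauchy_transform2 N z w"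
      using z w by (intro lim) (auto simp: complex_is_Real_iff)
    show "(\<lambda>n. cauchy_transform2 (\<nu> (r n)) z w) \<longlonglongrightarrow> G_transform z w"
      unfolding \<nu>(2)[OF z w] using Imsh z w
      by (intro G_transform_tendsto[where e = "min \<bar>Im z\<bar> \<bar>Im w\<bar>"] sh) (auto simp: min_le_iff_disj)
  qed
  \<comment> \<open>The form \<open>1 * (real n + 1)\<close> is that of
    \<open>G_transform_imaginary_axis\<close> with sign 1 and e = 1. That lemma normalises by n^2,
    and the factor (1 + 1/n)^2 below corrects this to (n + 1)^2.\<close>
  define \<zeta> :: "nat \<Rightarrow> complex" where "\<zeta> n = \<i> * of_real (1 * (real n + 1))" for n
  have n\<zeta>: "norm (\<zeta> n) = real n + 1" for n by (simp add: \<zeta>_def norm_mult del: of_real_add)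
  have inf: "filterlim \<zeta> at_infinity sequentially"
  proof -
    have "filterlim (\<lambda>n. real n + 1) at_top sequentially"
      by (rule filterlim_at_top_mono[OF filterlim_real_sequentially]) auto
    then show ?thesis by (rule filterlim_norm_at_top_imp_at_infinity[where f = \<zeta>, unfolded n\<zeta>])
  qed
  have "(\<lambda>n. \<zeta> n * \<zeta> n * cauchy_transform2 N (\<zeta> n) (\<zeta> n)) \<longlonglongrightarrow> of_real (measure N (space N))"
  proof -
    have "1 * norm (\<zeta> n) \<le> \<bar>Im (\<zeta> n)\<bar>" "\<zeta> n \<noteq> 0" for n
      unfolding n\<zeta> by (auto simp: \<zeta>_def complex_eq_iff)
    then show ?thesis by (intro cauchy_transform2_mass[OF N, where c = 1] inf) simp_all
  qed
  moreover have "(\<lambda>n. \<zeta> n * \<zeta> n * cauchy_transform2 N (\<zeta> n) (\<zeta> n)) \<longlonglongrightarrow> 1"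
  proof (rule Lim_transform_eventually)
    have "(\<lambda>n. - ((1 + 1 / of_nat n) ^ 2) * (of_nat n ^ 2 * G_transform (\<zeta> n) (\<zeta> n))) \<longlonglongrightarrow> - ((1 + 0) ^ 2) * (- of_real (1 * 1) :: complex)"
      unfolding \<zeta>_def by (intro tendsto_intros G_transform_imaginary_axis lim_1_over_n) auto
    then show "(\<lambda>n. - ((1 + 1 / of_nat n) ^ 2) * (of_nat n ^ 2 * G_transform (\<zeta> n) (\<zeta> n))) \<longlonglongrightarrow> 1" by simp
    show "\<forall>\<^sub>F n in sequentially. - ((1 + 1 / of_nat n) ^ 2) * (of_nat n ^ 2 * G_transform (\<zeta> n) (\<zeta> n))
        = \<zeta> n * \<zeta> n * cauchy_transform2 N (\<zeta> n) (\<zeta> n)"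
      using eventually_gt_at_top[of 0]
    proof eventually_elim
      case (elim n)
      have "(1 + 1 / of_nat n) * of_nat n = (of_nat n + 1 :: complex)"
        using elim by (simp add: distrib_right)
      then have "(1 + 1 / of_nat n) ^ 2 * of_nat n ^ 2 = (of_nat n + 1 :: complex) ^ 2"
        by (simp only: power_mult_distrib[symmetric])
      then have "- ((1 + 1 / of_nat n) ^ 2) * of_nat n ^ 2 = \<zeta> n * \<zeta> n"
        by (simp add: \<zeta>_def power2_eq_square complex_eq_iff)
      moreover have ne: "Im (\<zeta> n) \<noteq> 0" by (simp add: \<zeta>_def)
      ultimately show ?case by (simp only: eq[OF ne ne] mult.assoc[symmetric])
    qed
  qed
  ultimately have "complex_of_real (measure N (space N)) = 1" by (rule LIMSEQ_unique)
  then have "measure N (space N) = 1" by simp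
  then have "borel_prob N"
    using N finite_measure.emeasure_eq_measure[OF N(1)] unfolding borel_prob_def by (auto intro!: prob_spaceI)
  then show ?thesis by (rule that) (rule eq)
qed

end

section \<open>Limits of compound Poisson laws\<close>

lemma stolz_pair_iff:
  "z \<in> stolz_pair \<alpha> \<beta> \<longleftrightarrow> Im z \<noteq> 0 \<and> \<bar>Re z\<bar> < \<alpha> * \<bar>Im z\<bar> \<and> \<bar>Im z\<bar> < \<beta>"
proof -
  have "z \<in> cnj ` A \<longleftrightarrow> cnj z \<in> A" for A by (metis complex_cnj_cnj image_iff)
  then show ?thesis
    by (cases "Im z < 0") (auto simp: stolz_pair_def stolz_angle_def)
qed

lemma stolz_pair_mono: "\<alpha>' \<le> \<alpha> \<Longrightarrow> \<beta>' \<le> \<beta> \<Longrightarrow> stolz_pair \<alpha>' \<beta>' \<subseteq> stolz_pair \<alpha> \<beta>"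
proof
  fix z assume "\<alpha>' \<le> \<alpha>" "\<beta>' \<le> \<beta>" "z \<in> stolz_pair \<alpha>' \<beta>'"
  moreover from this have "\<alpha>' * \<bar>Im z\<bar> \<le> \<alpha> * \<bar>Im z\<bar>" by (intro mult_right_mono) auto
  ultimately show "z \<in> stolz_pair \<alpha> \<beta>"
    unfolding stolz_pair_iff by (elim conjE) (intro conjI; linarith)
qed

lemma open_stolz_pair: "open (stolz_pair \<alpha> \<beta>)"
proof -
  have "stolz_pair \<alpha> \<beta> = {z. Im z \<noteq> 0} \<inter> {z. \<bar>Re z\<bar> < \<alpha> * \<bar>Im z\<bar>} \<inter> {z. \<bar>Im z\<bar> < \<beta>}"
    by (auto simp: stolz_pair_iff)
  moreover have "open \<dots>"
    by (intro open_Int open_Collect_less open_Collect_neq continuous_intros)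
  ultimately show ?thesis by simp
qed

lemma stolz_pair_Im: "z \<in> stolz_pair \<alpha> \<beta> \<Longrightarrow> Im z \<noteq> 0"
  by (simp add: stolz_pair_iff)

lemma stolz_pair_neq_0: "z \<in> stolz_pair \<alpha> \<beta> \<Longrightarrow> z \<noteq> 0"
  by (auto simp: stolz_pair_iff)

lemma stolz_pair_norm_le:
  assumes "z \<in> stolz_pair \<alpha> \<beta>"
  shows "norm z \<le> (1 + \<alpha>) * \<bar>Im z\<bar>"
  using cmod_le[of z] assms by (auto simp: stolz_pair_iff distrib_right)

text \<open>\<open>c\<close> is the cone constant used from here on; it comes from |z| <= |Re z| +
  |Im z| <= (1 + \<alpha>) |Im z|.\<close>

lemma stolz_pair_cone:
  assumes "z \<in> stolz_pair \<alpha> \<beta>" "\<alpha> > 0" "c = 1 / (1 + \<alpha>)"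
  shows "c * norm z \<le> \<bar>Im z\<bar>" "0 < c" "c < 1"
proof -
  show c: "0 < c" "c < 1" using assms by auto
  have "c * norm z \<le> c * ((1 + \<alpha>) * \<bar>Im z\<bar>)"
    using c by (intro mult_left_mono stolz_pair_norm_le[OF assms(1)]) auto
  then show "c * norm z \<le> \<bar>Im z\<bar>" using assms by simp
qed

text \<open>A reference sequence on the negative imaginary axis that tends to 0 and lies in the
  Stolz pair with this \<beta> for every opening \<alpha> > 0.\<close>

definition stolz_seq :: "real \<Rightarrow> nat \<Rightarrow> complex" where
  "stolz_seq \<beta> n = - \<i> * of_real (\<beta> / 2 * inverse (real (Suc n)))"

lemma stolz_seq:
  assumes "\<alpha> > 0" "\<beta> > 0"
  shows "stolz_seq \<beta> n \<in> stolz_pair \<alpha> \<beta>" "stolz_seq \<beta> \<longlonglongrightarrow> 0"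
    "filterlim (stolz_seq \<beta>) (at 0 within stolz_pair \<alpha> \<beta>) sequentially"
proof -
  show mem: "stolz_seq \<beta> n \<in> stolz_pair \<alpha> \<beta>" for n
  proof -
    have "inverse (real (Suc n)) \<le> 1" by (simp add: field_simps)
    then have "\<beta> / 2 * inverse (real (Suc n)) \<le> \<beta> / 2 * 1" using assms by (intro mult_left_mono) auto
    then have "\<beta> / 2 * inverse (real (Suc n)) < \<beta>" using assms by linarith
    moreover have "\<beta> / 2 * inverse (real (Suc n)) > 0" using assms by simp
    ultimately have "- \<i> * of_real (\<beta> / 2 * inverse (real (Suc n))) \<in> stolz_pair \<alpha> \<beta>"
      using assms unfolding stolz_pair_iff
      by (simp only: complex_cnj_i Re_i_times Im_i_times minus_mult_left[symmetric] uminus_complex.sel Re_complex_of_real Im_complex_of_real) auto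
    then show ?thesis unfolding stolz_seq_def .
  qed
  have "stolz_seq \<beta> \<longlonglongrightarrow> - \<i> * of_real (\<beta> / 2 * 0)"
    unfolding stolz_seq_def by (intro tendsto_intros LIMSEQ_inverse_real_of_nat)
  then show lim: "stolz_seq \<beta> \<longlonglongrightarrow> 0" by simp
  then show "filterlim (stolz_seq \<beta>) (at 0 within stolz_pair \<alpha> \<beta>) sequentially"
    using mem stolz_pair_neq_0 by (auto simp: filterlim_at intro!: always_eventually)
qed

text \<open>The imaginary part of 1/z is at least c/|z| in absolute value, and the hypothesis makes
  R at most half of that. So 1/z + R stays in the half plane of 1/z; its modulus is at most 2/|z|,
  which leaves the cone constant c/4.\<close>

lemma shifted_inverse_estimates:
  assumes z: "z \<in> stolz_pair \<alpha> \<beta>" and \<alpha>: "\<alpha> > 0" and c: "c = 1 / (1 + \<alpha>)"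
    and R: "norm (z * R) \<le> c / 2"
  shows "Im (1 / z) * Im (1 / z + R) > 0" "Im (1 / z + R) \<noteq> 0" "1 / z + R \<notin> \<real>" "1 / z + R \<noteq> 0"
    "\<bar>Im (1 / z + R)\<bar> \<ge> c / 2 / norm z" "c / 4 * norm (1 / z + R) \<le> \<bar>Im (1 / z + R)\<bar>"
    "1 / 2 / norm z \<le> norm (1 / z + R)"
proof -
  have z0: "z \<noteq> 0" "norm z > 0" using stolz_pair_neq_0[OF z] by auto
  note cone = stolz_pair_cone[OF z \<alpha> c]
  have Imz: "Im (1 / z) = - Im z / (norm z)\<^sup>2" by (simp add: Im_divide cmod_power2)
  have "\<bar>Im (1 / z)\<bar> = \<bar>Im z\<bar> / (norm z)\<^sup>2" unfolding Imz by simp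
  also have "\<dots> \<ge> c * norm z / (norm z)\<^sup>2" by (intro divide_right_mono cone) auto
  also have "c * norm z / (norm z)\<^sup>2 = c / norm z" using z0 by (simp add: power2_eq_square)
  finally have 1: "\<bar>Im (1 / z)\<bar> \<ge> c / norm z" .
  have R': "norm R \<le> c / 2 / norm z" using R z0 by (simp add: norm_mult field_simps)
  then have ImR: "\<bar>Im R\<bar> \<le> c / 2 / norm z" using abs_Im_le_cmod[of R] by linarith
  have pos: "c / 2 / norm z > 0" using cone z0 by simp
  have half: "c / norm z = c / 2 / norm z + c / 2 / norm z" by (simp add: field_simps)
  have add: "Im (1 / z + R) = Im (1 / z) + Im R" by (rule plus_complex.sel)
  show 2: "\<bar>Im (1 / z + R)\<bar> \<ge> c / 2 / norm z" unfolding add using 1 ImR half by linarith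
  then show nz: "Im (1 / z + R) \<noteq> 0" using pos by linarith
  then show "1 / z + R \<notin> \<real>" unfolding complex_is_Real_iff .
  show "1 / z + R \<noteq> 0" using nz by (metis zero_complex.sel(2))
  show "Im (1 / z) * Im (1 / z + R) > 0"
  proof (cases "Im (1 / z) > 0")
    case True
    then have "Im (1 / z + R) > 0" unfolding add using 1 ImR half pos by linarith
    then show ?thesis using True by (rule mult_pos_pos[rotated])
  next
    case False
    then have "Im (1 / z) < 0" "Im (1 / z + R) < 0" unfolding add using 1 ImR half pos by linarith+
    then show ?thesis by (rule mult_neg_neg)
  qed
  have n1: "norm (1 / z) = 1 / norm z" by (simp add: norm_divide)
  have c2: "c / 2 / norm z \<le> 1 / 2 / norm z" using cone z0 by (intro divide_right_mono) auto
  have h1: "1 / norm z = 1 / 2 / norm z + 1 / 2 / norm z" by (simp add: field_simps)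
  have "norm (1 / z + R) \<le> 1 / norm z + 1 / norm z"
    using norm_triangle_ineq[of "1 / z" R] R' c2 n1 h1 pos by linarith
  then have "c / 4 * norm (1 / z + R) \<le> c / 4 * (1 / norm z + 1 / norm z)"
    using cone by (intro mult_left_mono) auto
  also have "\<dots> = c / 2 / norm z" by (simp add: field_simps)
  finally show "c / 4 * norm (1 / z + R) \<le> \<bar>Im (1 / z + R)\<bar>" using 2 by linarith
  show "1 / 2 / norm z \<le> norm (1 / z + R)"
    using norm_diff_ineq[of "1 / z" R] R' c2 n1 h1 by linarith
qed

lemma shifted_inverse_at_infinity:
  assumes S: "\<And>n. z n \<in> stolz_pair \<alpha> \<beta>" and \<alpha>: "\<alpha> > 0" and c: "c = 1 / (1 + \<alpha>)"
    and lim: "z \<longlonglongrightarrow> 0" and R: "\<And>n. norm (z n * R n) \<le> c / 2"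
  shows "filterlim (\<lambda>n. 1 / z n + R n) at_infinity sequentially"
proof -
  have z0: "z n \<noteq> 0" for n using stolz_pair_neq_0[OF S] .
  have "filterlim (\<lambda>n. inverse (z n)) at_infinity sequentially"
    by (rule filterlim_compose[OF filterlim_inverse_at_infinity])
      (use z0 lim in \<open>auto simp: filterlim_at\<close>)
  then have "filterlim (\<lambda>n. 1 / 2 * norm (inverse (z n))) at_top sequentially"
    by (intro filterlim_tendsto_pos_mult_at_top[OF tendsto_const] filterlim_at_infinity_imp_norm_at_top) auto
  then have "filterlim (\<lambda>n. norm (1 / z n + R n)) at_top sequentially"
  proof (rule filterlim_at_top_mono, intro always_eventually allI)
    fix n
    show "1 / 2 * norm (inverse (z n)) \<le> norm (1 / z n + R n)"
    proof -
      have "1 / 2 * norm (inverse (z n)) = 1 / 2 / norm (z n)"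
        by (simp only: norm_inverse divide_inverse)
      then show ?thesis using shifted_inverse_estimates(7)[OF S \<alpha> c R, of n] by (simp only:)
    qed
  qed
  then show ?thesis by (rule filterlim_norm_at_top_imp_at_infinity)
qed

lemma cauchy_transform2_integrable:
  assumes "finite_measure \<nu>" "sets \<nu> = sets borel" "Im \<zeta> \<noteq> 0" "Im \<omega> \<noteq> 0"
  shows "integrable \<nu> (\<lambda>p. 1 / ((\<zeta> - of_real (fst p)) * (\<omega> - of_real (snd p))))"
proof -
  interpret finite_measure \<nu> by fact
  have [measurable_cong]: "sets \<nu> = sets (borel \<Otimes>\<^sub>M borel)" by (simp only: assms(2) borel_prod)
  show ?thesis
  proof (rule integrable_const_bound[where B = "1 / (\<bar>Im \<zeta>\<bar> * \<bar>Im \<omega>\<bar>)"])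
    show "AE p in \<nu>. norm (1 / ((\<zeta> - of_real (fst p)) * (\<omega> - of_real (snd p)))) \<le> 1 / (\<bar>Im \<zeta>\<bar> * \<bar>Im \<omega>\<bar>)"
      unfolding norm_divide norm_mult norm_one using assms
      by (intro AE_I2 divide_left_mono mult_mono norm_diff_of_real_ge mult_pos_pos)
        (auto simp: diff_of_real_neq_0 intro!: mult_pos_pos)
  qed measurable
qed

lemma norm_resolvent_le: "Im a \<noteq> 0 \<Longrightarrow> norm (1 / (a - of_real x)) \<le> 1 / \<bar>Im a\<bar>"
  unfolding norm_divide norm_one by (intro frac_le norm_diff_of_real_ge) auto

lemma resolvent_diff:
  assumes "Im a \<noteq> 0" "Im b \<noteq> 0"
  shows "1 / (a - of_real x) - 1 / (b - of_real x) = (b - a) * (1 / (a - of_real x) * (1 / (b - of_real x)))"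
proof -
  have "1 / s - 1 / t = (t - s) * (1 / s * (1 / t))" if "s \<noteq> 0" "t \<noteq> 0" for s t :: complex
    using that by (simp add: diff_frac_eq)
  from this[of "a - of_real x" "b - of_real x"] show ?thesis
    using diff_of_real_neq_0[OF assms(1)] diff_of_real_neq_0[OF assms(2)] by simp
qed

lemma norm_resolvent_diff_le:
  assumes "Im a \<noteq> 0" "Im b \<noteq> 0"
  shows "norm (1 / (a - of_real x) - 1 / (b - of_real x)) \<le> norm (a - b) * (1 / \<bar>Im a\<bar> * (1 / \<bar>Im b\<bar>))"
  unfolding resolvent_diff[OF assms] norm_mult norm_minus_commute[of b a]
  by (intro mult_left_mono mult_mono norm_resolvent_le assms) auto

text \<open>The constant is the same for all laws. This allows \<open>limit_law\<close> to replace a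
  moving point of evaluation by its limit while the law moves as well.\<close>

lemma cauchy_transform2_lipschitz:
  assumes \<nu>: "borel_prob \<nu>" and Im: "Im \<zeta> \<noteq> 0" "Im \<omega> \<noteq> 0" "Im \<zeta>' \<noteq> 0" "Im \<omega>' \<noteq> 0"
  shows "norm (cauchy_transform2 \<nu> \<zeta> \<omega> - cauchy_transform2 \<nu> \<zeta>' \<omega>')
    \<le> norm (\<zeta> - \<zeta>') * (1 / \<bar>Im \<zeta>\<bar> * (1 / \<bar>Im \<zeta>'\<bar>)) * (1 / \<bar>Im \<omega>\<bar>)
      + 1 / \<bar>Im \<zeta>'\<bar> * (norm (\<omega> - \<omega>') * (1 / \<bar>Im \<omega>\<bar> * (1 / \<bar>Im \<omega>'\<bar>)))" (is "_ \<le> ?B")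
proof -
  interpret prob_space \<nu> using \<nu> by (simp add: borel_prob_def)
  have sets: "sets \<nu> = sets borel" using \<nu> by (simp add: borel_prob_def)
  let ?k = "\<lambda>\<zeta> \<omega> p. 1 / ((\<zeta> - of_real (fst p)) * (\<omega> - of_real (snd p))) :: complex"
  note int = cauchy_transform2_integrable[OF finite_measure_axioms sets Im(1,2)]
    cauchy_transform2_integrable[OF finite_measure_axioms sets Im(3,4)]
  have bound: "norm (?k \<zeta> \<omega> p - ?k \<zeta>' \<omega>' p) \<le> ?B" for p
  proof -
    define a a' b b' where "a = 1 / (\<zeta> - of_real (fst p))" and "a' = 1 / (\<zeta>' - of_real (fst p))"
      and "b = 1 / (\<omega> - of_real (snd p))" and "b' = 1 / (\<omega>' - of_real (snd p))"
    have "?k \<zeta> \<omega> p - ?k \<zeta>' \<omega>' p = a * b - a' * b'" by (simp add: a_def a'_def b_def b'_def)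
    also have "\<dots> = (a - a') * b + a' * (b - b')" by (simp add: algebra_simps)
    also have "norm \<dots> \<le> norm (a - a') * norm b + norm a' * norm (b - b')"
      by (rule order_trans[OF norm_triangle_ineq]) (simp add: norm_mult)
    also have "\<dots> \<le> ?B"
      unfolding a_def a'_def b_def b'_def
      by (rule add_mono; rule mult_mono;
          (rule norm_resolvent_diff_le norm_resolvent_le)?; (simp add: Im; fail)?)
    finally show ?thesis .
  qed
  have "norm (\<integral>p. ?k \<zeta> \<omega> p - ?k \<zeta>' \<omega>' p \<partial>\<nu>) \<le> (\<integral>p. ?B \<partial>\<nu>)"
    by (rule norm_integral_le[OF Bochner_Integration.integrable_diff[OF int] _ bound]) simp
  moreover have "(\<integral>p. ?k \<zeta> \<omega> p - ?k \<zeta>' \<omega>' p \<partial>\<nu>) = cauchy_transform2 \<nu> \<zeta> \<omega> - cauchy_transform2 \<nu> \<zeta>' \<omega>'"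
    unfolding cauchy_transform2_def by (rule Bochner_Integration.integral_diff[OF int])
  moreover have "(\<integral>p. ?B \<partial>\<nu>) = ?B" by (simp only: lebesgue_integral_const prob_space scaleR_one)
  ultimately show ?thesis by (simp only:)
qed

text \<open>Sending \<omega> to infinity in a cone turns \<omega> / (\<omega> - t) into 1 and leaves
  the resolvent of the first coordinate.\<close>

lemma cauchy_transform2_marginal1:
  assumes N: "finite_measure N" "sets N = sets borel" and c: "c > 0" and \<zeta>: "Im \<zeta> \<noteq> 0"
    and \<omega>: "\<And>n. c * norm (\<omega> n) \<le> \<bar>Im (\<omega> n)\<bar>" "\<And>n. \<omega> n \<noteq> 0" "filterlim \<omega> at_infinity sequentially"
  shows "(\<lambda>n. \<omega> n * cauchy_transform2 N \<zeta> (\<omega> n)) \<longlonglongrightarrow> cauchy_transform (marginal1 N) \<zeta>"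
proof -
  interpret finite_measure N by fact
  have [measurable_cong]: "sets N = sets (borel \<Otimes>\<^sub>M borel)" by (simp only: N(2) borel_prod)
  define h where "h n p = 1 / (\<zeta> - of_real (fst p)) * (\<omega> n / (\<omega> n - of_real (snd p)))" for n and p :: "real \<times> real"
  have "(\<lambda>n. \<integral>p. h n p \<partial>N) \<longlonglongrightarrow> (\<integral>p. 1 / (\<zeta> - of_real (fst p)) \<partial>N)"
  proof (rule integral_dominated_convergence[where w = "\<lambda>_. 1 / \<bar>Im \<zeta>\<bar> * (1 / c)"])
    show "AE p in N. (\<lambda>n. h n p) \<longlonglongrightarrow> 1 / (\<zeta> - of_real (fst p))"
    proof (rule AE_I2)
      fix p
      show "(\<lambda>n. h n p) \<longlonglongrightarrow> 1 / (\<zeta> - of_real (fst p))"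
        using tendsto_mult[OF tendsto_const[of "1 / (\<zeta> - of_real (fst p))"] tendsto_mult_resolvent[OF \<omega>(3), of "snd p"]]
        unfolding h_def by simp
    qed
    show "AE p in N. norm (h n p) \<le> 1 / \<bar>Im \<zeta>\<bar> * (1 / c)" for n
      unfolding h_def norm_mult using c \<zeta>
      by (intro AE_I2 mult_mono norm_mult_resolvent_le \<omega>)
        (auto simp: norm_divide intro!: frac_le norm_diff_of_real_ge)
  qed (auto simp: h_def)
  moreover have "(\<integral>p. h n p \<partial>N) = \<omega> n * cauchy_transform2 N \<zeta> (\<omega> n)" for n
    unfolding cauchy_transform2_def integral_mult_right_zero[symmetric] by (simp add: h_def)
  moreover have "(\<integral>p. 1 / (\<zeta> - of_real (fst p)) \<partial>N) = cauchy_transform (marginal1 N) \<zeta>"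
    unfolding cauchy_transform_def marginal1_def by (subst integral_distr) auto
  ultimately show ?thesis by simp
qed

lemma cauchy_transform2_marginal2:
  assumes N: "finite_measure N" "sets N = sets borel" and c: "c > 0" and \<omega>: "Im \<omega> \<noteq> 0"
    and \<zeta>: "\<And>n. c * norm (\<zeta> n) \<le> \<bar>Im (\<zeta> n)\<bar>" "\<And>n. \<zeta> n \<noteq> 0" "filterlim \<zeta> at_infinity sequentially"
  shows "(\<lambda>n. \<zeta> n * cauchy_transform2 N (\<zeta> n) \<omega>) \<longlonglongrightarrow> cauchy_transform (marginal2 N) \<omega>"
proof -
  have [measurable_cong]: "sets N = sets (borel \<Otimes>\<^sub>M borel)" by (simp only: N(2) borel_prod)
  define N' where "N' = distr N borel (\<lambda>p. (snd p, fst p))"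
  have sw [measurable]: "(\<lambda>p. (snd p, fst p)) \<in> N \<rightarrow>\<^sub>M (borel :: (real \<times> real) measure)"
    unfolding borel_prod[symmetric] by measurable
  have N': "finite_measure N'" "sets N' = sets borel"
    unfolding N'_def by (intro finite_measure.finite_measure_distr N sw) simp
  have "cauchy_transform2 N' \<omega> \<zeta> = cauchy_transform2 N \<zeta> \<omega>" for \<omega> \<zeta>
    unfolding N'_def cauchy_transform2_def
    by (subst integral_distr[OF sw]) (simp_all add: mult.commute borel_prod[symmetric])
  moreover have "marginal1 N' = marginal2 N"
    unfolding N'_def marginal1_def marginal2_def
    by (subst distr_distr) (simp_all add: comp_def borel_prod[symmetric])
  ultimately show ?thesis
    using cauchy_transform2_marginal1[OF N' c \<omega> \<zeta>] by simp
qed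


text \<open>The Cauchy transform of the m-th compound Poisson law is known exactly at the points
  \<open>K_transform\<close> (1/z) and \<open>K_transform\<close> (1/w), and by the first-order
  limits these converge to 1/z + R1 z and 1/w + R2 w. The limit is the identity \<open>key\<close>;
  letting both variables tend to 0 in it gives mass one, letting one of them tend to 0 gives the
  marginals.\<close>

proposition limit_law:
  fixes M :: "nat \<Rightarrow> 'a measure" and f g :: "nat \<Rightarrow> 'a \<Rightarrow> real" and B :: "nat \<Rightarrow> real"
    and R1 R2 :: "complex \<Rightarrow> complex" and C :: "complex \<Rightarrow> complex \<Rightarrow> complex"
  assumes jumps: "\<And>m. two_jumps (M m) (f m) (g m) (B m)"
    and \<alpha>: "\<alpha> > 0" and \<beta>: "\<beta> > 0" and c: "c = 1 / (1 + \<alpha>)"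
    and hol: "R1 holomorphic_on stolz_pair \<alpha> \<beta>" "R2 holomorphic_on stolz_pair \<alpha> \<beta>"
    and lim1: "\<And>z. z \<in> stolz_pair \<alpha> \<beta> \<Longrightarrow>
      (\<lambda>m. \<integral>x. bounded_jumps.jump_ratio (f m) (1 / z) x \<partial>M m) \<longlonglongrightarrow> z * R1 z"
    and lim2: "\<And>z. z \<in> stolz_pair \<alpha> \<beta> \<Longrightarrow>
      (\<lambda>m. \<integral>x. bounded_jumps.jump_ratio (g m) (1 / z) x \<partial>M m) \<longlonglongrightarrow> z * R2 z"
    and limC: "\<And>z w. z \<in> stolz_pair \<alpha> \<beta> \<Longrightarrow> w \<in> stolz_pair \<alpha> \<beta> \<Longrightarrow>
      (\<lambda>m. two_jumps.cross (M m) (f m) (g m) (1 / z) (1 / w)) \<longlonglongrightarrow> C z w"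
    and small: "\<And>z. z \<in> stolz_pair \<alpha> \<beta> \<Longrightarrow> norm (z * R1 z) \<le> c / 2"
      "\<And>z. z \<in> stolz_pair \<alpha> \<beta> \<Longrightarrow> norm (z * R2 z) \<le> c / 2"
      "\<And>z w. z \<in> stolz_pair \<alpha> \<beta> \<Longrightarrow> w \<in> stolz_pair \<alpha> \<beta> \<Longrightarrow> norm (C z w) < 1"
    and R0: "((\<lambda>z. z * R1 z) \<longlongrightarrow> 0) (at 0 within stolz_pair \<alpha> \<beta>)"
      "((\<lambda>z. z * R2 z) \<longlongrightarrow> 0) (at 0 within stolz_pair \<alpha> \<beta>)"
    and C0: "(\<lambda>n. C (stolz_seq \<beta> n) (stolz_seq \<beta> n)) \<longlonglongrightarrow> 0"
      "\<And>z. z \<in> stolz_pair \<alpha> \<beta> \<Longrightarrow> (\<lambda>n. C z (stolz_seq \<beta> n)) \<longlonglongrightarrow> 0"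
      "\<And>z. z \<in> stolz_pair \<alpha> \<beta> \<Longrightarrow> (\<lambda>n. C (stolz_seq \<beta> n) z) \<longlonglongrightarrow> 0"
  shows "\<exists>\<nu>. borel_prob \<nu> \<and> has_bifree_R_transform \<nu> \<alpha> \<beta> (\<lambda>(z, w). z * R1 z + w * R2 w + C z w)"
proof -
  let ?S = "stolz_pair \<alpha> \<beta>"
  define k1 k2 where "k1 z = 1 / z + R1 z" and "k2 z = 1 / z + R2 z" for z
  note est1 = shifted_inverse_estimates[OF _ \<alpha> c small(1), folded k1_def]
  note est2 = shifted_inverse_estimates[OF _ \<alpha> c small(2), folded k2_def]
  have "\<exists>\<nu>. borel_prob \<nu> \<and> (\<forall>\<zeta> \<omega>. Im \<zeta> \<noteq> 0 \<longrightarrow> Im \<omega> \<noteq> 0 \<longrightarrow>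
      cauchy_transform2 \<nu> \<zeta> \<omega> = two_jumps.G_transform (M m) (f m) (g m) \<zeta> \<omega>)" for m
    by (rule two_jumps.law_exists[OF jumps[of m]]) blast
  then have "\<exists>\<nu>. \<forall>m. borel_prob (\<nu> m) \<and> (\<forall>\<zeta> \<omega>. Im \<zeta> \<noteq> 0 \<longrightarrow> Im \<omega> \<noteq> 0 \<longrightarrow>
      cauchy_transform2 (\<nu> m) \<zeta> \<omega> = two_jumps.G_transform (M m) (f m) (g m) \<zeta> \<omega>)"
    by (intro choice allI)
  then obtain \<nu> where \<nu>: "\<And>m. borel_prob (\<nu> m)"
    "\<And>m \<zeta> \<omega>. Im \<zeta> \<noteq> 0 \<Longrightarrow> Im \<omega> \<noteq> 0 \<Longrightarrow>
      cauchy_transform2 (\<nu> m) \<zeta> \<omega> = two_jumps.G_transform (M m) (f m) (g m) \<zeta> \<omega>"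
    by blast
  obtain r N where r: "strict_mono r"
    and N: "finite_measure N" "sets N = sets borel"
    and lim: "\<And>z w. z \<notin> \<real> \<Longrightarrow> w \<notin> \<real> \<Longrightarrow>
       (\<lambda>n. cauchy_transform2 (\<nu> (r n)) z w) \<longlonglongrightarrow> cauchy_transform2 N z w"
    using cauchy_transform2_compactness[of \<nu>, OF \<nu>(1)] by blast
  have key: "cauchy_transform2 N (k1 z) (k2 w) = z * w / (1 - C z w)" if z: "z \<in> ?S" and w: "w \<in> ?S" for z w
  proof -
    define \<zeta> \<omega> where "\<zeta> m = bounded_jumps.K_transform (M m) (f m) (1 / z)"
      and "\<omega> m = bounded_jumps.K_transform (M m) (g m) (1 / w)" for m
    have z0: "z \<noteq> 0" "w \<noteq> 0" using z w stolz_pair_neq_0 by auto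
    have bj: "bounded_jumps (M m) (f m) (B m)" "bounded_jumps (M m) (g m) (B m)" for m
      using jumps[of m] by (auto simp: two_jumps_def)
    have K: "\<zeta> m = 1 / z + 1 / z * (\<integral>x. bounded_jumps.jump_ratio (f m) (1 / z) x \<partial>M m)"
      "\<omega> m = 1 / w + 1 / w * (\<integral>x. bounded_jumps.jump_ratio (g m) (1 / w) x \<partial>M m)" for m
      unfolding \<zeta>_def \<omega>_def bounded_jumps.K_transform_def[OF bj(1)] bounded_jumps.K_transform_def[OF bj(2)]
      by (simp_all only: integral_mult_right_zero)
    have "\<zeta> \<longlonglongrightarrow> 1 / z + 1 / z * (z * R1 z)" "\<omega> \<longlonglongrightarrow> 1 / w + 1 / w * (w * R2 w)"
      unfolding K by (rule tendsto_add tendsto_mult tendsto_const lim1[OF z] lim2[OF w])+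
    then have lk: "\<zeta> \<longlonglongrightarrow> k1 z" "\<omega> \<longlonglongrightarrow> k2 w"
      using z0 by (simp_all add: k1_def k2_def)
    have "(\<lambda>m. Im (1 / z) * Im (\<zeta> m)) \<longlonglongrightarrow> Im (1 / z) * Im (k1 z)"
      "(\<lambda>m. Im (1 / w) * Im (\<omega> m)) \<longlonglongrightarrow> Im (1 / w) * Im (k2 w)"
      by (intro tendsto_intros lk)+
    from order_tendstoD(1)[OF this(1) est1(1)[OF z z]] order_tendstoD(1)[OF this(2) est2(1)[OF w w]]
    have pos: "\<forall>\<^sub>F m in sequentially. Im (1 / z) * Im (\<zeta> m) > 0 \<and> Im (1 / w) * Im (\<omega> m) > 0"
      by (rule eventually_conj)
    have "(\<lambda>m. cauchy_transform2 (\<nu> m) (\<zeta> m) (\<omega> m)) \<longlonglongrightarrow> z * w / (1 - C z w)"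
    proof (rule Lim_transform_eventually)
      have "1 - C z w \<noteq> 0" using small(3)[OF z w] by auto
      then show "(\<lambda>m. 1 / (1 / z * (1 / w) * (1 - two_jumps.cross (M m) (f m) (g m) (1 / z) (1 / w)))) \<longlonglongrightarrow> z * w / (1 - C z w)"
        using tendsto_divide[OF tendsto_const[of 1] tendsto_mult[OF tendsto_const[of "1 / z * (1 / w)"] tendsto_diff[OF tendsto_const[of 1] limC[OF z w]]]] z0
        by simp
      show "\<forall>\<^sub>F m in sequentially. 1 / (1 / z * (1 / w) * (1 - two_jumps.cross (M m) (f m) (g m) (1 / z) (1 / w)))
          = cauchy_transform2 (\<nu> m) (\<zeta> m) (\<omega> m)"
        using pos
      proof eventually_elim
        case (elim m)
        interpret two_jumps "M m" "f m" "g m" "B m" by (rule jumps)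
        have "f.F_transform (\<zeta> m) = 1 / z" "g.F_transform (\<omega> m) = 1 / w"
          using elim by (auto intro: f.F_transform_unique g.F_transform_unique simp: \<zeta>_def \<omega>_def)
        moreover have nz: "Im (\<zeta> m) \<noteq> 0" "Im (\<omega> m) \<noteq> 0" using elim by auto
        ultimately show ?case
          by (simp only: \<nu>(2)[OF nz] G_transform_def green_def)
      qed
    qed
    \<comment> \<open>Compactness speaks about fixed points only, whereas the exact values are at
      points depending on m; the uniform Lipschitz bound bridges the gap.\<close>
    moreover have "(\<lambda>m. cauchy_transform2 (\<nu> m) (\<zeta> m) (\<omega> m) - cauchy_transform2 (\<nu> m) (k1 z) (k2 w)) \<longlonglongrightarrow> 0"
    proof (rule Lim_null_comparison)
      show "\<forall>\<^sub>F m in sequentially. norm (cauchy_transform2 (\<nu> m) (\<zeta> m) (\<omega> m) - cauchy_transform2 (\<nu> m) (k1 z) (k2 w))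
          \<le> norm (\<zeta> m - k1 z) * (1 / \<bar>Im (\<zeta> m)\<bar> * (1 / \<bar>Im (k1 z)\<bar>)) * (1 / \<bar>Im (\<omega> m)\<bar>)
            + 1 / \<bar>Im (k1 z)\<bar> * (norm (\<omega> m - k2 w) * (1 / \<bar>Im (\<omega> m)\<bar> * (1 / \<bar>Im (k2 w)\<bar>)))"
        using pos
      proof eventually_elim
        case (elim m)
        then have "Im (\<zeta> m) \<noteq> 0" "Im (\<omega> m) \<noteq> 0" by auto
        then show ?case using est1(2)[OF z z] est2(2)[OF w w] by (intro cauchy_transform2_lipschitz \<nu>(1))
      qed
      have "(\<lambda>m. norm (\<zeta> m - k1 z) * (1 / \<bar>Im (\<zeta> m)\<bar> * (1 / \<bar>Im (k1 z)\<bar>)) * (1 / \<bar>Im (\<omega> m)\<bar>)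
            + 1 / \<bar>Im (k1 z)\<bar> * (norm (\<omega> m - k2 w) * (1 / \<bar>Im (\<omega> m)\<bar> * (1 / \<bar>Im (k2 w)\<bar>))))
        \<longlonglongrightarrow> norm (k1 z - k1 z) * (1 / \<bar>Im (k1 z)\<bar> * (1 / \<bar>Im (k1 z)\<bar>)) * (1 / \<bar>Im (k2 w)\<bar>)
            + 1 / \<bar>Im (k1 z)\<bar> * (norm (k2 w - k2 w) * (1 / \<bar>Im (k2 w)\<bar> * (1 / \<bar>Im (k2 w)\<bar>)))"
        using est1(2)[OF z z] est2(2)[OF w w] by (intro tendsto_intros lk) auto
      then show "(\<lambda>m. norm (\<zeta> m - k1 z) * (1 / \<bar>Im (\<zeta> m)\<bar> * (1 / \<bar>Im (k1 z)\<bar>)) * (1 / \<bar>Im (\<omega> m)\<bar>)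
            + 1 / \<bar>Im (k1 z)\<bar> * (norm (\<omega> m - k2 w) * (1 / \<bar>Im (\<omega> m)\<bar> * (1 / \<bar>Im (k2 w)\<bar>)))) \<longlonglongrightarrow> 0"
        by simp
    qed
    ultimately have "(\<lambda>m. cauchy_transform2 (\<nu> m) (k1 z) (k2 w)) \<longlonglongrightarrow> z * w / (1 - C z w)"
      using tendsto_diff by fastforce
    then have "(\<lambda>n. cauchy_transform2 (\<nu> (r n)) (k1 z) (k2 w)) \<longlonglongrightarrow> z * w / (1 - C z w)"
      using LIMSEQ_subseq_LIMSEQ[OF _ r] by (auto simp: comp_def)
    then show ?thesis using lim[OF est1(3)[OF z z] est2(3)[OF w w]] LIMSEQ_unique by blast
  qed
  define s where "s = stolz_seq \<beta>"
  have s: "s n \<in> ?S" for n using stolz_seq(1)[OF \<alpha> \<beta>] by (simp add: s_def)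
  have s0: "s n \<noteq> 0" for n using stolz_pair_neq_0[OF s] .
  have c4: "c / 4 > 0" using c \<alpha> by simp
  have cone: "c / 4 * norm (k1 (s n)) \<le> \<bar>Im (k1 (s n))\<bar>" "k1 (s n) \<noteq> 0"
    "c / 4 * norm (k2 (s n)) \<le> \<bar>Im (k2 (s n))\<bar>" "k2 (s n) \<noteq> 0" for n
    by (rule est1(6)[OF s s] est1(4)[OF s s] est2(6)[OF s s] est2(4)[OF s s])+
  have inf: "filterlim (\<lambda>n. k1 (s n)) at_infinity sequentially" "filterlim (\<lambda>n. k2 (s n)) at_infinity sequentially"
    unfolding k1_def k2_def using small(1,2)[OF s] stolz_seq(2)[OF \<alpha> \<beta>]
    by (intro shifted_inverse_at_infinity[OF s \<alpha> c]; simp add: s_def)+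
  have sR: "(\<lambda>n. s n * R1 (s n)) \<longlonglongrightarrow> 0" "(\<lambda>n. s n * R2 (s n)) \<longlonglongrightarrow> 0"
    using filterlim_compose[OF R0(1) stolz_seq(3)[OF \<alpha> \<beta>]] filterlim_compose[OF R0(2) stolz_seq(3)[OF \<alpha> \<beta>]]
    by (simp_all add: s_def)
  \<comment> \<open>Since s k(s) = 1 + s R(s) tends to 1, multiplying \<open>key\<close> by k1, by
    k2 or by both cancels exactly the factors s n that tend to 0.\<close>
  have sk: "s n * k1 (s n) = 1 + s n * R1 (s n)" "s n * k2 (s n) = 1 + s n * R2 (s n)" for n
    using s0 by (simp_all add: k1_def k2_def distrib_left)
  have "(\<lambda>n. k1 (s n) * k2 (s n) * cauchy_transform2 N (k1 (s n)) (k2 (s n))) \<longlonglongrightarrow> of_real (measure N (space N))"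
    by (rule cauchy_transform2_mass[OF N c4 cone(1,2) inf(1) cone(3,4) inf(2)])
  moreover have "(\<lambda>n. k1 (s n) * k2 (s n) * cauchy_transform2 N (k1 (s n)) (k2 (s n))) \<longlonglongrightarrow> 1"
  proof -
    have "k1 (s n) * k2 (s n) * cauchy_transform2 N (k1 (s n)) (k2 (s n)) =
        (1 + s n * R1 (s n)) * (1 + s n * R2 (s n)) / (1 - C (s n) (s n))" for n
      unfolding key[OF s s] sk[symmetric] by (simp add: mult_ac)
    moreover have "(\<lambda>n. (1 + s n * R1 (s n)) * (1 + s n * R2 (s n)) / (1 - C (s n) (s n))) \<longlonglongrightarrow> (1 + 0) * (1 + 0) / (1 - 0)"
      by (intro tendsto_intros sR C0(1)[folded s_def]) simp
    ultimately show ?thesis by simp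
  qed
  ultimately have "complex_of_real (measure N (space N)) = 1" by (rule LIMSEQ_unique)
  then have "measure N (space N) = 1" by simp
  then have prob: "borel_prob N"
    using N finite_measure.emeasure_eq_measure[OF N(1)] unfolding borel_prob_def by (auto intro!: prob_spaceI)
  have m1: "cauchy_transform (marginal1 N) (k1 z) = z" if z: "z \<in> ?S" for z
  proof (rule LIMSEQ_unique)
    show "(\<lambda>n. k2 (s n) * cauchy_transform2 N (k1 z) (k2 (s n))) \<longlonglongrightarrow> cauchy_transform (marginal1 N) (k1 z)"
      by (rule cauchy_transform2_marginal1[OF N c4 est1(2)[OF z z] cone(3,4) inf(2)])
    have "k2 (s n) * cauchy_transform2 N (k1 z) (k2 (s n)) = z * (1 + s n * R2 (s n)) / (1 - C z (s n))" for n
      unfolding key[OF z s] sk[symmetric] by (simp add: mult_ac)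
    moreover have "(\<lambda>n. z * (1 + s n * R2 (s n)) / (1 - C z (s n))) \<longlonglongrightarrow> z * (1 + 0) / (1 - 0)"
      by (intro tendsto_intros sR C0(2)[OF z, folded s_def]) simp
    ultimately show "(\<lambda>n. k2 (s n) * cauchy_transform2 N (k1 z) (k2 (s n))) \<longlonglongrightarrow> z" by simp
  qed
  have m2: "cauchy_transform (marginal2 N) (k2 z) = z" if z: "z \<in> ?S" for z
  proof (rule LIMSEQ_unique)
    show "(\<lambda>n. k1 (s n) * cauchy_transform2 N (k1 (s n)) (k2 z)) \<longlonglongrightarrow> cauchy_transform (marginal2 N) (k2 z)"
      by (rule cauchy_transform2_marginal2[OF N c4 est2(2)[OF z z] cone(1,2) inf(1)])
    have "k1 (s n) * cauchy_transform2 N (k1 (s n)) (k2 z) = z * (1 + s n * R1 (s n)) / (1 - C (s n) z)" for n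
      unfolding key[OF s z] sk[symmetric] by (simp add: mult_ac)
    moreover have "(\<lambda>n. z * (1 + s n * R1 (s n)) / (1 - C (s n) z)) \<longlonglongrightarrow> z * (1 + 0) / (1 - 0)"
      by (intro tendsto_intros sR C0(3)[OF z, folded s_def]) simp
    ultimately show "(\<lambda>n. k1 (s n) * cauchy_transform2 N (k1 (s n)) (k2 z)) \<longlonglongrightarrow> z" by simp
  qed
  have "has_R_transform (marginal1 N) \<alpha> \<beta> R1" "has_R_transform (marginal2 N) \<alpha> \<beta> R2"
    unfolding has_R_transform_def using hol R0 m1 m2 est1(3) est2(3) by (auto simp: k1_def k2_def)
  moreover have "h_quotient N R1 R2 z w \<noteq> 0 \<and>
      z * R1 z + w * R2 w + C z w = z * R1 z + w * R2 w + (1 - 1 / h_quotient N R1 R2 z w)"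
    if "z \<in> ?S" "w \<in> ?S" for z w
  proof -
    have "1 - C z w \<noteq> 0" using small(3)[OF that] by auto
    moreover have "h_quotient N R1 R2 z w = 1 / (1 - C z w)"
      unfolding h_quotient_def k1_def[symmetric] k2_def[symmetric] key[OF that]
      using stolz_pair_neq_0[OF that(1)] stolz_pair_neq_0[OF that(2)] by simp
    ultimately show ?thesis by simp
  qed
  ultimately have "has_bifree_R_transform N \<alpha> \<beta> (\<lambda>(z, w). z * R1 z + w * R2 w + C z w)"
    unfolding has_bifree_R_transform_def stolz_product_def by (intro exI[of _ R1] exI[of _ R2]) auto
  with prob show ?thesis by blast
qed

section \<open>First-order asymptotics of the roots\<close>

text \<open>Every \<open>X n\<close> lives on its own probability space, so the limit has to be a
  constant. The uniform bound is what makes the notion stable under products.\<close>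

definition l1_conv :: "(nat \<Rightarrow> 'a measure) \<Rightarrow> (nat \<Rightarrow> 'a \<Rightarrow> complex) \<Rightarrow> complex \<Rightarrow> bool" where
  "l1_conv \<mu> X x \<longleftrightarrow> (\<forall>n. X n \<in> borel_measurable (\<mu> n)) \<and> (\<exists>B. \<forall>n p. norm (X n p) \<le> B) \<and>
     (\<lambda>n. \<integral>p. norm (X n p - x) \<partial>\<mu> n) \<longlonglongrightarrow> 0"

lemma l1_conv_integrable:
  assumes "prob_space (\<mu> n)" "l1_conv \<mu> X x"
  shows "integrable (\<mu> n) (X n)" "integrable (\<mu> n) (\<lambda>p. norm (X n p - c))"
proof -
  interpret prob_space "\<mu> n" by fact
  obtain B where "\<And>n p. norm (X n p) \<le> B" and [measurable]: "X n \<in> borel_measurable (\<mu> n)"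
    using assms(2) by (auto simp: l1_conv_def)
  then show 1: "integrable (\<mu> n) (X n)" by (intro integrable_const_bound[where B = B]) auto
  show "integrable (\<mu> n) (\<lambda>p. norm (X n p - c))"
    by (intro integrable_norm Bochner_Integration.integrable_diff 1 integrable_const)
qed

lemma l1_conv_integral:
  assumes p: "\<And>n. prob_space (\<mu> n)" and X: "l1_conv \<mu> X x"
  shows "(\<lambda>n. \<integral>p. X n p \<partial>\<mu> n) \<longlonglongrightarrow> x"
proof (rule LIM_zero_cancel, rule Lim_null_comparison)
  show "(\<lambda>n. \<integral>p. norm (X n p - x) \<partial>\<mu> n) \<longlonglongrightarrow> 0" using X by (simp add: l1_conv_def)
  show "\<forall>\<^sub>F n in sequentially. norm ((\<integral>p. X n p \<partial>\<mu> n) - x) \<le> (\<integral>p. norm (X n p - x) \<partial>\<mu> n)"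
  proof (intro always_eventually allI)
    fix n
    interpret prob_space "\<mu> n" by (rule p)
    have "(\<integral>p. X n p \<partial>\<mu> n) - x = (\<integral>p. X n p - x \<partial>\<mu> n)"
      using l1_conv_integrable(1)[OF p X] by (subst Bochner_Integration.integral_diff) (auto simp: prob_space)
    then show "norm ((\<integral>p. X n p \<partial>\<mu> n) - x) \<le> (\<integral>p. norm (X n p - x) \<partial>\<mu> n)"
      by (metis integral_norm_bound)
  qed
qed

lemma l1_conv_mult:
  assumes p: "\<And>n. prob_space (\<mu> n)" and X: "l1_conv \<mu> X x" and Y: "l1_conv \<mu> Y y"
  shows "l1_conv \<mu> (\<lambda>n p. X n p * Y n p) (x * y)"
proof -
  obtain A where A: "\<And>n p. norm (X n p) \<le> A" and [measurable]: "\<And>n. X n \<in> borel_measurable (\<mu> n)"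
    using X by (auto simp: l1_conv_def)
  obtain B where B: "\<And>n p. norm (Y n p) \<le> B" and [measurable]: "\<And>n. Y n \<in> borel_measurable (\<mu> n)"
    using Y by (auto simp: l1_conv_def)
  have A0: "A \<ge> 0" using order_trans[OF norm_ge_zero A] .
  have bd: "norm (X n p * Y n p) \<le> A * B" for n p
    unfolding norm_mult by (intro mult_mono A B A0) auto
  have "(\<lambda>n. \<integral>p. norm (X n p * Y n p - x * y) \<partial>\<mu> n) \<longlonglongrightarrow> 0"
  proof (rule Lim_null_comparison)
    show "\<forall>\<^sub>F n in sequentially. norm (\<integral>p. norm (X n p * Y n p - x * y) \<partial>\<mu> n)
        \<le> A * (\<integral>p. norm (Y n p - y) \<partial>\<mu> n) + norm y * (\<integral>p. norm (X n p - x) \<partial>\<mu> n)"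
    proof (intro always_eventually allI)
      fix n
      interpret prob_space "\<mu> n" by (rule p)
      have i: "integrable (\<mu> n) (\<lambda>p. norm (X n p - x))" "integrable (\<mu> n) (\<lambda>p. norm (Y n p - y))"
        using l1_conv_integrable(2)[OF p X] l1_conv_integrable(2)[OF p Y] by auto
      have "norm (X n p * Y n p - x * y) \<le> A * norm (Y n p - y) + norm y * norm (X n p - x)" for p
      proof -
        have "X n p * Y n p - x * y = X n p * (Y n p - y) + y * (X n p - x)" by (simp add: algebra_simps)
        then have "norm (X n p * Y n p - x * y) \<le> norm (X n p) * norm (Y n p - y) + norm y * norm (X n p - x)"
          using norm_triangle_ineq[of "X n p * (Y n p - y)" "y * (X n p - x)"] by (simp add: norm_mult)
        also have "\<dots> \<le> A * norm (Y n p - y) + norm y * norm (X n p - x)"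
          by (intro add_right_mono mult_right_mono A) auto
        finally show ?thesis .
      qed
      moreover have "integrable (\<mu> n) (\<lambda>p. norm (X n p * Y n p - x * y))"
        by (intro integrable_norm Bochner_Integration.integrable_diff integrable_const
            integrable_const_bound[where B = "A * B"]) (auto simp: bd)
      ultimately have "(\<integral>p. norm (X n p * Y n p - x * y) \<partial>\<mu> n) \<le> (\<integral>p. A * norm (Y n p - y) + norm y * norm (X n p - x) \<partial>\<mu> n)"
        using i by (intro integral_mono) auto
      also have "\<dots> = A * (\<integral>p. norm (Y n p - y) \<partial>\<mu> n) + norm y * (\<integral>p. norm (X n p - x) \<partial>\<mu> n)"
        using i by simp
      finally show "norm (\<integral>p. norm (X n p * Y n p - x * y) \<partial>\<mu> n)
        \<le> A * (\<integral>p. norm (Y n p - y) \<partial>\<mu> n) + norm y * (\<integral>p. norm (X n p - x) \<partial>\<mu> n)"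
        by simp
    qed
    have "(\<lambda>n. A * (\<integral>p. norm (Y n p - y) \<partial>\<mu> n) + norm y * (\<integral>p. norm (X n p - x) \<partial>\<mu> n)) \<longlonglongrightarrow> A * 0 + norm y * 0"
      using X Y by (intro tendsto_intros) (auto simp: l1_conv_def)
    then show "(\<lambda>n. A * (\<integral>p. norm (Y n p - y) \<partial>\<mu> n) + norm y * (\<integral>p. norm (X n p - x) \<partial>\<mu> n)) \<longlonglongrightarrow> 0" by simp
  qed
  then show ?thesis unfolding l1_conv_def using bd by auto
qed

text \<open>A bounded stand-in for the square of a jump, since the roots may have no second
  moment.\<close>

definition sq_ratio :: "real \<Rightarrow> real" where "sq_ratio s = s\<^sup>2 / (1 + s\<^sup>2)"

lemma sq_ratio_bounds: "0 \<le> sq_ratio s" "sq_ratio s \<le> 1"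
  by (auto simp: sq_ratio_def divide_le_eq_1 add_nonneg_eq_0_iff intro: order.not_eq_order_implies_strict)

lemma sq_ratio_measurable [measurable]: "sq_ratio \<in> borel_measurable borel"
  unfolding sq_ratio_def by measurable

lemma one_plus_sq_pos: "0 < 1 + (s::real)\<^sup>2"
  by (simp add: add_pos_nonneg)

lemma norm_resolvent_times_le:
  assumes a: "Im a \<noteq> 0"
  shows "norm (of_real s / (a - of_real s)) \<le> 1 + norm a / \<bar>Im a\<bar>"
proof -
  have "of_real s / (a - of_real s) = a * (1 / (a - of_real s)) - 1"
    using diff_of_real_neq_0[OF a, of s] by (simp add: field_simps)
  then have "norm (of_real s / (a - of_real s)) \<le> norm a * norm (1 / (a - of_real s)) + 1"
    using norm_triangle_ineq4[of "a * (1 / (a - of_real s))" 1] by (simp only: norm_mult norm_one)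
  also have "norm a * norm (1 / (a - of_real s)) \<le> norm a * (1 / \<bar>Im a\<bar>)"
    by (intro mult_left_mono norm_resolvent_le a) auto
  finally show ?thesis by simp
qed

text \<open>A bound for (1 + s^2) / |a - s|^2 uniformly in s, obtained by bounding 1/(a - s) and
  s/(a - s) separately. It converts squared jump ratios into \<open>sq_ratio\<close>.\<close>

definition resolvent_const :: "complex \<Rightarrow> real" where
  "resolvent_const a = (1 / \<bar>Im a\<bar>)\<^sup>2 + (1 + norm a / \<bar>Im a\<bar>)\<^sup>2"

lemma norm_jump_sq_le:
  assumes a: "Im a \<noteq> 0"
  shows "(norm (of_real s / (a - of_real s)))\<^sup>2 \<le> resolvent_const a * sq_ratio s"
proof -
  let ?r = "norm (1 / (a - of_real s))"
  have "(norm (of_real s / (a - of_real s)))\<^sup>2 = s\<^sup>2 * ?r\<^sup>2"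
    by (simp add: norm_divide power_divide)
  also have "\<dots> = sq_ratio s * (?r\<^sup>2 * (1 + s\<^sup>2))"
    using one_plus_sq_pos[of s] by (simp add: sq_ratio_def)
  also have "\<dots> \<le> sq_ratio s * resolvent_const a"
  proof (rule mult_left_mono[OF _ sq_ratio_bounds(1)])
    have "?r\<^sup>2 * (1 + s\<^sup>2) = ?r\<^sup>2 + (norm (of_real s / (a - of_real s)))\<^sup>2"
      by (simp add: norm_divide power_divide add_divide_distrib)
    also have "\<dots> \<le> resolvent_const a"
      unfolding resolvent_const_def
      by (intro add_mono power_mono norm_resolvent_le norm_resolvent_times_le a) auto
    finally show "?r\<^sup>2 * (1 + s\<^sup>2) \<le> resolvent_const a" .
  qed
  finally show ?thesis by (simp only: mult.commute)
qed

lemma (in prob_space) expectation_le_sqrt: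
  fixes X :: "'a \<Rightarrow> real"
  assumes [measurable]: "X \<in> borel_measurable M" and B: "\<And>x. \<bar>X x\<bar> \<le> B"
  shows "expectation X \<le> sqrt (expectation (\<lambda>x. (X x)\<^sup>2))"
proof -
  have "integrable M X" by (rule integrable_const_bound[where B = B]) (use B in auto)
  moreover have "integrable M (\<lambda>x. (X x)\<^sup>2)"
    by (rule integrable_const_bound[where B = "B\<^sup>2"]) (use B in \<open>auto simp: abs_le_square_iff[symmetric] intro: order_trans[OF _ abs_ge_self]\<close>)
  ultimately have "0 \<le> expectation (\<lambda>x. (X x)\<^sup>2) - (expectation X)\<^sup>2"
    using variance_positive[of X] variance_eq[of X] by simp
  then have "\<bar>expectation X\<bar> \<le> sqrt (expectation (\<lambda>x. (X x)\<^sup>2))"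
    by (intro real_le_rsqrt) simp
  then show ?thesis by linarith
qed

text \<open>Two errors are added: moving the point from \<open>a n\<close> to \<open>a0\<close>
  costs a multiple of the distance, and replacing the jump by 0 costs a multiple of the square root
  of \<open>sq_ratio\<close>, whose mean is controlled by the mean of
  \<open>sq_ratio\<close>.\<close>

lemma l1_conv_resolvent:
  fixes \<mu> :: "nat \<Rightarrow> 'a measure" and f :: "'a \<Rightarrow> real"
  assumes p: "\<And>n. prob_space (\<mu> n)" and [measurable]: "\<And>n. f \<in> borel_measurable (\<mu> n)"
    and q: "(\<lambda>n. \<integral>x. sq_ratio (f x) \<partial>\<mu> n) \<longlonglongrightarrow> 0"
    and a: "a \<longlonglongrightarrow> a0" "\<And>n. Im (a n) \<noteq> 0" "Im a0 \<noteq> 0"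
  shows "l1_conv \<mu> (\<lambda>n x. 1 / (a n - of_real (f x))) (1 / a0)"
proof -
  have "(\<lambda>n. 1 / \<bar>Im (a n)\<bar>) \<longlonglongrightarrow> 1 / \<bar>Im a0\<bar>" using a by (intro tendsto_intros) auto
  then have "Bseq (\<lambda>n. 1 / \<bar>Im (a n)\<bar>)" by (rule convergent_imp_Bseq[OF convergentI])
  then obtain B where B: "\<And>n. 1 / \<bar>Im (a n)\<bar> \<le> B" unfolding Bseq_def by auto
  have bd: "norm (1 / (a n - of_real (f x))) \<le> B" for n x
    using order_trans[OF norm_resolvent_le[OF a(2)] B] .
  have a0: "a0 \<noteq> 0" using a(3) by auto
  define C where "C = sqrt (resolvent_const a0) / norm a0"
  have rc: "resolvent_const a0 \<ge> 0" by (simp add: resolvent_const_def)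
  have k: "norm (1 / (a n - of_real (f x)) - 1 / a0) \<le> norm (a n - a0) * (B * (1 / \<bar>Im a0\<bar>)) + C * sqrt (sq_ratio (f x))" for n x
  proof -
    have "norm (1 / (a n - of_real (f x)) - 1 / (a0 - of_real (f x))) \<le> norm (a n - a0) * (1 / \<bar>Im (a n)\<bar> * (1 / \<bar>Im a0\<bar>))"
      by (rule norm_resolvent_diff_le[OF a(2,3)])
    also have "\<dots> \<le> norm (a n - a0) * (B * (1 / \<bar>Im a0\<bar>))"
      by (intro mult_left_mono mult_right_mono B) auto
    finally have 1: "norm (1 / (a n - of_real (f x)) - 1 / (a0 - of_real (f x))) \<le> norm (a n - a0) * (B * (1 / \<bar>Im a0\<bar>))" .
    have "1 / (a0 - of_real (f x)) - 1 / a0 = of_real (f x) / (a0 - of_real (f x)) / a0"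
      using a0 diff_of_real_neq_0[OF a(3), of "f x"] by (simp add: field_simps)
    then have "norm (1 / (a0 - of_real (f x)) - 1 / a0) = norm (of_real (f x) / (a0 - of_real (f x))) / norm a0"
      by (simp only: norm_divide)
    also have "\<dots> \<le> sqrt (resolvent_const a0 * sq_ratio (f x)) / norm a0"
      by (intro divide_right_mono real_le_rsqrt norm_jump_sq_le a(3)) auto
    also have "\<dots> = C * sqrt (sq_ratio (f x))" by (simp add: C_def real_sqrt_mult)
    finally have 2: "norm (1 / (a0 - of_real (f x)) - 1 / a0) \<le> C * sqrt (sq_ratio (f x))" .
    have eq: "1 / (a n - of_real (f x)) - 1 / a0 = (1 / (a n - of_real (f x)) - 1 / (a0 - of_real (f x))) + (1 / (a0 - of_real (f x)) - 1 / a0)"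
      by simp
    show ?thesis unfolding eq by (rule norm_triangle_le[OF add_mono[OF 1 2]])
  qed
  have "(\<lambda>n. \<integral>x. norm (1 / (a n - of_real (f x)) - 1 / a0) \<partial>\<mu> n) \<longlonglongrightarrow> 0"
  proof (rule Lim_null_comparison)
    show "\<forall>\<^sub>F n in sequentially. norm (\<integral>x. norm (1 / (a n - of_real (f x)) - 1 / a0) \<partial>\<mu> n)
        \<le> norm (a n - a0) * (B * (1 / \<bar>Im a0\<bar>)) + C * sqrt (\<integral>x. sq_ratio (f x) \<partial>\<mu> n)"
    proof (intro always_eventually allI)
      fix n
      interpret prob_space "\<mu> n" by (rule p)
      have C0: "C \<ge> 0" using rc by (simp add: C_def)
      have sq1: "\<bar>sqrt (sq_ratio s)\<bar> \<le> 1" for s using sq_ratio_bounds[of s] by simp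
      have isq: "integrable (\<mu> n) (\<lambda>x. sqrt (sq_ratio (f x)))"
        by (rule integrable_const_bound[where B = 1]) (use sq1 in auto)
      have "integrable (\<mu> n) (\<lambda>x. norm (1 / (a n - of_real (f x)) - 1 / a0))"
        by (intro integrable_norm Bochner_Integration.integrable_diff integrable_const
            integrable_const_bound[where B = B]) (auto simp: bd)
      then have "(\<integral>x. norm (1 / (a n - of_real (f x)) - 1 / a0) \<partial>\<mu> n) \<le>
          (\<integral>x. norm (a n - a0) * (B * (1 / \<bar>Im a0\<bar>)) + C * sqrt (sq_ratio (f x)) \<partial>\<mu> n)"
        using isq k by (intro integral_mono) auto
      also have "\<dots> = norm (a n - a0) * (B * (1 / \<bar>Im a0\<bar>)) + C * (\<integral>x. sqrt (sq_ratio (f x)) \<partial>\<mu> n)"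
        using isq by (simp add: prob_space)
      also have "(\<integral>x. sqrt (sq_ratio (f x)) \<partial>\<mu> n) \<le> sqrt (\<integral>x. sq_ratio (f x) \<partial>\<mu> n)"
        using expectation_le_sqrt[of "\<lambda>x. sqrt (sq_ratio (f x))" 1] sq1 sq_ratio_bounds by simp
      finally show "norm (\<integral>x. norm (1 / (a n - of_real (f x)) - 1 / a0) \<partial>\<mu> n)
        \<le> norm (a n - a0) * (B * (1 / \<bar>Im a0\<bar>)) + C * sqrt (\<integral>x. sq_ratio (f x) \<partial>\<mu> n)"
        using C0 by (simp add: mult_left_mono)
    qed
    have "(\<lambda>n. norm (a n - a0) * (B * (1 / \<bar>Im a0\<bar>)) + C * sqrt (\<integral>x. sq_ratio (f x) \<partial>\<mu> n))
        \<longlonglongrightarrow> norm (a0 - a0) * (B * (1 / \<bar>Im a0\<bar>)) + C * sqrt 0"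
      by (intro tendsto_intros a q)
    then show "(\<lambda>n. norm (a n - a0) * (B * (1 / \<bar>Im a0\<bar>)) + C * sqrt (\<integral>x. sq_ratio (f x) \<partial>\<mu> n)) \<longlonglongrightarrow> 0"
      by simp
  qed
  then show ?thesis unfolding l1_conv_def using bd by auto
qed

lemma sq_ratio_le_Re_jump:
  assumes y: "y > 0"
  shows "sq_ratio s \<le> max 1 (y\<^sup>2) * (- Re (of_real s / (\<i> * of_real y - of_real s)))"
proof -
  have pos: "s\<^sup>2 + y\<^sup>2 > 0" using y by (simp add: add_nonneg_pos)
  have re: "- Re (of_real s / (\<i> * of_real y - of_real s)) = s\<^sup>2 / (s\<^sup>2 + y\<^sup>2)"
    by (simp add: Re_divide power2_eq_square)
  have "1 * s\<^sup>2 \<le> max 1 (y\<^sup>2) * s\<^sup>2" by (intro mult_right_mono) auto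
  moreover have "y\<^sup>2 \<le> max 1 (y\<^sup>2)" by simp
  ultimately have "s\<^sup>2 + y\<^sup>2 \<le> max 1 (y\<^sup>2) * (1 + s\<^sup>2)" unfolding distrib_left by linarith
  then have "s\<^sup>2 * (s\<^sup>2 + y\<^sup>2) \<le> s\<^sup>2 * (max 1 (y\<^sup>2) * (1 + s\<^sup>2))" by (intro mult_left_mono) auto
  then have "s\<^sup>2 \<le> max 1 (y\<^sup>2) * s\<^sup>2 * (1 + s\<^sup>2) / (s\<^sup>2 + y\<^sup>2)"
    using pos by (subst pos_le_divide_eq) (auto simp: mult_ac)
  then show ?thesis
    unfolding re sq_ratio_def using one_plus_sq_pos[of s] by (subst pos_divide_le_eq) auto
qed

text \<open>The value 1/(i y) taken at \<open>a n\<close> is also the Cauchy transform at i y of the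
  point mass at 0. At i y the defect from that point mass has an imaginary part proportional to the
  integral of s^2 / (s^2 + y^2), which dominates \<open>sq_ratio\<close>; moving the point from
  \<open>a n\<close> to i y costs an error that tends to 0.\<close>

lemma concentration:
  fixes \<mu> :: "nat \<Rightarrow> 'a measure" and f :: "'a \<Rightarrow> real"
  assumes p: "\<And>n. prob_space (\<mu> n)" and [measurable]: "\<And>n. f \<in> borel_measurable (\<mu> n)"
    and y: "y > 0" and a: "a \<longlonglongrightarrow> \<i> * of_real y" "\<And>n. Im (a n) \<noteq> 0"
    and G: "\<And>n. (\<integral>x. 1 / (a n - of_real (f x)) \<partial>\<mu> n) = 1 / (\<i> * of_real y)"
  shows "(\<lambda>n. \<integral>x. sq_ratio (f x) \<partial>\<mu> n) \<longlonglongrightarrow> 0"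
proof (rule Lim_null_comparison)
  define a0 where "a0 = \<i> * complex_of_real y"
  have Ima0: "Im a0 = y" "Im a0 \<noteq> 0" using y by (auto simp: a0_def)
  define Y where "Y = max 1 (y\<^sup>2)"
  have int: "integrable (\<mu> n) (\<lambda>x. 1 / (b - of_real (f x)))" if "Im b \<noteq> 0" for n b
  proof -
    interpret prob_space "\<mu> n" by (rule p)
    show ?thesis by (rule integrable_const_bound[where B = "1 / \<bar>Im b\<bar>"]) (use norm_resolvent_le[OF that] in auto)
  qed
  show "\<forall>\<^sub>F n in sequentially. norm (\<integral>x. sq_ratio (f x) \<partial>\<mu> n)
      \<le> Y * (y * (norm (a0 - a n) * (1 / \<bar>Im a0\<bar> * (1 / \<bar>Im (a n)\<bar>))))"
  proof (intro always_eventually allI)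
    fix n
    interpret prob_space "\<mu> n" by (rule p)
    have iq: "integrable (\<mu> n) (\<lambda>x. sq_ratio (f x))"
      by (rule integrable_const_bound[where B = 1]) (use sq_ratio_bounds in auto)
    let ?D = "\<lambda>x. 1 / (a0 - of_real (f x)) - 1 / a0"
    have pw: "sq_ratio s \<le> Y * (y * Im (1 / (a0 - of_real s) - 1 / a0))" for s
    proof -
      have "1 / (a0 - of_real s) - 1 / a0 = of_real s / (a0 - of_real s) / a0"
        using y diff_of_real_neq_0[OF Ima0(2), of s] by (subst diff_frac_eq) (simp_all add: a0_def)
      moreover have "y * Im (u / a0) = - Re u" for u
        using y by (simp add: a0_def Im_divide power2_eq_square)
      ultimately have "y * Im (1 / (a0 - of_real s) - 1 / a0) = - Re (of_real s / (a0 - of_real s))"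
        by (simp only:)
      then show ?thesis using sq_ratio_le_Re_jump[OF y, of s, folded a0_def Y_def] by (simp only:)
    qed
    have ID: "integrable (\<mu> n) ?D" by (intro Bochner_Integration.integrable_diff int Ima0(2) integrable_const)
    have "(\<integral>x. sq_ratio (f x) \<partial>\<mu> n) \<le> (\<integral>x. Y * (y * Im (?D x)) \<partial>\<mu> n)"
      by (intro integral_mono iq integrable_mult_right integrable_Im ID pw)
    also have "\<dots> = Y * (y * Im (\<integral>x. ?D x \<partial>\<mu> n))"
      by (simp only: integral_mult_right_zero integral_Im[OF ID])
    also have "(\<integral>x. ?D x \<partial>\<mu> n) = (\<integral>x. 1 / (a0 - of_real (f x)) - 1 / (a n - of_real (f x)) \<partial>\<mu> n)"
      using int[OF Ima0(2), of n] int[OF a(2), of n n] G[of n, folded a0_def]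
      by (simp add: Bochner_Integration.integral_diff prob_space)
    also have "Im \<dots> \<le> norm (a0 - a n) * (1 / \<bar>Im a0\<bar> * (1 / \<bar>Im (a n)\<bar>))"
    proof (rule order_trans[OF order_trans[OF abs_ge_self abs_Im_le_cmod]])
      have "norm (\<integral>x. 1 / (a0 - of_real (f x)) - 1 / (a n - of_real (f x)) \<partial>\<mu> n)
        \<le> (\<integral>x. norm (a0 - a n) * (1 / \<bar>Im a0\<bar> * (1 / \<bar>Im (a n)\<bar>)) \<partial>\<mu> n)"
        by (rule norm_integral_le[OF _ integrable_const norm_resolvent_diff_le[OF Ima0(2) a(2)]])
          (intro Bochner_Integration.integrable_diff int Ima0(2) a(2))
      then show "norm (\<integral>x. 1 / (a0 - of_real (f x)) - 1 / (a n - of_real (f x)) \<partial>\<mu> n)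
        \<le> norm (a0 - a n) * (1 / \<bar>Im a0\<bar> * (1 / \<bar>Im (a n)\<bar>))" by (simp only: lebesgue_integral_const prob_space scaleR_one)
    qed
    finally show "norm (\<integral>x. sq_ratio (f x) \<partial>\<mu> n) \<le> Y * (y * (norm (a0 - a n) * (1 / \<bar>Im a0\<bar> * (1 / \<bar>Im (a n)\<bar>))))"
      using y sq_ratio_bounds by (simp add: Y_def mult_left_mono)
  qed
  have "(\<lambda>n. Y * (y * (norm (a0 - a n) * (1 / \<bar>Im a0\<bar> * (1 / \<bar>Im (a n)\<bar>)))))
      \<longlonglongrightarrow> Y * (y * (norm (a0 - a0) * (1 / \<bar>Im a0\<bar> * (1 / \<bar>Im a0\<bar>))))"
    using Ima0 by (intro tendsto_intros a(1)[folded a0_def]) auto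
  then show "(\<lambda>n. Y * (y * (norm (a0 - a n) * (1 / \<bar>Im a0\<bar> * (1 / \<bar>Im (a n)\<bar>))))) \<longlonglongrightarrow> 0" by simp
qed

text \<open>Write h as k1 k2 G(k1, k2) divided by (z k1)(w k2). If both variables tend to 0 the
  numerator tends to the total mass; if only one does, the remaining factor is a marginal Cauchy
  transform at its own inverse point. The sequence runs in the smaller pair \<beta>', where the
  smallness holds, while the other variable ranges over the full pair.\<close>

lemma h_quotient_limits:
  assumes \<nu>: "borel_prob \<nu>" and \<alpha>: "\<alpha> > 0" and \<beta>: "\<beta> > 0" and c: "c = 1 / (1 + \<alpha>)"
    and R: "has_R_transform (marginal1 \<nu>) \<alpha> \<beta> R1" "has_R_transform (marginal2 \<nu>) \<alpha> \<beta> R2"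
    and \<beta>': "0 < \<beta>'" "\<beta>' \<le> \<beta>"
    and small: "\<And>z. z \<in> stolz_pair \<alpha> \<beta>' \<Longrightarrow> norm (z * R1 z) \<le> c / 2"
      "\<And>z. z \<in> stolz_pair \<alpha> \<beta>' \<Longrightarrow> norm (z * R2 z) \<le> c / 2"
  shows "(\<lambda>n. h_quotient \<nu> R1 R2 (stolz_seq \<beta>' n) (stolz_seq \<beta>' n)) \<longlonglongrightarrow> 1"
    "z \<in> stolz_pair \<alpha> \<beta> \<Longrightarrow> (\<lambda>n. h_quotient \<nu> R1 R2 z (stolz_seq \<beta>' n)) \<longlonglongrightarrow> 1"
    "z \<in> stolz_pair \<alpha> \<beta> \<Longrightarrow> (\<lambda>n. h_quotient \<nu> R1 R2 (stolz_seq \<beta>' n) z) \<longlonglongrightarrow> 1"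
    "(\<lambda>n. stolz_seq \<beta>' n * R1 (stolz_seq \<beta>' n)) \<longlonglongrightarrow> 0"
    "(\<lambda>n. stolz_seq \<beta>' n * R2 (stolz_seq \<beta>' n)) \<longlonglongrightarrow> 0"
proof -
  interpret prob_space \<nu> using \<nu> by (simp add: borel_prob_def)
  have fin: "finite_measure \<nu>" "sets \<nu> = sets borel"
    using \<nu> finite_measure_axioms by (auto simp: borel_prob_def)
  have sub: "stolz_pair \<alpha> \<beta>' \<subseteq> stolz_pair \<alpha> \<beta>" by (rule stolz_pair_mono) (use \<beta>' in auto)
  define s where "s = stolz_seq \<beta>'"
  define k1 k2 where "k1 z = 1 / z + R1 z" and "k2 z = 1 / z + R2 z" for z
  note seq = stolz_seq[OF \<alpha> \<beta>'(1), folded s_def]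
  have s0: "s n \<noteq> 0" for n using stolz_pair_neq_0[OF seq(1)] .
  note est1 = shifted_inverse_estimates[OF seq(1) \<alpha> c small(1)[OF seq(1)], folded k1_def]
  note est2 = shifted_inverse_estimates[OF seq(1) \<alpha> c small(2)[OF seq(1)], folded k2_def]
  have c4: "c / 4 > 0" using c \<alpha> by simp
  have inf: "filterlim (\<lambda>n. k1 (s n)) at_infinity sequentially" "filterlim (\<lambda>n. k2 (s n)) at_infinity sequentially"
    unfolding k1_def k2_def
    by (rule shifted_inverse_at_infinity[OF seq(1) \<alpha> c seq(2)], rule small(1)[OF seq(1)])
      (rule shifted_inverse_at_infinity[OF seq(1) \<alpha> c seq(2)], rule small(2)[OF seq(1)])
  have fl: "filterlim s (at 0 within stolz_pair \<alpha> \<beta>) sequentially"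
    using seq s0 sub by (auto simp: filterlim_at intro!: always_eventually)
  show sR: "(\<lambda>n. stolz_seq \<beta>' n * R1 (stolz_seq \<beta>' n)) \<longlonglongrightarrow> 0"
    "(\<lambda>n. stolz_seq \<beta>' n * R2 (stolz_seq \<beta>' n)) \<longlonglongrightarrow> 0"
    using R filterlim_compose[OF _ fl, of "\<lambda>z. z * R1 z"] filterlim_compose[OF _ fl, of "\<lambda>z. z * R2 z"]
    unfolding has_R_transform_def s_def by auto
  have sk: "s n * k1 (s n) = 1 + s n * R1 (s n)" "s n * k2 (s n) = 1 + s n * R2 (s n)" for n
    using s0 by (simp_all add: k1_def k2_def distrib_left)
  have skl: "(\<lambda>n. s n * k1 (s n)) \<longlonglongrightarrow> 1" "(\<lambda>n. s n * k2 (s n)) \<longlonglongrightarrow> 1"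
    unfolding sk using tendsto_add[OF tendsto_const[of 1] sR(1)] tendsto_add[OF tendsto_const[of 1] sR(2)]
    by (simp_all add: s_def)
  have h: "h_quotient \<nu> R1 R2 z w = cauchy_transform2 \<nu> (k1 z) (k2 w) / (z * w)" for z w
    by (simp add: h_quotient_def k1_def k2_def)
  have nz: "k1 (s n) \<noteq> 0" "k2 (s n) \<noteq> 0" for n by (rule est1(4), rule est2(4))
  show "(\<lambda>n. h_quotient \<nu> R1 R2 (stolz_seq \<beta>' n) (stolz_seq \<beta>' n)) \<longlonglongrightarrow> 1"
  proof -
    have "(\<lambda>n. k1 (s n) * k2 (s n) * cauchy_transform2 \<nu> (k1 (s n)) (k2 (s n)) / (s n * k1 (s n) * (s n * k2 (s n)))) \<longlonglongrightarrow> of_real (measure \<nu> (space \<nu>)) / (1 * 1)"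
      by (intro tendsto_intros skl cauchy_transform2_mass[OF fin c4 est1(6) est1(4) inf(1) est2(6) est2(4) inf(2)]) simp
    then show ?thesis unfolding h s_def[symmetric] using nz by (simp add: prob_space mult_ac)
  qed
  {
    assume z: "z \<in> stolz_pair \<alpha> \<beta>"
    then have z0: "z \<noteq> 0" by (rule stolz_pair_neq_0)
    have kz: "Im (k1 z) \<noteq> 0" "cauchy_transform (marginal1 \<nu>) (k1 z) = z" "Im (k2 z) \<noteq> 0" "cauchy_transform (marginal2 \<nu>) (k2 z) = z"
      using R z unfolding has_R_transform_def k1_def k2_def complex_is_Real_iff by blast+
    show "(\<lambda>n. h_quotient \<nu> R1 R2 z (stolz_seq \<beta>' n)) \<longlonglongrightarrow> 1"
    proof -
      have "(\<lambda>n. k2 (s n) * cauchy_transform2 \<nu> (k1 z) (k2 (s n)) / (z * (s n * k2 (s n)))) \<longlonglongrightarrow> cauchy_transform (marginal1 \<nu>) (k1 z) / (z * 1)"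
        by (intro tendsto_intros skl cauchy_transform2_marginal1[OF fin c4 kz(1) est2(6) est2(4) inf(2)]) (use z0 in simp)
      then show ?thesis unfolding h s_def[symmetric] kz using nz z0 by (simp add: mult_ac)
    qed
    show "(\<lambda>n. h_quotient \<nu> R1 R2 (stolz_seq \<beta>' n) z) \<longlonglongrightarrow> 1"
    proof -
      have "(\<lambda>n. k1 (s n) * cauchy_transform2 \<nu> (k1 (s n)) (k2 z) / (z * (s n * k1 (s n)))) \<longlonglongrightarrow> cauchy_transform (marginal2 \<nu>) (k2 z) / (z * 1)"
        by (intro tendsto_intros skl cauchy_transform2_marginal2[OF fin c4 kz(3) est1(6) est1(4) inf(1)]) (use z0 in simp)
      then show ?thesis unfolding h s_def[symmetric] kz using nz z0 by (simp add: mult_ac)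
    qed
  }
qed

lemma has_R_transform_small:
  assumes "has_R_transform m \<alpha> \<beta> R" and \<alpha>: "\<alpha> > 0" and \<beta>: "\<beta> > 0" and d: "\<delta> > 0"
  shows "\<exists>\<beta>'>0. \<beta>' \<le> \<beta> \<and> (\<forall>z \<in> stolz_pair \<alpha> \<beta>'. norm (z * R z) \<le> \<delta>)"
proof -
  have "\<forall>\<^sub>F z in at 0 within stolz_pair \<alpha> \<beta>. dist (z * R z) 0 < \<delta>"
    using assms unfolding has_R_transform_def by (intro tendstoD) auto
  then obtain r where r: "r > 0" "\<And>z. z \<in> stolz_pair \<alpha> \<beta> \<Longrightarrow> z \<noteq> 0 \<Longrightarrow> dist z 0 < r \<Longrightarrow> dist (z * R z) 0 < \<delta>"
    unfolding eventually_at by blast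
  define \<beta>' where "\<beta>' = min \<beta> (r / (1 + \<alpha>))"
  show ?thesis
  proof (intro exI[of _ \<beta>'] conjI ballI)
    show "\<beta>' > 0" "\<beta>' \<le> \<beta>" using r \<alpha> \<beta> by (auto simp: \<beta>'_def)
    fix z assume z: "z \<in> stolz_pair \<alpha> \<beta>'"
    have "norm z \<le> (1 + \<alpha>) * \<bar>Im z\<bar>" by (rule stolz_pair_norm_le[OF z])
    also have "\<dots> < (1 + \<alpha>) * (r / (1 + \<alpha>))"
      using z \<alpha> by (intro mult_strict_left_mono) (auto simp: stolz_pair_iff \<beta>'_def)
    also have "\<dots> = r" using \<alpha> by simp
    finally have "norm z < r" .
    moreover have "z \<in> stolz_pair \<alpha> \<beta>" using z stolz_pair_mono[of \<alpha> \<alpha> \<beta>' \<beta>] by (auto simp: \<beta>'_def)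
    ultimately show "norm (z * R z) \<le> \<delta>" using r(2)[of z] stolz_pair_neq_0[OF z] by auto
  qed
qed

text \<open>Only the sum of three terms is known to scale. Letting w tend to 0 along
  \<open>stolz_seq\<close> removes the second and third terms on both sides and isolates the first;
  the second is isolated likewise, and the third is what remains.\<close>

lemma bifree_R_scaling:
  assumes \<nu>: "borel_prob \<nu>" "borel_prob \<mu>" and \<alpha>: "\<alpha> > 0" and \<beta>: "\<beta> > 0" and m: "(m::nat) > 0"
    and R: "has_R_transform (marginal1 \<nu>) \<alpha> \<beta> R1" "has_R_transform (marginal2 \<nu>) \<alpha> \<beta> R2"
    and Q: "has_R_transform (marginal1 \<mu>) \<alpha> \<beta> Q1" "has_R_transform (marginal2 \<mu>) \<alpha> \<beta> Q2"
    and eq: "\<And>z w. z \<in> stolz_pair \<alpha> \<beta> \<Longrightarrow> w \<in> stolz_pair \<alpha> \<beta> \<Longrightarrow>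
      z * R1 z + w * R2 w + (1 - 1 / h_quotient \<nu> R1 R2 z w) =
      of_nat m * (z * Q1 z + w * Q2 w + (1 - 1 / h_quotient \<mu> Q1 Q2 z w))"
  shows "\<And>z. z \<in> stolz_pair \<alpha> \<beta> \<Longrightarrow> R1 z = of_nat m * Q1 z"
    and "\<And>z. z \<in> stolz_pair \<alpha> \<beta> \<Longrightarrow> R2 z = of_nat m * Q2 z"
    and "\<And>z w. z \<in> stolz_pair \<alpha> \<beta> \<Longrightarrow> w \<in> stolz_pair \<alpha> \<beta> \<Longrightarrow>
      1 - 1 / h_quotient \<nu> R1 R2 z w = of_nat m * (1 - 1 / h_quotient \<mu> Q1 Q2 z w)"
proof -
  define c where "c = 1 / (1 + \<alpha>)"
  have c0: "c / 2 > 0" using \<alpha> by (simp add: c_def)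
  obtain b1 where b1: "b1 > 0" "b1 \<le> \<beta>" "\<forall>z \<in> stolz_pair \<alpha> b1. norm (z * R1 z) \<le> c / 2"
    using has_R_transform_small[OF R(1) \<alpha> \<beta> c0] by blast
  obtain b2 where b2: "b2 > 0" "b2 \<le> \<beta>" "\<forall>z \<in> stolz_pair \<alpha> b2. norm (z * R2 z) \<le> c / 2"
    using has_R_transform_small[OF R(2) \<alpha> \<beta> c0] by blast
  obtain b3 where b3: "b3 > 0" "b3 \<le> \<beta>" "\<forall>z \<in> stolz_pair \<alpha> b3. norm (z * Q1 z) \<le> c / 2"
    using has_R_transform_small[OF Q(1) \<alpha> \<beta> c0] by blast
  obtain b4 where b4: "b4 > 0" "b4 \<le> \<beta>" "\<forall>z \<in> stolz_pair \<alpha> b4. norm (z * Q2 z) \<le> c / 2"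
    using has_R_transform_small[OF Q(2) \<alpha> \<beta> c0] by blast
  define b where "b = min (min b1 b2) (min b3 b4)"
  have b: "b > 0" "b \<le> \<beta>" using b1 b2 b3 b4 by (auto simp: b_def)
  have sub: "stolz_pair \<alpha> b \<subseteq> stolz_pair \<alpha> b1" "stolz_pair \<alpha> b \<subseteq> stolz_pair \<alpha> b2"
    "stolz_pair \<alpha> b \<subseteq> stolz_pair \<alpha> b3" "stolz_pair \<alpha> b \<subseteq> stolz_pair \<alpha> b4"
    by (rule stolz_pair_mono; simp add: b_def)+
  have small: "norm (z * R1 z) \<le> c / 2" "norm (z * R2 z) \<le> c / 2" "norm (z * Q1 z) \<le> c / 2" "norm (z * Q2 z) \<le> c / 2"
    if "z \<in> stolz_pair \<alpha> b" for z
    using that sub b1(3) b2(3) b3(3) b4(3) by blast+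
  note lR = h_quotient_limits[OF \<nu>(1) \<alpha> \<beta> c_def R b small(1,2)]
  note lQ = h_quotient_limits[OF \<nu>(2) \<alpha> \<beta> c_def Q b small(3,4)]
  define s where "s = stolz_seq b"
  have s: "s n \<in> stolz_pair \<alpha> \<beta>" for n
    using stolz_seq(1)[OF \<alpha> b(1)] stolz_pair_mono[OF order_refl b(2)] by (auto simp: s_def)
  have R1: "z * R1 z = of_nat m * (z * Q1 z)" if z: "z \<in> stolz_pair \<alpha> \<beta>" for z
  proof (rule LIMSEQ_unique)
    have "(\<lambda>n. z * R1 z + s n * R2 (s n) + (1 - 1 / h_quotient \<nu> R1 R2 z (s n))) \<longlonglongrightarrow> z * R1 z + 0 + (1 - 1 / 1)"
      unfolding s_def by (intro tendsto_intros lR z) simp_all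
    then show "(\<lambda>n. z * R1 z + s n * R2 (s n) + (1 - 1 / h_quotient \<nu> R1 R2 z (s n))) \<longlonglongrightarrow> z * R1 z" by simp
    have "(\<lambda>n. of_nat m * (z * Q1 z + s n * Q2 (s n) + (1 - 1 / h_quotient \<mu> Q1 Q2 z (s n)))) \<longlonglongrightarrow> of_nat m * (z * Q1 z + 0 + (1 - 1 / 1))"
      unfolding s_def by (intro tendsto_intros lQ z) simp_all
    then show "(\<lambda>n. z * R1 z + s n * R2 (s n) + (1 - 1 / h_quotient \<nu> R1 R2 z (s n))) \<longlonglongrightarrow> of_nat m * (z * Q1 z)"
      unfolding eq[OF z s] by simp
  qed
  have R2: "z * R2 z = of_nat m * (z * Q2 z)" if z: "z \<in> stolz_pair \<alpha> \<beta>" for z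
  proof (rule LIMSEQ_unique)
    have "(\<lambda>n. s n * R1 (s n) + z * R2 z + (1 - 1 / h_quotient \<nu> R1 R2 (s n) z)) \<longlonglongrightarrow> 0 + z * R2 z + (1 - 1 / 1)"
      unfolding s_def by (intro tendsto_intros lR z) simp_all
    then show "(\<lambda>n. s n * R1 (s n) + z * R2 z + (1 - 1 / h_quotient \<nu> R1 R2 (s n) z)) \<longlonglongrightarrow> z * R2 z" by simp
    have "(\<lambda>n. of_nat m * (s n * Q1 (s n) + z * Q2 z + (1 - 1 / h_quotient \<mu> Q1 Q2 (s n) z))) \<longlonglongrightarrow> of_nat m * (0 + z * Q2 z + (1 - 1 / 1))"
      unfolding s_def by (intro tendsto_intros lQ z) simp_all
    then show "(\<lambda>n. s n * R1 (s n) + z * R2 z + (1 - 1 / h_quotient \<nu> R1 R2 (s n) z)) \<longlonglongrightarrow> of_nat m * (z * Q2 z)"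
      unfolding eq[OF s z] by simp
  qed
  show "R1 z = of_nat m * Q1 z" "R2 z = of_nat m * Q2 z" if "z \<in> stolz_pair \<alpha> \<beta>" for z
    using R1[OF that] R2[OF that] stolz_pair_neq_0[OF that] by (auto simp: mult.left_commute)
  show "1 - 1 / h_quotient \<nu> R1 R2 z w = of_nat m * (1 - 1 / h_quotient \<mu> Q1 Q2 z w)"
    if "z \<in> stolz_pair \<alpha> \<beta>" "w \<in> stolz_pair \<alpha> \<beta>" for z w
    using eq[OF that] R1[OF that(1)] R2[OF that(2)] by (simp add: distrib_left)
qed

lemma cauchy_transform_marginal1:
  assumes "sets \<mu> = sets borel"
  shows "cauchy_transform (marginal1 \<mu>) a = (\<integral>p. 1 / (a - of_real (fst p)) \<partial>\<mu>)"
proof -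
  have [measurable_cong]: "sets \<mu> = sets (borel \<Otimes>\<^sub>M borel)" by (simp only: assms borel_prod)
  show ?thesis unfolding cauchy_transform_def marginal1_def by (subst integral_distr) auto
qed

lemma cauchy_transform_marginal2:
  assumes "sets \<mu> = sets borel"
  shows "cauchy_transform (marginal2 \<mu>) a = (\<integral>p. 1 / (a - of_real (snd p)) \<partial>\<mu>)"
proof -
  have [measurable_cong]: "sets \<mu> = sets (borel \<Otimes>\<^sub>M borel)" by (simp only: assms borel_prod)
  show ?thesis unfolding cauchy_transform_def marginal2_def by (subst integral_distr) auto
qed

lemma jump_resolvent: "Im a \<noteq> 0 \<Longrightarrow> of_real s / (a - of_real s) = a * (1 / (a - of_real s)) - 1"
  using diff_of_real_neq_0[of a s] by (simp add: field_simps)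

lemma (in finite_measure) integrable_resolvent:
  assumes "f \<in> borel_measurable M" "Im a \<noteq> 0"
  shows "integrable M (\<lambda>x. 1 / (a - of_real (f x)))"
  by (rule integrable_const_bound[where B = "1 / \<bar>Im a\<bar>"]) (use assms norm_resolvent_le in auto)

lemma mult_divide_mult_self: "n \<noteq> 0 \<Longrightarrow> n * (r / n * x) = r * (x :: complex)"
  by simp

text \<open>A root satisfies G(1/z + R/(n+2)) = z, so the difference is one between resolvent
  integrals at two nearby points. The resolvent identity extracts R/(n+2), and concentration at 0
  sends the remaining product of resolvents to z^2. The shift by 2 reflects that roots are given for
  orders at least 2.\<close>

lemma first_order_resolvent:
  fixes \<mu> :: "nat \<Rightarrow> 'a measure" and f :: "'a \<Rightarrow> real"
  assumes p: "\<And>n. prob_space (\<mu> n)" and f [measurable]: "\<And>n. f \<in> borel_measurable (\<mu> n)"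
    and q: "(\<lambda>n. \<integral>x. sq_ratio (f x) \<partial>\<mu> n) \<longlonglongrightarrow> 0"
    and z: "Im (1 / z) \<noteq> 0" and nr: "\<And>n. Im (1 / z + R / of_nat (n + 2)) \<noteq> 0"
    and G: "\<And>n. (\<integral>x. 1 / (1 / z + R / of_nat (n + 2) - of_real (f x)) \<partial>\<mu> n) = z"
  shows "(\<lambda>n. of_nat (n + 2) * ((\<integral>x. 1 / (1 / z - of_real (f x)) \<partial>\<mu> n) - z)) \<longlonglongrightarrow> R * (z * z)"
proof -
  define a where "a n = 1 / z + R / of_nat (n + 2)" for n
  have a: "a \<longlonglongrightarrow> 1 / z"
  proof -
    have "(\<lambda>n. 1 / z + R / of_nat (n + 2)) \<longlonglongrightarrow> 1 / z + 0"
      by (intro tendsto_intros LIMSEQ_ignore_initial_segment[OF lim_const_over_n])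
    then show ?thesis by (simp add: a_def[abs_def])
  qed
  have L: "l1_conv \<mu> (\<lambda>n x. 1 / (1 / z - of_real (f x))) (1 / (1 / z))"
    "l1_conv \<mu> (\<lambda>n x. 1 / (a n - of_real (f x))) (1 / (1 / z))"
    by (rule l1_conv_resolvent[OF p f q tendsto_const z z] l1_conv_resolvent[OF p f q a nr[folded a_def] z])+
  have "(\<lambda>n. R * (\<integral>x. 1 / (1 / z - of_real (f x)) * (1 / (a n - of_real (f x))) \<partial>\<mu> n)) \<longlonglongrightarrow> R * (1 / (1 / z) * (1 / (1 / z)))"
    by (intro tendsto_intros l1_conv_integral[OF p l1_conv_mult[OF p L]])
  moreover have "of_nat (n + 2) * ((\<integral>x. 1 / (1 / z - of_real (f x)) \<partial>\<mu> n) - z) =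
      R * (\<integral>x. 1 / (1 / z - of_real (f x)) * (1 / (a n - of_real (f x))) \<partial>\<mu> n)" for n
  proof -
    interpret prob_space "\<mu> n" by (rule p)
    have N: "of_nat (n + 2) \<noteq> (0::complex)" by (metis add_2_eq_Suc' of_nat_neq_0)
    have "(\<integral>x. 1 / (1 / z - of_real (f x)) \<partial>\<mu> n) - z =
        (\<integral>x. 1 / (1 / z - of_real (f x)) - 1 / (a n - of_real (f x)) \<partial>\<mu> n)"
      using G[of n, folded a_def] integrable_resolvent[OF f z] integrable_resolvent[OF f nr, folded a_def]
      by (simp add: Bochner_Integration.integral_diff)
    also have "\<dots> = (\<integral>x. (R / of_nat (n + 2)) * (1 / (1 / z - of_real (f x)) * (1 / (a n - of_real (f x)))) \<partial>\<mu> n)"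
      unfolding resolvent_diff[OF z nr[of n, folded a_def]] by (simp add: a_def)
    also have "\<dots> = (R / of_nat (n + 2)) * (\<integral>x. 1 / (1 / z - of_real (f x)) * (1 / (a n - of_real (f x))) \<partial>\<mu> n)"
      by (rule integral_mult_right_zero)
    finally show ?thesis by (simp only: mult_divide_mult_self[OF N])
  qed
  ultimately show ?thesis by simp
qed

text \<open>The two resolvents are changed one at a time, and each change contributes one
  first-order term.\<close>

lemma first_order_resolvent2:
  fixes \<mu> :: "nat \<Rightarrow> 'a measure" and f g :: "'a \<Rightarrow> real"
  assumes p: "\<And>n. prob_space (\<mu> n)" and f [measurable]: "\<And>n. f \<in> borel_measurable (\<mu> n)"
    and g [measurable]: "\<And>n. g \<in> borel_measurable (\<mu> n)"
    and q: "(\<lambda>n. \<integral>x. sq_ratio (f x) \<partial>\<mu> n) \<longlonglongrightarrow> 0" "(\<lambda>n. \<integral>x. sq_ratio (g x) \<partial>\<mu> n) \<longlonglongrightarrow> 0"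
    and z: "Im (1 / z) \<noteq> 0" and nr: "\<And>n. Im (1 / z + R / of_nat (n + 2)) \<noteq> 0"
    and w: "Im (1 / w) \<noteq> 0" and nr': "\<And>n. Im (1 / w + Q / of_nat (n + 2)) \<noteq> 0"
  shows "(\<lambda>n. of_nat (n + 2) * ((\<integral>x. 1 / (1 / z - of_real (f x)) * (1 / (1 / w - of_real (g x))) \<partial>\<mu> n)
      - (\<integral>x. 1 / (1 / z + R / of_nat (n + 2) - of_real (f x)) * (1 / (1 / w + Q / of_nat (n + 2) - of_real (g x))) \<partial>\<mu> n)))
    \<longlonglongrightarrow> R * (z * z * w) + Q * (z * (w * w))"
proof -
  define a where "a n = 1 / z + R / of_nat (n + 2)" for n
  define b where "b n = 1 / w + Q / of_nat (n + 2)" for n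
  have a: "a \<longlonglongrightarrow> 1 / z" and b: "b \<longlonglongrightarrow> 1 / w"
  proof -
    have "(\<lambda>n. 1 / z + R / of_nat (n + 2)) \<longlonglongrightarrow> 1 / z + 0" "(\<lambda>n. 1 / w + Q / of_nat (n + 2)) \<longlonglongrightarrow> 1 / w + 0"
      by (intro tendsto_intros LIMSEQ_ignore_initial_segment[OF lim_const_over_n])+
    then show "a \<longlonglongrightarrow> 1 / z" "b \<longlonglongrightarrow> 1 / w" by (simp_all add: a_def[abs_def] b_def[abs_def])
  qed
  have L: "l1_conv \<mu> (\<lambda>n x. 1 / (1 / z - of_real (f x))) (1 / (1 / z))"
    "l1_conv \<mu> (\<lambda>n x. 1 / (a n - of_real (f x))) (1 / (1 / z))"
    by (rule l1_conv_resolvent[OF p f q(1) tendsto_const z z] l1_conv_resolvent[OF p f q(1) a nr[folded a_def] z])+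
  have K: "l1_conv \<mu> (\<lambda>n x. 1 / (1 / w - of_real (g x))) (1 / (1 / w))"
    "l1_conv \<mu> (\<lambda>n x. 1 / (b n - of_real (g x))) (1 / (1 / w))"
    by (rule l1_conv_resolvent[OF p g q(2) tendsto_const w w] l1_conv_resolvent[OF p g q(2) b nr'[folded b_def] w])+
  define X where "X n x = 1 / (1 / z - of_real (f x)) * (1 / (a n - of_real (f x))) * (1 / (1 / w - of_real (g x)))" for n x
  define Y where "Y n x = 1 / (a n - of_real (f x)) * (1 / (1 / w - of_real (g x)) * (1 / (b n - of_real (g x))))" for n x
  have X: "l1_conv \<mu> X (1 / (1 / z) * (1 / (1 / z)) * (1 / (1 / w)))"
    unfolding X_def by (intro l1_conv_mult p L K)
  have Y: "l1_conv \<mu> Y (1 / (1 / z) * (1 / (1 / w) * (1 / (1 / w))))"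
    unfolding Y_def by (intro l1_conv_mult p L K)
  have "(\<lambda>n. R * (\<integral>x. X n x \<partial>\<mu> n) + Q * (\<integral>x. Y n x \<partial>\<mu> n)) \<longlonglongrightarrow>
      R * (1 / (1 / z) * (1 / (1 / z)) * (1 / (1 / w))) + Q * (1 / (1 / z) * (1 / (1 / w) * (1 / (1 / w))))"
    by (intro tendsto_intros l1_conv_integral[OF p X] l1_conv_integral[OF p Y])
  moreover have "of_nat (n + 2) * ((\<integral>x. 1 / (1 / z - of_real (f x)) * (1 / (1 / w - of_real (g x))) \<partial>\<mu> n)
      - (\<integral>x. 1 / (a n - of_real (f x)) * (1 / (b n - of_real (g x))) \<partial>\<mu> n)) =
      R * (\<integral>x. X n x \<partial>\<mu> n) + Q * (\<integral>x. Y n x \<partial>\<mu> n)" for n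
  proof -
    interpret prob_space "\<mu> n" by (rule p)
    have N: "of_nat (n + 2) \<noteq> (0::complex)" by (metis add_2_eq_Suc' of_nat_neq_0)
    note iX = l1_conv_integrable(1)[OF p X, of n] and iY = l1_conv_integrable(1)[OF p Y, of n]
    have "(\<integral>x. 1 / (1 / z - of_real (f x)) * (1 / (1 / w - of_real (g x))) \<partial>\<mu> n)
      - (\<integral>x. 1 / (a n - of_real (f x)) * (1 / (b n - of_real (g x))) \<partial>\<mu> n) =
      (\<integral>x. 1 / (1 / z - of_real (f x)) * (1 / (1 / w - of_real (g x))) - 1 / (a n - of_real (f x)) * (1 / (b n - of_real (g x))) \<partial>\<mu> n)"
      by (rule Bochner_Integration.integral_diff[symmetric,
            OF l1_conv_integrable(1)[where X = "\<lambda>n x. _ n x", OF p l1_conv_mult[OF p L(1) K(1)]]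
               l1_conv_integrable(1)[OF p l1_conv_mult[OF p L(2) K(2)]]])
    also have "\<dots> = (\<integral>x. (R / of_nat (n + 2)) * X n x + (Q / of_nat (n + 2)) * Y n x \<partial>\<mu> n)"
    proof (intro Bochner_Integration.integral_cong refl)
      fix x
      let ?r = "1 / (1 / z - of_real (f x))" and ?r' = "1 / (a n - of_real (f x))"
        and ?t = "1 / (1 / w - of_real (g x))" and ?t' = "1 / (b n - of_real (g x))"
      have "?r * ?t - ?r' * ?t' = (?r - ?r') * ?t + ?r' * (?t - ?t')" by (simp only: algebra_simps)
      also have "?r - ?r' = (R / of_nat (n + 2)) * (?r * ?r')"
        unfolding resolvent_diff[OF z nr[of n, folded a_def]] by (simp only: a_def add_diff_cancel_left')
      also have "?t - ?t' = (Q / of_nat (n + 2)) * (?t * ?t')"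
        unfolding resolvent_diff[OF w nr'[of n, folded b_def]] by (simp only: b_def add_diff_cancel_left')
      finally show "?r * ?t - ?r' * ?t' = (R / of_nat (n + 2)) * X n x + (Q / of_nat (n + 2)) * Y n x"
        unfolding X_def Y_def by (simp only: mult_ac)
    qed
    also have "\<dots> = (R / of_nat (n + 2)) * (\<integral>x. X n x \<partial>\<mu> n) + (Q / of_nat (n + 2)) * (\<integral>x. Y n x \<partial>\<mu> n)"
      using iX iY by (simp only: Bochner_Integration.integral_add integrable_mult_right integral_mult_right_zero)
    finally show ?thesis by (simp only: distrib_left mult_divide_mult_self[OF N])
  qed
  ultimately show ?thesis by (simp add: a_def b_def mult_ac)
qed


text \<open>With r = 1/(a - s) and q = 1/(b - t), where a = 1/z and b = 1/w, one has u v = a b r q -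
  a r - b q + 1. In the third limit the first-order terms in R1 and R2 of the product r q cancel
  against those of the single resolvents. What is left is (n + 2)(h - 1) for the quotient h of the
  root, and this tends to 1 - 1/h of the given law because (n + 2)(1 - 1/h) equals it for every
  n.\<close>

proposition BID_asymptotics:
  assumes "\<nu> \<in> BID"
  obtains \<alpha> \<beta> F R1 R2 \<mu> where "\<alpha> > 0" "\<beta> > 0" "has_bifree_R_transform \<nu> \<alpha> \<beta> F"
    "has_R_transform (marginal1 \<nu>) \<alpha> \<beta> R1" "has_R_transform (marginal2 \<nu>) \<alpha> \<beta> R2"
    "\<And>z w. z \<in> stolz_pair \<alpha> \<beta> \<Longrightarrow> w \<in> stolz_pair \<alpha> \<beta> \<Longrightarrow> h_quotient \<nu> R1 R2 z w \<noteq> 0 \<and>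
      F (z, w) = z * R1 z + w * R2 w + (1 - 1 / h_quotient \<nu> R1 R2 z w)"
    "\<And>n::nat. borel_prob (\<mu> n)"
    "\<And>z. z \<in> stolz_pair \<alpha> \<beta> \<Longrightarrow>
      (\<lambda>n. of_nat (n + 2) * (\<integral>p. of_real (fst p) / (1 / z - of_real (fst p)) \<partial>\<mu> n)) \<longlonglongrightarrow> z * R1 z"
    "\<And>z. z \<in> stolz_pair \<alpha> \<beta> \<Longrightarrow>
      (\<lambda>n. of_nat (n + 2) * (\<integral>p. of_real (snd p) / (1 / z - of_real (snd p)) \<partial>\<mu> n)) \<longlonglongrightarrow> z * R2 z"
    "\<And>z w. z \<in> stolz_pair \<alpha> \<beta> \<Longrightarrow> w \<in> stolz_pair \<alpha> \<beta> \<Longrightarrow>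
      (\<lambda>n. of_nat (n + 2) * (\<integral>p. of_real (fst p) / (1 / z - of_real (fst p)) *
          (of_real (snd p) / (1 / w - of_real (snd p))) \<partial>\<mu> n)) \<longlonglongrightarrow> 1 - 1 / h_quotient \<nu> R1 R2 z w"
proof -
  from assms obtain \<alpha> \<beta> F where \<nu>: "borel_prob \<nu>" and \<alpha>: "\<alpha> > 0" and \<beta>: "\<beta> > 0"
    and F: "has_bifree_R_transform \<nu> \<alpha> \<beta> F"
    and roots: "\<And>m::nat. m \<ge> 2 \<Longrightarrow> \<exists>\<mu>\<^sub>m F\<^sub>m. borel_prob \<mu>\<^sub>m \<and> has_bifree_R_transform \<mu>\<^sub>m \<alpha> \<beta> F\<^sub>m \<and>
      (\<forall>p \<in> stolz_product \<alpha> \<beta>. F p = of_nat m * F\<^sub>m p)"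
    unfolding BID_def by blast
  let ?S = "stolz_pair \<alpha> \<beta>"
  from F obtain R1 R2 where R: "has_R_transform (marginal1 \<nu>) \<alpha> \<beta> R1" "has_R_transform (marginal2 \<nu>) \<alpha> \<beta> R2"
    and FR: "\<And>z w. z \<in> ?S \<Longrightarrow> w \<in> ?S \<Longrightarrow> h_quotient \<nu> R1 R2 z w \<noteq> 0 \<and>
      F (z, w) = z * R1 z + w * R2 w + (1 - 1 / h_quotient \<nu> R1 R2 z w)"
    unfolding has_bifree_R_transform_def stolz_product_def by blast
  have "\<exists>\<mu> Q1 Q2. borel_prob \<mu> \<and> has_R_transform (marginal1 \<mu>) \<alpha> \<beta> Q1 \<and> has_R_transform (marginal2 \<mu>) \<alpha> \<beta> Q2 \<and>
      (\<forall>z \<in> ?S. \<forall>w \<in> ?S. h_quotient \<mu> Q1 Q2 z w \<noteq> 0 \<and> z * R1 z + w * R2 w + (1 - 1 / h_quotient \<nu> R1 R2 z w) =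
        of_nat (n + 2) * (z * Q1 z + w * Q2 w + (1 - 1 / h_quotient \<mu> Q1 Q2 z w)))" for n
  proof -
    obtain \<mu> G where \<mu>: "borel_prob \<mu>" "has_bifree_R_transform \<mu> \<alpha> \<beta> G"
      and FG: "\<forall>p \<in> stolz_product \<alpha> \<beta>. F p = of_nat (n + 2) * G p"
      using roots[of "n + 2"] by auto
    from \<mu>(2) obtain Q1 Q2 where Q: "has_R_transform (marginal1 \<mu>) \<alpha> \<beta> Q1" "has_R_transform (marginal2 \<mu>) \<alpha> \<beta> Q2"
      and GQ: "\<And>z w. z \<in> ?S \<Longrightarrow> w \<in> ?S \<Longrightarrow> h_quotient \<mu> Q1 Q2 z w \<noteq> 0 \<and>
        G (z, w) = z * Q1 z + w * Q2 w + (1 - 1 / h_quotient \<mu> Q1 Q2 z w)"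
      unfolding has_bifree_R_transform_def stolz_product_def by blast
    have "h_quotient \<mu> Q1 Q2 z w \<noteq> 0 \<and> z * R1 z + w * R2 w + (1 - 1 / h_quotient \<nu> R1 R2 z w) =
        of_nat (n + 2) * (z * Q1 z + w * Q2 w + (1 - 1 / h_quotient \<mu> Q1 Q2 z w))"
      if "z \<in> ?S" "w \<in> ?S" for z w
      using FR[OF that] GQ[OF that] FG that unfolding stolz_product_def by (metis SigmaI)
    then show ?thesis using \<mu>(1) Q by blast
  qed
  then have "\<exists>\<mu>. \<forall>n. \<exists>Q1 Q2. borel_prob (\<mu> n) \<and> has_R_transform (marginal1 (\<mu> n)) \<alpha> \<beta> Q1 \<and> has_R_transform (marginal2 (\<mu> n)) \<alpha> \<beta> Q2 \<and>
      (\<forall>z \<in> ?S. \<forall>w \<in> ?S. h_quotient (\<mu> n) Q1 Q2 z w \<noteq> 0 \<and> z * R1 z + w * R2 w + (1 - 1 / h_quotient \<nu> R1 R2 z w) =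
        of_nat (n + 2) * (z * Q1 z + w * Q2 w + (1 - 1 / h_quotient (\<mu> n) Q1 Q2 z w)))"
    by (intro choice allI)
  then obtain \<mu> where \<mu>ex: "\<And>n. \<exists>Q1 Q2. borel_prob (\<mu> n) \<and> has_R_transform (marginal1 (\<mu> n)) \<alpha> \<beta> Q1 \<and> has_R_transform (marginal2 (\<mu> n)) \<alpha> \<beta> Q2 \<and>
      (\<forall>z \<in> ?S. \<forall>w \<in> ?S. h_quotient (\<mu> n) Q1 Q2 z w \<noteq> 0 \<and> z * R1 z + w * R2 w + (1 - 1 / h_quotient \<nu> R1 R2 z w) =
        of_nat (n + 2) * (z * Q1 z + w * Q2 w + (1 - 1 / h_quotient (\<mu> n) Q1 Q2 z w)))" by blast
  define e where "e z w = 1 - 1 / h_quotient \<nu> R1 R2 z w" for z w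
  \<comment> \<open>Only the roots are chosen as a sequence. By \<open>bifree_R_scaling\<close> any
    R-transforms of the n-th root on this Stolz pair are R1/(n+2) and R2/(n+2), so the points of
    evaluation can be written with R1 and R2.\<close>
  define a where "a n z = 1 / z + R1 z / of_nat (n + 2)" for n z
  define b where "b n z = 1 / z + R2 z / of_nat (n + 2)" for n z
  have N: "of_nat (n + 2) \<noteq> (0::complex)" for n by (metis add_2_eq_Suc' of_nat_neq_0)
  have \<mu>: "borel_prob (\<mu> n)" for n using \<mu>ex[of n] by blast
  have sets: "sets (\<mu> n) = sets borel" and p: "prob_space (\<mu> n)" for n using \<mu>[of n] by (auto simp: borel_prob_def)
  have [measurable_cong]: "sets (\<mu> n) = sets (borel \<Otimes>\<^sub>M borel)" for n by (simp only: sets borel_prod)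
  have meas: "fst \<in> borel_measurable (\<mu> n)" "snd \<in> borel_measurable (\<mu> n)" for n by measurable
  have data: "Im (a n z) \<noteq> 0 \<and> (\<integral>p. 1 / (a n z - of_real (fst p)) \<partial>\<mu> n) = z"
    "Im (b n z) \<noteq> 0 \<and> (\<integral>p. 1 / (b n z - of_real (snd p)) \<partial>\<mu> n) = z" if z: "z \<in> ?S" for n z
  proof -
    obtain Q1 Q2 where Q: "has_R_transform (marginal1 (\<mu> n)) \<alpha> \<beta> Q1" "has_R_transform (marginal2 (\<mu> n)) \<alpha> \<beta> Q2"
      and eq: "\<And>z w. z \<in> ?S \<Longrightarrow> w \<in> ?S \<Longrightarrow> z * R1 z + w * R2 w + (1 - 1 / h_quotient \<nu> R1 R2 z w) =
        of_nat (n + 2) * (z * Q1 z + w * Q2 w + (1 - 1 / h_quotient (\<mu> n) Q1 Q2 z w))"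
      using \<mu>ex[of n] by blast
    have n2: "n + 2 > 0" by simp
    have sc: "R1 z = of_nat (n + 2) * Q1 z" "R2 z = of_nat (n + 2) * Q2 z"
      by (rule bifree_R_scaling(1)[OF \<nu> \<mu> \<alpha> \<beta> n2 R Q eq z]; assumption)
        (rule bifree_R_scaling(2)[OF \<nu> \<mu> \<alpha> \<beta> n2 R Q eq z]; assumption)
    have "a n z = 1 / z + Q1 z" "b n z = 1 / z + Q2 z"
      using N[of n] unfolding a_def b_def sc
      by (simp_all only: nonzero_mult_div_cancel_left not_False_eq_True)
    then show "Im (a n z) \<noteq> 0 \<and> (\<integral>p. 1 / (a n z - of_real (fst p)) \<partial>\<mu> n) = z"
      "Im (b n z) \<noteq> 0 \<and> (\<integral>p. 1 / (b n z - of_real (snd p)) \<partial>\<mu> n) = z"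
      using Q z unfolding has_R_transform_def complex_is_Real_iff
      cauchy_transform_marginal1[OF sets] cauchy_transform_marginal2[OF sets] by auto
  qed
  have data2: "\<exists>h. h \<noteq> 0 \<and> of_nat (n + 2) * (1 - 1 / h) = e z w \<and>
      (\<integral>p. 1 / (a n z - of_real (fst p)) * (1 / (b n w - of_real (snd p))) \<partial>\<mu> n) = z * w * h"
    if z: "z \<in> ?S" and w: "w \<in> ?S" for n z w
  proof -
    obtain Q1 Q2 where Q: "has_R_transform (marginal1 (\<mu> n)) \<alpha> \<beta> Q1" "has_R_transform (marginal2 (\<mu> n)) \<alpha> \<beta> Q2"
      and h0: "h_quotient (\<mu> n) Q1 Q2 z w \<noteq> 0"
      and eq: "\<And>z w. z \<in> ?S \<Longrightarrow> w \<in> ?S \<Longrightarrow> z * R1 z + w * R2 w + (1 - 1 / h_quotient \<nu> R1 R2 z w) =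
        of_nat (n + 2) * (z * Q1 z + w * Q2 w + (1 - 1 / h_quotient (\<mu> n) Q1 Q2 z w))"
      using \<mu>ex[of n] z w by blast
    have n2: "n + 2 > 0" by simp
    have sc: "R1 z = of_nat (n + 2) * Q1 z" "R2 w = of_nat (n + 2) * Q2 w"
      by (rule bifree_R_scaling(1)[OF \<nu> \<mu> \<alpha> \<beta> n2 R Q eq z]; assumption)
        (rule bifree_R_scaling(2)[OF \<nu> \<mu> \<alpha> \<beta> n2 R Q eq w]; assumption)
    have sc3: "1 - 1 / h_quotient \<nu> R1 R2 z w = of_nat (n + 2) * (1 - 1 / h_quotient (\<mu> n) Q1 Q2 z w)"
      by (rule bifree_R_scaling(3)[OF \<nu> \<mu> \<alpha> \<beta> n2 R Q eq z w]; assumption)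
    have ab: "a n z = 1 / z + Q1 z" "b n w = 1 / w + Q2 w"
      using N[of n] unfolding a_def b_def sc
      by (simp_all only: nonzero_mult_div_cancel_left not_False_eq_True)
    have "(\<integral>p. 1 / (a n z - of_real (fst p)) * (1 / (b n w - of_real (snd p))) \<partial>\<mu> n) = z * w * h_quotient (\<mu> n) Q1 Q2 z w"
      using stolz_pair_neq_0[OF z] stolz_pair_neq_0[OF w]
      unfolding h_quotient_def ab[symmetric] cauchy_transform2_def by simp
    then show ?thesis using h0 sc3 unfolding e_def by metis
  qed
  \<comment> \<open>A point of the Stolz pair whose inverse is i y with y = 2/\<beta> > 0, as
    \<open>concentration\<close> demands.\<close>
  define z0 where "z0 = stolz_seq \<beta> 0"
  have z0: "z0 \<in> ?S" "z0 = 1 / (\<i> * of_real (2 / \<beta>))"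
  proof -
    show "z0 \<in> ?S" unfolding z0_def by (rule stolz_seq(1)[OF \<alpha> \<beta>])
    have "z0 * (\<i> * of_real (2 / \<beta>)) = 1" using \<beta> by (simp add: z0_def stolz_seq_def)
    then show "z0 = 1 / (\<i> * of_real (2 / \<beta>))" using \<beta> by (simp add: eq_divide_eq)
  qed
  have alim: "(\<lambda>n. 1 / z + Q / of_nat (n + 2)) \<longlonglongrightarrow> 1 / z" for z Q :: complex
    using tendsto_add[OF tendsto_const[of "1 / z"] LIMSEQ_ignore_initial_segment[OF lim_const_over_n[of Q], of 2]] by simp
  have iz0: "1 / z0 = \<i> * of_real (2 / \<beta>)" unfolding z0(2) by simp
  have q: "(\<lambda>n. \<integral>p. sq_ratio (fst p) \<partial>\<mu> n) \<longlonglongrightarrow> 0" "(\<lambda>n. \<integral>p. sq_ratio (snd p) \<partial>\<mu> n) \<longlonglongrightarrow> 0"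
  proof -
    have y: "2 / \<beta> > 0" using \<beta> by simp
    have A: "(\<lambda>n. a n z0) \<longlonglongrightarrow> \<i> * of_real (2 / \<beta>)" "(\<lambda>n. b n z0) \<longlonglongrightarrow> \<i> * of_real (2 / \<beta>)"
      unfolding a_def b_def iz0[symmetric] by (rule alim)+
    show "(\<lambda>n. \<integral>p. sq_ratio (fst p) \<partial>\<mu> n) \<longlonglongrightarrow> 0"
      by (rule concentration[OF p meas(1) y A(1) conjunct1[OF data(1)[OF z0(1)]] trans[OF conjunct2[OF data(1)[OF z0(1)]] z0(2)]])
    show "(\<lambda>n. \<integral>p. sq_ratio (snd p) \<partial>\<mu> n) \<longlonglongrightarrow> 0"
      by (rule concentration[OF p meas(2) y A(2) conjunct1[OF data(2)[OF z0(1)]] trans[OF conjunct2[OF data(2)[OF z0(1)]] z0(2)]])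
  qed
  have Imz: "Im (1 / z) \<noteq> 0" if "z \<in> ?S" for z
    using stolz_pair_Im[OF that] by (auto simp: Im_divide)
  note data' = data[unfolded a_def b_def]
  have r1: "(\<lambda>n. of_nat (n + 2) * ((\<integral>p. 1 / (1 / z - of_real (fst p)) \<partial>\<mu> n) - z)) \<longlonglongrightarrow> R1 z * (z * z)" if z: "z \<in> ?S" for z
    by (rule first_order_resolvent[OF p meas(1) q(1) Imz[OF z]]) (use data'(1)[OF z] in blast)+
  have r2: "(\<lambda>n. of_nat (n + 2) * ((\<integral>p. 1 / (1 / z - of_real (snd p)) \<partial>\<mu> n) - z)) \<longlonglongrightarrow> R2 z * (z * z)" if z: "z \<in> ?S" for z
    by (rule first_order_resolvent[OF p meas(2) q(2) Imz[OF z]]) (use data'(2)[OF z] in blast)+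
  have i1: "integrable (\<mu> n) (\<lambda>p. 1 / (1 / z - of_real (fst p)))" "integrable (\<mu> n) (\<lambda>p. 1 / (1 / z - of_real (snd p)))"
    if z: "z \<in> ?S" for n z
    using finite_measure.integrable_resolvent[OF prob_space.finite_measure[OF p] meas(1) Imz[OF z]]
      finite_measure.integrable_resolvent[OF prob_space.finite_measure[OF p] meas(2) Imz[OF z]] by auto
  have const: "(\<integral>p. c \<partial>\<mu> n) = c" for c :: complex and n
    using prob_space.prob_space[OF p] by simp
  have ic: "integrable (\<mu> n) (\<lambda>p. c)" for c :: complex and n
    using finite_measure.integrable_const[OF prob_space.finite_measure[OF p]] .
  show thesis
  proof (rule that[OF \<alpha> \<beta> F R FR \<mu>])
    fix z assume z: "z \<in> ?S"
    note z0 = stolz_pair_neq_0[OF z]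
    have "(\<integral>p. of_real (fst p) / (1 / z - of_real (fst p)) \<partial>\<mu> n) = 1 / z * ((\<integral>p. 1 / (1 / z - of_real (fst p)) \<partial>\<mu> n) - z)" for n
      unfolding jump_resolvent[OF Imz[OF z]] using i1[OF z, of n] ic[of n 1] z0
      by (simp only: Bochner_Integration.integral_diff integrable_mult_right integral_mult_right_zero const) (simp add: right_diff_distrib)
    moreover have "(\<lambda>n. 1 / z * (of_nat (n + 2) * ((\<integral>p. 1 / (1 / z - of_real (fst p)) \<partial>\<mu> n) - z))) \<longlonglongrightarrow> 1 / z * (R1 z * (z * z))"
      by (intro tendsto_intros r1 z)
    ultimately show "(\<lambda>n. of_nat (n + 2) * (\<integral>p. of_real (fst p) / (1 / z - of_real (fst p)) \<partial>\<mu> n)) \<longlonglongrightarrow> z * R1 z"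
      using z0 by (simp add: mult_ac)
  next
    fix z assume z: "z \<in> ?S"
    note z0 = stolz_pair_neq_0[OF z]
    have "(\<integral>p. of_real (snd p) / (1 / z - of_real (snd p)) \<partial>\<mu> n) = 1 / z * ((\<integral>p. 1 / (1 / z - of_real (snd p)) \<partial>\<mu> n) - z)" for n
      unfolding jump_resolvent[OF Imz[OF z]] using i1[OF z, of n] ic[of n 1] z0
      by (simp only: Bochner_Integration.integral_diff integrable_mult_right integral_mult_right_zero const) (simp add: right_diff_distrib)
    moreover have "(\<lambda>n. 1 / z * (of_nat (n + 2) * ((\<integral>p. 1 / (1 / z - of_real (snd p)) \<partial>\<mu> n) - z))) \<longlonglongrightarrow> 1 / z * (R2 z * (z * z))"
      by (intro tendsto_intros r2 z)
    ultimately show "(\<lambda>n. of_nat (n + 2) * (\<integral>p. of_real (snd p) / (1 / z - of_real (snd p)) \<partial>\<mu> n)) \<longlonglongrightarrow> z * R2 z"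
      using z0 by (simp add: mult_ac)
  next
    fix z w assume z: "z \<in> ?S" and w: "w \<in> ?S"
    note nz = stolz_pair_neq_0[OF z] stolz_pair_neq_0[OF w]
    define A where "A n = (\<integral>p. 1 / (1 / z - of_real (fst p)) \<partial>\<mu> n)" for n
    define B where "B n = (\<integral>p. 1 / (1 / w - of_real (snd p)) \<partial>\<mu> n)" for n
    define C where "C n = (\<integral>p. 1 / (1 / z - of_real (fst p)) * (1 / (1 / w - of_real (snd p))) \<partial>\<mu> n)" for n
    define D where "D n = (\<integral>p. 1 / (a n z - of_real (fst p)) * (1 / (b n w - of_real (snd p))) \<partial>\<mu> n)" for n
    have "\<exists>h. \<forall>n. h n \<noteq> 0 \<and> of_nat (n + 2) * (1 - 1 / h n) = e z w \<and> D n = z * w * h n"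
      using data2[OF z w] unfolding D_def by (intro choice allI)
    then obtain h where h: "\<And>n. h n \<noteq> 0" "\<And>n. of_nat (n + 2) * (1 - 1 / h n) = e z w" "\<And>n. D n = z * w * h n"
      by blast
    have hinv: "1 / h n = 1 - e z w / of_nat (n + 2)" for n
    proof -
      have "1 / h n = 1 - (1 - 1 / h n)" by simp
      also have "1 - 1 / h n = e z w / of_nat (n + 2)"
        unfolding h(2)[symmetric, of n] using N[of n] by (simp only: nonzero_mult_div_cancel_left not_False_eq_True)
      finally show ?thesis .
    qed
    have "(\<lambda>n. 1 / h n) \<longlonglongrightarrow> 1 - 0"
      unfolding hinv by (intro tendsto_intros LIMSEQ_ignore_initial_segment[OF lim_const_over_n])
    then have "(\<lambda>n. 1 / (1 / h n)) \<longlonglongrightarrow> 1 / 1" by (intro tendsto_divide tendsto_const) auto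
    then have hl: "h \<longlonglongrightarrow> 1" by simp
    \<comment> \<open>(n + 2)(h - 1) is the constant (n + 2)(1 - 1/h) = \<open>e z w\<close>
      multiplied by h, and h tends to 1.\<close>
    have Dl: "(\<lambda>n. of_nat (n + 2) * (D n - z * w)) \<longlonglongrightarrow> z * w * e z w"
    proof -
      have "of_nat (n + 2) * (D n - z * w) = z * w * (e z w * h n)" for n
      proof -
        have "D n - z * w = z * w * ((1 - 1 / h n) * h n)" unfolding h(3) using h(1)[of n] by (simp add: algebra_simps)
        then show ?thesis unfolding h(2)[symmetric, of n] by (simp only: mult_ac)
      qed
      moreover have "(\<lambda>n. z * w * (e z w * h n)) \<longlonglongrightarrow> z * w * (e z w * 1)" by (intro tendsto_intros hl)
      ultimately show ?thesis by simp
    qed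
    have CD: "(\<lambda>n. of_nat (n + 2) * (C n - D n)) \<longlonglongrightarrow> R1 z * (z * z * w) + R2 w * (z * (w * w))"
      unfolding C_def D_def a_def b_def
      by (rule first_order_resolvent2[OF p meas q Imz[OF z] _ Imz[OF w]]) (use data'(1)[OF z] data'(2)[OF w] in blast)+
    have "(\<lambda>n. 1 / z * (1 / w) * (of_nat (n + 2) * (C n - D n) + of_nat (n + 2) * (D n - z * w))
        - 1 / z * (of_nat (n + 2) * (A n - z)) - 1 / w * (of_nat (n + 2) * (B n - w)))
      \<longlonglongrightarrow> 1 / z * (1 / w) * (R1 z * (z * z * w) + R2 w * (z * (w * w)) + z * w * e z w)
        - 1 / z * (R1 z * (z * z)) - 1 / w * (R2 w * (w * w))"
      unfolding A_def B_def by (intro tendsto_intros CD Dl r1 r2 z w)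
    also have "1 / z * (1 / w) * (R1 z * (z * z * w) + R2 w * (z * (w * w)) + z * w * e z w)
        - 1 / z * (R1 z * (z * z)) - 1 / w * (R2 w * (w * w)) = e z w"
      using nz by (simp add: field_simps)
    also have "(\<lambda>n. 1 / z * (1 / w) * (of_nat (n + 2) * (C n - D n) + of_nat (n + 2) * (D n - z * w))
        - 1 / z * (of_nat (n + 2) * (A n - z)) - 1 / w * (of_nat (n + 2) * (B n - w))) =
      (\<lambda>n. of_nat (n + 2) * (\<integral>p. of_real (fst p) / (1 / z - of_real (fst p)) *
          (of_real (snd p) / (1 / w - of_real (snd p))) \<partial>\<mu> n))"
    proof
      fix n
      have iC: "integrable (\<mu> n) (\<lambda>p. 1 / (1 / z - of_real (fst p)) * (1 / (1 / w - of_real (snd p))))"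
        using cauchy_transform2_integrable[OF prob_space.finite_measure[OF p] sets Imz[OF z] Imz[OF w], of n] by simp
      have "of_real (fst p) / (1 / z - of_real (fst p)) * (of_real (snd p) / (1 / w - of_real (snd p))) =
          1 / z * (1 / w) * (1 / (1 / z - of_real (fst p)) * (1 / (1 / w - of_real (snd p))))
          - 1 / z * (1 / (1 / z - of_real (fst p))) - 1 / w * (1 / (1 / w - of_real (snd p))) + 1" for p :: "real \<times> real"
        unfolding jump_resolvent[OF Imz[OF z]] jump_resolvent[OF Imz[OF w]]
        by (simp only: left_diff_distrib right_diff_distrib) (simp add: mult_ac)
      then have "(\<integral>p. of_real (fst p) / (1 / z - of_real (fst p)) * (of_real (snd p) / (1 / w - of_real (snd p))) \<partial>\<mu> n)
          = 1 / z * (1 / w) * C n - 1 / z * A n - 1 / w * B n + 1"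
        unfolding A_def B_def C_def using i1(1)[OF z, of n] i1(2)[OF w, of n] iC ic[of n 1]
        by (simp only: Bochner_Integration.integral_diff Bochner_Integration.integral_add Bochner_Integration.integrable_diff
            integrable_mult_right integral_mult_right_zero const)
      moreover have "1 / z * (1 / w) * (m * (C n - D n) + m * (D n - z * w)) - 1 / z * (m * (A n - z)) - 1 / w * (m * (B n - w))
          = m * (1 / z * (1 / w) * C n - 1 / z * A n - 1 / w * B n + 1)" for m
        using nz by (simp add: field_simps)
      ultimately show "1 / z * (1 / w) * (of_nat (n + 2) * (C n - D n) + of_nat (n + 2) * (D n - z * w))
        - 1 / z * (of_nat (n + 2) * (A n - z)) - 1 / w * (of_nat (n + 2) * (B n - w)) = of_nat (n + 2) *
        (\<integral>p. of_real (fst p) / (1 / z - of_real (fst p)) * (of_real (snd p) / (1 / w - of_real (snd p))) \<partial>\<mu> n)"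
        by (simp only:)
    qed
    finally show "(\<lambda>n. of_nat (n + 2) * (\<integral>p. of_real (fst p) / (1 / z - of_real (fst p)) *
          (of_real (snd p) / (1 / w - of_real (snd p))) \<partial>\<mu> n)) \<longlonglongrightarrow> 1 - 1 / h_quotient \<nu> R1 R2 z w"
      unfolding e_def .
  qed
qed

section \<open>Holomorphic extension\<close>

lemma not_LIMSEQ_subseq:
  assumes "\<not> X \<longlonglongrightarrow> (L :: 'a :: metric_space)"
  shows "\<exists>e r. e > 0 \<and> strict_mono (r :: nat \<Rightarrow> nat) \<and> (\<forall>n. dist (X (r n)) L \<ge> e)"
proof -
  obtain e where e: "e > 0" "\<not> (\<forall>\<^sub>F n in sequentially. dist (X n) L < e)"
    using assms unfolding tendsto_iff by blast
  have "infinite {n. \<not> dist (X n) L < e}"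
  proof
    assume "finite {n. \<not> dist (X n) L < e}"
    then obtain N where "\<forall>n \<in> {n. \<not> dist (X n) L < e}. n < N"
      using finite_nat_set_iff_bounded by blast
    then have "\<forall>n\<ge>N. dist (X n) L < e" by force
    then show False using e(2) unfolding eventually_sequentially by blast
  qed
  then obtain r :: "nat \<Rightarrow> nat" where r: "strict_mono r" "\<forall>n. r n \<in> {n. \<not> dist (X n) L < e}"
    using infinite_enumerate by blast
  have "dist (X (r n)) L \<ge> e" for n using r(2) by (simp add: not_less)
  then show ?thesis using e(1) r(1) by (intro exI[of _ e] exI[of _ r]) simp
qed

text \<open>Montel's theorem gives one subsequence with a holomorphic limit g. If the full sequence
  failed to converge to g at some point, a subsequence staying away from g there would by Montel
  have another limit, equal to g on U and hence everywhere by the identity theorem.\<close>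

proposition Vitali_convergence:
  fixes f :: "nat \<Rightarrow> complex \<Rightarrow> complex"
  assumes S: "open S" "connected S" and hol: "\<And>n. f n holomorphic_on S"
    and bd: "\<And>K. compact K \<Longrightarrow> K \<subseteq> S \<Longrightarrow> \<exists>B. \<forall>n. \<forall>z \<in> K. norm (f n z) \<le> B"
    and U: "open U" "U \<noteq> {}" "U \<subseteq> S" and lim: "\<And>z. z \<in> U \<Longrightarrow> (\<lambda>n. f n z) \<longlonglongrightarrow> l z"
  shows "\<exists>g. g holomorphic_on S \<and> (\<forall>z \<in> S. (\<lambda>n. f n z) \<longlonglongrightarrow> g z)"
proof -
  have M: "\<exists>g r. g holomorphic_on S \<and> strict_mono r \<and> (\<forall>z \<in> S. (\<lambda>n. f (s (r n)) z) \<longlonglongrightarrow> g z)"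
    for s :: "nat \<Rightarrow> nat"
  proof (rule Montel[of S "range f" "\<lambda>n. f (s n)"])
    show "\<exists>B. \<forall>h \<in> range f. \<forall>z \<in> K. norm (h z) \<le> B" if "compact K" "K \<subseteq> S" for K
      using bd[OF that] by blast
    show "h holomorphic_on S" if "h \<in> range f" for h using that hol by blast
    show "range (\<lambda>n. f (s n)) \<subseteq> range f" by blast
    show "open S" by fact
    fix g r
    assume "g holomorphic_on S" "strict_mono (r :: nat \<Rightarrow> nat)" "\<And>x. x \<in> S \<Longrightarrow> (\<lambda>n. f (s (r n)) x) \<longlonglongrightarrow> g x"
    then show ?thesis by blast
  qed
  from M[of "\<lambda>n. n"] obtain g r where gr: "g holomorphic_on S \<and> strict_mono r \<and> (\<forall>z \<in> S. (\<lambda>n. f (r n) z) \<longlonglongrightarrow> g z)"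
    by (elim exE)
  then have g: "g holomorphic_on S" and r: "strict_mono r" "\<And>z. z \<in> S \<Longrightarrow> (\<lambda>n. f (r n) z) \<longlonglongrightarrow> g z"
    by simp_all
  have gl: "g z = l z" if "z \<in> U" for z
  proof (rule LIMSEQ_unique)
    show "(\<lambda>n. f (r n) z) \<longlonglongrightarrow> g z" using r(2) that U(3) by blast
    show "(\<lambda>n. f (r n) z) \<longlonglongrightarrow> l z" using LIMSEQ_subseq_LIMSEQ[OF lim[OF that] r(1)] by (simp add: comp_def)
  qed
  have "(\<lambda>n. f n z) \<longlonglongrightarrow> g z" if z: "z \<in> S" for z
  proof (rule ccontr)
    assume "\<not> (\<lambda>n. f n z) \<longlonglongrightarrow> g z"
    from not_LIMSEQ_subseq[OF this] obtain e and s :: "nat \<Rightarrow> nat"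
      where es: "e > 0 \<and> strict_mono s \<and> (\<forall>n. dist (f (s n) z) (g z) \<ge> e)"
      by (elim exE)
    then have e: "e > 0" and s: "strict_mono s" "\<And>n. dist (f (s n) z) (g z) \<ge> e"
      by simp_all
    from M[of s] obtain h t where ht: "h holomorphic_on S \<and> strict_mono t \<and> (\<forall>z \<in> S. (\<lambda>n. f (s (t n)) z) \<longlonglongrightarrow> h z)"
      by (elim exE)
    then have h: "h holomorphic_on S" and t: "strict_mono t" "\<And>z. z \<in> S \<Longrightarrow> (\<lambda>n. f (s (t n)) z) \<longlonglongrightarrow> h z"
      by simp_all
    have "h w = g w" if "w \<in> U" for w
    proof -
      have "(\<lambda>n. f (s (t n)) w) \<longlonglongrightarrow> l w"
        using LIMSEQ_subseq_LIMSEQ[OF lim[OF that] strict_mono_o[OF s(1) t(1)]] by (simp add: comp_def)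
      moreover have "(\<lambda>n. f (s (t n)) w) \<longlonglongrightarrow> h w" using t(2) that U(3) by blast
      ultimately show ?thesis unfolding gl[OF that] by (rule LIMSEQ_unique[rotated])
    qed
    then have "h z = g z"
      by (rule analytic_continuation_open[OF U(1) S(1) U(2) S(2) U(3) h g _ z])
    then have "(\<lambda>n. f (s (t n)) z) \<longlonglongrightarrow> g z" using t(2)[OF z] by simp
    from tendstoD[OF this e] obtain n where "dist (f (s (t n)) z) (g z) < e"
      unfolding eventually_sequentially by blast
    then show False using s(2)[of "t n"] by simp
  qed
  then show ?thesis using g by (intro exI[of _ g]) simp
qed

section \<open>Osgood's lemma\<close>

lemma holomorphic_bounded_Lipschitz:
  assumes hol: "f holomorphic_on ball z0 (2 * r)" and r: "r > 0"
    and bd: "\<And>z. z \<in> ball z0 (2 * r) \<Longrightarrow> norm (f z) \<le> B"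
    and zw: "z \<in> ball z0 r" "w \<in> ball z0 r"
  shows "norm (f z - f w) \<le> (2 * B / r) * norm (z - w)"
proof (rule field_differentiable_bound[OF convex_ball _ _ zw])
  fix x assume x: "x \<in> ball z0 r"
  have sub: "cball x (r / 2) \<subseteq> ball z0 (2 * r)"
  proof
    fix y assume "y \<in> cball x (r / 2)"
    then have "dist z0 y \<le> dist z0 x + r / 2" using dist_triangle[of z0 y x] by (simp add: dist_commute)
    then show "y \<in> ball z0 (2 * r)" using x r by simp
  qed
  have "x \<in> ball z0 (2 * r)" using x r by simp
  then show "(f has_field_derivative deriv f x) (at x within ball z0 r)"
    using holomorphic_derivI[OF hol open_ball] has_field_derivative_at_within by blast
  have "norm ((deriv ^^ 1) f x) \<le> fact 1 * B / (r / 2) ^ 1"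
  proof (rule Cauchy_inequality)
    show "f holomorphic_on ball x (r / 2)"
      using hol sub ball_subset_cball by (meson holomorphic_on_subset order_trans)
    show "continuous_on (cball x (r / 2)) f"
      using continuous_on_subset[OF holomorphic_on_imp_continuous_on[OF hol] sub] .
    show "norm (f y) \<le> B" if "norm (x - y) = r / 2" for y
      using that sub by (intro bd) (auto simp: dist_norm)
  qed (use r in auto)
  then show "norm (deriv f x) \<le> 2 * B / r" by (simp add: mult.commute)
qed

text \<open>The mixed second difference \<open>A\<close> is bounded by a multiple of |z - z0| |w -
  w0|: apply the Lipschitz estimate in w, and then in z to the resulting difference. So
  \<open>A\<close> has derivative 0, and what remains of F is a sum of functions of one variable and
  a constant.\<close>

lemma separately_holomorphic_imp_has_derivative:
  fixes F :: "complex \<times> complex \<Rightarrow> complex"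
  assumes r: "r > 0"
    and hol1: "\<And>w. w \<in> ball w0 (2 * r) \<Longrightarrow> (\<lambda>z. F (z, w)) holomorphic_on ball z0 (2 * r)"
    and hol2: "\<And>z. z \<in> ball z0 (2 * r) \<Longrightarrow> (\<lambda>w. F (z, w)) holomorphic_on ball w0 (2 * r)"
    and bd: "\<And>z w. z \<in> ball z0 (2 * r) \<Longrightarrow> w \<in> ball w0 (2 * r) \<Longrightarrow> norm (F (z, w)) \<le> B"
  shows "\<exists>a b. (F has_derivative (\<lambda>(h, k). a * h + b * k)) (at (z0, w0))"
proof -
  have c0: "z0 \<in> ball z0 (2 * r)" "w0 \<in> ball w0 (2 * r)" "z0 \<in> ball z0 r" "w0 \<in> ball w0 r" using r by auto
  define a where "a = deriv (\<lambda>z. F (z, w0)) z0"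
  define b where "b = deriv (\<lambda>w. F (z0, w)) w0"
  have a: "((\<lambda>z. F (z, w0)) has_derivative (*) a) (at z0)"
    using holomorphic_derivI[OF hol1[OF c0(2)] open_ball c0(1)] by (simp add: a_def has_field_derivative_def)
  have b: "((\<lambda>w. F (z0, w)) has_derivative (*) b) (at w0)"
    using holomorphic_derivI[OF hol2[OF c0(1)] open_ball c0(2)] by (simp add: b_def has_field_derivative_def)
  define A where "A p = F p - F (fst p, w0) - F (z0, snd p) + F (z0, w0)" for p
  define L where "L = 2 * (2 * B / r) / (r / 2)"
  have B0: "B \<ge> 0" using order_trans[OF norm_ge_zero bd[OF c0(1,2)]] .
  have Abound: "norm (A (z, w)) \<le> L * norm (z - z0) * norm (w - w0)"
    if z: "z \<in> ball z0 (r / 2)" and w: "w \<in> ball w0 r" for z w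
  proof -
    define g where "g \<zeta> = F (\<zeta>, w) - F (\<zeta>, w0)" for \<zeta>
    have w2: "w \<in> ball w0 (2 * r)" using w r by simp
    have "g holomorphic_on ball z0 (2 * (r / 2))"
      unfolding g_def using r
      by (intro holomorphic_on_diff holomorphic_on_subset[OF hol1[OF w2]] holomorphic_on_subset[OF hol1[OF c0(2)]]) auto
    moreover have "norm (g \<zeta>) \<le> 2 * B / r * norm (w - w0)" if "\<zeta> \<in> ball z0 (2 * (r / 2))" for \<zeta>
    proof -
      have \<zeta>: "\<zeta> \<in> ball z0 (2 * r)" using that r by simp
      show ?thesis unfolding g_def
        by (rule holomorphic_bounded_Lipschitz[OF hol2[OF \<zeta>] r bd[OF \<zeta>] w c0(4)])
    qed
    ultimately have "norm (g z - g z0) \<le> 2 * (2 * B / r * norm (w - w0)) / (r / 2) * norm (z - z0)"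
      using z r by (intro holomorphic_bounded_Lipschitz[where r = "r / 2" and ?z0.0 = z0]) auto
    moreover have "g z - g z0 = A (z, w)" by (simp add: g_def A_def)
    ultimately show ?thesis by (simp add: L_def mult_ac)
  qed
  have L0: "L \<ge> 0" using B0 r by (simp add: L_def)
  have "(A has_derivative (\<lambda>_. 0)) (at (z0, w0))"
  proof (rule has_derivativeI)
    have A0: "A (z0, w0) = 0" by (simp add: A_def)
    show "((\<lambda>y. (A y - A (z0, w0) - 0) /\<^sub>R norm (y - (z0, w0))) \<longlongrightarrow> 0) (at (z0, w0))"
    proof (rule Lim_null_comparison)
      show "\<forall>\<^sub>F y in at (z0, w0). norm ((A y - A (z0, w0) - 0) /\<^sub>R norm (y - (z0, w0))) \<le> L * norm (y - (z0, w0))"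
        unfolding eventually_at
      proof (intro exI[of _ "r / 2"] conjI ballI impI)
        show "r / 2 > 0" using r by simp
        fix y :: "complex \<times> complex" assume y: "y \<noteq> (z0, w0) \<and> dist y (z0, w0) < r / 2"
        obtain z w where zw: "y = (z, w)" by (cases y)
        have n: "norm (z - z0) \<le> norm (y - (z0, w0))" "norm (w - w0) \<le> norm (y - (z0, w0))"
          using norm_fst_le[of "z - z0" "w - w0"] norm_snd_le[of "w - w0" "z - z0"] by (simp_all add: zw)
        have "norm (A y) \<le> L * norm (z - z0) * norm (w - w0)"
          unfolding zw using n y r by (intro Abound) (auto simp: dist_norm norm_minus_commute)
        also have "\<dots> \<le> L * norm (y - (z0, w0)) * norm (y - (z0, w0))"
          using L0 n by (intro mult_mono) auto
        finally have "norm (A y) / norm (y - (z0, w0)) \<le> L * norm (y - (z0, w0))"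
          using y by (subst pos_divide_le_eq) auto
        then show "norm ((A y - A (z0, w0) - 0) /\<^sub>R norm (y - (z0, w0))) \<le> L * norm (y - (z0, w0))"
          by (simp add: A0 divide_inverse mult.commute)
      qed
      have "((\<lambda>y. L * norm (y - (z0, w0))) \<longlongrightarrow> L * norm ((z0, w0) - (z0, w0))) (at (z0, w0))"
        by (intro tendsto_intros)
      then show "((\<lambda>y. L * norm (y - (z0, w0))) \<longlongrightarrow> 0) (at (z0, w0))" by simp
    qed
  qed simp
  moreover have "((\<lambda>p. F (fst p, w0)) has_derivative (\<lambda>p. a * fst p)) (at (z0, w0))"
    using has_derivative_compose[of fst fst "(z0, w0)" UNIV "\<lambda>z. F (z, w0)" "(*) a"] a
    by (simp add: has_derivative_fst)
  moreover have "((\<lambda>p. F (z0, snd p)) has_derivative (\<lambda>p. b * snd p)) (at (z0, w0))"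
    using has_derivative_compose[of snd snd "(z0, w0)" UNIV "\<lambda>w. F (z0, w)" "(*) b"] b
    by (simp add: has_derivative_snd)
  ultimately have "((\<lambda>p. A p + (F (fst p, w0) + F (z0, snd p)) - F (z0, w0)) has_derivative (\<lambda>p. 0 + (a * fst p + b * snd p) - 0)) (at (z0, w0))"
    by (intro has_derivative_add has_derivative_diff has_derivative_const)
  moreover have "(\<lambda>p. A p + (F (fst p, w0) + F (z0, snd p)) - F (z0, w0)) = F" by (auto simp: A_def)
  moreover have "(\<lambda>p. 0 + (a * fst p + b * snd p) - 0) = (\<lambda>(h, k). a * h + b * k)" by auto
  ultimately show ?thesis by auto
qed

lemma open_nonreal: "open (- \<real> :: complex set)"
  by (rule open_Compl[OF closed_complex_Reals])

lemma open_nonreal2: "open nonreal2"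
  unfolding nonreal2_def by (intro open_Times open_nonreal)

proposition separately_holomorphic_imp_holomorphic2:
  fixes F :: "complex \<times> complex \<Rightarrow> complex"
  assumes hol1: "\<And>w. w \<in> - \<real> \<Longrightarrow> (\<lambda>z. F (z, w)) holomorphic_on (- \<real>)"
    and hol2: "\<And>z. z \<in> - \<real> \<Longrightarrow> (\<lambda>w. F (z, w)) holomorphic_on (- \<real>)"
    and bd: "\<And>K K'. compact K \<Longrightarrow> compact K' \<Longrightarrow> K \<subseteq> - \<real> \<Longrightarrow> K' \<subseteq> - \<real> \<Longrightarrow> \<exists>B. \<forall>z \<in> K. \<forall>w \<in> K'. norm (F (z, w)) \<le> B"
  shows "holomorphic2_on F nonreal2"
  unfolding holomorphic2_on_def
proof
  fix p assume "p \<in> nonreal2"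
  then obtain z0 w0 where p: "p = (z0, w0)" "z0 \<in> - \<real>" "w0 \<in> - \<real>" by (auto simp: nonreal2_def)
  obtain r1 where r1: "r1 > 0" "cball z0 r1 \<subseteq> - \<real>" using p(2) open_nonreal open_contains_cball by blast
  obtain r2 where r2: "r2 > 0" "cball w0 r2 \<subseteq> - \<real>" using p(3) open_nonreal open_contains_cball by blast
  define r where "r = min r1 r2 / 2"
  have r: "r > 0" using r1 r2 by (simp add: r_def)
  have sub: "ball z0 (2 * r) \<subseteq> cball z0 r1" "ball w0 (2 * r) \<subseteq> cball w0 r2" by (auto simp: r_def)
  obtain B where B: "\<And>z w. z \<in> cball z0 r1 \<Longrightarrow> w \<in> cball w0 r2 \<Longrightarrow> norm (F (z, w)) \<le> B"
    using bd[OF compact_cball compact_cball r1(2) r2(2)] by blast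
  have "\<exists>a b. (F has_derivative (\<lambda>(h, k). a * h + b * k)) (at (z0, w0))"
  proof (rule separately_holomorphic_imp_has_derivative[OF r])
    show "(\<lambda>z. F (z, w)) holomorphic_on ball z0 (2 * r)" if "w \<in> ball w0 (2 * r)" for w
      using that sub r1 r2 by (intro holomorphic_on_subset[OF hol1]) auto
    show "(\<lambda>w. F (z, w)) holomorphic_on ball w0 (2 * r)" if "z \<in> ball z0 (2 * r)" for z
      using that sub r1 r2 by (intro holomorphic_on_subset[OF hol2]) auto
    show "norm (F (z, w)) \<le> B" if "z \<in> ball z0 (2 * r)" "w \<in> ball w0 (2 * r)" for z w
      using that sub by (intro B) auto
  qed
  then show "\<exists>a b. (F has_derivative (\<lambda>(h, k). a * h + b * k)) (at p within nonreal2)"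
    unfolding p using has_derivative_at_withinI by blast
qed

lemma holomorphic2_on_slice:
  assumes "holomorphic2_on F nonreal2"
  shows "w \<in> - \<real> \<Longrightarrow> (\<lambda>z. F (z, w)) holomorphic_on (- \<real>)"
    and "w \<in> - \<real> \<Longrightarrow> (\<lambda>z. F (w, z)) holomorphic_on (- \<real>)"
proof -
  assume w: "w \<in> - \<real>"
  show "(\<lambda>z. F (z, w)) holomorphic_on (- \<real>)"
    unfolding holomorphic_on_open[OF open_nonreal]
  proof
    fix z :: complex assume z: "z \<in> - \<real>"
    then have zw: "(z, w) \<in> nonreal2" using w by (simp add: nonreal2_def)
    with assms obtain a b where "(F has_derivative (\<lambda>(h, k). a * h + b * k)) (at (z, w) within nonreal2)"
      unfolding holomorphic2_on_def by blast
    then have F': "(F has_derivative (\<lambda>(h, k). a * h + b * k)) (at (z, w))"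
      by (simp only: at_within_open[OF zw open_nonreal2])
    have d: "((\<lambda>z. (z, w)) has_derivative (\<lambda>h. (h, 0))) (at z)"
      by (rule has_derivative_Pair[OF has_derivative_ident has_derivative_const])
    have "((\<lambda>z. F (z, w)) has_derivative (\<lambda>h. (\<lambda>(h, k). a * h + b * k) (h, 0))) (at z)"
      by (rule has_derivative_compose[OF d F'])
    moreover have "(\<lambda>h. (\<lambda>(h, k). a * h + b * k) (h, 0)) = (*) a" by (simp add: fun_eq_iff)
    ultimately show "\<exists>f'. ((\<lambda>z. F (z, w)) has_field_derivative f') (at z)"
      unfolding has_field_derivative_def by (intro exI[of _ a]) simp
  qed
  show "(\<lambda>z. F (w, z)) holomorphic_on (- \<real>)"
    unfolding holomorphic_on_open[OF open_nonreal]
  proof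
    fix z :: complex assume z: "z \<in> - \<real>"
    then have zw: "(w, z) \<in> nonreal2" using w by (simp add: nonreal2_def)
    with assms obtain a b where "(F has_derivative (\<lambda>(h, k). a * h + b * k)) (at (w, z) within nonreal2)"
      unfolding holomorphic2_on_def by blast
    then have F': "(F has_derivative (\<lambda>(h, k). a * h + b * k)) (at (w, z))"
      by (simp only: at_within_open[OF zw open_nonreal2])
    have d: "((\<lambda>z. (w, z)) has_derivative (\<lambda>h. (0, h))) (at z)"
      by (rule has_derivative_Pair[OF has_derivative_const has_derivative_ident])
    have "((\<lambda>z. F (w, z)) has_derivative (\<lambda>h. (\<lambda>(h, k). a * h + b * k) (0, h))) (at z)"
      by (rule has_derivative_compose[OF d F'])
    moreover have "(\<lambda>h. (\<lambda>(h, k). a * h + b * k) (0, h)) = (*) b" by (simp add: fun_eq_iff)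
    ultimately show "\<exists>f'. ((\<lambda>z. F (w, z)) has_field_derivative f') (at z)"
      unfolding has_field_derivative_def by (intro exI[of _ b]) simp
  qed
qed

text \<open>Both half planes are reached at once because a Stolz pair meets each of them.\<close>

lemma nonreal_half_plane:
  assumes "\<alpha> > 0" "\<beta> > 0" "z \<in> - (\<real> :: complex set)"
  obtains H where "open H" "connected H" "H \<subseteq> - \<real>" "z \<in> H" "H \<inter> stolz_pair \<alpha> \<beta> \<noteq> {}"
proof (cases "Im z > 0")
  case True
  show ?thesis
  proof (rule that)
    show "open {z. Im z > 0}" by (rule open_halfspace_Im_gt)
    show "connected {z. Im z > 0}" by (intro convex_connected convex_halfspace_Im_gt)
    have "cnj (stolz_seq \<beta> 0) \<in> stolz_pair \<alpha> \<beta>"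
      using stolz_seq(1)[OF assms(1,2), of 0] by (simp add: stolz_pair_iff)
    moreover have "Im (cnj (stolz_seq \<beta> 0)) > 0" using assms(2) by (simp add: stolz_seq_def)
    ultimately have "cnj (stolz_seq \<beta> 0) \<in> {z. Im z > 0} \<inter> stolz_pair \<alpha> \<beta>" by simp
    then show "{z. Im z > 0} \<inter> stolz_pair \<alpha> \<beta> \<noteq> {}" by blast
  qed (use True in \<open>auto simp: complex_is_Real_iff\<close>)
next
  case False
  then have neg: "Im z < 0" using assms(3) by (simp add: complex_is_Real_iff)
  show ?thesis
  proof (rule that)
    show "open {z. Im z < 0}" by (rule open_halfspace_Im_lt)
    show "connected {z. Im z < 0}" by (intro convex_connected convex_halfspace_Im_lt)
    have "Im (stolz_seq \<beta> 0) < 0" using assms(2) by (simp add: stolz_seq_def)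
    then have "stolz_seq \<beta> 0 \<in> {z. Im z < 0} \<inter> stolz_pair \<alpha> \<beta>"
      using stolz_seq(1)[OF assms(1,2), of 0] by simp
    then show "{z. Im z < 0} \<inter> stolz_pair \<alpha> \<beta> \<noteq> {}" by blast
  qed (use neg in \<open>auto simp: complex_is_Real_iff\<close>)
qed

lemma holomorphic_eq_on_nonreal:
  assumes "\<alpha> > 0" "\<beta> > 0" and f: "f holomorphic_on (- \<real>)" and g: "g holomorphic_on (- \<real>)"
    and eq: "\<And>z. z \<in> stolz_pair \<alpha> \<beta> \<Longrightarrow> f z = g z" and z: "z \<in> - \<real>"
  shows "f z = g z"
proof -
  obtain H where H: "open H" "connected H" "H \<subseteq> - \<real>" "z \<in> H" "H \<inter> stolz_pair \<alpha> \<beta> \<noteq> {}"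
    using nonreal_half_plane[OF assms(1,2) z] by blast
  show ?thesis
    by (rule analytic_continuation_open[OF open_Int[OF H(1) open_stolz_pair] H(1,5,2) Int_lower1
          holomorphic_on_subset[OF f H(3)] holomorphic_on_subset[OF g H(3)] _ H(4)]) (use eq in blast)
qed

text \<open>The identity theorem is applied one variable at a time: in z with w in the Stolz pair,
  then in w for each nonreal z.\<close>

lemma holomorphic2_eq_on_nonreal2:
  assumes \<alpha>: "\<alpha> > 0" and \<beta>: "\<beta> > 0" and F: "holomorphic2_on F nonreal2" and G: "holomorphic2_on G nonreal2"
    and eq: "\<And>z w. z \<in> stolz_pair \<alpha> \<beta> \<Longrightarrow> w \<in> stolz_pair \<alpha> \<beta> \<Longrightarrow> F (z, w) = G (z, w)" and p: "p \<in> nonreal2"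
  shows "F p = G p"
proof -
  have nr: "z \<in> - \<real>" if "z \<in> stolz_pair \<alpha> \<beta>" for z
    using stolz_pair_Im[OF that] by (simp add: complex_is_Real_iff)
  have 1: "F (z, w) = G (z, w)" if z: "z \<in> - \<real>" and w: "w \<in> stolz_pair \<alpha> \<beta>" for z w
    using holomorphic_eq_on_nonreal[OF \<alpha> \<beta> holomorphic2_on_slice(1)[OF F nr[OF w]] holomorphic2_on_slice(1)[OF G nr[OF w]] _ z] eq w
    by blast
  obtain z w where zw: "p = (z, w)" "z \<in> - \<real>" "w \<in> - \<real>" using p by (auto simp: nonreal2_def)
  show ?thesis unfolding zw(1)
    using holomorphic_eq_on_nonreal[OF \<alpha> \<beta> holomorphic2_on_slice(2)[OF F zw(2)] holomorphic2_on_slice(2)[OF G zw(2)] _ zw(3)] 1 zw(2)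
    by blast
qed

text \<open>Convergence spreads in z for w in the Stolz pair, then in w for every nonreal z. A last
  pass in z, now for every nonreal w, makes the limit holomorphic in z as well; Osgood's lemma joins
  the variables.\<close>

proposition Vitali_nonreal2:
  fixes \<Phi> :: "nat \<Rightarrow> complex \<times> complex \<Rightarrow> complex"
  assumes \<alpha>: "\<alpha> > 0" and \<beta>: "\<beta> > 0"
    and hol1: "\<And>n w. w \<in> - \<real> \<Longrightarrow> (\<lambda>z. \<Phi> n (z, w)) holomorphic_on (- \<real>)"
    and hol2: "\<And>n z. z \<in> - \<real> \<Longrightarrow> (\<lambda>w. \<Phi> n (z, w)) holomorphic_on (- \<real>)"
    and bd: "\<And>K K'. compact K \<Longrightarrow> compact K' \<Longrightarrow> K \<subseteq> - \<real> \<Longrightarrow> K' \<subseteq> - \<real> \<Longrightarrow>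
      \<exists>B. \<forall>n. \<forall>z \<in> K. \<forall>w \<in> K'. norm (\<Phi> n (z, w)) \<le> B"
    and lim: "\<And>z w. z \<in> stolz_pair \<alpha> \<beta> \<Longrightarrow> w \<in> stolz_pair \<alpha> \<beta> \<Longrightarrow> (\<lambda>n. \<Phi> n (z, w)) \<longlonglongrightarrow> F (z, w)"
  obtains E where "holomorphic2_on E nonreal2"
    "\<And>z w. z \<in> stolz_pair \<alpha> \<beta> \<Longrightarrow> w \<in> stolz_pair \<alpha> \<beta> \<Longrightarrow> E (z, w) = F (z, w)"
proof -
  let ?S = "stolz_pair \<alpha> \<beta>"
  have nr: "z \<in> - \<real>" if "z \<in> ?S" for z
    using stolz_pair_Im[OF that] by (simp add: complex_is_Real_iff)
  \<comment> \<open>The nonreal numbers are disconnected, so Vitali's theorem is applied in a single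
    half plane at a time. \<open>lh\<close> records what can be glued afterwards: a holomorphic
    limit near each point.\<close>
  define lh where "lh f z \<longleftrightarrow> (\<exists>H g. open H \<and> z \<in> H \<and> g holomorphic_on H \<and> (\<forall>z \<in> H. (\<lambda>n. f n z) \<longlonglongrightarrow> g z))"
    for f :: "nat \<Rightarrow> complex \<Rightarrow> complex" and z
  have V: "lh f z"
    if z: "z \<in> - \<real>" and hol: "\<And>n. f n holomorphic_on (- \<real>)"
      and b: "\<And>K. compact K \<Longrightarrow> K \<subseteq> - \<real> \<Longrightarrow> \<exists>B. \<forall>n. \<forall>z \<in> K. norm (f n z) \<le> B"
      and l: "\<And>z. z \<in> ?S \<Longrightarrow> convergent (\<lambda>n. f n z)" for f :: "nat \<Rightarrow> complex \<Rightarrow> complex" and z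
  proof -
    obtain H where H: "open H" "connected H" "H \<subseteq> - \<real>" "z \<in> H" "H \<inter> ?S \<noteq> {}"
      using nonreal_half_plane[OF \<alpha> \<beta> z] by blast
    have "\<exists>g. g holomorphic_on H \<and> (\<forall>z \<in> H. (\<lambda>n. f n z) \<longlonglongrightarrow> g z)"
    proof (rule Vitali_convergence[of H f "H \<inter> ?S" "\<lambda>z. lim (\<lambda>n. f n z)"])
      show "f n holomorphic_on H" for n using hol H(3) by (rule holomorphic_on_subset)
      show "\<exists>B. \<forall>n. \<forall>z \<in> K. norm (f n z) \<le> B" if "compact K" "K \<subseteq> H" for K
        by (rule b[OF that(1) order_trans[OF that(2) H(3)]])
      show "open (H \<inter> ?S)" by (rule open_Int[OF H(1) open_stolz_pair])
      show "(\<lambda>n. f n z) \<longlonglongrightarrow> lim (\<lambda>n. f n z)" if "z \<in> H \<inter> ?S" for z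
        using l[of z] that unfolding convergent_LIMSEQ_iff by simp
    qed (use H in simp_all)
    then show ?thesis unfolding lh_def using H(1,4) by blast
  qed
  have lhc: "convergent (\<lambda>n. f n z)" if "lh f z" for f z
    using that unfolding lh_def by (auto intro: convergentI)
  have b1: "\<exists>B. \<forall>n. \<forall>z \<in> K. norm (\<Phi> n (z, w)) \<le> B" if "compact K" "K \<subseteq> - \<real>" "w \<in> - \<real>" for K w
    using bd[of K "{w}"] that by auto
  have b2: "\<exists>B. \<forall>n. \<forall>w \<in> K. norm (\<Phi> n (z, w)) \<le> B" if "compact K" "K \<subseteq> - \<real>" "z \<in> - \<real>" for K z
    using bd[of "{z}" K] that by auto
  have c1: "convergent (\<lambda>n. \<Phi> n (z, w))" if z: "z \<in> - \<real>" and w: "w \<in> ?S" for z w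
  proof -
    have "lh (\<lambda>n z. \<Phi> n (z, w)) z"
    proof (rule V[OF z])
      show "(\<lambda>z. \<Phi> n (z, w)) holomorphic_on - \<real>" for n by (rule hol1[OF nr[OF w]])
      show "\<exists>B. \<forall>n. \<forall>z \<in> K. norm (\<Phi> n (z, w)) \<le> B" if "compact K" "K \<subseteq> - \<real>" for K by (rule b1[OF that nr[OF w]])
      show "convergent (\<lambda>n. \<Phi> n (z, w))" if "z \<in> ?S" for z using lim[OF that w] by (rule convergentI)
    qed
    from lhc[OF this] show ?thesis .
  qed
  have l2: "lh (\<lambda>n w. \<Phi> n (z, w)) w" if z: "z \<in> - \<real>" and w: "w \<in> - \<real>" for z w
  proof (rule V[OF w])
    show "(\<lambda>w. \<Phi> n (z, w)) holomorphic_on - \<real>" for n by (rule hol2[OF z])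
    show "\<exists>B. \<forall>n. \<forall>w \<in> K. norm (\<Phi> n (z, w)) \<le> B" if "compact K" "K \<subseteq> - \<real>" for K by (rule b2[OF that z])
    show "convergent (\<lambda>n. \<Phi> n (z, w))" if "w \<in> ?S" for w by (rule c1[OF z that])
  qed
  have c2: "convergent (\<lambda>n. \<Phi> n (z, w))" if z: "z \<in> - \<real>" and w: "w \<in> - \<real>" for z w
    using lhc[OF l2[OF z w]] .
  have l1: "lh (\<lambda>n z. \<Phi> n (z, w)) z" if z: "z \<in> - \<real>" and w: "w \<in> - \<real>" for z w
  proof (rule V[OF z])
    show "(\<lambda>z. \<Phi> n (z, w)) holomorphic_on - \<real>" for n by (rule hol1[OF w])
    show "\<exists>B. \<forall>n. \<forall>z \<in> K. norm (\<Phi> n (z, w)) \<le> B" if "compact K" "K \<subseteq> - \<real>" for K by (rule b1[OF that w])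
    show "convergent (\<lambda>n. \<Phi> n (z, w))" if "z \<in> ?S" for z by (rule c2[OF nr[OF that] w])
  qed
  define E where "E p = lim (\<lambda>n. \<Phi> n p)" for p
  have El: "(\<lambda>n. \<Phi> n (z, w)) \<longlonglongrightarrow> E (z, w)" if "z \<in> - \<real>" "w \<in> - \<real>" for z w
    using c2[OF that] unfolding E_def convergent_LIMSEQ_iff .
  have local: "h holomorphic_on (- \<real>)"
    if l: "\<And>z. z \<in> - \<real> \<Longrightarrow> lh f z" and c: "\<And>z. z \<in> - \<real> \<Longrightarrow> (\<lambda>n. f n z) \<longlonglongrightarrow> h z"
    for f :: "nat \<Rightarrow> complex \<Rightarrow> complex" and h
    unfolding holomorphic_on_open[OF open_nonreal]
  proof
    fix z :: complex assume z: "z \<in> - \<real>"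
    obtain H g where H: "open H" "z \<in> H" "g holomorphic_on H" "\<forall>z \<in> H. (\<lambda>n. f n z) \<longlonglongrightarrow> g z"
      using l[OF z] unfolding lh_def by (elim exE conjE)
    have g': "g holomorphic_on H \<inter> - \<real>" using H(3) by (rule holomorphic_on_subset) simp
    have "h holomorphic_on H \<inter> - \<real>"
    proof (rule holomorphic_transform[OF g'])
      fix x assume "x \<in> H \<inter> - \<real>"
      then show "g x = h x" using H(4) c[of x] LIMSEQ_unique[of "\<lambda>n. f n x" "g x" "h x"] by simp
    qed
    then have "(h has_field_derivative deriv h z) (at z)"
      by (rule holomorphic_derivI) (use H z open_nonreal in auto)
    then show "\<exists>f'. (h has_field_derivative f') (at z)" by (rule exI)
  qed
  show ?thesis
  proof (rule that)
    show "holomorphic2_on E nonreal2"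
    proof (rule separately_holomorphic_imp_holomorphic2)
      show "(\<lambda>z. E (z, w)) holomorphic_on - \<real>" if w: "w \<in> - \<real>" for w
        by (rule local[of "\<lambda>n z. \<Phi> n (z, w)"]) (rule l1[OF _ w], assumption, rule El[OF _ w])
      show "(\<lambda>w. E (z, w)) holomorphic_on - \<real>" if z: "z \<in> - \<real>" for z
        by (rule local[of "\<lambda>n w. \<Phi> n (z, w)"]) (rule l2[OF z], assumption, rule El[OF z])
      fix K K' :: "complex set" assume K: "compact K" "compact K'" "K \<subseteq> - \<real>" "K' \<subseteq> - \<real>"
      obtain B where B: "\<forall>n. \<forall>z \<in> K. \<forall>w \<in> K'. norm (\<Phi> n (z, w)) \<le> B" using bd[OF K] by (elim exE)
      have "norm (E (z, w)) \<le> B" if "z \<in> K" "w \<in> K'" for z w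
      proof (rule LIMSEQ_le_const2[OF tendsto_norm[OF El]])
        show "z \<in> - \<real>" "w \<in> - \<real>" using that K(3,4) by auto
        show "\<exists>N. \<forall>n\<ge>N. norm (\<Phi> n (z, w)) \<le> B" using B that by simp
      qed
      then show "\<exists>B. \<forall>z \<in> K. \<forall>w \<in> K'. norm (E (z, w)) \<le> B" by (intro exI[of _ B] ballI)
    qed
    show "E (z, w) = F (z, w)" if "z \<in> ?S" "w \<in> ?S" for z w
      by (rule LIMSEQ_unique[OF El[OF nr[OF that(1)] nr[OF that(2)]] lim[OF that]])
  qed
qed

section \<open>Uniqueness of the transforms\<close>

lemma has_R_transform_mono:
  assumes "has_R_transform m \<alpha> \<beta> R" "\<alpha>' \<le> \<alpha>" "\<beta>' \<le> \<beta>"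
  shows "has_R_transform m \<alpha>' \<beta>' R"
proof -
  have sub: "stolz_pair \<alpha>' \<beta>' \<subseteq> stolz_pair \<alpha> \<beta>" by (rule stolz_pair_mono) (use assms in auto)
  show ?thesis
    using assms(1) sub unfolding has_R_transform_def
    by (auto intro: holomorphic_on_subset tendsto_within_subset)
qed

lemma borel_prob_marginal:
  assumes "borel_prob \<nu>"
  shows "borel_prob (marginal1 \<nu>)" "borel_prob (marginal2 \<nu>)"
proof -
  interpret prob_space \<nu> using assms by (simp add: borel_prob_def)
  have "sets \<nu> = sets borel" using assms by (simp add: borel_prob_def)
  then have [measurable_cong]: "sets \<nu> = sets (borel \<Otimes>\<^sub>M borel)" by (simp only: borel_prod)
  show "borel_prob (marginal1 \<nu>)" "borel_prob (marginal2 \<nu>)"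
    unfolding borel_prob_def marginal1_def marginal2_def by (auto intro!: prob_space_distr)
qed

lemma stolz_pair_shrink_limit:
  assumes \<alpha>: "\<alpha> > 0" and z: "\<And>n. z n \<in> stolz_pair \<alpha> (b * inverse (real (Suc n)))"
  shows "z \<longlonglongrightarrow> 0"
proof (rule Lim_null_comparison)
  show "\<forall>\<^sub>F n in sequentially. norm (z n) \<le> (1 + \<alpha>) * (b * inverse (real (Suc n)))"
  proof (intro always_eventually allI)
    fix n
    have "norm (z n) \<le> (1 + \<alpha>) * \<bar>Im (z n)\<bar>" by (rule stolz_pair_norm_le[OF z])
    also have "\<dots> \<le> (1 + \<alpha>) * (b * inverse (real (Suc n)))"
      using z[of n] \<alpha> by (intro mult_left_mono) (auto simp: stolz_pair_iff simp del: of_nat_Suc)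
    finally show "norm (z n) \<le> (1 + \<alpha>) * (b * inverse (real (Suc n)))" .
  qed
  have "(\<lambda>n. (1 + \<alpha>) * (b * inverse (real (Suc n)))) \<longlonglongrightarrow> (1 + \<alpha>) * (b * 0)"
    by (intro tendsto_intros LIMSEQ_inverse_real_of_nat)
  then show "(\<lambda>n. (1 + \<alpha>) * (b * inverse (real (Suc n)))) \<longlonglongrightarrow> 0" by simp
qed

text \<open>Two preimages of \<open>z\<close> under the Cauchy transform would make a divided difference of it
  vanish, which after normalisation tends to the total mass instead.\<close>

proposition R_transform_unique:
  assumes m: "borel_prob m" and \<alpha>: "\<alpha> > 0" and \<beta>: "\<beta> > 0"
    and R: "has_R_transform m \<alpha> \<beta> R" and R': "has_R_transform m \<alpha> \<beta> R'"
  shows "\<exists>b>0. b \<le> \<beta> \<and> (\<forall>z \<in> stolz_pair \<alpha> b. R z = R' z)"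
proof (rule ccontr)
  assume contra: "\<not> ?thesis"
  interpret prob_space m using m by (simp add: borel_prob_def)
  have [measurable_cong]: "sets m = sets borel" using m by (simp add: borel_prob_def)
  define c where "c = 1 / (1 + \<alpha>)"
  have c2: "c / 2 > 0" and c4: "c / 4 > 0" using \<alpha> by (auto simp: c_def)
  obtain b1 where b1: "b1 > 0" "b1 \<le> \<beta>" "\<forall>z \<in> stolz_pair \<alpha> b1. norm (z * R z) \<le> c / 2"
    using has_R_transform_small[OF R \<alpha> \<beta> c2] by blast
  obtain b2 where b2: "b2 > 0" "b2 \<le> \<beta>" "\<forall>z \<in> stolz_pair \<alpha> b2. norm (z * R' z) \<le> c / 2"
    using has_R_transform_small[OF R' \<alpha> \<beta> c2] by blast
  define b where "b = min b1 b2"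
  have b: "b > 0" "b \<le> \<beta>" using b1 b2 by (auto simp: b_def)
  have bn: "b * inverse (real (Suc n)) > 0" "b * inverse (real (Suc n)) \<le> b" for n
  proof -
    show "b * inverse (real (Suc n)) > 0" using b by simp
    have "inverse (real (Suc n)) \<le> 1" by (simp add: field_simps)
    then show "b * inverse (real (Suc n)) \<le> b" using b by (simp add: mult_left_le)
  qed
  have "\<exists>z. z \<in> stolz_pair \<alpha> (b * inverse (real (Suc n))) \<and> R z \<noteq> R' z" for n
    using contra bn(1)[of n] order_trans[OF bn(2)[of n] b(2)] by blast
  then have "\<exists>z. \<forall>n. z n \<in> stolz_pair \<alpha> (b * inverse (real (Suc n))) \<and> R (z n) \<noteq> R' (z n)"
    by (intro choice allI)
  then obtain z where z: "\<And>n. z n \<in> stolz_pair \<alpha> (b * inverse (real (Suc n)))" "\<And>n. R (z n) \<noteq> R' (z n)"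
    by blast
  have zlim: "z \<longlonglongrightarrow> 0" by (rule stolz_pair_shrink_limit[OF \<alpha> z(1)])
  have zb: "z n \<in> stolz_pair \<alpha> b" "z n \<in> stolz_pair \<alpha> b1" "z n \<in> stolz_pair \<alpha> b2" "z n \<in> stolz_pair \<alpha> \<beta>" for n
    using z(1)[of n] bn(2)[of n] b by (auto simp: stolz_pair_iff b_def)
  have small: "norm (z n * R (z n)) \<le> c / 2" "norm (z n * R' (z n)) \<le> c / 2" for n
    using b1(3) b2(3) zb[of n] by auto
  define k k' where "k n = 1 / z n + R (z n)" and "k' n = 1 / z n + R' (z n)" for n
  note est = shifted_inverse_estimates[OF zb(1) \<alpha> c_def small(1), folded k_def]
  note est' = shifted_inverse_estimates[OF zb(1) \<alpha> c_def small(2), folded k'_def]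
  have inf: "filterlim k at_infinity sequentially" "filterlim k' at_infinity sequentially"
    unfolding k_def k'_def
    by (rule shifted_inverse_at_infinity[OF zb(1) \<alpha> c_def zlim small(1)])
      (rule shifted_inverse_at_infinity[OF zb(1) \<alpha> c_def zlim small(2)])
  \<comment> \<open>Placing m on the diagonal turns the divided difference of its Cauchy transform
    into a two-variable Cauchy transform, to which \<open>cauchy_transform2_mass\<close>
    applies.\<close>
  define N where "N = distr m (borel \<Otimes>\<^sub>M borel) (\<lambda>x. (x, x))"
  have N: "finite_measure N" "sets N = sets borel"
    unfolding N_def by (intro finite_measure_distr; measurable) (simp add: borel_prod)
  have "cauchy_transform2 N (k n) (k' n) = 0" for n
  proof -
    have int: "integrable m (\<lambda>x. 1 / (a - of_real x))" if "Im a \<noteq> 0" for a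
      using integrable_resolvent[of "\<lambda>x. x" a] that by simp
    have "(\<integral>x. 1 / (k n - of_real x) - 1 / (k' n - of_real x) \<partial>m) = z n - z n"
      using R R' zb(4)[of n] int[OF est(2)[of n]] int[OF est'(2)[of n]]
      unfolding has_R_transform_def cauchy_transform_def k_def k'_def
      by (subst Bochner_Integration.integral_diff) auto
    also have "(\<integral>x. 1 / (k n - of_real x) - 1 / (k' n - of_real x) \<partial>m) =
        (k' n - k n) * (\<integral>x. 1 / (k n - of_real x) * (1 / (k' n - of_real x)) \<partial>m)"
      unfolding resolvent_diff[OF est(2) est'(2)] by (rule integral_mult_right_zero)
    also have "(\<integral>x. 1 / (k n - of_real x) * (1 / (k' n - of_real x)) \<partial>m) = cauchy_transform2 N (k n) (k' n)"
      unfolding cauchy_transform2_def N_def by (subst integral_distr) simp_all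
    finally show ?thesis using z(2)[of n] by (simp add: k_def k'_def)
  qed
  moreover have "(\<lambda>n. k n * k' n * cauchy_transform2 N (k n) (k' n)) \<longlonglongrightarrow> of_real (measure N (space N))"
    by (rule cauchy_transform2_mass[OF N c4 est(6) est(4) inf(1) est'(6) est'(4) inf(2)])
  ultimately have "(\<lambda>n. 0) \<longlonglongrightarrow> complex_of_real (measure N (space N))" by simp
  then have "of_real (measure N (space N)) = (0::complex)" by (rule LIMSEQ_unique) (rule tendsto_const)
  moreover have "measure N (space N) = 1"
    using prob_space_distr[of "\<lambda>x. (x, x)" "borel \<Otimes>\<^sub>M borel"] prob_space.prob_space[of N] unfolding N_def by simp
  ultimately show False by simp
qed

text \<open>\<open>R_transform_unique\<close> makes the R-transforms of each marginal agree on some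
  smaller Stolz pair, hence also both values of h. Agreement there is the starting point for the
  identity theorem on \<open>nonreal2\<close>.\<close>

lemma bifree_R_transform_unique:
  assumes \<nu>: "borel_prob \<nu>" and pos: "\<alpha> > 0" "\<beta> > 0" "\<alpha>' > 0" "\<beta>' > 0"
    and E: "has_bifree_R_transform \<nu> \<alpha> \<beta> E" and E': "has_bifree_R_transform \<nu> \<alpha>' \<beta>' E'"
  shows "\<exists>a>0. \<exists>b>0. \<forall>z \<in> stolz_pair a b. \<forall>w \<in> stolz_pair a b. E (z, w) = E' (z, w)"
proof -
  define a where "a = min \<alpha> \<alpha>'"
  define b0 where "b0 = min \<beta> \<beta>'"
  have ab: "a > 0" "b0 > 0" "a \<le> \<alpha>" "a \<le> \<alpha>'" "b0 \<le> \<beta>" "b0 \<le> \<beta>'" using pos by (auto simp: a_def b0_def)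
  obtain R1 R2 where R: "has_R_transform (marginal1 \<nu>) \<alpha> \<beta> R1" "has_R_transform (marginal2 \<nu>) \<alpha> \<beta> R2"
    and ER: "\<forall>(z, w) \<in> stolz_product \<alpha> \<beta>. h_quotient \<nu> R1 R2 z w \<noteq> 0 \<and>
      E (z, w) = z * R1 z + w * R2 w + (1 - 1 / h_quotient \<nu> R1 R2 z w)"
    using E unfolding has_bifree_R_transform_def by blast
  obtain Q1 Q2 where Q: "has_R_transform (marginal1 \<nu>) \<alpha>' \<beta>' Q1" "has_R_transform (marginal2 \<nu>) \<alpha>' \<beta>' Q2"
    and EQ: "\<forall>(z, w) \<in> stolz_product \<alpha>' \<beta>'. h_quotient \<nu> Q1 Q2 z w \<noteq> 0 \<and>
      E' (z, w) = z * Q1 z + w * Q2 w + (1 - 1 / h_quotient \<nu> Q1 Q2 z w)"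
    using E' unfolding has_bifree_R_transform_def by blast
  obtain b1 where b1: "b1 > 0" "b1 \<le> b0" "\<forall>z \<in> stolz_pair a b1. R1 z = Q1 z"
    using R_transform_unique[OF borel_prob_marginal(1)[OF \<nu>] ab(1,2) has_R_transform_mono[OF R(1) ab(3,5)]
        has_R_transform_mono[OF Q(1) ab(4,6)]] by blast
  obtain b2 where b2: "b2 > 0" "b2 \<le> b0" "\<forall>z \<in> stolz_pair a b2. R2 z = Q2 z"
    using R_transform_unique[OF borel_prob_marginal(2)[OF \<nu>] ab(1,2) has_R_transform_mono[OF R(2) ab(3,5)]
        has_R_transform_mono[OF Q(2) ab(4,6)]] by blast
  define b where "b = min b1 b2"
  have sub: "stolz_pair a b \<subseteq> stolz_pair a b1" "stolz_pair a b \<subseteq> stolz_pair a b2"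
    "stolz_pair a b \<subseteq> stolz_pair \<alpha> \<beta>" "stolz_pair a b \<subseteq> stolz_pair \<alpha>' \<beta>'"
    by (rule stolz_pair_mono; use ab b1 b2 in \<open>simp add: b_def min_le_iff_disj\<close>)+
  have "E (z, w) = E' (z, w)" if zw: "z \<in> stolz_pair a b" "w \<in> stolz_pair a b" for z w
  proof -
    have eq: "R1 z = Q1 z" "R2 w = Q2 w" using zw sub b1(3) b2(3) by auto
    then have h: "h_quotient \<nu> R1 R2 z w = h_quotient \<nu> Q1 Q2 z w" by (simp add: h_quotient_def)
    have mem: "(z, w) \<in> stolz_product \<alpha> \<beta>" "(z, w) \<in> stolz_product \<alpha>' \<beta>'" using zw sub by (auto simp: stolz_product_def)
    have "E (z, w) = z * R1 z + w * R2 w + (1 - 1 / h_quotient \<nu> R1 R2 z w)" using bspec[OF ER mem(1)] by simp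
    moreover have "E' (z, w) = z * Q1 z + w * Q2 w + (1 - 1 / h_quotient \<nu> Q1 Q2 z w)" using bspec[OF EQ mem(2)] by simp
    ultimately show ?thesis by (simp only: eq h)
  qed
  moreover have "b > 0" using b1 b2 by (simp add: b_def)
  ultimately show ?thesis using ab(1) by blast
qed

text \<open>One extension is enough for the choice in \<open>bifree_R\<close> to be meaningful;
  uniqueness near 0 and the identity theorem then fix the chosen values on
  \<open>nonreal2\<close>.\<close>

lemma bifree_R_eq:
  assumes \<nu>: "borel_prob \<nu>" and pos: "\<alpha> > 0" "\<beta> > 0"
    and E: "has_bifree_R_transform \<nu> \<alpha> \<beta> E" and hol: "holomorphic2_on E nonreal2"
  shows "holomorphic2_on (bifree_R \<nu>) nonreal2"
    and "\<exists>\<alpha>>0. \<exists>\<beta>>0. has_bifree_R_transform \<nu> \<alpha> \<beta> (bifree_R \<nu>)"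
    and "p \<in> nonreal2 \<Longrightarrow> bifree_R \<nu> p = E p"
proof -
  have "\<exists>F. holomorphic2_on F nonreal2 \<and> (\<exists>\<alpha>>0. \<exists>\<beta>>0. has_bifree_R_transform \<nu> \<alpha> \<beta> F)"
    using assms by blast
  from someI_ex[OF this] show spec: "holomorphic2_on (bifree_R \<nu>) nonreal2"
    "\<exists>\<alpha>>0. \<exists>\<beta>>0. has_bifree_R_transform \<nu> \<alpha> \<beta> (bifree_R \<nu>)"
    unfolding bifree_R_def by auto
  assume p: "p \<in> nonreal2"
  obtain \<alpha>' \<beta>' where pos': "\<alpha>' > 0" "\<beta>' > 0" "has_bifree_R_transform \<nu> \<alpha>' \<beta>' (bifree_R \<nu>)" using spec(2) by blast
  obtain a b where "a > 0" "b > 0" "\<forall>z \<in> stolz_pair a b. \<forall>w \<in> stolz_pair a b. bifree_R \<nu> (z, w) = E (z, w)"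
    using bifree_R_transform_unique[OF \<nu> pos'(1,2) pos pos'(3) E] by blast
  then show "bifree_R \<nu> p = E p"
    using holomorphic2_eq_on_nonreal2[OF _ _ spec(1) hol _ p] by blast
qed

section \<open>Holomorphic extension of the transform of a law in \<open>BID\<close>\<close>

lemma norm_jump_mult_le:
  assumes "Im a \<noteq> 0" "Im b \<noteq> 0"
  shows "norm (of_real s / (a - of_real s) * (of_real t / (b - of_real t)))
    \<le> (resolvent_const a * sq_ratio s + resolvent_const b * sq_ratio t) / 2"
proof -
  let ?u = "norm (of_real s / (a - of_real s))" and ?v = "norm (of_real t / (b - of_real t))"
  have "?u * ?v \<le> (?u\<^sup>2 + ?v\<^sup>2) / 2" using sum_squares_bound[of ?u ?v] by simp
  also have "\<dots> \<le> (resolvent_const a * sq_ratio s + resolvent_const b * sq_ratio t) / 2"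
    by (intro divide_right_mono add_mono norm_jump_sq_le assms) auto
  finally show ?thesis by (simp only: norm_mult)
qed

lemma (in prob_space) holomorphic_integral_jump:
  fixes \<phi> :: "'a \<Rightarrow> complex" and f :: "'a \<Rightarrow> real"
  assumes [measurable]: "\<phi> \<in> borel_measurable M" "f \<in> borel_measurable M"
    and bd: "\<And>x. norm (\<phi> x) \<le> B"
  shows "(\<lambda>z. \<integral>x. of_real (f x) / (1 / z - of_real (f x)) * \<phi> x \<partial>M) holomorphic_on (- \<real>)"
proof -
  have inv: "Im (1 / z) \<noteq> 0" if "z \<in> - \<real>" for z
    using that by (auto simp: notin_Reals_iff_Im Im_divide power2_eq_square)
  have B: "B \<ge> 0" using order_trans[OF norm_ge_zero bd] .
  have int: "integrable M \<phi>" by (rule integrable_const_bound[where B = B]) (use bd in auto)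
  have eq: "(\<integral>x. of_real (f x) / (1 / z - of_real (f x)) * \<phi> x \<partial>M) =
      1 / z * (\<integral>x. \<phi> x / (1 / z - of_real (f x)) \<partial>M) - (\<integral>x. \<phi> x \<partial>M)" if z: "z \<in> - \<real>" for z
  proof -
    have int2: "integrable M (\<lambda>x. \<phi> x / (1 / z - of_real (f x)))"
    proof (rule integrable_const_bound[where B = "B * (1 / \<bar>Im (1 / z)\<bar>)"])
      have "norm (\<phi> x / (1 / z - of_real (f x))) \<le> B * (1 / \<bar>Im (1 / z)\<bar>)" for x
      proof -
        have "norm (\<phi> x / (1 / z - of_real (f x))) = norm (\<phi> x) * norm (1 / (1 / z - of_real (f x)))"
          by (simp add: norm_divide)
        also have "\<dots> \<le> B * (1 / \<bar>Im (1 / z)\<bar>)"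
          by (intro mult_mono bd norm_resolvent_le inv z B) auto
        finally show ?thesis .
      qed
      then show "AE x in M. norm (\<phi> x / (1 / z - of_real (f x))) \<le> B * (1 / \<bar>Im (1 / z)\<bar>)" by simp
    qed measurable
    have "(\<integral>x. of_real (f x) / (1 / z - of_real (f x)) * \<phi> x \<partial>M) =
        (\<integral>x. 1 / z * (\<phi> x / (1 / z - of_real (f x))) - \<phi> x \<partial>M)"
      unfolding jump_resolvent[OF inv[OF z]] by (simp add: left_diff_distrib)
    also have "\<dots> = 1 / z * (\<integral>x. \<phi> x / (1 / z - of_real (f x)) \<partial>M) - (\<integral>x. \<phi> x \<partial>M)"
      by (subst Bochner_Integration.integral_diff[OF integrable_mult_right[OF int2] int])
        (simp only: integral_mult_right_zero)
    finally show ?thesis .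
  qed
  have "(\<lambda>z. \<integral>x. \<phi> x / (1 / z - of_real (f x)) \<partial>M) holomorphic_on (- \<real>)"
  proof (rule holomorphic_on_compose_gen[where f = "\<lambda>z. 1 / z" and t = "- \<real>", unfolded o_def])
    show "(\<lambda>a. \<integral>x. \<phi> x / (a - of_real (f x)) \<partial>M) holomorphic_on (- \<real>)"
      by (rule holomorphic_integral_resolvent[where B = B]) (use bd in auto)
    show "(\<lambda>z. 1 / z) holomorphic_on (- \<real>)" by (intro holomorphic_intros) auto
    show "(\<lambda>z. 1 / z) ` (- \<real>) \<subseteq> - (\<real> :: complex set)"
    proof (rule image_subsetI)
      show "1 / z \<in> - \<real>" if "z \<in> - \<real>" for z :: complex
        using inv[OF that] unfolding Compl_iff notin_Reals_iff_Im .
    qed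
  qed
  then have "(\<lambda>z. 1 / z * (\<integral>x. \<phi> x / (1 / z - of_real (f x)) \<partial>M) - (\<integral>x. \<phi> x \<partial>M)) holomorphic_on (- \<real>)"
    by (intro holomorphic_intros) auto
  then show ?thesis by (rule holomorphic_transform) (simp only: eq)
qed

lemma (in prob_space) jump_integral_bounds:
  assumes [measurable]: "f \<in> borel_measurable M" "g \<in> borel_measurable M" and a: "Im a \<noteq> 0" and b: "Im b \<noteq> 0"
  shows "integrable M (\<lambda>x. of_real (f x) / (a - of_real (f x)))"
    and "integrable M (\<lambda>x. of_real (f x) / (a - of_real (f x)) * (of_real (g x) / (b - of_real (g x))))"
    and "integrable M (\<lambda>x. sq_ratio (f x))"
    and "norm (\<integral>x. of_real (f x) / (a - of_real (f x)) * (of_real (g x) / (b - of_real (g x))) \<partial>M)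
      \<le> (resolvent_const a * (\<integral>x. sq_ratio (f x) \<partial>M) + resolvent_const b * (\<integral>x. sq_ratio (g x) \<partial>M)) / 2"
proof -
  have [measurable]: "(\<lambda>x. sq_ratio (f x)) \<in> borel_measurable M" "(\<lambda>x. sq_ratio (g x)) \<in> borel_measurable M"
    by measurable
  show "integrable M (\<lambda>x. of_real (f x) / (a - of_real (f x)))"
    by (rule integrable_const_bound[where B = "1 + norm a / \<bar>Im a\<bar>"])
      (use norm_resolvent_times_le[OF a] in auto)
  show int: "integrable M (\<lambda>x. of_real (f x) / (a - of_real (f x)) * (of_real (g x) / (b - of_real (g x))))"
  proof (rule integrable_const_bound[where B = "(1 + norm a / \<bar>Im a\<bar>) * (1 + norm b / \<bar>Im b\<bar>)"])
    have "norm (of_real (f x) / (a - of_real (f x)) * (of_real (g x) / (b - of_real (g x))))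
      \<le> (1 + norm a / \<bar>Im a\<bar>) * (1 + norm b / \<bar>Im b\<bar>)" for x
      unfolding norm_mult by (intro mult_mono norm_resolvent_times_le a b) auto
    then show "AE x in M. norm (of_real (f x) / (a - of_real (f x)) * (of_real (g x) / (b - of_real (g x))))
      \<le> (1 + norm a / \<bar>Im a\<bar>) * (1 + norm b / \<bar>Im b\<bar>)" by simp
  qed measurable
  show ints: "integrable M (\<lambda>x. sq_ratio (f x))"
    by (rule integrable_const_bound[where B = 1]) (use sq_ratio_bounds in auto)
  have intg: "integrable M (\<lambda>x. sq_ratio (g x))"
    by (rule integrable_const_bound[where B = 1]) (use sq_ratio_bounds in auto)
  have "norm (\<integral>x. of_real (f x) / (a - of_real (f x)) * (of_real (g x) / (b - of_real (g x))) \<partial>M)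
      \<le> (\<integral>x. (resolvent_const a * sq_ratio (f x) + resolvent_const b * sq_ratio (g x)) / 2 \<partial>M)"
    by (rule norm_integral_le[OF int _ norm_jump_mult_le[OF a b]]) (use ints intg in auto)
  also have "\<dots> = (resolvent_const a * (\<integral>x. sq_ratio (f x) \<partial>M) + resolvent_const b * (\<integral>x. sq_ratio (g x) \<partial>M)) / 2"
    using ints intg by simp
  finally show "norm (\<integral>x. of_real (f x) / (a - of_real (f x)) * (of_real (g x) / (b - of_real (g x))) \<partial>M)
      \<le> (resolvent_const a * (\<integral>x. sq_ratio (f x) \<partial>M) + resolvent_const b * (\<integral>x. sq_ratio (g x) \<partial>M)) / 2" .
qed

text \<open>This transports control of the integrated jump ratio from b to any other nonreal point:
  the correction is quadratic in the ratios and so bounded by \<open>sq_ratio\<close>.\<close>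

lemma jump_shift:
  assumes "Im a \<noteq> 0" "Im b \<noteq> 0"
  shows "a * (of_real s / (a - of_real s)) =
    b * (of_real s / (b - of_real s)) + (b - a) * (of_real s / (a - of_real s) * (of_real s / (b - of_real s)))"
  using diff_of_real_neq_0[OF assms(1), of s] diff_of_real_neq_0[OF assms(2), of s]
  by (simp add: divide_simps) (simp add: algebra_simps)

lemma resolvent_const_nonneg: "resolvent_const a \<ge> 0"
  by (simp add: resolvent_const_def)

lemma continuous_on_resolvent_const:
  "continuous_on (- \<real>) (\<lambda>z. resolvent_const (1 / z))"
proof -
  have "Im (1 / z) \<noteq> 0" "z \<noteq> 0" if "z \<in> - \<real>" for z
    using that by (auto simp: notin_Reals_iff_Im Im_divide power2_eq_square)
  then show ?thesis unfolding resolvent_const_def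
    by (intro continuous_intros) auto
qed

text \<open>At a purely imaginary point the real part of the jump ratio has a sign, so the convergence
  of the first-order term at one such point bounds it locally uniformly.\<close>

lemma first_order_locally_bounded:
  fixes \<mu> :: "nat \<Rightarrow> 'a measure" and f :: "'a \<Rightarrow> real"
  assumes p: "\<And>n. prob_space (\<mu> n)" and meas: "\<And>n. f \<in> borel_measurable (\<mu> n)" and \<beta>: "\<beta> > 0"
    and lim: "(\<lambda>n. of_nat (n + 2) * (\<integral>x. of_real (f x) / (1 / stolz_seq \<beta> 0 - of_real (f x)) \<partial>\<mu> n)) \<longlonglongrightarrow> l"
  obtains D :: "complex \<Rightarrow> real" and \<Sigma> where "continuous_on (- \<real>) D" "\<And>n. real (n + 2) * (\<integral>x. sq_ratio (f x) \<partial>\<mu> n) \<le> \<Sigma>"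
    "\<And>n z. z \<in> - \<real> \<Longrightarrow> norm (of_nat (n + 2) * (\<integral>x. of_real (f x) / (1 / z - of_real (f x)) \<partial>\<mu> n)) \<le> D z"
proof -
  define y where "y = 2 / \<beta>"
  have y: "y > 0" using \<beta> by (simp add: y_def)
  define a0 where "a0 = \<i> * complex_of_real y"
  have a0: "1 / stolz_seq \<beta> 0 = a0" using \<beta> by (simp add: stolz_seq_def a0_def y_def field_simps)
  have Im0: "Im a0 \<noteq> 0" using y by (simp add: a0_def)
  let ?L = "\<lambda>n a. of_nat (n + 2) * (\<integral>x. of_real (f x) / (a - of_real (f x)) \<partial>\<mu> n)"
  obtain \<Lambda> where \<Lambda>: "\<And>n. norm (?L n a0) \<le> \<Lambda>"
    using convergent_imp_Bseq[OF convergentI[OF lim]] unfolding a0 Bseq_def by blast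
  define \<Sigma> where "\<Sigma> = max 1 (y\<^sup>2) * \<Lambda>"
  have \<Sigma>: "real (n + 2) * (\<integral>x. sq_ratio (f x) \<partial>\<mu> n) \<le> \<Sigma>" for n
  proof -
    interpret prob_space "\<mu> n" by (rule p)
    note b = jump_integral_bounds[OF meas meas Im0 Im0]
    have "(\<integral>x. sq_ratio (f x) \<partial>\<mu> n) \<le> (\<integral>x. max 1 (y\<^sup>2) * (- Re (of_real (f x) / (a0 - of_real (f x)))) \<partial>\<mu> n)"
      unfolding a0_def by (rule integral_mono[OF b(3) _ sq_ratio_le_Re_jump[OF y]])
        (use b(1) in \<open>simp add: a0_def integrable_Re\<close>)
    also have "\<dots> = max 1 (y\<^sup>2) * (- Re (\<integral>x. of_real (f x) / (a0 - of_real (f x)) \<partial>\<mu> n))"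
      using b(1) by (simp add: integrable_Re)
    finally have "real (n + 2) * (\<integral>x. sq_ratio (f x) \<partial>\<mu> n) \<le>
        real (n + 2) * (max 1 (y\<^sup>2) * (- Re (\<integral>x. of_real (f x) / (a0 - of_real (f x)) \<partial>\<mu> n)))"
      by (rule mult_left_mono) simp
    also have "\<dots> = max 1 (y\<^sup>2) * (- Re (?L n a0))" by (simp add: algebra_simps)
    also have "\<dots> \<le> \<Sigma>"
      unfolding \<Sigma>_def using \<Lambda>[of n] abs_Re_le_cmod[of "?L n a0"] by (intro mult_left_mono) auto
    finally show ?thesis .
  qed
  define D where "D z = (norm a0 * \<Lambda> + norm (a0 - 1 / z) * ((resolvent_const (1 / z) + resolvent_const a0) / 2 * \<Sigma>)) * norm z" for z
  show thesis
  proof (rule that[of D \<Sigma>])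
    show "real (n + 2) * (\<integral>x. sq_ratio (f x) \<partial>\<mu> n) \<le> \<Sigma>" for n by (rule \<Sigma>)
    show "continuous_on (- \<real>) D"
      unfolding D_def by (intro continuous_intros continuous_on_resolvent_const) auto
    fix n z assume z: "z \<in> - (\<real> :: complex set)"
    define a where "a = 1 / z"
    have Ima: "Im a \<noteq> 0" and z0: "z \<noteq> 0"
      using z by (auto simp: a_def notin_Reals_iff_Im Im_divide power2_eq_square)
    interpret prob_space "\<mu> n" by (rule p)
    note b = jump_integral_bounds[OF meas meas Ima Im0] and b0 = jump_integral_bounds[OF meas meas Im0 Im0]
    let ?uu = "\<integral>x. of_real (f x) / (a - of_real (f x)) * (of_real (f x) / (a0 - of_real (f x))) \<partial>\<mu> n"
    let ?N = "of_nat (n + 2) :: complex"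
    have "a * (\<integral>x. of_real (f x) / (a - of_real (f x)) \<partial>\<mu> n) = (\<integral>x. a * (of_real (f x) / (a - of_real (f x))) \<partial>\<mu> n)"
      by (rule integral_mult_right_zero[symmetric])
    also have "\<dots> = (\<integral>x. a0 * (of_real (f x) / (a0 - of_real (f x))) +
        (a0 - a) * (of_real (f x) / (a - of_real (f x)) * (of_real (f x) / (a0 - of_real (f x)))) \<partial>\<mu> n)"
      unfolding jump_shift[OF Ima Im0] ..
    also have "\<dots> = a0 * (\<integral>x. of_real (f x) / (a0 - of_real (f x)) \<partial>\<mu> n) + (a0 - a) * ?uu"
      by (subst Bochner_Integration.integral_add[OF integrable_mult_right[OF b0(1)] integrable_mult_right[OF b(2)]])
        (simp only: integral_mult_right_zero)
    finally have *: "a * (\<integral>x. of_real (f x) / (a - of_real (f x)) \<partial>\<mu> n) =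
        a0 * (\<integral>x. of_real (f x) / (a0 - of_real (f x)) \<partial>\<mu> n) + (a0 - a) * ?uu" .
    have "?L n a = ?N * (a * (\<integral>x. of_real (f x) / (a - of_real (f x)) \<partial>\<mu> n)) * z"
      using z0 by (simp add: a_def)
    also have "\<dots> = (a0 * ?L n a0 + (a0 - a) * (?N * ?uu)) * z"
      unfolding * by (simp only: distrib_left mult.left_commute)
    finally have eq: "?L n a = (a0 * ?L n a0 + (a0 - a) * (?N * ?uu)) * z" .
    have "norm (?N * ?uu) \<le> real (n + 2) * ((resolvent_const a * (\<integral>x. sq_ratio (f x) \<partial>\<mu> n) + resolvent_const a0 * (\<integral>x. sq_ratio (f x) \<partial>\<mu> n)) / 2)"
      unfolding norm_mult norm_of_nat by (rule mult_left_mono[OF b(4)]) simp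
    also have "\<dots> = (resolvent_const a + resolvent_const a0) / 2 * (real (n + 2) * (\<integral>x. sq_ratio (f x) \<partial>\<mu> n))"
      by (simp add: algebra_simps add_divide_distrib)
    also have "\<dots> \<le> (resolvent_const a + resolvent_const a0) / 2 * \<Sigma>"
      using resolvent_const_nonneg by (intro mult_left_mono \<Sigma>) auto
    finally have 1: "norm (?N * ?uu) \<le> (resolvent_const a + resolvent_const a0) / 2 * \<Sigma>" .
    have "norm (a0 * ?L n a0 + (a0 - a) * (?N * ?uu)) \<le> norm a0 * \<Lambda> + norm (a0 - a) * ((resolvent_const a + resolvent_const a0) / 2 * \<Sigma>)"
      by (rule norm_triangle_le) (unfold norm_mult[of a0] norm_mult[of "a0 - a"], intro add_mono mult_left_mono \<Lambda> 1 norm_ge_zero)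
    then show "norm (?L n (1 / z)) \<le> D z"
      unfolding a_def[symmetric] eq D_def norm_mult[of _ z] by (rule mult_right_mono) simp
  qed
qed

text \<open>The prelimit expressions are holomorphic in each variable on all of
  \<open>nonreal2\<close> and converge on the Stolz pair. The locally uniform bounds for Vitali's
  theorem come from the boundedness of n + 2 times the mean of \<open>sq_ratio\<close> in each
  coordinate.\<close>

proposition BID_extension:
  assumes "\<nu> \<in> BID"
  obtains \<alpha> \<beta> E where "\<alpha> > 0" "\<beta> > 0" "has_bifree_R_transform \<nu> \<alpha> \<beta> E" "holomorphic2_on E nonreal2"
proof -
  obtain \<alpha> \<beta> F R1 R2 \<mu> where \<alpha>: "\<alpha> > 0" and \<beta>: "\<beta> > 0" and "has_bifree_R_transform \<nu> \<alpha> \<beta> F"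
    and R: "has_R_transform (marginal1 \<nu>) \<alpha> \<beta> R1" "has_R_transform (marginal2 \<nu>) \<alpha> \<beta> R2"
    and F: "\<And>z w. z \<in> stolz_pair \<alpha> \<beta> \<Longrightarrow> w \<in> stolz_pair \<alpha> \<beta> \<Longrightarrow> h_quotient \<nu> R1 R2 z w \<noteq> 0 \<and>
      F (z, w) = z * R1 z + w * R2 w + (1 - 1 / h_quotient \<nu> R1 R2 z w)"
    and \<mu>: "\<And>n::nat. borel_prob (\<mu> n)"
    and lim1: "\<And>z. z \<in> stolz_pair \<alpha> \<beta> \<Longrightarrow>
      (\<lambda>n. of_nat (n + 2) * (\<integral>p. of_real (fst p) / (1 / z - of_real (fst p)) \<partial>\<mu> n)) \<longlonglongrightarrow> z * R1 z"
    and lim2: "\<And>z. z \<in> stolz_pair \<alpha> \<beta> \<Longrightarrow>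
      (\<lambda>n. of_nat (n + 2) * (\<integral>p. of_real (snd p) / (1 / z - of_real (snd p)) \<partial>\<mu> n)) \<longlonglongrightarrow> z * R2 z"
    and limC: "\<And>z w. z \<in> stolz_pair \<alpha> \<beta> \<Longrightarrow> w \<in> stolz_pair \<alpha> \<beta> \<Longrightarrow>
      (\<lambda>n. of_nat (n + 2) * (\<integral>p. of_real (fst p) / (1 / z - of_real (fst p)) *
          (of_real (snd p) / (1 / w - of_real (snd p))) \<partial>\<mu> n)) \<longlonglongrightarrow> 1 - 1 / h_quotient \<nu> R1 R2 z w"
    by (rule BID_asymptotics[OF assms], rule that)
  have p: "prob_space (\<mu> n)" and "sets (\<mu> n) = sets borel" for n using \<mu>[of n] by (auto simp: borel_prob_def)
  then have [measurable_cong]: "sets (\<mu> n) = sets (borel \<Otimes>\<^sub>M borel)" for n by (simp only: borel_prod)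
  have meas [measurable]: "fst \<in> borel_measurable (\<mu> n)" "snd \<in> borel_measurable (\<mu> n)" for n by measurable
  define L1 where "L1 n z = of_nat (n + 2) * (\<integral>p. of_real (fst p) / (1 / z - of_real (fst p)) \<partial>\<mu> n)" for n and z :: complex
  define L2 where "L2 n z = of_nat (n + 2) * (\<integral>p. of_real (snd p) / (1 / z - of_real (snd p)) \<partial>\<mu> n)" for n and z :: complex
  define C where "C n z w = of_nat (n + 2) * (\<integral>p. of_real (fst p) / (1 / z - of_real (fst p)) *
          (of_real (snd p) / (1 / w - of_real (snd p))) \<partial>\<mu> n)" for n and z w :: complex
  note s0 = stolz_seq(1)[OF \<alpha> \<beta>, of 0]
  obtain D1 :: "complex \<Rightarrow> real" and \<Sigma>1 where D1: "continuous_on (- \<real>) D1" "\<And>n. real (n + 2) * (\<integral>x. sq_ratio (fst x) \<partial>\<mu> n) \<le> \<Sigma>1"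
    "\<And>n z. z \<in> - \<real> \<Longrightarrow> norm (of_nat (n + 2) * (\<integral>x. of_real (fst x) / (1 / z - of_real (fst x)) \<partial>\<mu> n)) \<le> D1 z"
    by (rule first_order_locally_bounded[OF p meas(1) \<beta> lim1[OF s0]], rule that)
  note D1 = D1(1,2) D1(3)[folded L1_def]
  obtain D2 :: "complex \<Rightarrow> real" and \<Sigma>2 where D2: "continuous_on (- \<real>) D2" "\<And>n. real (n + 2) * (\<integral>x. sq_ratio (snd x) \<partial>\<mu> n) \<le> \<Sigma>2"
    "\<And>n z. z \<in> - \<real> \<Longrightarrow> norm (of_nat (n + 2) * (\<integral>x. of_real (snd x) / (1 / z - of_real (snd x)) \<partial>\<mu> n)) \<le> D2 z"
    by (rule first_order_locally_bounded[OF p meas(2) \<beta> lim2[OF s0]], rule that)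
  note D2 = D2(1,2) D2(3)[folded L2_def]
  have inv: "Im (1 / z) \<noteq> 0" if "z \<in> - \<real>" for z :: complex
    using that by (auto simp: notin_Reals_iff_Im Im_divide power2_eq_square)
  have Cbd: "norm (C n z w) \<le> (resolvent_const (1 / z) * \<Sigma>1 + resolvent_const (1 / w) * \<Sigma>2) / 2"
    if "z \<in> - \<real>" "w \<in> - \<real>" for n and z w :: complex
  proof -
    interpret prob_space "\<mu> n" by (rule p)
    let ?s1 = "\<integral>x. sq_ratio (fst x) \<partial>\<mu> n" and ?s2 = "\<integral>x. sq_ratio (snd x) \<partial>\<mu> n"
    have "norm (C n z w) \<le> real (n + 2) * ((resolvent_const (1 / z) * ?s1 + resolvent_const (1 / w) * ?s2) / 2)"
      unfolding C_def norm_mult[of "of_nat (n + 2)"] norm_of_nat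
      by (rule mult_left_mono[OF jump_integral_bounds(4)[OF meas inv[OF that(1)] inv[OF that(2)]]]) simp
    also have "\<dots> = (resolvent_const (1 / z) * (real (n + 2) * ?s1) + resolvent_const (1 / w) * (real (n + 2) * ?s2)) / 2"
      by (simp add: algebra_simps add_divide_distrib)
    also have "\<dots> \<le> (resolvent_const (1 / z) * \<Sigma>1 + resolvent_const (1 / w) * \<Sigma>2) / 2"
      by (intro divide_right_mono add_mono mult_left_mono D1 D2 resolvent_const_nonneg) simp
    finally show ?thesis .
  qed
  have hol: "L1 n holomorphic_on (- \<real>)" "L2 n holomorphic_on (- \<real>)"
    "w \<in> - \<real> \<Longrightarrow> (\<lambda>z. C n z w) holomorphic_on (- \<real>)" "z \<in> - \<real> \<Longrightarrow> C n z holomorphic_on (- \<real>)" for n and z w :: complex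
  proof -
    interpret prob_space "\<mu> n" by (rule p)
    show "L1 n holomorphic_on (- \<real>)"
      using holomorphic_integral_jump[of "\<lambda>_. 1" fst 1] unfolding L1_def by (simp add: holomorphic_intros)
    show "L2 n holomorphic_on (- \<real>)"
      using holomorphic_integral_jump[of "\<lambda>_. 1" snd 1] unfolding L2_def by (simp add: holomorphic_intros)
    show "(\<lambda>z. C n z w) holomorphic_on (- \<real>)" if w: "w \<in> - \<real>"
      unfolding C_def
      by (intro holomorphic_intros holomorphic_integral_jump[where B = "1 + norm (1 / w) / \<bar>Im (1 / w)\<bar>"]
          norm_resolvent_times_le inv w) measurable
    have "(\<lambda>w. \<integral>p. of_real (snd p) / (1 / w - of_real (snd p)) * (of_real (fst p) / (1 / z - of_real (fst p))) \<partial>\<mu> n)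
      holomorphic_on (- \<real>)" if z: "z \<in> - \<real>"
      by (intro holomorphic_integral_jump[where B = "1 + norm (1 / z) / \<bar>Im (1 / z)\<bar>"]
          norm_resolvent_times_le inv z) measurable
    moreover have "C n z = (\<lambda>w. of_nat (n + 2) * (\<integral>p. of_real (snd p) / (1 / w - of_real (snd p)) *
        (of_real (fst p) / (1 / z - of_real (fst p))) \<partial>\<mu> n))"
      by (rule ext) (simp only: C_def mult.commute)
    ultimately show "C n z holomorphic_on (- \<real>)" if z: "z \<in> - \<real>"
      using z by (simp add: holomorphic_intros)
  qed
  \<comment> \<open>The sum L1 + L2 + C is n + 2 times the mean of (1 + u)(1 + v) - 1. Since 1 + u =
    1 / (z (1/z - s)), the mean of the product is the Cauchy transform at (1/z, 1/w) divided by z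
    w.\<close>
  obtain E where E: "holomorphic2_on E nonreal2"
    "\<And>z w. z \<in> stolz_pair \<alpha> \<beta> \<Longrightarrow> w \<in> stolz_pair \<alpha> \<beta> \<Longrightarrow> E (z, w) = F (z, w)"
  proof (rule Vitali_nonreal2[OF \<alpha> \<beta>, of "\<lambda>n (z, w). L1 n z + L2 n w + C n z w" F])
    show "(\<lambda>z. case (z, w) of (z, w) \<Rightarrow> L1 n z + L2 n w + C n z w) holomorphic_on - \<real>" if "w \<in> - \<real>" for n and w :: complex
      unfolding prod.case by (intro holomorphic_intros hol that)
    show "(\<lambda>w. case (z, w) of (z, w) \<Rightarrow> L1 n z + L2 n w + C n z w) holomorphic_on - \<real>" if "z \<in> - \<real>" for n and z :: complex
      unfolding prod.case by (intro holomorphic_intros hol that)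
    show "(\<lambda>n. case (z, w) of (z, w) \<Rightarrow> L1 n z + L2 n w + C n z w) \<longlonglongrightarrow> F (z, w)"
      if "z \<in> stolz_pair \<alpha> \<beta>" "w \<in> stolz_pair \<alpha> \<beta>" for z w
      using tendsto_add[OF tendsto_add[OF lim1[OF that(1)] lim2[OF that(2)]] limC[OF that]] F[OF that]
      by (simp add: L1_def L2_def C_def)
    fix K K' :: "complex set" assume K: "compact K" "compact K'" "K \<subseteq> - \<real>" "K' \<subseteq> - \<real>"
    have bound: "\<exists>B. \<forall>z \<in> K. g z \<le> B" if "compact K" "K \<subseteq> - \<real>" "continuous_on (- \<real>) g" for g :: "complex \<Rightarrow> real" and K
    proof -
      have "bounded (g ` K)"
        using that by (intro compact_imp_bounded compact_continuous_image) (auto intro: continuous_on_subset)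
      then show ?thesis unfolding bounded_iff by (auto intro: order_trans[OF abs_ge_self])
    qed
    obtain B1 where B1: "\<forall>z \<in> K. D1 z + resolvent_const (1 / z) * \<Sigma>1 / 2 \<le> B1"
      using bound[OF K(1,3) continuous_on_add[OF D1(1) continuous_on_mult_right[OF continuous_on_resolvent_const, of "\<Sigma>1 / 2"]]]
      by auto
    obtain B2 where B2: "\<forall>z \<in> K'. D2 z + resolvent_const (1 / z) * \<Sigma>2 / 2 \<le> B2"
      using bound[OF K(2,4) continuous_on_add[OF D2(1) continuous_on_mult_right[OF continuous_on_resolvent_const, of "\<Sigma>2 / 2"]]]
      by auto
    have "norm (L1 n z + L2 n w + C n z w) \<le> B1 + B2" if zw: "z \<in> K" "w \<in> K'" for n z w
    proof -
      have nr: "z \<in> - \<real>" "w \<in> - \<real>" using zw K by auto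
      have "norm (L1 n z + L2 n w + C n z w) \<le> D1 z + D2 w + (resolvent_const (1 / z) * \<Sigma>1 + resolvent_const (1 / w) * \<Sigma>2) / 2"
        by (intro norm_triangle_le add_mono norm_triangle_mono D1(3) D2(3) Cbd nr)
      then show ?thesis using bspec[OF B1 zw(1)] bspec[OF B2 zw(2)] by (simp add: add_divide_distrib)
    qed
    then show "\<exists>B. \<forall>n. \<forall>z \<in> K. \<forall>w \<in> K'. norm (case (z, w) of (z, w) \<Rightarrow> L1 n z + L2 n w + C n z w) \<le> B"
      by auto
  qed (rule that)
  have "has_bifree_R_transform \<nu> \<alpha> \<beta> E"
    unfolding has_bifree_R_transform_def
    by (intro exI[of _ R1] exI[of _ R2] conjI R) (use F E(2) in \<open>auto simp: stolz_product_def\<close>)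
  then show thesis by (rule that[OF \<alpha> \<beta> _ E(1)])
qed

section \<open>Sums of bi-freely infinitely divisible laws\<close>

text \<open>Here both variables tend to 0 independently. If no pair works, there are points z n, w n
  in pairs shrinking to 0 at which the bound fails, yet the asymptotics of the total mass force h to
  tend to 1 along them.\<close>

lemma h_quotient_near_1:
  assumes \<nu>: "borel_prob \<nu>" and \<alpha>: "\<alpha> > 0" and \<beta>: "\<beta> > 0" and \<delta>: "\<delta> > 0"
    and R1: "has_R_transform (marginal1 \<nu>) \<alpha> \<beta> R1" and R2: "has_R_transform (marginal2 \<nu>) \<alpha> \<beta> R2"
  shows "\<exists>b>0. b \<le> \<beta> \<and> (\<forall>z \<in> stolz_pair \<alpha> b. \<forall>w \<in> stolz_pair \<alpha> b. norm (1 - 1 / h_quotient \<nu> R1 R2 z w) < \<delta>)"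
proof (rule ccontr)
  assume contra: "\<not> ?thesis"
  interpret prob_space \<nu> using \<nu> by (simp add: borel_prob_def)
  have fin: "finite_measure \<nu>" "sets \<nu> = sets borel"
    using \<nu> finite_measure_axioms by (auto simp: borel_prob_def)
  define c where "c = 1 / (1 + \<alpha>)"
  have c2: "c / 2 > 0" and c4: "c / 4 > 0" using \<alpha> by (auto simp: c_def)
  obtain b1 where b1: "b1 > 0" "b1 \<le> \<beta>" "\<forall>z \<in> stolz_pair \<alpha> b1. norm (z * R1 z) \<le> c / 2"
    using has_R_transform_small[OF R1 \<alpha> \<beta> c2] by blast
  obtain b2 where b2: "b2 > 0" "b2 \<le> \<beta>" "\<forall>z \<in> stolz_pair \<alpha> b2. norm (z * R2 z) \<le> c / 2"
    using has_R_transform_small[OF R2 \<alpha> \<beta> c2] by blast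
  define b where "b = min b1 b2"
  have b: "b > 0" "b \<le> \<beta>" using b1 b2 by (auto simp: b_def)
  have bn: "b * inverse (real (Suc n)) > 0" "b * inverse (real (Suc n)) \<le> b" for n
  proof -
    show "b * inverse (real (Suc n)) > 0" using b by simp
    have "inverse (real (Suc n)) \<le> 1" by (simp add: field_simps)
    then show "b * inverse (real (Suc n)) \<le> b" using b by (simp add: mult_left_le)
  qed
  have "\<exists>w. fst w \<in> stolz_pair \<alpha> (b * inverse (real (Suc n))) \<and> snd w \<in> stolz_pair \<alpha> (b * inverse (real (Suc n))) \<and>
      \<not> norm (1 - 1 / h_quotient \<nu> R1 R2 (fst w) (snd w)) < \<delta>" for n
    using contra bn(1)[of n] order_trans[OF bn(2)[of n] b(2)] by (metis fst_conv snd_conv)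
  then have "\<exists>p. \<forall>n. fst (p n) \<in> stolz_pair \<alpha> (b * inverse (real (Suc n))) \<and> snd (p n) \<in> stolz_pair \<alpha> (b * inverse (real (Suc n))) \<and>
      \<not> norm (1 - 1 / h_quotient \<nu> R1 R2 (fst (p n)) (snd (p n))) < \<delta>"
    by (intro choice allI)
  then obtain p where p: "\<And>n. fst (p n) \<in> stolz_pair \<alpha> (b * inverse (real (Suc n)))"
    "\<And>n. snd (p n) \<in> stolz_pair \<alpha> (b * inverse (real (Suc n)))"
    "\<And>n. \<not> norm (1 - 1 / h_quotient \<nu> R1 R2 (fst (p n)) (snd (p n))) < \<delta>"
    by blast
  define z w where "z n = fst (p n)" and "w n = snd (p n)" for n
  note zw = p[folded z_def w_def]
  have lim: "z \<longlonglongrightarrow> 0" "w \<longlonglongrightarrow> 0"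
    by (rule stolz_pair_shrink_limit[OF \<alpha> zw(1)], rule stolz_pair_shrink_limit[OF \<alpha> zw(2)])
  have sub: "stolz_pair \<alpha> (b * inverse (real (Suc n))) \<subseteq> stolz_pair \<alpha> b" "stolz_pair \<alpha> b \<subseteq> stolz_pair \<alpha> b1"
    "stolz_pair \<alpha> b \<subseteq> stolz_pair \<alpha> b2" "stolz_pair \<alpha> b \<subseteq> stolz_pair \<alpha> \<beta>" for n
    by (intro stolz_pair_mono order_refl bn(2), intro stolz_pair_mono, (simp_all add: b_def)[2],
        intro stolz_pair_mono, (simp_all add: b_def)[2], intro stolz_pair_mono order_refl b(2))
  have mem: "z n \<in> stolz_pair \<alpha> b" "w n \<in> stolz_pair \<alpha> b" "z n \<in> stolz_pair \<alpha> b1" "w n \<in> stolz_pair \<alpha> b2"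
    "z n \<in> stolz_pair \<alpha> \<beta>" "w n \<in> stolz_pair \<alpha> \<beta>" for n
    using zw(1,2)[of n] sub by blast+
  have small: "norm (z n * R1 (z n)) \<le> c / 2" "norm (w n * R2 (w n)) \<le> c / 2" for n
    using b1(3) b2(3) mem[of n] by auto
  have nz: "z n \<noteq> 0" "w n \<noteq> 0" for n using mem stolz_pair_neq_0 by blast+
  define k1 k2 where "k1 n = 1 / z n + R1 (z n)" and "k2 n = 1 / w n + R2 (w n)" for n
  note est1 = shifted_inverse_estimates[OF mem(1) \<alpha> c_def small(1), folded k1_def]
  note est2 = shifted_inverse_estimates[OF mem(2) \<alpha> c_def small(2), folded k2_def]
  have inf: "filterlim k1 at_infinity sequentially" "filterlim k2 at_infinity sequentially"
    unfolding k1_def k2_def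
    by (rule shifted_inverse_at_infinity[OF mem(1) \<alpha> c_def lim(1) small(1)])
      (rule shifted_inverse_at_infinity[OF mem(2) \<alpha> c_def lim(2) small(2)])
  have fl: "filterlim z (at 0 within stolz_pair \<alpha> \<beta>) sequentially" "filterlim w (at 0 within stolz_pair \<alpha> \<beta>) sequentially"
    using lim nz mem by (auto simp: filterlim_at intro!: always_eventually)
  have zR: "(\<lambda>n. z n * R1 (z n)) \<longlonglongrightarrow> 0" "(\<lambda>n. w n * R2 (w n)) \<longlonglongrightarrow> 0"
    using R1 R2 filterlim_compose[OF _ fl(1), of "\<lambda>z. z * R1 z"] filterlim_compose[OF _ fl(2), of "\<lambda>z. z * R2 z"]
    unfolding has_R_transform_def by auto
  have zk: "z n * k1 n = 1 + z n * R1 (z n)" "w n * k2 n = 1 + w n * R2 (w n)" for n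
    using nz[of n] by (simp_all add: k1_def k2_def distrib_left)
  have zkl: "(\<lambda>n. z n * k1 n) \<longlonglongrightarrow> 1" "(\<lambda>n. w n * k2 n) \<longlonglongrightarrow> 1"
    unfolding zk using tendsto_add[OF tendsto_const[of 1] zR(1)] tendsto_add[OF tendsto_const[of 1] zR(2)]
    by simp_all
  have "(\<lambda>n. k1 n * k2 n * cauchy_transform2 \<nu> (k1 n) (k2 n) / (z n * k1 n * (w n * k2 n)))
      \<longlonglongrightarrow> of_real (measure \<nu> (space \<nu>)) / (1 * 1)"
    by (intro tendsto_intros zkl cauchy_transform2_mass[OF fin c4 est1(6) est1(4) inf(1) est2(6) est2(4) inf(2)]) simp
  moreover have "k1 n * k2 n * cauchy_transform2 \<nu> (k1 n) (k2 n) / (z n * k1 n * (w n * k2 n)) =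
      h_quotient \<nu> R1 R2 (z n) (w n)" for n
    using est1(4)[of n] est2(4)[of n] by (simp add: h_quotient_def k1_def[symmetric] k2_def[symmetric] mult_ac)
  ultimately have "(\<lambda>n. h_quotient \<nu> R1 R2 (z n) (w n)) \<longlonglongrightarrow> 1" by (simp add: prob_space)
  then have "(\<lambda>n. norm (1 - 1 / h_quotient \<nu> R1 R2 (z n) (w n))) \<longlonglongrightarrow> norm (1 - 1 / 1 :: complex)"
    by (intro tendsto_intros) auto
  then have "\<forall>\<^sub>F n in sequentially. norm (1 - 1 / h_quotient \<nu> R1 R2 (z n) (w n)) < \<delta>"
    by (rule order_tendstoD) (use \<delta> in simp)
  then show False using zw(3) by (simp add: eventually_sequentially)
qed

text \<open>A weighted sum of two laws is realised on a single space: two labelled sheets of the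
  product of P and Q, each reading only one coordinate while the other integrates to 1. This
  provides the single measure, carrying one function per coordinate, that the locale
  \<open>two_jumps\<close> works with.\<close>

lemma
  fixes P :: "'a measure" and Q :: "'b measure"
  assumes P: "prob_space P" and Q: "prob_space Q" and c: "c \<ge> 0"
  defines "M \<equiv> density (count_space (UNIV :: bool set) \<Otimes>\<^sub>M (P \<Otimes>\<^sub>M Q)) (\<lambda>_. ennreal c)"
  shows finite_measure_two_sheets: "finite_measure M"
    and integral_two_sheets: "\<And>G :: bool \<times> 'a \<times> 'b \<Rightarrow> complex. G \<in> borel_measurable M \<Longrightarrow> (\<And>x. norm (G x) \<le> B) \<Longrightarrow>
      (\<And>x y. G (True, x, y) = G1 x) \<Longrightarrow> (\<And>x y. G (False, x, y) = G2 y) \<Longrightarrow>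
      (\<integral>x. G x \<partial>M) = of_real c * ((\<integral>x. G1 x \<partial>P) + (\<integral>y. G2 y \<partial>Q))"
proof -
  interpret P: prob_space P by (rule P)
  interpret Q: prob_space Q by (rule Q)
  interpret PQ: pair_prob_space P Q ..
  interpret C: finite_measure "count_space (UNIV :: bool set)" by (rule finite_measure_count_space) simp
  interpret CPQ: pair_sigma_finite "count_space (UNIV :: bool set)" "P \<Otimes>\<^sub>M Q" ..
  let ?N = "count_space (UNIV :: bool set) \<Otimes>\<^sub>M (P \<Otimes>\<^sub>M Q)"
  have N: "finite_measure ?N" by (rule finite_measure_pair_measure) (rule C.finite_measure_axioms PQ.finite_measure_axioms)+
  interpret N: finite_measure ?N by (rule N)
  show "finite_measure M"
    unfolding M_def
    by (rule finite_measureI)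
      (simp add: emeasure_density nn_integral_cmult ennreal_mult_eq_top_iff N.emeasure_eq_measure[of "space ?N"])
  fix G :: "bool \<times> 'a \<times> 'b \<Rightarrow> complex"
  assume G: "G \<in> borel_measurable M" and B: "\<And>x. norm (G x) \<le> B"
    and T: "\<And>x y. G (True, x, y) = G1 x" and F: "\<And>x y. G (False, x, y) = G2 y"
  have [measurable]: "G \<in> borel_measurable ?N" using G by (simp add: M_def)
  have int: "integrable ?N G" by (rule N.integrable_const_bound[where B = B]) (use B in auto)
  have meas: "(\<lambda>p. G (b, p)) \<in> borel_measurable (P \<Otimes>\<^sub>M Q)" for b by measurable
  have intb: "integrable (P \<Otimes>\<^sub>M Q) (\<lambda>p. G (b, p))" for b
    by (rule PQ.integrable_const_bound[where B = B]) (use B meas in auto)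
  have "(\<integral>x. G x \<partial>M) = (\<integral>x. c *\<^sub>R G x \<partial>?N)"
    unfolding M_def by (rule integral_density) (use c in auto)
  also have "\<dots> = of_real c * (\<integral>x. G x \<partial>?N)" by (simp add: scaleR_conv_of_real)
  also have "(\<integral>x. G x \<partial>?N) = (\<integral>b. (\<integral>p. G (b, p) \<partial>(P \<Otimes>\<^sub>M Q)) \<partial>count_space UNIV)"
    by (rule CPQ.integral_fst'[symmetric, OF int])
  also have "\<dots> = (\<integral>p. G (True, p) \<partial>(P \<Otimes>\<^sub>M Q)) + (\<integral>p. G (False, p) \<partial>(P \<Otimes>\<^sub>M Q))"
    by (subst lebesgue_integral_count_space_finite) (simp_all add: UNIV_bool)
  also have "(\<integral>p. G (True, p) \<partial>(P \<Otimes>\<^sub>M Q)) = (\<integral>x. G1 x \<partial>P)"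
    using PQ.integral_fst'[OF intb[of True]] by (simp add: T P.prob_space Q.prob_space)
  also have "(\<integral>p. G (False, p) \<partial>(P \<Otimes>\<^sub>M Q)) = (\<integral>y. G2 y \<partial>Q)"
    using PQ.integral_fst'[OF intb[of False]] by (simp add: F P.prob_space Q.prob_space)
  finally show "(\<integral>x. G x \<partial>M) = of_real c * ((\<integral>x. G1 x \<partial>P) + (\<integral>y. G2 y \<partial>Q))" .
qed

text \<open>Large values are sent to 0 instead of being clipped, because a jump of size 0 has no
  effect.\<close>

definition truncate :: "real \<Rightarrow> 'a::real_normed_vector \<Rightarrow> 'a" where
  "truncate T x = (if norm x \<le> T then x else 0)"

lemma norm_truncate_le: "T \<ge> 0 \<Longrightarrow> norm (truncate T x) \<le> T"
  by (simp add: truncate_def)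

lemma truncate_measurable [measurable]:
  "truncate T \<in> borel_measurable (borel :: 'a::{real_normed_vector, second_countable_topology} measure)"
  unfolding truncate_def by measurable

text \<open>The roots may have unbounded support, whereas \<open>bounded_jumps\<close> asks for a
  bound. Each T n is taken so large that n + 2 times the discarded mass is at most 1/(n + 1); for a
  bounded G with G 0 = 0 the weighted integrals then keep their limit.\<close>

lemma truncation_sequence:
  fixes \<mu> :: "nat \<Rightarrow> 'a::{real_normed_vector, second_countable_topology} measure"
  assumes \<mu>: "\<And>n. borel_prob (\<mu> n)"
  obtains T :: "nat \<Rightarrow> real" where "\<And>n. T n \<ge> 0"
    "\<And>G B l. (G :: 'a \<Rightarrow> complex) \<in> borel_measurable borel \<Longrightarrow> (\<And>x. norm (G x) \<le> B) \<Longrightarrow> G 0 = 0 \<Longrightarrow>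
      (\<lambda>n. of_nat (n + 2) * (\<integral>x. G x \<partial>\<mu> n)) \<longlonglongrightarrow> l \<Longrightarrow>
      (\<lambda>n. of_nat (n + 2) * (\<integral>x. G (truncate (T n) x) \<partial>\<mu> n)) \<longlonglongrightarrow> l"
proof -
  have p: "prob_space (\<mu> n)" and sets [measurable_cong]: "sets (\<mu> n) = sets borel" for n
    using \<mu>[of n] by (auto simp: borel_prob_def)
  have sp: "space (\<mu> n) = UNIV" for n using sets_eq_imp_space_eq[OF sets] by simp
  have "\<exists>T\<ge>0. real (n + 2) * measure (\<mu> n) {x. norm x > T} \<le> inverse (real (Suc n))" for n
  proof -
    interpret prob_space "\<mu> n" by (rule p)
    have "(\<lambda>k. measure (\<mu> n) {x. norm x > real k}) \<longlonglongrightarrow> measure (\<mu> n) (\<Inter>k. {x. norm x > real k})"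
      by (rule Lim_measure_decseq) (auto simp: decseq_def sets)
    moreover have "(\<Inter>k. {x :: 'a. norm x > real k}) = {}"
    proof -
      have "\<exists>k. \<not> norm x > real k" for x :: 'a using reals_Archimedean2[of "norm x"] less_asym by blast
      then show ?thesis by blast
    qed
    ultimately have "(\<lambda>k. measure (\<mu> n) {x. norm x > real k}) \<longlonglongrightarrow> 0" by simp
    then have "\<forall>\<^sub>F k in sequentially. measure (\<mu> n) {x. norm x > real k} < inverse (real (Suc n)) / real (n + 2)"
      by (rule order_tendstoD) simp
    then obtain k where "measure (\<mu> n) {x. norm x > real k} < inverse (real (Suc n)) / real (n + 2)"
      by (auto simp: eventually_sequentially)
    then have "real (n + 2) * measure (\<mu> n) {x. norm x > real k} \<le> inverse (real (Suc n))"
      by (simp add: pos_less_divide_eq mult.commute less_imp_le)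
    then show ?thesis by (intro exI[of _ "real k"]) simp
  qed
  then have "\<exists>T :: nat \<Rightarrow> real. \<forall>n. T n \<ge> 0 \<and> real (n + 2) * measure (\<mu> n) {x. norm x > T n} \<le> inverse (real (Suc n))"
    by (intro choice allI)
  then obtain T :: "nat \<Rightarrow> real" where T: "\<And>n. T n \<ge> 0"
    "\<And>n. real (n + 2) * measure (\<mu> n) {x. norm x > T n} \<le> inverse (real (Suc n))" by blast
  show thesis
  proof (rule that[of T])
    show "T n \<ge> 0" for n by (rule T)
    fix G :: "'a \<Rightarrow> complex" and B l
    assume [measurable]: "G \<in> borel_measurable borel" and B: "\<And>x. norm (G x) \<le> B" and G0: "G 0 = 0"
      and lim: "(\<lambda>n. of_nat (n + 2) * (\<integral>x. G x \<partial>\<mu> n)) \<longlonglongrightarrow> l"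
    have B0: "B \<ge> 0" using order_trans[OF norm_ge_zero B] .
    let ?D = "\<lambda>n. (\<integral>x. G (truncate (T n) x) \<partial>\<mu> n) - (\<integral>x. G x \<partial>\<mu> n)"
    have D: "norm (of_nat (n + 2) * ?D n) \<le> B * inverse (real (Suc n))" for n
    proof -
      interpret prob_space "\<mu> n" by (rule p)
      have int: "integrable (\<mu> n) G" "integrable (\<mu> n) (\<lambda>x. G (truncate (T n) x))"
        by (rule integrable_const_bound[where B = B]; use B in simp)+
      have "norm (?D n) = norm (\<integral>x. G (truncate (T n) x) - G x \<partial>\<mu> n)"
        using int by simp
      also have "\<dots> \<le> (\<integral>x. B * indicator {x. norm x > T n} x \<partial>\<mu> n)"
      proof (rule norm_integral_le)
        show "norm (G (truncate (T n) x) - G x) \<le> B * indicator {x. norm x > T n} x" for x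
          using B[of x] by (auto simp: truncate_def G0 indicator_def)
        show "integrable (\<mu> n) (\<lambda>x. B * indicator {x. norm x > T n} x :: real)"
          by (intro integrable_mult_right integrable_real_indicator) (simp_all add: sets emeasure_eq_measure)
      qed (use int in simp)
      also have "\<dots> = B * measure (\<mu> n) {x. norm x > T n}" by (simp add: sp)
      finally have "norm (of_nat (n + 2) * ?D n) \<le> real (n + 2) * (B * measure (\<mu> n) {x. norm x > T n})"
        unfolding norm_mult norm_of_nat by (rule mult_left_mono) simp
      also have "\<dots> = B * (real (n + 2) * measure (\<mu> n) {x. norm x > T n})" by (simp only: mult.left_commute)
      also have "\<dots> \<le> B * inverse (real (Suc n))" by (rule mult_left_mono[OF T(2) B0])
      finally show ?thesis .
    qed
    have "(\<lambda>n. B * inverse (real (Suc n))) \<longlonglongrightarrow> B * 0" by (intro tendsto_intros LIMSEQ_inverse_real_of_nat)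
    then have "(\<lambda>n. of_nat (n + 2) * ?D n) \<longlonglongrightarrow> 0"
      by (intro Lim_null_comparison[OF always_eventually[OF allI[OF D]]]) simp
    from tendsto_add[OF this lim]
    show "(\<lambda>n. of_nat (n + 2) * (\<integral>x. G (truncate (T n) x) \<partial>\<mu> n)) \<longlonglongrightarrow> l"
      by (simp only: right_diff_distrib diff_add_cancel add_0)
  qed
qed

lemma has_bifree_R_transform_mono:
  assumes "has_bifree_R_transform \<nu> \<alpha> \<beta> F" "\<alpha>' \<le> \<alpha>" "\<beta>' \<le> \<beta>"
    and eq: "\<And>p. p \<in> stolz_product \<alpha>' \<beta>' \<Longrightarrow> F p = E p"
  shows "has_bifree_R_transform \<nu> \<alpha>' \<beta>' E"
proof -
  have sub: "stolz_product \<alpha>' \<beta>' \<subseteq> stolz_product \<alpha> \<beta>"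
    unfolding stolz_product_def by (intro Sigma_mono stolz_pair_mono assms)
  obtain R1 R2 where R: "has_R_transform (marginal1 \<nu>) \<alpha> \<beta> R1" "has_R_transform (marginal2 \<nu>) \<alpha> \<beta> R2"
    and F: "\<forall>(z, w) \<in> stolz_product \<alpha> \<beta>. h_quotient \<nu> R1 R2 z w \<noteq> 0 \<and>
      F (z, w) = z * R1 z + w * R2 w + (1 - 1 / h_quotient \<nu> R1 R2 z w)"
    using assms(1) unfolding has_bifree_R_transform_def by blast
  show ?thesis
    unfolding has_bifree_R_transform_def
  proof (rule exI[of _ R1], rule exI[of _ R2], intro conjI ballI)
    fix p assume p: "p \<in> stolz_product \<alpha>' \<beta>'"
    show "case p of (z, w) \<Rightarrow> h_quotient \<nu> R1 R2 z w \<noteq> 0 \<and> E (z, w) = z * R1 z + w * R2 w + (1 - 1 / h_quotient \<nu> R1 R2 z w)"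
      using bspec[OF F subsetD[OF sub p]] eq[OF p] by (cases p) simp
  qed (use has_R_transform_mono[OF R(1) assms(2,3)] has_R_transform_mono[OF R(2) assms(2,3)] in auto)
qed

text \<open>The laws with transform \<open>(F\<^sub>1 + F\<^sub>2) / k\<close> are limits of compound Poisson laws whose
  jump measure is the sum, with weight \<open>(n + 2) / k\<close>, of truncated \<open>(n + 2)\<close>-nd roots
  of the two given laws.\<close>

proposition BID_sum:
  assumes "\<nu>1 \<in> BID" "\<nu>2 \<in> BID"
  obtains \<nu> \<alpha> \<beta> F1 F2 where "\<nu> \<in> BID" "\<alpha> > 0" "\<beta> > 0" "has_bifree_R_transform \<nu>1 \<alpha> \<beta> F1"
    "has_bifree_R_transform \<nu>2 \<alpha> \<beta> F2" "has_bifree_R_transform \<nu> \<alpha> \<beta> (\<lambda>p. F1 p + F2 p)"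
proof -
  obtain \<alpha>1 \<beta>1 F1 R1 S1 \<mu>1 where 1: "\<alpha>1 > 0" "\<beta>1 > 0" "has_bifree_R_transform \<nu>1 \<alpha>1 \<beta>1 F1"
    and R1: "has_R_transform (marginal1 \<nu>1) \<alpha>1 \<beta>1 R1" and S1: "has_R_transform (marginal2 \<nu>1) \<alpha>1 \<beta>1 S1"
    and F1: "\<And>z w. z \<in> stolz_pair \<alpha>1 \<beta>1 \<Longrightarrow> w \<in> stolz_pair \<alpha>1 \<beta>1 \<Longrightarrow> h_quotient \<nu>1 R1 S1 z w \<noteq> 0 \<and>
      F1 (z, w) = z * R1 z + w * S1 w + (1 - 1 / h_quotient \<nu>1 R1 S1 z w)"
    and \<mu>1: "\<And>n::nat. borel_prob (\<mu>1 n)"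
    and limR1: "\<And>z. z \<in> stolz_pair \<alpha>1 \<beta>1 \<Longrightarrow>
      (\<lambda>n. of_nat (n + 2) * (\<integral>p. of_real (fst p) / (1 / z - of_real (fst p)) \<partial>\<mu>1 n)) \<longlonglongrightarrow> z * R1 z"
    and limS1: "\<And>z. z \<in> stolz_pair \<alpha>1 \<beta>1 \<Longrightarrow>
      (\<lambda>n. of_nat (n + 2) * (\<integral>p. of_real (snd p) / (1 / z - of_real (snd p)) \<partial>\<mu>1 n)) \<longlonglongrightarrow> z * S1 z"
    and limC1: "\<And>z w. z \<in> stolz_pair \<alpha>1 \<beta>1 \<Longrightarrow> w \<in> stolz_pair \<alpha>1 \<beta>1 \<Longrightarrow>
      (\<lambda>n. of_nat (n + 2) * (\<integral>p. of_real (fst p) / (1 / z - of_real (fst p)) *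
          (of_real (snd p) / (1 / w - of_real (snd p))) \<partial>\<mu>1 n)) \<longlonglongrightarrow> 1 - 1 / h_quotient \<nu>1 R1 S1 z w"
    by (rule BID_asymptotics[OF assms(1)], rule that)
  obtain \<alpha>2 \<beta>2 F2 R2 S2 \<mu>2 where 2: "\<alpha>2 > 0" "\<beta>2 > 0" "has_bifree_R_transform \<nu>2 \<alpha>2 \<beta>2 F2"
    and R2: "has_R_transform (marginal1 \<nu>2) \<alpha>2 \<beta>2 R2" and S2: "has_R_transform (marginal2 \<nu>2) \<alpha>2 \<beta>2 S2"
    and F2: "\<And>z w. z \<in> stolz_pair \<alpha>2 \<beta>2 \<Longrightarrow> w \<in> stolz_pair \<alpha>2 \<beta>2 \<Longrightarrow> h_quotient \<nu>2 R2 S2 z w \<noteq> 0 \<and>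
      F2 (z, w) = z * R2 z + w * S2 w + (1 - 1 / h_quotient \<nu>2 R2 S2 z w)"
    and \<mu>2: "\<And>n::nat. borel_prob (\<mu>2 n)"
    and limR2: "\<And>z. z \<in> stolz_pair \<alpha>2 \<beta>2 \<Longrightarrow>
      (\<lambda>n. of_nat (n + 2) * (\<integral>p. of_real (fst p) / (1 / z - of_real (fst p)) \<partial>\<mu>2 n)) \<longlonglongrightarrow> z * R2 z"
    and limS2: "\<And>z. z \<in> stolz_pair \<alpha>2 \<beta>2 \<Longrightarrow>
      (\<lambda>n. of_nat (n + 2) * (\<integral>p. of_real (snd p) / (1 / z - of_real (snd p)) \<partial>\<mu>2 n)) \<longlonglongrightarrow> z * S2 z"
    and limC2: "\<And>z w. z \<in> stolz_pair \<alpha>2 \<beta>2 \<Longrightarrow> w \<in> stolz_pair \<alpha>2 \<beta>2 \<Longrightarrow>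
      (\<lambda>n. of_nat (n + 2) * (\<integral>p. of_real (fst p) / (1 / z - of_real (fst p)) *
          (of_real (snd p) / (1 / w - of_real (snd p))) \<partial>\<mu>2 n)) \<longlonglongrightarrow> 1 - 1 / h_quotient \<nu>2 R2 S2 z w"
    by (rule BID_asymptotics[OF assms(2)], rule that)
  have \<nu>: "borel_prob \<nu>1" "borel_prob \<nu>2" using assms by (auto simp: BID_def)
  define \<alpha> where "\<alpha> = min \<alpha>1 \<alpha>2"
  define \<beta>0 where "\<beta>0 = min \<beta>1 \<beta>2"
  have \<alpha>: "\<alpha> > 0" "\<alpha> \<le> \<alpha>1" "\<alpha> \<le> \<alpha>2" and \<beta>0: "\<beta>0 > 0" "\<beta>0 \<le> \<beta>1" "\<beta>0 \<le> \<beta>2"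
    using 1 2 by (auto simp: \<alpha>_def \<beta>0_def)
  note R1' = has_R_transform_mono[OF R1 \<alpha>(2) \<beta>0(2)] and S1' = has_R_transform_mono[OF S1 \<alpha>(2) \<beta>0(2)]
    and R2' = has_R_transform_mono[OF R2 \<alpha>(3) \<beta>0(3)] and S2' = has_R_transform_mono[OF S2 \<alpha>(3) \<beta>0(3)]
  \<comment> \<open>Each law gets c/4 for its two R-transforms and 1/2 for 1 - 1/h, so that the sums
    meet the bounds c/2 and 1 of \<open>limit_law\<close>. Division by k >= 1 preserves these
    bounds, so a single \<beta> serves all k, as \<open>BID\<close> requires.\<close>
  define c where "c = 1 / (1 + \<alpha>)"
  have c: "c / 4 > 0" using \<alpha> by (simp add: c_def)
  define e1 where "e1 z w = 1 - 1 / h_quotient \<nu>1 R1 S1 z w" for z w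
  define e2 where "e2 z w = 1 - 1 / h_quotient \<nu>2 R2 S2 z w" for z w
  obtain b1 where b1: "b1 > 0" "b1 \<le> \<beta>0" "\<forall>z \<in> stolz_pair \<alpha> b1. norm (z * R1 z) \<le> c / 4"
    using has_R_transform_small[OF R1' \<alpha>(1) \<beta>0(1) c] by blast
  obtain b2 where b2: "b2 > 0" "b2 \<le> \<beta>0" "\<forall>z \<in> stolz_pair \<alpha> b2. norm (z * S1 z) \<le> c / 4"
    using has_R_transform_small[OF S1' \<alpha>(1) \<beta>0(1) c] by blast
  obtain b3 where b3: "b3 > 0" "b3 \<le> \<beta>0" "\<forall>z \<in> stolz_pair \<alpha> b3. norm (z * R2 z) \<le> c / 4"
    using has_R_transform_small[OF R2' \<alpha>(1) \<beta>0(1) c] by blast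
  obtain b4 where b4: "b4 > 0" "b4 \<le> \<beta>0" "\<forall>z \<in> stolz_pair \<alpha> b4. norm (z * S2 z) \<le> c / 4"
    using has_R_transform_small[OF S2' \<alpha>(1) \<beta>0(1) c] by blast
  have half: "1 / 2 > (0::real)" by simp
  obtain b5 where b5: "b5 > 0" "b5 \<le> \<beta>0" "\<forall>z \<in> stolz_pair \<alpha> b5. \<forall>w \<in> stolz_pair \<alpha> b5. norm (e1 z w) < 1 / 2"
    using h_quotient_near_1[OF \<nu>(1) \<alpha>(1) \<beta>0(1) half R1' S1'] unfolding e1_def by blast
  obtain b6 where b6: "b6 > 0" "b6 \<le> \<beta>0" "\<forall>z \<in> stolz_pair \<alpha> b6. \<forall>w \<in> stolz_pair \<alpha> b6. norm (e2 z w) < 1 / 2"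
    using h_quotient_near_1[OF \<nu>(2) \<alpha>(1) \<beta>0(1) half R2' S2'] unfolding e2_def by blast
  define \<beta> where "\<beta> = Min {b1, b2, b3, b4, b5, b6}"
  have \<beta>: "\<beta> > 0" "\<beta> \<le> b1" "\<beta> \<le> b2" "\<beta> \<le> b3" "\<beta> \<le> b4" "\<beta> \<le> b5" "\<beta> \<le> b6"
    using b1 b2 b3 b4 b5 b6 by (auto simp: \<beta>_def)
  have \<beta>0': "\<beta> \<le> \<beta>0" "\<beta> \<le> \<beta>1" "\<beta> \<le> \<beta>2" using \<beta>(2) b1(2) \<beta>0 by linarith+
  let ?S = "stolz_pair \<alpha> \<beta>"
  have sub: "?S \<subseteq> stolz_pair \<alpha> b" if "\<beta> \<le> b" for b by (rule stolz_pair_mono[OF order_refl that])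
  have mem: "z \<in> stolz_pair \<alpha>1 \<beta>1" "z \<in> stolz_pair \<alpha>2 \<beta>2" if "z \<in> ?S" for z
    using that stolz_pair_mono[OF \<alpha>(2) \<beta>0'(2)] stolz_pair_mono[OF \<alpha>(3) \<beta>0'(3)] by blast+
  have small: "norm (z * R1 z) \<le> c / 4" "norm (z * S1 z) \<le> c / 4" "norm (z * R2 z) \<le> c / 4" "norm (z * S2 z) \<le> c / 4"
    if "z \<in> ?S" for z
    using that b1(3) b2(3) b3(3) b4(3) sub[OF \<beta>(2)] sub[OF \<beta>(3)] sub[OF \<beta>(4)] sub[OF \<beta>(5)] by blast+
  have small_e: "norm (e1 z w) < 1 / 2" "norm (e2 z w) < 1 / 2" if "z \<in> ?S" "w \<in> ?S" for z w
    using that b5(3) b6(3) sub[OF \<beta>(6)] sub[OF \<beta>(7)] by blast+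
  obtain T1 :: "nat \<Rightarrow> real" where T1: "\<And>n. T1 n \<ge> 0"
    "\<And>G B l. (G :: real \<times> real \<Rightarrow> complex) \<in> borel_measurable borel \<Longrightarrow> (\<And>x. norm (G x) \<le> B) \<Longrightarrow> G 0 = 0 \<Longrightarrow>
      (\<lambda>n. of_nat (n + 2) * (\<integral>x. G x \<partial>\<mu>1 n)) \<longlonglongrightarrow> l \<Longrightarrow>
      (\<lambda>n. of_nat (n + 2) * (\<integral>x. G (truncate (T1 n) x) \<partial>\<mu>1 n)) \<longlonglongrightarrow> l"
  proof (rule truncation_sequence[of \<mu>1, OF \<mu>1])
    note out = that
    show thesis if "\<And>n. T n \<ge> 0"
      "\<And>G B l. (G :: real \<times> real \<Rightarrow> complex) \<in> borel_measurable borel \<Longrightarrow> (\<And>x. norm (G x) \<le> B) \<Longrightarrow> G 0 = 0 \<Longrightarrow>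
        (\<lambda>n. of_nat (n + 2) * (\<integral>x. G x \<partial>\<mu>1 n)) \<longlonglongrightarrow> l \<Longrightarrow>
        (\<lambda>n. of_nat (n + 2) * (\<integral>x. G (truncate (T n) x) \<partial>\<mu>1 n)) \<longlonglongrightarrow> l" for T
      by (rule out[of T], rule that(1), rule that(2))
  qed
  obtain T2 :: "nat \<Rightarrow> real" where T2: "\<And>n. T2 n \<ge> 0"
    "\<And>G B l. (G :: real \<times> real \<Rightarrow> complex) \<in> borel_measurable borel \<Longrightarrow> (\<And>x. norm (G x) \<le> B) \<Longrightarrow> G 0 = 0 \<Longrightarrow>
      (\<lambda>n. of_nat (n + 2) * (\<integral>x. G x \<partial>\<mu>2 n)) \<longlonglongrightarrow> l \<Longrightarrow>
      (\<lambda>n. of_nat (n + 2) * (\<integral>x. G (truncate (T2 n) x) \<partial>\<mu>2 n)) \<longlonglongrightarrow> l"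
  proof (rule truncation_sequence[of \<mu>2, OF \<mu>2])
    note out = that
    show thesis if "\<And>n. T n \<ge> 0"
      "\<And>G B l. (G :: real \<times> real \<Rightarrow> complex) \<in> borel_measurable borel \<Longrightarrow> (\<And>x. norm (G x) \<le> B) \<Longrightarrow> G 0 = 0 \<Longrightarrow>
        (\<lambda>n. of_nat (n + 2) * (\<integral>x. G x \<partial>\<mu>2 n)) \<longlonglongrightarrow> l \<Longrightarrow>
        (\<lambda>n. of_nat (n + 2) * (\<integral>x. G (truncate (T n) x) \<partial>\<mu>2 n)) \<longlonglongrightarrow> l" for T
      by (rule out[of T], rule that(1), rule that(2))
  qed
  have p: "prob_space (\<mu>1 n)" "prob_space (\<mu>2 n)" and sets [measurable_cong]: "sets (\<mu>1 n) = sets borel" "sets (\<mu>2 n) = sets borel" for n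
    using \<mu>1[of n] \<mu>2[of n] by (auto simp: borel_prob_def)
  define \<tau> where "\<tau> n x = (if fst x then truncate (T1 n) (fst (snd x)) else truncate (T2 n) (snd (snd x)))"
    for n and x :: "bool \<times> (real \<times> real) \<times> (real \<times> real)"
  define M where "M k n = density (count_space (UNIV :: bool set) \<Otimes>\<^sub>M (\<mu>1 n \<Otimes>\<^sub>M \<mu>2 n)) (\<lambda>_. ennreal (real (n + 2) / real k))" for k n
  have \<tau>m: "\<tau> n \<in> borel_measurable (M k n)" for k n unfolding \<tau>_def M_def by measurable
  have lim: "(\<lambda>n. \<integral>x. G (\<tau> n x) \<partial>M k n) \<longlonglongrightarrow> (l1 + l2) / of_nat k"
    if k: "k > 0" and G: "G \<in> borel_measurable borel" "\<And>x. norm (G x) \<le> B" "G 0 = 0"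
      and l1: "(\<lambda>n. of_nat (n + 2) * (\<integral>x. G x \<partial>\<mu>1 n)) \<longlonglongrightarrow> l1"
      and l2: "(\<lambda>n. of_nat (n + 2) * (\<integral>x. G x \<partial>\<mu>2 n)) \<longlonglongrightarrow> l2"
    for k :: nat and G :: "real \<times> real \<Rightarrow> complex" and B l1 l2
  proof -
    have "(\<integral>x. G (\<tau> n x) \<partial>M k n) = of_real (real (n + 2) / real k) *
        ((\<integral>x. G (truncate (T1 n) x) \<partial>\<mu>1 n) + (\<integral>y. G (truncate (T2 n) y) \<partial>\<mu>2 n))" for n
      unfolding M_def
    proof (rule integral_two_sheets[OF p, where B = B])
      show "(\<lambda>x. G (\<tau> n x)) \<in> borel_measurable (density (count_space UNIV \<Otimes>\<^sub>M (\<mu>1 n \<Otimes>\<^sub>M \<mu>2 n)) (\<lambda>_. ennreal (real (n + 2) / real k)))"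
        using measurable_compose[OF \<tau>m G(1)] unfolding M_def .
    qed (use G(2) in \<open>auto simp: \<tau>_def\<close>)
    also have "of_real (real (n + 2) / real k) *
        ((\<integral>x. G (truncate (T1 n) x) \<partial>\<mu>1 n) + (\<integral>y. G (truncate (T2 n) y) \<partial>\<mu>2 n)) =
      (of_nat (n + 2) * (\<integral>x. G (truncate (T1 n) x) \<partial>\<mu>1 n) + of_nat (n + 2) * (\<integral>y. G (truncate (T2 n) y) \<partial>\<mu>2 n)) / of_nat k" for n
      by (simp only: of_real_divide of_real_of_nat_eq distrib_left[symmetric] times_divide_eq_left)
    finally have eq: "(\<integral>x. G (\<tau> n x) \<partial>M k n) = (of_nat (n + 2) * (\<integral>x. G (truncate (T1 n) x) \<partial>\<mu>1 n) +
        of_nat (n + 2) * (\<integral>y. G (truncate (T2 n) y) \<partial>\<mu>2 n)) / of_nat k" for n .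
    show ?thesis
      unfolding eq by (intro tendsto_intros T1(2)[OF G l1] T2(2)[OF G l2]) (use k in simp)
  qed
  have jumps: "two_jumps (M k n) (\<lambda>x. fst (\<tau> n x)) (\<lambda>x. snd (\<tau> n x)) (max (T1 n) (T2 n))" for k n
  proof -
    have fin: "finite_measure (M k n)"
      unfolding M_def by (rule finite_measure_two_sheets[OF p]) simp
    have \<tau>b: "norm (\<tau> n x) \<le> max (T1 n) (T2 n)" for x
      using norm_truncate_le[OF T1(1)[of n], of "fst (snd x)"] norm_truncate_le[OF T2(1)[of n], of "snd (snd x)"]
      by (auto simp: \<tau>_def le_max_iff_disj)
    have bd: "\<bar>fst (\<tau> n x)\<bar> \<le> max (T1 n) (T2 n)" "\<bar>snd (\<tau> n x)\<bar> \<le> max (T1 n) (T2 n)" for x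
      using norm_fst_le[of "fst (\<tau> n x)" "snd (\<tau> n x)"] norm_snd_le[of "snd (\<tau> n x)" "fst (\<tau> n x)"]
      by (auto intro: order_trans[OF _ \<tau>b[of x]])
    have [measurable]: "\<tau> n \<in> M k n \<rightarrow>\<^sub>M borel \<Otimes>\<^sub>M borel" using \<tau>m[of n k] by (simp only: borel_prod)
    show ?thesis
      by (intro two_jumps.intro bounded_jumps.intro bounded_jumps_axioms.intro fin bd) measurable
  qed
  \<comment> \<open>\<open>jump_ratio\<close> depends on the function alone, so the instance with k
    = 1 unfolds it for every measure \<open>M k n\<close>.\<close>
  have jr1: "bounded_jumps.jump_ratio (\<lambda>x. fst (\<tau> n x)) a = (\<lambda>x. of_real (fst (\<tau> n x)) / (a - of_real (fst (\<tau> n x))))" for n a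
    by (rule ext) (rule bounded_jumps.jump_ratio_def[OF two_jumps.axioms(1)[OF jumps[of 1 n]]])
  have jr2: "bounded_jumps.jump_ratio (\<lambda>x. snd (\<tau> n x)) a = (\<lambda>x. of_real (snd (\<tau> n x)) / (a - of_real (snd (\<tau> n x))))" for n a
    by (rule ext) (rule bounded_jumps.jump_ratio_def[OF two_jumps.axioms(2)[OF jumps[of 1 n]]])
  have cr: "two_jumps.cross (M k n) (\<lambda>x. fst (\<tau> n x)) (\<lambda>x. snd (\<tau> n x)) a b =
      (\<integral>x. of_real (fst (\<tau> n x)) / (a - of_real (fst (\<tau> n x))) * (of_real (snd (\<tau> n x)) / (b - of_real (snd (\<tau> n x)))) \<partial>M k n)"
    for k n a b
    unfolding two_jumps.cross_def[OF jumps] jr1 jr2 ..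
  have inv: "Im (1 / z) \<noteq> 0" if "z \<in> ?S" for z
    using stolz_pair_Im[OF that] by (auto simp: Im_divide power2_eq_square)
  have limit: "\<exists>\<nu>. borel_prob \<nu> \<and> has_bifree_R_transform \<nu> \<alpha> \<beta>
      (\<lambda>(z, w). z * ((R1 z + R2 z) / of_nat k) + w * ((S1 w + S2 w) / of_nat k) + (e1 z w + e2 z w) / of_nat k)"
    if k: "k > 0" for k :: nat
  proof (rule limit_law[OF jumps[of k] \<alpha>(1) \<beta>(1) c_def])
    have k1: "1 \<le> real k" using k by simp
    have div_le: "norm (x / of_nat k) \<le> norm x" for x :: complex
      using k1 by (simp add: norm_divide divide_le_eq mult_le_cancel_left1)
    note tr = has_R_transform_mono[OF R1' order_refl \<beta>0'(1)] has_R_transform_mono[OF S1' order_refl \<beta>0'(1)]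
      has_R_transform_mono[OF R2' order_refl \<beta>0'(1)] has_R_transform_mono[OF S2' order_refl \<beta>0'(1)]
    note hol = tr[unfolded has_R_transform_def, THEN conjunct1]
    note lim0 = tr[unfolded has_R_transform_def, THEN conjunct2, THEN conjunct2]
    show "(\<lambda>z. (R1 z + R2 z) / of_nat k) holomorphic_on ?S" "(\<lambda>z. (S1 z + S2 z) / of_nat k) holomorphic_on ?S"
      by (intro holomorphic_intros hol; use k in simp)+
    show "(\<lambda>n. \<integral>x. bounded_jumps.jump_ratio (\<lambda>x. fst (\<tau> n x)) (1 / z) x \<partial>M k n) \<longlonglongrightarrow> z * ((R1 z + R2 z) / of_nat k)"
      if z: "z \<in> ?S" for z
    proof -
      have "(\<lambda>n. \<integral>x. bounded_jumps.jump_ratio (\<lambda>x. fst (\<tau> n x)) (1 / z) x \<partial>M k n) \<longlonglongrightarrow> (z * R1 z + z * R2 z) / of_nat k"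
        unfolding jr1
        by (rule lim[OF k, of "\<lambda>x. of_real (fst x) / (1 / z - of_real (fst x))"])
          (use norm_resolvent_times_le[OF inv[OF z]] limR1[OF mem(1)[OF z]] limR2[OF mem(2)[OF z]] in \<open>auto simp: borel_prod[symmetric]\<close>)
      then show ?thesis by (simp add: distrib_left)
    qed
    show "(\<lambda>n. \<integral>x. bounded_jumps.jump_ratio (\<lambda>x. snd (\<tau> n x)) (1 / z) x \<partial>M k n) \<longlonglongrightarrow> z * ((S1 z + S2 z) / of_nat k)"
      if z: "z \<in> ?S" for z
    proof -
      have "(\<lambda>n. \<integral>x. bounded_jumps.jump_ratio (\<lambda>x. snd (\<tau> n x)) (1 / z) x \<partial>M k n) \<longlonglongrightarrow> (z * S1 z + z * S2 z) / of_nat k"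
        unfolding jr2
        by (rule lim[OF k, of "\<lambda>x. of_real (snd x) / (1 / z - of_real (snd x))"])
          (use norm_resolvent_times_le[OF inv[OF z]] limS1[OF mem(1)[OF z]] limS2[OF mem(2)[OF z]] in \<open>auto simp: borel_prod[symmetric]\<close>)
      then show ?thesis by (simp add: distrib_left)
    qed
    show "(\<lambda>n. two_jumps.cross (M k n) (\<lambda>x. fst (\<tau> n x)) (\<lambda>x. snd (\<tau> n x)) (1 / z) (1 / w)) \<longlonglongrightarrow> (e1 z w + e2 z w) / of_nat k"
      if zw: "z \<in> ?S" "w \<in> ?S" for z w
      unfolding cr e1_def e2_def
    proof (rule lim[OF k, of "\<lambda>x. of_real (fst x) / (1 / z - of_real (fst x)) * (of_real (snd x) / (1 / w - of_real (snd x)))"])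
      show "norm (of_real (fst x) / (1 / z - of_real (fst x)) * (of_real (snd x) / (1 / w - of_real (snd x))))
          \<le> (1 + norm (1 / z) / \<bar>Im (1 / z)\<bar>) * (1 + norm (1 / w) / \<bar>Im (1 / w)\<bar>)" for x
        unfolding norm_mult by (intro mult_mono norm_resolvent_times_le inv zw) auto
    qed (use limC1[OF mem(1)[OF zw(1)] mem(1)[OF zw(2)]] limC2[OF mem(2)[OF zw(1)] mem(2)[OF zw(2)]] in \<open>auto simp: borel_prod[symmetric]\<close>)
    show "norm (z * ((R1 z + R2 z) / of_nat k)) \<le> c / 2" "norm (z * ((S1 z + S2 z) / of_nat k)) \<le> c / 2" if z: "z \<in> ?S" for z
    proof -
      have "norm (z * ((R1 z + R2 z) / of_nat k)) \<le> norm (z * R1 z + z * R2 z)"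
        using div_le[of "z * R1 z + z * R2 z"] by (simp add: distrib_left)
      then show "norm (z * ((R1 z + R2 z) / of_nat k)) \<le> c / 2"
        using norm_triangle_ineq[of "z * R1 z" "z * R2 z"] small(1,3)[OF z] by linarith
      have "norm (z * ((S1 z + S2 z) / of_nat k)) \<le> norm (z * S1 z + z * S2 z)"
        using div_le[of "z * S1 z + z * S2 z"] by (simp add: distrib_left)
      then show "norm (z * ((S1 z + S2 z) / of_nat k)) \<le> c / 2"
        using norm_triangle_ineq[of "z * S1 z" "z * S2 z"] small(2,4)[OF z] by linarith
    qed
    show "norm ((e1 z w + e2 z w) / of_nat k) < 1" if "z \<in> ?S" "w \<in> ?S" for z w
      using div_le[of "e1 z w + e2 z w"] norm_triangle_ineq[of "e1 z w" "e2 z w"] small_e[OF that] by linarith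
    show "((\<lambda>z. z * ((R1 z + R2 z) / of_nat k)) \<longlongrightarrow> 0) (at 0 within ?S)"
      using tendsto_divide[OF tendsto_add[OF lim0(1) lim0(3)] tendsto_const[of "of_nat k"]] k by (simp add: distrib_left)
    show "((\<lambda>z. z * ((S1 z + S2 z) / of_nat k)) \<longlongrightarrow> 0) (at 0 within ?S)"
      using tendsto_divide[OF tendsto_add[OF lim0(2) lim0(4)] tendsto_const[of "of_nat k"]] k by (simp add: distrib_left)
    have sm: "norm (z * R1 z) \<le> c / 2" "norm (z * S1 z) \<le> c / 2" "norm (z * R2 z) \<le> c / 2" "norm (z * S2 z) \<le> c / 2"
      if "z \<in> ?S" for z
      using small[OF that] c by linarith+
    note h1 = h_quotient_limits[OF \<nu>(1) \<alpha>(1) \<beta>(1) c_def tr(1,2) \<beta>(1) order_refl sm(1) sm(2)]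
    note h2 = h_quotient_limits[OF \<nu>(2) \<alpha>(1) \<beta>(1) c_def tr(3,4) \<beta>(1) order_refl sm(3) sm(4)]
    have vanish: "(\<lambda>n. ((1 - 1 / x n) + (1 - 1 / y n)) / of_nat k) \<longlonglongrightarrow> 0" if "x \<longlonglongrightarrow> 1" "y \<longlonglongrightarrow> 1" for x y :: "nat \<Rightarrow> complex"
    proof -
      have "(\<lambda>n. ((1 - 1 / x n) + (1 - 1 / y n)) / of_nat k) \<longlonglongrightarrow> ((1 - 1 / 1) + (1 - 1 / 1)) / of_nat k"
        by (intro tendsto_intros that) (use k in auto)
      then show ?thesis by simp
    qed
    show "(\<lambda>n. (e1 (stolz_seq \<beta> n) (stolz_seq \<beta> n) + e2 (stolz_seq \<beta> n) (stolz_seq \<beta> n)) / of_nat k) \<longlonglongrightarrow> 0"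
      unfolding e1_def e2_def by (rule vanish[OF h1(1) h2(1)])
    show "(\<lambda>n. (e1 z (stolz_seq \<beta> n) + e2 z (stolz_seq \<beta> n)) / of_nat k) \<longlonglongrightarrow> 0" if "z \<in> ?S" for z
      unfolding e1_def e2_def by (rule vanish[OF h1(2)[OF _ _ that] h2(2)[OF _ _ that]])
    show "(\<lambda>n. (e1 (stolz_seq \<beta> n) z + e2 (stolz_seq \<beta> n) z) / of_nat k) \<longlonglongrightarrow> 0" if "z \<in> ?S" for z
      unfolding e1_def e2_def by (rule vanish[OF h1(3)[OF _ _ that] h2(3)[OF _ _ that]])
  qed
  have val: "z * ((R1 z + R2 z) / of_nat k) + w * ((S1 w + S2 w) / of_nat k) + (e1 z w + e2 z w) / of_nat k =
      (F1 (z, w) + F2 (z, w)) / of_nat k" if "z \<in> ?S" "w \<in> ?S" for z w and k :: nat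
    using F1[OF mem(1)[OF that(1)] mem(1)[OF that(2)]] F2[OF mem(2)[OF that(1)] mem(2)[OF that(2)]]
    by (simp add: e1_def e2_def add_divide_distrib[symmetric] algebra_simps)
  have roots: "\<exists>\<nu>. borel_prob \<nu> \<and> has_bifree_R_transform \<nu> \<alpha> \<beta> (\<lambda>p. (F1 p + F2 p) / of_nat k)" if k: "k > 0" for k :: nat
  proof -
    obtain \<nu> where \<nu>: "borel_prob \<nu>" "has_bifree_R_transform \<nu> \<alpha> \<beta>
      (\<lambda>(z, w). z * ((R1 z + R2 z) / of_nat k) + w * ((S1 w + S2 w) / of_nat k) + (e1 z w + e2 z w) / of_nat k)"
      using limit[OF k] by blast
    have "has_bifree_R_transform \<nu> \<alpha> \<beta> (\<lambda>p. (F1 p + F2 p) / of_nat k)"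
      by (rule has_bifree_R_transform_mono[OF \<nu>(2) order_refl order_refl]) (use val in \<open>auto simp: stolz_product_def\<close>)
    then show ?thesis using \<nu>(1) by blast
  qed
  \<comment> \<open>k = 1 yields the law itself, and k = m its m-th root on the same Stolz
    pair.\<close>
  obtain \<nu> where N: "borel_prob \<nu>" "has_bifree_R_transform \<nu> \<alpha> \<beta> (\<lambda>p. F1 p + F2 p)"
    using roots[of 1] by auto
  have "\<exists>\<mu>\<^sub>m F\<^sub>m. borel_prob \<mu>\<^sub>m \<and> has_bifree_R_transform \<mu>\<^sub>m \<alpha> \<beta> F\<^sub>m \<and>
      (\<forall>p \<in> stolz_product \<alpha> \<beta>. F1 p + F2 p = of_nat m * F\<^sub>m p)" if "m \<ge> 2" for m
  proof -
    have m: "m > 0" using that by simp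
    obtain \<mu> where "borel_prob \<mu>" "has_bifree_R_transform \<mu> \<alpha> \<beta> (\<lambda>p. (F1 p + F2 p) / of_nat m)"
      using roots[OF m] by blast
    moreover have "\<forall>p \<in> stolz_product \<alpha> \<beta>. F1 p + F2 p = of_nat m * ((F1 p + F2 p) / of_nat m)" using m by simp
    ultimately show ?thesis by (intro exI conjI)
  qed
  then have "\<nu> \<in> BID" unfolding BID_def using N \<alpha>(1) \<beta>(1) by blast
  then show thesis
    by (rule that[OF _ \<alpha>(1) \<beta>(1) has_bifree_R_transform_mono[OF 1(3) \<alpha>(2) \<beta>0'(2) refl]
          has_bifree_R_transform_mono[OF 2(3) \<alpha>(3) \<beta>0'(3) refl] N(2)])
qed

section \<open>The operation on \<open>BID\<close>\<close>

lemma BID_bifree_R: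
  assumes "\<nu> \<in> BID"
  shows "holomorphic2_on (bifree_R \<nu>) nonreal2"
    and "\<exists>\<alpha>>0. \<exists>\<beta>>0. has_bifree_R_transform \<nu> \<alpha> \<beta> (bifree_R \<nu>)"
proof -
  have \<nu>: "borel_prob \<nu>" using assms by (simp add: BID_def)
  obtain \<alpha> \<beta> E where "\<alpha> > 0" "\<beta> > 0" "has_bifree_R_transform \<nu> \<alpha> \<beta> E" "holomorphic2_on E nonreal2"
    using BID_extension[OF assms] .
  then show "holomorphic2_on (bifree_R \<nu>) nonreal2"
    "\<exists>\<alpha>>0. \<exists>\<beta>>0. has_bifree_R_transform \<nu> \<alpha> \<beta> (bifree_R \<nu>)"
    using bifree_R_eq(1,2)[OF \<nu>] by blast+
qed

lemma BID_bifree_R_eq_near_0: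
  assumes \<nu>: "\<nu> \<in> BID" and pos: "\<alpha> > 0" "\<beta> > 0" and F: "has_bifree_R_transform \<nu> \<alpha> \<beta> F"
  shows "\<exists>a>0. \<exists>b>0. \<forall>z \<in> stolz_pair a b. \<forall>w \<in> stolz_pair a b. F (z, w) = bifree_R \<nu> (z, w)"
proof -
  obtain \<alpha>' \<beta>' where "\<alpha>' > 0" "\<beta>' > 0" "has_bifree_R_transform \<nu> \<alpha>' \<beta>' (bifree_R \<nu>)"
    using BID_bifree_R(2)[OF \<nu>] by blast
  moreover have "borel_prob \<nu>" using \<nu> by (simp add: BID_def)
  ultimately show ?thesis using bifree_R_transform_unique pos F by blast
qed

text \<open>On a small Stolz pair the transform found in \<open>BID_sum\<close> agrees with the sum
  of the two extensions. That sum is holomorphic on \<open>nonreal2\<close>, so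
  \<open>bifree_R_eq\<close> identifies it with the extension of the new law.\<close>

proposition BID_closed_sum:
  assumes \<nu>1: "\<nu>1 \<in> BID" and \<nu>2: "\<nu>2 \<in> BID"
  shows "\<exists>\<nu> \<in> BID. \<forall>p \<in> nonreal2. bifree_R \<nu> p = bifree_R \<nu>1 p + bifree_R \<nu>2 p"
proof -
  obtain \<nu> \<alpha> \<beta> F1 F2 where \<nu>: "\<nu> \<in> BID" and pos: "\<alpha> > 0" "\<beta> > 0"
    and F: "has_bifree_R_transform \<nu>1 \<alpha> \<beta> F1" "has_bifree_R_transform \<nu>2 \<alpha> \<beta> F2"
      "has_bifree_R_transform \<nu> \<alpha> \<beta> (\<lambda>p. F1 p + F2 p)"
    using BID_sum[OF assms] .
  obtain a1 b1 where 1: "a1 > 0" "b1 > 0" "\<forall>z \<in> stolz_pair a1 b1. \<forall>w \<in> stolz_pair a1 b1. F1 (z, w) = bifree_R \<nu>1 (z, w)"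
    using BID_bifree_R_eq_near_0[OF \<nu>1 pos F(1)] by blast
  obtain a2 b2 where 2: "a2 > 0" "b2 > 0" "\<forall>z \<in> stolz_pair a2 b2. \<forall>w \<in> stolz_pair a2 b2. F2 (z, w) = bifree_R \<nu>2 (z, w)"
    using BID_bifree_R_eq_near_0[OF \<nu>2 pos F(2)] by blast
  define a where "a = min \<alpha> (min a1 a2)"
  define b where "b = min \<beta> (min b1 b2)"
  have ab: "a > 0" "b > 0" "a \<le> \<alpha>" "b \<le> \<beta>" "a \<le> a1" "b \<le> b1" "a \<le> a2" "b \<le> b2"
    using pos 1 2 by (auto simp: a_def b_def)
  have "has_bifree_R_transform \<nu> a b (\<lambda>p. bifree_R \<nu>1 p + bifree_R \<nu>2 p)"
  proof (rule has_bifree_R_transform_mono[OF F(3) ab(3,4)])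
    fix p assume "p \<in> stolz_product a b"
    then show "F1 p + F2 p = bifree_R \<nu>1 p + bifree_R \<nu>2 p"
      using 1(3) 2(3) stolz_pair_mono[OF ab(5,6)] stolz_pair_mono[OF ab(7,8)]
      unfolding stolz_product_def by (cases p) (simp add: subset_iff)
  qed
  moreover have "holomorphic2_on (\<lambda>p. bifree_R \<nu>1 p + bifree_R \<nu>2 p) nonreal2"
    unfolding holomorphic2_on_def
  proof
    fix p assume p: "p \<in> nonreal2"
    obtain r s where "(bifree_R \<nu>1 has_derivative (\<lambda>(h, k). r * h + s * k)) (at p within nonreal2)"
      using BID_bifree_R(1)[OF \<nu>1] p unfolding holomorphic2_on_def by blast
    moreover obtain r' s' where "(bifree_R \<nu>2 has_derivative (\<lambda>(h, k). r' * h + s' * k)) (at p within nonreal2)"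
      using BID_bifree_R(1)[OF \<nu>2] p unfolding holomorphic2_on_def by blast
    ultimately have "((\<lambda>p. bifree_R \<nu>1 p + bifree_R \<nu>2 p) has_derivative
        (\<lambda>x. (case x of (h, k) \<Rightarrow> r * h + s * k) + (case x of (h, k) \<Rightarrow> r' * h + s' * k))) (at p within nonreal2)"
      by (rule has_derivative_add)
    moreover have "(\<lambda>x. (case x of (h, k) \<Rightarrow> r * h + s * k) + (case x of (h, k) \<Rightarrow> r' * h + s' * k)) =
        (\<lambda>(h, k). (r + r') * h + (s + s') * k)"
      by (auto simp: fun_eq_iff algebra_simps)
    ultimately show "\<exists>r s. ((\<lambda>p. bifree_R \<nu>1 p + bifree_R \<nu>2 p) has_derivative (\<lambda>(h, k). r * h + s * k)) (at p within nonreal2)"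
      by auto
  qed
  moreover have "borel_prob \<nu>" using \<nu> by (simp add: BID_def)
  ultimately have "bifree_R \<nu> p = bifree_R \<nu>1 p + bifree_R \<nu>2 p" if "p \<in> nonreal2" for p
    using bifree_R_eq(3)[of \<nu> a b] ab(1,2) that by blast
  then show ?thesis using \<nu> by blast
qed

theorem proposition3p12:
  "\<exists>bfconv :: (real \<times> real) measure \<Rightarrow> (real \<times> real) measure \<Rightarrow> (real \<times> real) measure.
     (\<forall>\<nu>\<^sub>1\<in>BID. \<forall>\<nu>\<^sub>2\<in>BID. bfconv \<nu>\<^sub>1 \<nu>\<^sub>2 \<in> BID) \<and>
     (\<forall>\<nu>\<^sub>1\<in>BID. \<forall>\<nu>\<^sub>2\<in>BID. \<forall>\<nu>\<^sub>3\<in>BID.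
        bfconv (bfconv \<nu>\<^sub>1 \<nu>\<^sub>2) \<nu>\<^sub>3 = bfconv \<nu>\<^sub>1 (bfconv \<nu>\<^sub>2 \<nu>\<^sub>3)) \<and>
     (\<forall>\<nu>\<^sub>1\<in>BID. \<forall>\<nu>\<^sub>2\<in>BID. bfconv \<nu>\<^sub>1 \<nu>\<^sub>2 = bfconv \<nu>\<^sub>2 \<nu>\<^sub>1) \<and>
     (\<forall>\<nu>\<^sub>1\<in>BID. \<forall>\<nu>\<^sub>2\<in>BID. \<forall>p\<in>nonreal2.
        bifree_R (bfconv \<nu>\<^sub>1 \<nu>\<^sub>2) p = bifree_R \<nu>\<^sub>1 p + bifree_R \<nu>\<^sub>2 p)"
proof -
  define law where "law F = (SOME \<nu>. \<nu> \<in> BID \<and> (\<forall>p \<in> nonreal2. bifree_R \<nu> p = F p))"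
    for F :: "complex \<times> complex \<Rightarrow> complex"
  define conv where "conv \<nu> \<nu>' = law (\<lambda>p. bifree_R \<nu> p + bifree_R \<nu>' p)" for \<nu> \<nu>'
  \<comment> \<open>\<open>law\<close> sees F only through its values on \<open>nonreal2\<close>.
    Two bracketings with equal sums of transforms there choose the same measure, which gives
    equality of laws and not merely of their transforms.\<close>
  have law_cong: "law F = law G" if "\<And>p. p \<in> nonreal2 \<Longrightarrow> F p = G p" for F G
    using that by (simp add: law_def)
  have conv: "conv \<nu> \<nu>' \<in> BID" "\<And>p. p \<in> nonreal2 \<Longrightarrow> bifree_R (conv \<nu> \<nu>') p = bifree_R \<nu> p + bifree_R \<nu>' p"
    if "\<nu> \<in> BID" "\<nu>' \<in> BID" for \<nu> \<nu>'
    using someI_ex[OF BID_closed_sum[OF that, unfolded Bex_def]] unfolding conv_def law_def by blast+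
  show ?thesis
  proof (intro exI[of _ conv] conjI ballI)
    show "conv \<nu>1 \<nu>2 = conv \<nu>2 \<nu>1" for \<nu>1 \<nu>2 by (simp add: conv_def add.commute)
    show "conv (conv \<nu>1 \<nu>2) \<nu>3 = conv \<nu>1 (conv \<nu>2 \<nu>3)" if "\<nu>1 \<in> BID" "\<nu>2 \<in> BID" "\<nu>3 \<in> BID" for \<nu>1 \<nu>2 \<nu>3
      unfolding conv_def[of "conv \<nu>1 \<nu>2"] conv_def[of \<nu>1 "conv \<nu>2 \<nu>3"]
      by (rule law_cong) (simp add: conv that add.assoc)
  qed (simp_all add: conv)
qed

end
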